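(* Let $M$ be a complete $n$-dimensional smooth orientable Riemannian manifold that is locally Euclidean. Let $\{R_t\}_{t=1}^N$ be an iterated relation system (IRS) on a nonempty compact subset of $M$, and let $K$ be its attractor. Assume that there exists a graph-directed iterated function system (GIFS) $G=(V,E)$ associated to $\{R_t\}_{t=1}^N$ and that $G$ consists of contractive similitudes. Assume that $G$ satisfies the graph finite type condition (GFTC). For $\alpha\ge0$ let $\lambda_\alpha$ be the spectral radius of the weighted incidence matrix $A_\alpha$ associated to $G$. Then $$\dim_H(K)=\alpha,$$ where $\alpha$ is the unique real number such that $\lambda_\alpha=1$.
   Context: Locally Euclidean means locally isometric to $\mathbb R^n$ (flat). Distances on $M$ are Riemannian distances; $\dim_H$ is Hausdorff dimension. A contractive similitude $f$ with contraction ratio $\rho\in(0,1)$ satisfies $d(f(x),f(y))=\rho\, d(x,y)$ on its domain. IRS. A relation $R$ on $E_0$ assigns to each $x\in E_0$ a set $R(x)$; $R(F):=\bigcup_{x\in F}R(x)$. Let $E_0\subseteq M$ be nonempty compact. A family $\{R_t\}_{t=1}^N$ of relations on $E_0$ is an IRS if (1) $R_t(F)$ is nonempty compact for every nonempty compact $F\subseteq E_0$ and every $t$; (2) $R_t(E_0)\subseteq E_0$ for every $t$. Put $E_{k+1}:=\bigcup_{t=1}^NR_t(E_k)$ for $k\ge0$. The attractor is $K:=\bigcap_{k=0}^\infty E_k$. Put $\Sigma=\{1,\dots,N\}$; for $t=(t_1,\dots,t_q)\in\Sigma^q$ let $R_t:=R_{t_1}\circ\cdots\circ R_{t_q}$.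 GIFS. A GIFS of contractions on $M$ is a directed graph $G=(V,E)$ with $V=\{1,\dots,m\}$, finite edge set $E$ (multiple edges allowed), with domains $X_j\subseteq M$ ($j\in V$) and contractions $f_e:X_j\to X_i$ for each $e\in E^{i,j}$, the set of edges from $i$ to $j$. $E_q^{i,j}$ is the set of directed paths $\mathbf e=(e_1,\dots,e_q)$ of length $|\mathbf e|=q$ from $i$ to $j$, $E^*$ is the set of all directed paths, and $f_{\mathbf e}=f_{e_1}\circ\cdots\circ f_{e_q}$. A family $\{U_j\}_{j=1}^m$ ($U_j\subseteq X_j$) is an invariant family under $G$ if $\bigcup_{e\in E^{i,j}}f_e(U_j)\subseteq U_i$ for all $i,j$. Associated GIFS. $G$ is associated to $\{R_t\}_{t=1}^N$ (on $E_{k_0}$) if for some integer $k_0\ge0$ one has $E_{k_0}=\bigcup_{j=1}^mW_j$ with each $W_j\subseteq E_{k_0}$ compact (and $W_j\subseteq X_j$), and for every $q\ge1$: $\bigcup_{t\in\Sigma^q}R_t(E_{k_0})=\bigcup_{i,j=1}^m\bigcup_{\mathbf e\in E_q^{i,j}}f_{\mathbf e}(W_j)$. Nested index sets. Write $\mathbf e\preceq\mathbf e'$ if $\mathbf e$ is an initial segment of $\mathbf e'$ or $\mathbf e=\mathbf e'$. For a finite $\mathcal M_k\subseteq E^*$ let $\underline m_k,\overline m_k$ be the minimum and maximum of $|\mathbf e|$, $\mathbf e\in\mathcal M_k$. $\{\mathcal M_k\}_{k\ge0}$ is a sequence of nested index sets if: (1) $\{\underline m_k\}$, $\{\overline m_k\}$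 are nondecreasing and tend to $\infty$; (2) for $k\ge1$, $\mathcal M_k$ is an antichain for $\preceq$; (3) each $\mathbf e'\in E^*$ with $|\mathbf e'|>\overline m_k$ has some $\mathbf e\in\mathcal M_k$ with $\mathbf e\preceq\mathbf e'$; (4) each $\mathbf e'\in E^*$ with $|\mathbf e'|<\underline m_k$ has some $\mathbf e\in\mathcal M_k$ with $\mathbf e'\preceq\mathbf e$; (5) there is $L$ independent of $k$ such that $|\mathbf e'|-|\mathbf e|\le L$ whenever $\mathbf e\in\mathcal M_k$, $\mathbf e'\in\mathcal M_{k+1}$, $\mathbf e\preceq\mathbf e'$. By convention $\mathcal M_0=\{1,\dots,m\}$ (the empty paths at the vertices). $\mathcal M_k^{i,j}$ is the set of paths in $\mathcal M_k$ from $i$ to $j$. Vertices. For $k\ge1$, $\mathcal V_k:=\{(f_{\mathbf e},i,j,k):\mathbf e\in\mathcal M_k^{i,j},\ 1\le i,j\le m\}$ (not counting multiplicity: paths with the same $f_{\mathbf e},i,j,k$ give the same vertex); $\mathcal V_0:=\{\mathbf v^i_{\rm root}=(\mathrm{id},i,i,0):1\le i\le m\}$; $\mathcal V:=\bigcup_{k\ge0}\mathcal V_k$. Let $\pi(\mathbf e)$ be the vertex given by $\mathbf e$. For a vertex $\mathbf v=(f_{\mathbf e},i,j,k)$ write $f_{\mathbf v}=f_{\mathbf e}$. Graph $\mathcal G=(\mathcal V,\mathcal E)$: there is a directed edge $\mathbf k:\mathbf v\to\mathbf v'$ if there are $\mathbf e\in\mathcal M_k$, $\mathbf e'\in\mathcal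 M_{k+1}$ with $\mathbf v=\pi(\mathbf e)$, $\mathbf v'=\pi(\mathbf e')$ and $\mathbf e'=\mathbf e\mathbf k$ (concatenation); $\mathbf v'$ is then an offspring of $\mathbf v$. Reduced graph $\mathcal G_{\mathcal R}=(\mathcal V_{\mathcal R},\mathcal E_{\mathcal R})$: fix an enumeration of $E$ and the induced lexicographical order on paths; for each vertex keep only the smallest edge going into it and remove the other incoming edges; then remove all vertices having no offspring, together with all vertices and edges leading only to them. Neighborhood types. Fix an invariant family $\mathbf U=\{U_i\}_{i=1}^m$ of nonempty bounded open sets. Vertices $\mathbf v=(f_{\mathbf e},i,j,k)$, $\mathbf v'=(f_{\mathbf e'},i',j',k)$ in the same $\mathcal V_k$ are neighbors if $i=i'$ and $f_{\mathbf e}(U_j)\cap f_{\mathbf e'}(U_{j'})\ne\emptyset$; $\mathcal N(\mathbf v)$ is the set of neighbors of $\mathbf v$. Vertices $\mathbf v\in\mathcal V_k$, $\mathbf v'\in\mathcal V_{k'}$ are equivalent, $\mathbf v\sim\mathbf v'$, if $\#\mathcal N(\mathbf v)=\#\mathcal N(\mathbf v')$ and $\tau=f_{\mathbf v'}\circ f_{\mathbf v}^{-1}$ (understood as a similitude defined on $\bigcup_{\mathbf u\in\mathcal N(\mathbf v)}f_{\mathbf u}(U_{j(\mathbf u)})$, where $j(\mathbf u)$ is the third coordinate of $\mathbf u$, extending this composition) induces a bijection $g_\tau:\mathcal N(\mathbf v)\to\mathcal N(\mathbf v')$, $g_\tau(f_{\mathbf u},i,j,k)=(\tau\circ f_{\mathbf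 u},i',j',k')$, such that (a) $j=j'$; (b) whenever $g_\tau(\mathbf u)=\mathbf u'$ and $l\ge1$, a path $\mathbf e\in E^*$ satisfies $(f_{\mathbf u}\circ f_{\mathbf e},k+l)\in\mathcal V_{k+l}$ if and only if $(f_{\mathbf u'}\circ f_{\mathbf e},k'+l)\in\mathcal V_{k'+l}$ (abbreviating a vertex $(f,i,j,k)$ by $(f,k)$). The equivalence class $[\mathbf v]=[\mathbf v]_{\mathbf U}$ is the neighborhood type of $\mathbf v$. GFTC. $G$ satisfies (GFTC) if there exist an invariant family $\mathbf U$ of nonempty bounded open sets and a sequence of nested index sets such that $\{[\mathbf v]_{\mathbf U}:\mathbf v\in\mathcal V\}$ is finite. Weighted incidence matrix. Given such $\mathbf U$ and $\{\mathcal M_k\}$, let $\mathcal T_1,\dots,\mathcal T_Q$ be all the distinct neighborhood types (including those of the root vertices). For each $i$ choose $\mathbf v\in\mathcal V_{\mathcal R}$ with $[\mathbf v]=\mathcal T_i$, let $\mathbf u_1,\dots,\mathbf u_s$ be its offspring in $\mathcal G_{\mathcal R}$ and $\mathbf k_l$ the unique edge of $\mathcal G_{\mathcal R}$ from $\mathbf v$ to $\mathbf u_l$. Then $A_\alpha=(A_\alpha(i,j))_{i,j=1}^Q$ with $A_\alpha(i,j):=\sum\{\rho_{\mathbf k_l}^\alpha:\mathbf v\xrightarrow{\mathbf k_l}\mathbf u_l,\ [\mathbf u_l]=\mathcal T_j\}$, where $\rho_{\mathbf k}$ is the contraction ratio of $f_{\mathbf k}$.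
   Formalization: It is also assumed that every W_j is nonempty, that every path in M_{k+1} has an initial segment in M_k, and that the rows of A_α do not depend on the chosen vertices v; without these the claim can fail. M is taken to be connected. *)

theory Defs
  imports
    "HOL-Analysis.Analysis"
    "HOL-Library.Sublist"
    "Graph_Theory.Arc_Walk"
    "Jordan_Normal_Form.Spectral_Radius"
begin

section \<open>Smooth and Riemannian manifolds\<close>

primrec Ck_on :: "nat \<Rightarrow> 'a::real_normed_vector set \<Rightarrow> ('a \<Rightarrow> 'b::real_normed_vector) \<Rightarrow> bool" where
  "Ck_on 0 S f \<longleftrightarrow> continuous_on S f"
| "Ck_on (Suc k) S f \<longleftrightarrow>
     (\<forall>x\<in>S. f differentiable (at x)) \<and> (\<forall>v. Ck_on k S (\<lambda>x. frechet_derivative f (at x) v))"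

text \<open>Only used for open \<open>S\<close>.\<close>
definition smooth_on :: "'a::real_normed_vector set \<Rightarrow> ('a \<Rightarrow> 'b::real_normed_vector) \<Rightarrow> bool" where
  "smooth_on S f \<longleftrightarrow> (\<forall>k. Ck_on k S f)"

text \<open>A chart is a pair of a domain and a coordinate map.\<close>
type_synonym ('p, 'n) chart = "'p set \<times> ('p \<Rightarrow> real ^ 'n)"

definition is_chart :: "'p topology \<Rightarrow> ('p, 'n::finite) chart \<Rightarrow> bool" where
  "is_chart T c \<longleftrightarrow> openin T (fst c) \<and> open (snd c ` fst c) \<and>
     homeomorphic_map (subtopology T (fst c)) (top_of_set (snd c ` fst c)) (snd c)"

definition transition :: "('p, 'n::finite) chart \<Rightarrow> ('p, 'n) chart \<Rightarrow> real ^ 'n \<Rightarrow> real ^ 'n" where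
  "transition c c' = snd c' \<circ> inv_into (fst c) (snd c)"

definition transition_deriv ::
  "('p, 'n::finite) chart \<Rightarrow> ('p, 'n) chart \<Rightarrow> 'p \<Rightarrow> real ^ 'n \<Rightarrow> real ^ 'n" where
  "transition_deriv c c' p = frechet_derivative (transition c c') (at (snd c p))"

definition smooth_atlas :: "'p topology \<Rightarrow> ('p, 'n::finite) chart set \<Rightarrow> bool" where
  "smooth_atlas T A \<longleftrightarrow> (\<forall>c\<in>A. is_chart T c) \<and> (\<Union>c\<in>A. fst c) = topspace T \<and>
     (\<forall>c\<in>A. \<forall>c'\<in>A. smooth_on (snd c ` (fst c \<inter> fst c')) (transition c c'))"

text \<open>\<open>rm_tensor M c p v w\<close> is the metric tensor at the point \<open>p\<close>, evaluated on the tangent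
  vectors with coordinates \<open>v\<close> and \<open>w\<close> in the chart \<open>c\<close>.\<close>
record ('p, 'n) riem_mfd =
  rm_top :: "'p topology"
  rm_atlas :: "('p, 'n) chart set"
  rm_tensor :: "('p, 'n) chart \<Rightarrow> 'p \<Rightarrow> real ^ 'n \<Rightarrow> real ^ 'n \<Rightarrow> real"

definition pts :: "('p, 'n::finite) riem_mfd \<Rightarrow> 'p set" where
  "pts M = topspace (rm_top M)"

text \<open>Connectedness is part of the definition, so that the Riemannian distance is finite.\<close>
definition smooth_manifold :: "('p, 'n::finite) riem_mfd \<Rightarrow> bool" where
  "smooth_manifold M \<longleftrightarrow> Hausdorff_space (rm_top M) \<and> second_countable (rm_top M) \<and>
     connected_space (rm_top M) \<and> smooth_atlas (rm_top M) (rm_atlas M)"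

definition riemannian_metric :: "('p, 'n::finite) riem_mfd \<Rightarrow> bool" where
  "riemannian_metric M \<longleftrightarrow>
     (\<forall>c\<in>rm_atlas M. \<forall>p\<in>fst c.
        bilinear (rm_tensor M c p) \<and>
        (\<forall>v w. rm_tensor M c p v w = rm_tensor M c p w v) \<and>
        (\<forall>v. v \<noteq> 0 \<longrightarrow> rm_tensor M c p v v > 0)) \<and>
     (\<forall>c\<in>rm_atlas M. \<forall>v w.
        smooth_on (snd c ` fst c) (\<lambda>x. rm_tensor M c (inv_into (fst c) (snd c) x) v w)) \<and>
     (\<forall>c\<in>rm_atlas M. \<forall>c'\<in>rm_atlas M. \<forall>p\<in>fst c \<inter> fst c'. \<forall>v w.
        rm_tensor M c p v w =
        rm_tensor M c' p (transition_deriv c c' p v) (transition_deriv c c' p w))"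

definition riemannian_manifold :: "('p, 'n::finite) riem_mfd \<Rightarrow> bool" where
  "riemannian_manifold M \<longleftrightarrow> smooth_manifold M \<and> riemannian_metric M"

text \<open>A smooth atlas of oriented charts exists within the given smooth structure.\<close>
definition orientable :: "('p, 'n::finite) riem_mfd \<Rightarrow> bool" where
  "orientable M \<longleftrightarrow> (\<exists>B. smooth_atlas (rm_top M) (rm_atlas M \<union> B) \<and>
     (\<Union>c\<in>B. fst c) = pts M \<and>
     (\<forall>c\<in>B. \<forall>c'\<in>B. \<forall>p\<in>fst c \<inter> fst c'.
        Determinants.det (matrix (transition_deriv c c' p)) > 0))"

text \<open>Around each point there is a chart of the smooth structure that is a Riemannian isometry
  onto an open subset of Euclidean space.\<close>
definition locally_euclidean :: "('p, 'n::finite) riem_mfd \<Rightarrow> bool" where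
  "locally_euclidean M \<longleftrightarrow> (\<forall>p\<in>pts M. \<exists>c. p \<in> fst c \<and>
     smooth_atlas (rm_top M) (insert c (rm_atlas M)) \<and>
     (\<forall>c'\<in>rm_atlas M. \<forall>q\<in>fst c \<inter> fst c'. \<forall>v w.
        rm_tensor M c' q v w = inner (transition_deriv c' c q v) (transition_deriv c' c q w)))"

definition C1_on_segment :: "real \<Rightarrow> real \<Rightarrow> (real \<Rightarrow> 'a::real_normed_vector) \<Rightarrow> bool" where
  "C1_on_segment a b h \<longleftrightarrow> (\<exists>D. continuous_on {a..b} D \<and>
     (\<forall>t\<in>{a..b}. (h has_vector_derivative D t) (at t within {a..b})))"

text \<open>\<open>S\<close> is the finite set of corners.\<close>
definition piecewise_C1_curve :: "('p, 'n::finite) riem_mfd \<Rightarrow> (real \<Rightarrow> 'p) \<Rightarrow> bool" where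
  "piecewise_C1_curve M \<gamma> \<longleftrightarrow> pathin (rm_top M) \<gamma> \<and>
     (\<exists>S. finite S \<and> (\<forall>c\<in>rm_atlas M. \<forall>a b.
        0 \<le> a \<and> a < b \<and> b \<le> 1 \<and> \<gamma> ` {a..b} \<subseteq> fst c \<and> {a<..<b} \<inter> S = {}
        \<longrightarrow> C1_on_segment a b (snd c \<circ> \<gamma>)))"

text \<open>The compatibility of the tensor with chart changes makes the choice of the chart irrelevant.\<close>
definition curve_speed :: "('p, 'n::finite) riem_mfd \<Rightarrow> (real \<Rightarrow> 'p) \<Rightarrow> real \<Rightarrow> real" where
  "curve_speed M \<gamma> t =
     (let c = (SOME c. c \<in> rm_atlas M \<and> \<gamma> t \<in> fst c);
          v = vector_derivative (snd c \<circ> \<gamma>) (at t)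
      in sqrt (rm_tensor M c (\<gamma> t) v v))"

definition curve_length :: "('p, 'n::finite) riem_mfd \<Rightarrow> (real \<Rightarrow> 'p) \<Rightarrow> real" where
  "curve_length M \<gamma> = integral {0..1} (curve_speed M \<gamma>)"

definition riem_dist :: "('p, 'n::finite) riem_mfd \<Rightarrow> 'p \<Rightarrow> 'p \<Rightarrow> real" where
  "riem_dist M p q =
     Inf {curve_length M \<gamma> | \<gamma>. piecewise_C1_curve M \<gamma> \<and> \<gamma> 0 = p \<and> \<gamma> 1 = q}"

definition complete_manifold :: "('p, 'n::finite) riem_mfd \<Rightarrow> bool" where
  "complete_manifold M \<longleftrightarrow> Metric_space.mcomplete (pts M) (riem_dist M)"

section \<open>Hausdorff dimension\<close>

definition set_diam :: "('p \<Rightarrow> 'p \<Rightarrow> real) \<Rightarrow> 'p set \<Rightarrow> real" where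
  "set_diam d S = Sup {d x y | x y. x \<in> S \<and> y \<in> S}"

text \<open>The case \<open>s = 0\<close> is separate because \<open>0 powr 0 = 0\<close>, whereas \<open>0^0 = 1\<close> is needed for
  singletons.\<close>
definition hausdorff_gauge :: "('p \<Rightarrow> 'p \<Rightarrow> real) \<Rightarrow> real \<Rightarrow> 'p set \<Rightarrow> ennreal" where
  "hausdorff_gauge d s S =
     (if S = {} then 0 else if s = 0 then 1 else ennreal (set_diam d S powr s))"

definition hausdorff_premeasure ::
  "'p set \<Rightarrow> ('p \<Rightarrow> 'p \<Rightarrow> real) \<Rightarrow> real \<Rightarrow> real \<Rightarrow> 'p set \<Rightarrow> ennreal" where
  "hausdorff_premeasure X d s \<delta> S =
     Inf {(\<Sum>i. hausdorff_gauge d s (C i)) | C :: nat \<Rightarrow> 'p set.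
            S \<subseteq> (\<Union>i. C i) \<and> (\<forall>i. C i \<subseteq> X \<and> (\<forall>x\<in>C i. \<forall>y\<in>C i. d x y \<le> \<delta>))}"

definition hausdorff_measure ::
  "'p set \<Rightarrow> ('p \<Rightarrow> 'p \<Rightarrow> real) \<Rightarrow> real \<Rightarrow> 'p set \<Rightarrow> ennreal" where
  "hausdorff_measure X d s S = (SUP \<delta>\<in>{0<..}. hausdorff_premeasure X d s \<delta> S)"

definition hausdorff_dim :: "'p set \<Rightarrow> ('p \<Rightarrow> 'p \<Rightarrow> real) \<Rightarrow> 'p set \<Rightarrow> ereal" where
  "hausdorff_dim X d S = Inf (ereal ` {s. 0 \<le> s \<and> hausdorff_measure X d s S = 0})"

section \<open>Iterated relation systems\<close>

text \<open>\<open>R t `` F\<close> is the union of the sets \<open>R t (x)\<close>, \<open>x \<in> F\<close>.\<close>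
definition is_IRS :: "'p topology \<Rightarrow> 'p set \<Rightarrow> nat \<Rightarrow> (nat \<Rightarrow> ('p \<times> 'p) set) \<Rightarrow> bool" where
  "is_IRS T E0 N R \<longleftrightarrow> 1 \<le> N \<and> E0 \<noteq> {} \<and> compactin T E0 \<and>
     (\<forall>t\<in>{1..N}. \<forall>F. F \<noteq> {} \<and> F \<subseteq> E0 \<and> compactin T F \<longrightarrow>
        R t `` F \<noteq> {} \<and> compactin T (R t `` F)) \<and>
     (\<forall>t\<in>{1..N}. R t `` E0 \<subseteq> E0)"

primrec irs_level :: "'p set \<Rightarrow> nat \<Rightarrow> (nat \<Rightarrow> ('p \<times> 'p) set) \<Rightarrow> nat \<Rightarrow> 'p set" where
  "irs_level E0 N R 0 = E0"
| "irs_level E0 N R (Suc k) = (\<Union>t\<in>{1..N}. R t `` irs_level E0 N R k)"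

definition irs_attractor :: "'p set \<Rightarrow> nat \<Rightarrow> (nat \<Rightarrow> ('p \<times> 'p) set) \<Rightarrow> 'p set" where
  "irs_attractor E0 N R = (\<Inter>k. irs_level E0 N R k)"

text \<open>The image of a set under \<open>R\<^bsub>t1\<^esub> \<circ> \<dots> \<circ> R\<^bsub>tq\<^esub>\<close>; the last relation is applied first.\<close>
definition word_image :: "(nat \<Rightarrow> ('p \<times> 'p) set) \<Rightarrow> nat list \<Rightarrow> 'p set \<Rightarrow> 'p set" where
  "word_image R ts F = foldr (\<lambda>t A. R t `` A) ts F"

section \<open>Graph-directed iterated function systems\<close>

record ('v, 'e, 'p) gifs =
  gr :: "('v, 'e) pre_digraph"
  gdom :: "'v \<Rightarrow> 'p set"
  gmap :: "'e \<Rightarrow> 'p \<Rightarrow> 'p"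

text \<open>An edge from \<open>i\<close> to \<open>j\<close> carries a map from the domain at \<open>j\<close> to the domain at \<open>i\<close>.\<close>
definition is_gifs :: "'p set \<Rightarrow> ('p \<Rightarrow> 'p \<Rightarrow> real) \<Rightarrow> ('v, 'e, 'p) gifs \<Rightarrow> bool" where
  "is_gifs X d G \<longleftrightarrow> fin_digraph (gr G) \<and> verts (gr G) \<noteq> {} \<and>
     (\<forall>j\<in>verts (gr G). gdom G j \<subseteq> X) \<and>
     (\<forall>e\<in>arcs (gr G).
        gmap G e ` gdom G (head (gr G) e) \<subseteq> gdom G (tail (gr G) e) \<and>
        (\<exists>r. 0 \<le> r \<and> r < 1 \<and> (\<forall>x\<in>gdom G (head (gr G) e). \<forall>y\<in>gdom G (head (gr G) e).
           d (gmap G e x) (gmap G e y) \<le> r * d x y)))"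

definition similitude_with_ratio ::
  "('p \<Rightarrow> 'p \<Rightarrow> real) \<Rightarrow> 'p set \<Rightarrow> ('p \<Rightarrow> 'p) \<Rightarrow> real \<Rightarrow> bool" where
  "similitude_with_ratio d D h r \<longleftrightarrow> (\<forall>x\<in>D. \<forall>y\<in>D. d (h x) (h y) = r * d x y)"

definition ratio :: "('p \<Rightarrow> 'p \<Rightarrow> real) \<Rightarrow> 'p set \<Rightarrow> ('p \<Rightarrow> 'p) \<Rightarrow> real" where
  "ratio d D h = (THE r. similitude_with_ratio d D h r)"

definition of_contractive_similitudes ::
  "('p \<Rightarrow> 'p \<Rightarrow> real) \<Rightarrow> ('v, 'e, 'p) gifs \<Rightarrow> bool" where
  "of_contractive_similitudes d G \<longleftrightarrow> (\<forall>e\<in>arcs (gr G).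
     \<exists>r. 0 < r \<and> r < 1 \<and> similitude_with_ratio d (gdom G (head (gr G) e)) (gmap G e) r)"

text \<open>A path is a triple of source, list of edges and target. The empty paths \<open>(i, [], i)\<close> are
  included.\<close>
type_synonym ('v, 'e) gpath = "'v \<times> 'e list \<times> 'v"

definition gpaths :: "('v, 'e, 'p) gifs \<Rightarrow> ('v, 'e) gpath set" where
  "gpaths G = {(i, es, j). pre_digraph.awalk (gr G) i es j}"

definition plen :: "('v, 'e) gpath \<Rightarrow> nat" where
  "plen p = length (fst (snd p))"

definition pprefix :: "('v, 'e) gpath \<Rightarrow> ('v, 'e) gpath \<Rightarrow> bool" where
  "pprefix p p' \<longleftrightarrow> fst p = fst p' \<and> prefix (fst (snd p)) (fst (snd p'))"

definition path_map :: "('v, 'e, 'p) gifs \<Rightarrow> 'e list \<Rightarrow> 'p \<Rightarrow> 'p" where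
  "path_map G es = foldr (\<lambda>e h. gmap G e \<circ> h) es id"

definition associated_gifs ::
  "'p topology \<Rightarrow> 'p set \<Rightarrow> nat \<Rightarrow> (nat \<Rightarrow> ('p \<times> 'p) set) \<Rightarrow> ('v, 'e, 'p) gifs \<Rightarrow> bool" where
  "associated_gifs T E0 N R G \<longleftrightarrow> (\<exists>k0 W.
     irs_level E0 N R k0 = (\<Union>j\<in>verts (gr G). W j) \<and>
     (\<forall>j\<in>verts (gr G). W j \<noteq> {} \<and> compactin T (W j) \<and>
        W j \<subseteq> irs_level E0 N R k0 \<and> W j \<subseteq> gdom G j) \<and>
     (\<forall>q\<ge>1. (\<Union>ts\<in>{ts. length ts = q \<and> set ts \<subseteq> {1..N}}.
                word_image R ts (irs_level E0 N R k0)) =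
             (\<Union>(i, es, j)\<in>{p \<in> gpaths G. plen p = q}. path_map G es ` W j)))"

definition invariant_family :: "('v, 'e, 'p) gifs \<Rightarrow> ('v \<Rightarrow> 'p set) \<Rightarrow> bool" where
  "invariant_family G U \<longleftrightarrow> (\<forall>j\<in>verts (gr G). U j \<subseteq> gdom G j) \<and>
     (\<forall>e\<in>arcs (gr G). gmap G e ` U (head (gr G) e) \<subseteq> U (tail (gr G) e))"

section \<open>Nested index sets, vertices and neighborhood types\<close>

definition min_len :: "(nat \<Rightarrow> ('v, 'e) gpath set) \<Rightarrow> nat \<Rightarrow> nat" where
  "min_len \<M> k = Min (plen ` \<M> k)"

definition max_len :: "(nat \<Rightarrow> ('v, 'e) gpath set) \<Rightarrow> nat \<Rightarrow> nat" where
  "max_len \<M> k = Max (plen ` \<M> k)"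

text \<open>The disjunct \<open>p \<in> \<M> (Suc k)\<close> expresses that the sequence is nested: every path of
  \<open>\<M> (Suc k)\<close> extends one of \<open>\<M> k\<close>. The converse, that every nonempty path of \<open>\<M> k\<close> is extended
  by one of \<open>\<M> (Suc k)\<close>, follows from the other conditions. Empty paths are exempted in the
  condition on short paths, as otherwise there could be no vertices without outgoing edges.\<close>
definition nested_index_sets ::
  "('v, 'e, 'p) gifs \<Rightarrow> (nat \<Rightarrow> ('v, 'e) gpath set) \<Rightarrow> bool" where
  "nested_index_sets G \<M> \<longleftrightarrow>
     \<M> 0 = {(i, [], i) | i. i \<in> verts (gr G)} \<and>
     (\<forall>k. finite (\<M> k) \<and> \<M> k \<noteq> {} \<and> \<M> k \<subseteq> gpaths G) \<and>
     mono (min_len \<M>) \<and> mono (max_len \<M>) \<and>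
     filterlim (min_len \<M>) at_top sequentially \<and> filterlim (max_len \<M>) at_top sequentially \<and>
     (\<forall>k\<ge>1. \<forall>p\<in>\<M> k. \<forall>p'\<in>\<M> k. pprefix p p' \<longrightarrow> p = p') \<and>
     (\<forall>k. \<forall>p\<in>gpaths G. plen p > max_len \<M> k \<or> p \<in> \<M> (Suc k) \<longrightarrow> (\<exists>p'\<in>\<M> k. pprefix p' p)) \<and>
     (\<forall>k. \<forall>p\<in>gpaths G. 0 < plen p \<and> plen p < min_len \<M> k \<longrightarrow> (\<exists>p'\<in>\<M> k. pprefix p p')) \<and>
     (\<exists>L. \<forall>k. \<forall>p\<in>\<M> k. \<forall>p'\<in>\<M> (Suc k). pprefix p p' \<longrightarrow> plen p' - plen p \<le> L)"

datatype ('v, 'p) vertex = Vertex (vmap: "'p \<Rightarrow> 'p") (vsrc: 'v) (vtgt: 'v) (vlevel: nat)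

text \<open>The maps of vertices are restricted (in the sense of \<^const>\<open>restrict\<close>) to the domain at the
  target, so that HOL equality of vertices is equality of maps on their domain.\<close>
definition path_vertex :: "('v, 'e, 'p) gifs \<Rightarrow> nat \<Rightarrow> ('v, 'e) gpath \<Rightarrow> ('v, 'p) vertex" where
  "path_vertex G k = (\<lambda>(i, es, j). Vertex (restrict (path_map G es) (gdom G j)) i j k)"

definition vertices_at ::
  "('v, 'e, 'p) gifs \<Rightarrow> (nat \<Rightarrow> ('v, 'e) gpath set) \<Rightarrow> nat \<Rightarrow> ('v, 'p) vertex set" where
  "vertices_at G \<M> k = path_vertex G k ` \<M> k"

definition vertices ::
  "('v, 'e, 'p) gifs \<Rightarrow> (nat \<Rightarrow> ('v, 'e) gpath set) \<Rightarrow> ('v, 'p) vertex set" where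
  "vertices G \<M> = (\<Union>k. vertices_at G \<M> k)"

definition neighbors ::
  "('v, 'e, 'p) gifs \<Rightarrow> ('v \<Rightarrow> 'p set) \<Rightarrow> (nat \<Rightarrow> ('v, 'e) gpath set) \<Rightarrow>
   ('v, 'p) vertex \<Rightarrow> ('v, 'p) vertex set" where
  "neighbors G U \<M> v = {u \<in> vertices_at G \<M> (vlevel v).
     vsrc u = vsrc v \<and> vmap v ` U (vtgt v) \<inter> vmap u ` U (vtgt u) \<noteq> {}}"

text \<open>The (potential) vertex \<open>(f\<^bsub>u\<^esub> \<circ> f\<^bsub>e\<^esub>, k + l)\<close>, where \<open>es\<close> leads from the target of \<open>u\<close> to \<open>j\<close>.\<close>
definition extend_vertex ::
  "('v, 'e, 'p) gifs \<Rightarrow> ('v, 'p) vertex \<Rightarrow> 'e list \<Rightarrow> 'v \<Rightarrow> nat \<Rightarrow> ('v, 'p) vertex" where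
  "extend_vertex G u es j l =
     Vertex (restrict (vmap u \<circ> path_map G es) (gdom G j)) (vsrc u) j (vlevel u + l)"

text \<open>\<open>\<tau>\<close> is the similitude extending \<open>f\<^bsub>v'\<^esub> \<circ> f\<^bsub>v\<^esub>\<^sup>-\<^sup>1\<close>, and \<open>g\<close> the bijection of neighborhoods
  induced by it; \<open>g v = v'\<close> contains that \<open>\<tau> \<circ> f\<^bsub>v\<^esub> = f\<^bsub>v'\<^esub>\<close>.\<close>
definition same_type ::
  "('p \<Rightarrow> 'p \<Rightarrow> real) \<Rightarrow> ('v, 'e, 'p) gifs \<Rightarrow> ('v \<Rightarrow> 'p set) \<Rightarrow> (nat \<Rightarrow> ('v, 'e) gpath set) \<Rightarrow>
   ('v, 'p) vertex \<Rightarrow> ('v, 'p) vertex \<Rightarrow> bool" where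
  "same_type d G U \<M> v v' \<longleftrightarrow>
     card (neighbors G U \<M> v) = card (neighbors G U \<M> v') \<and>
     (\<exists>\<tau> g.
        (\<exists>r>0. similitude_with_ratio d (\<Union>u\<in>neighbors G U \<M> v. vmap u ` U (vtgt u)) \<tau> r) \<and>
        bij_betw g (neighbors G U \<M> v) (neighbors G U \<M> v') \<and> g v = v' \<and>
        (\<forall>u\<in>neighbors G U \<M> v.
           (\<forall>x\<in>U (vtgt u). vmap (g u) x = \<tau> (vmap u x)) \<and>
           vtgt (g u) = vtgt u \<and>
           (\<forall>l\<ge>1. \<forall>es j. (vtgt u, es, j) \<in> gpaths G \<longrightarrow>
              (extend_vertex G u es j l \<in> vertices_at G \<M> (vlevel u + l) \<longleftrightarrow>
               extend_vertex G (g u) es j l \<in> vertices_at G \<M> (vlevel (g u) + l)))))"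

definition ntype ::
  "('p \<Rightarrow> 'p \<Rightarrow> real) \<Rightarrow> ('v, 'e, 'p) gifs \<Rightarrow> ('v \<Rightarrow> 'p set) \<Rightarrow> (nat \<Rightarrow> ('v, 'e) gpath set) \<Rightarrow>
   ('v, 'p) vertex \<Rightarrow> ('v, 'p) vertex set" where
  "ntype d G U \<M> v = {v' \<in> vertices G \<M>. same_type d G U \<M> v v'}"

text \<open>\<open>U\<close> and \<open>\<M>\<close> witness the graph finite type condition.\<close>
definition GFTC_witness ::
  "'p topology \<Rightarrow> ('p \<Rightarrow> 'p \<Rightarrow> real) \<Rightarrow> ('v, 'e, 'p) gifs \<Rightarrow> ('v \<Rightarrow> 'p set) \<Rightarrow>
   (nat \<Rightarrow> ('v, 'e) gpath set) \<Rightarrow> bool" where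
  "GFTC_witness T d G U \<M> \<longleftrightarrow> invariant_family G U \<and>
     (\<forall>j\<in>verts (gr G). U j \<noteq> {} \<and> openin T (U j) \<and> Metric_space.mbounded (topspace T) d (U j)) \<and>
     nested_index_sets G \<M> \<and> finite (ntype d G U \<M> ` vertices G \<M>)"

section \<open>Reduced graph and weighted incidence matrix\<close>

type_synonym ('v, 'e, 'p) vedge = "('v, 'p) vertex \<times> 'e list \<times> ('v, 'p) vertex"

definition vedges ::
  "('v, 'e, 'p) gifs \<Rightarrow> (nat \<Rightarrow> ('v, 'e) gpath set) \<Rightarrow> ('v, 'e, 'p) vedge set" where
  "vedges G \<M> = {(path_vertex G k (i, es, j), ks, path_vertex G (Suc k) (i, es @ ks, j')) |
     k i es j ks j'. (i, es, j) \<in> \<M> k \<and> (i, es @ ks, j') \<in> \<M> (Suc k)}"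

text \<open>\<open>enum\<close> enumerates the edges of the GIFS; paths are ordered lexicographically.\<close>
definition minimal_vedges ::
  "('v, 'e, 'p) gifs \<Rightarrow> ('e \<Rightarrow> nat) \<Rightarrow> (nat \<Rightarrow> ('v, 'e) gpath set) \<Rightarrow> ('v, 'e, 'p) vedge set" where
  "minimal_vedges G enum \<M> = {(v, ks, v') \<in> vedges G \<M>.
     \<not> (\<exists>u ls. (u, ls, v') \<in> vedges G \<M> \<and> (ls, ks) \<in> lexord {(a, b). enum a < enum b})}"

text \<open>Vertices without offspring and, recursively, those leading only to such vertices.\<close>
inductive dead :: "('v, 'e, 'p) vedge set \<Rightarrow> ('v, 'p) vertex \<Rightarrow> bool" for P where
  "(\<And>ks v'. (v, ks, v') \<in> P \<Longrightarrow> dead P v') \<Longrightarrow> dead P v"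

definition reduced_vertices ::
  "('v, 'e, 'p) gifs \<Rightarrow> ('e \<Rightarrow> nat) \<Rightarrow> (nat \<Rightarrow> ('v, 'e) gpath set) \<Rightarrow> ('v, 'p) vertex set" where
  "reduced_vertices G enum \<M> = {v \<in> vertices G \<M>. \<not> dead (minimal_vedges G enum \<M>) v}"

definition reduced_vedges ::
  "('v, 'e, 'p) gifs \<Rightarrow> ('e \<Rightarrow> nat) \<Rightarrow> (nat \<Rightarrow> ('v, 'e) gpath set) \<Rightarrow> ('v, 'e, 'p) vedge set" where
  "reduced_vedges G enum \<M> = {(v, ks, v') \<in> minimal_vedges G enum \<M>.
     v \<in> reduced_vertices G enum \<M> \<and> v' \<in> reduced_vertices G enum \<M>}"

text \<open>The matrix is computed from representatives of the neighborhood types \<open>Ts\<close> and does not depend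
  on their choice; hence the quantifier over all representatives \<open>v\<close> in the reduced graph. Types all
  of whose vertices were removed have no offspring and get a zero row.\<close>
definition weighted_incidence_matrix ::
  "('p \<Rightarrow> 'p \<Rightarrow> real) \<Rightarrow> ('v, 'e, 'p) gifs \<Rightarrow> ('e \<Rightarrow> nat) \<Rightarrow> ('v \<Rightarrow> 'p set) \<Rightarrow>
   (nat \<Rightarrow> ('v, 'e) gpath set) \<Rightarrow> ('v, 'p) vertex set list \<Rightarrow> real \<Rightarrow> real mat \<Rightarrow> bool" where
  "weighted_incidence_matrix d G enum U \<M> Ts \<alpha> A \<longleftrightarrow>
     A \<in> carrier_mat (length Ts) (length Ts) \<and>
     (\<forall>i<length Ts. \<forall>j<length Ts.
        (\<forall>v\<in>reduced_vertices G enum \<M>. ntype d G U \<M> v = Ts ! i \<longrightarrow>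
           A $$ (i, j) = (\<Sum>(ks, u)\<in>{(ks, u). (v, ks, u) \<in> reduced_vedges G enum \<M> \<and>
                                         ntype d G U \<M> u = Ts ! j}.
                            ratio d (gdom G (vtgt u)) (path_map G ks) powr \<alpha>)) \<and>
        ((\<forall>v\<in>reduced_vertices G enum \<M>. ntype d G U \<M> v \<noteq> Ts ! i) \<longrightarrow> A $$ (i, j) = 0))"

end

(*
The Riemannian distance is locally Euclidean, so that only a metric space whose small balls are isometric
to Euclidean balls matters. Over the reduced graph, the powers of A_s count the paths from a vertex by
type of their end, weighted by powers of the ratio. As every cycle contracts, lambda_s is continuous and
strictly decreasing to 0, and lambda_0 >= 1; this gives the unique alpha.

If lambda_s < 1, the images of E_0 under the live vertices of level k form covers of K whose sums of s-th
powers of diameters are bounded, so the s'-measure of K vanishes for s' > s. If lambda_s > 1, some power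
A_s^m has a diagonal entry S > 1. Then some type reproduces with weight S: dividing by powers of S one gets
mass distributions on the descendants of a vertex of this type. The two ends of distinct paths of the
reduced graph are distinct vertices because a similitude of a flat space near K is determined by its values
on an open set, and the open sets of neighboring vertices overlap only boundedly often by finiteness of the
types. So a ball of radius r has mass O(r^s), and the s-measure of K is positive.
*)
theory Submission
  imports Defs
begin

section \<open>Charts and curves\<close>

text \<open>Keeping only the smallest incoming edges fixes the label of the edge into a vertex, but
  not its parent: vertices are maps, and several parents can reach one vertex with the same label.
  So \<open>chain_weight\<close> counts paths, not vertices. For covers the overcount is harmless;
  for the mass it must be excluded. The obstacle is that the argument by which values on an open set
  determine a similitude compares distances, and distances are Euclidean only inside a single flat
  ball. Below a vertex of an expanding type there is a cycle; composing with a high power of it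
  squeezes both maps into one such ball, and the cycle is cancelled afterwards because it is
  injective. The mass is not a measure but a family of finite weights, one for each generation;
  compactness and the decreasing levels of the relation system replace a weak limit. Neighborhood
  types compare vertices of one level, whereas a ball is met by vertices of many levels; the
  comparison is made by going back to the earliest of these levels.\<close>

lemma chart_domain_subset: "is_chart T c \<Longrightarrow> fst c \<subseteq> topspace T"
  unfolding is_chart_def by (meson openin_subset)

lemma chart_topspace: "is_chart T c \<Longrightarrow> topspace (subtopology T (fst c)) = fst c"
  using chart_domain_subset[of T c] by (simp add: inf_absorb2)

lemma chart_inj: "is_chart T c \<Longrightarrow> inj_on (snd c) (fst c)"
  using chart_topspace[of T c] unfolding is_chart_def homeomorphic_eq_everything_map by simp

lemma chart_open_image:
  assumes c: "is_chart T c" and V: "openin T V"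
  shows "open (snd c ` (V \<inter> fst c))"
proof -
  have "open_map (subtopology T (fst c)) (top_of_set (snd c ` fst c)) (snd c)"
    using c unfolding is_chart_def homeomorphic_eq_everything_map by blast
  then have "openin (top_of_set (snd c ` fst c)) (snd c ` (V \<inter> fst c))"
    unfolding open_map_def using openin_subtopology_Int[OF V, of "fst c"] by blast
  then show ?thesis using c unfolding is_chart_def by (simp add: openin_open_eq)
qed

lemma chart_preimage_open:
  assumes c: "is_chart T c" and V: "open V"
  shows "openin T {p \<in> fst c. snd c p \<in> V}"
proof -
  have "continuous_map (subtopology T (fst c)) (top_of_set (snd c ` fst c)) (snd c)"
    using c unfolding is_chart_def homeomorphic_eq_everything_map by blast
  then have "continuous_map (subtopology T (fst c)) euclidean (snd c)"
    by (rule continuous_map_into_fulltopology)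
  from openin_continuous_map_preimage[OF this, of V]
  have "openin (subtopology T (fst c)) {p \<in> topspace (subtopology T (fst c)). snd c p \<in> V}"
    using V by simp
  then have "openin (subtopology T (fst c)) {p \<in> fst c. snd c p \<in> V}"
    by (simp only: chart_topspace[OF c])
  moreover have "openin T (fst c)" using c by (simp add: is_chart_def)
  ultimately show ?thesis by (simp add: openin_open_subtopology)
qed

lemma chart_inv_continuous:
  assumes c: "is_chart T c"
  shows "continuous_map (top_of_set (snd c ` fst c)) T (inv_into (fst c) (snd c))"
  unfolding continuous_map_def
proof (intro conjI allI impI)
  show "inv_into (fst c) (snd c) \<in> topspace (top_of_set (snd c ` fst c)) \<rightarrow> topspace T"
    using chart_domain_subset[OF c] inv_into_into[of _ "snd c" "fst c"] by auto
  fix V assume V: "openin T V"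
  have "{y \<in> topspace (top_of_set (snd c ` fst c)). inv_into (fst c) (snd c) y \<in> V} = snd c ` (V \<inter> fst c)"
    using chart_inj[OF c] by auto
  then show "openin (top_of_set (snd c ` fst c))
      {y \<in> topspace (top_of_set (snd c ` fst c)). inv_into (fst c) (snd c) y \<in> V}"
    using chart_open_image[OF c V] c by (auto simp: is_chart_def openin_open_eq)
qed

text \<open>Continuity in terms of radii around each parameter. Reparametrized and glued curves are
  checked in this form, since a curve is a function on all reals of which only the part over
  \<open>{0..1}\<close> counts.\<close>

lemma pathin_local:
  "pathin T g \<longleftrightarrow> (\<forall>t\<in>{0..1}. g t \<in> topspace T \<and>
     (\<forall>V. openin T V \<longrightarrow> g t \<in> V \<longrightarrow> (\<exists>e>0. \<forall>s\<in>{0..1}. \<bar>s - t\<bar> < e \<longrightarrow> g s \<in> V)))"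
  (is "_ \<longleftrightarrow> ?R")
proof
  assume L: "pathin T g"
  then have c: "continuous_map (top_of_set {0..1}) T g" by (simp add: pathin_def)
  show ?R
  proof (intro ballI conjI allI impI)
    fix t :: real assume t: "t \<in> {0..1}"
    show "g t \<in> topspace T" using c t unfolding continuous_map_def by auto
    fix V assume V: "openin T V" "g t \<in> V"
    have "openin (top_of_set {0..1}) {s \<in> {0..1}. g s \<in> V}"
      using openin_continuous_map_preimage[OF c V(1)] by simp
    then have "\<exists>e>0. \<forall>s\<in>{0..1}. dist s t < e \<longrightarrow> s \<in> {s \<in> {0..1}. g s \<in> V}"
      using t V(2) unfolding openin_euclidean_subtopology_iff by blast
    then show "\<exists>e>0. \<forall>s\<in>{0..1}. \<bar>s - t\<bar> < e \<longrightarrow> g s \<in> V"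
      by (auto simp: dist_real_def)
  qed
next
  assume R: ?R
  have "openin (top_of_set {0..1}) {s \<in> {0..1}. g s \<in> V}" if "openin T V" for V
    unfolding openin_euclidean_subtopology_iff using R that by (auto simp: dist_real_def)
  then show "pathin T g"
    using R unfolding pathin_def continuous_map_def by auto
qed

text \<open>The end points are written with \<open>min\<close> and \<open>max\<close> because
  \<open>m\<close> may be negative, as it is for a curve traversed backwards.\<close>

lemma C1_on_segment_affine:
  assumes h: "C1_on_segment (min (m * a + l) (m * b + l)) (max (m * a + l) (m * b + l)) h"
    and eq: "\<And>t. t \<in> {a..b} \<Longrightarrow> g t = h (m * t + l)" and ab: "a < b"
  shows "C1_on_segment a b g"
proof -
  let ?J = "{min (m * a + l) (m * b + l)..max (m * a + l) (m * b + l)}"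
  have J: "(\<lambda>t. m * t + l) ` {a..b} = ?J"
  proof (cases "0 \<le> m")
    case True
    then have "m * a + l \<le> m * b + l" using ab by (simp add: mult_left_mono)
    then show ?thesis using True ab by (simp add: image_affinity_atLeastAtMost)
  next
    case False
    then have "m * b + l \<le> m * a + l" using ab by (simp add: mult_left_mono_neg)
    then show ?thesis using False ab by (simp add: image_affinity_atLeastAtMost)
  qed
  obtain D where D: "continuous_on ?J D" "\<And>t. t \<in> ?J \<Longrightarrow> (h has_vector_derivative D t) (at t within ?J)"
    using h unfolding C1_on_segment_def by blast
  have aff: "((\<lambda>t. m * t + l) has_vector_derivative m) (at t within {a..b})" for t
    by (auto intro!: derivative_eq_intros simp flip: has_real_derivative_iff_has_vector_derivative)
  show ?thesis
    unfolding C1_on_segment_def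
  proof (intro exI[of _ "\<lambda>t. m *\<^sub>R D (m * t + l)"] conjI ballI)
    show "continuous_on {a..b} (\<lambda>t. m *\<^sub>R D (m * t + l))"
      by (intro continuous_intros continuous_on_compose2[OF D(1)]) (simp only: J subset_refl)
    fix t assume t: "t \<in> {a..b}"
    then have "m * t + l \<in> ?J" using J by blast
    then have "(h has_vector_derivative D (m * t + l)) (at (m * t + l) within (\<lambda>t. m * t + l) ` {a..b})"
      unfolding J by (rule D(2))
    from vector_diff_chain_within[OF aff this]
    have "((\<lambda>t. h (m * t + l)) has_vector_derivative m *\<^sub>R D (m * t + l)) (at t within {a..b})"
      by (simp add: o_def)
    then show "(g has_vector_derivative m *\<^sub>R D (m * t + l)) (at t within {a..b})"
      by (intro has_vector_derivative_transform[OF t, of g]) (simp_all add: eq)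
  qed
qed

lemma C1_on_segment_at:
  assumes "C1_on_segment a b g" "t \<in> {a<..<b}"
  obtains v where "(g has_vector_derivative v) (at t)"
proof -
  obtain D where "(g has_vector_derivative D t) (at t within {a..b})"
    using assms unfolding C1_on_segment_def by force
  then show ?thesis using that assms(2) by (simp add: at_within_Icc_at)
qed

lemma smooth_on_D:
  assumes "smooth_on S f"
  shows "\<And>x. x \<in> S \<Longrightarrow> f differentiable (at x)"
    and "continuous_on S (\<lambda>x. frechet_derivative f (at x) v)"
proof -
  have "Ck_on (Suc 0) S f" using assms unfolding smooth_on_def by blast
  then show "\<And>x. x \<in> S \<Longrightarrow> f differentiable (at x)"
    "continuous_on S (\<lambda>x. frechet_derivative f (at x) v)" by simp_all
qed

text \<open>Smoothness only gives continuity of the derivative in each fixed direction. Expanding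
  the varying vector in the basis turns the expression into a finite sum of products of continuous
  functions.\<close>

lemma continuous_on_frechet_derivative_apply:
  fixes f :: "'a::euclidean_space \<Rightarrow> 'b::real_normed_vector"
  assumes f: "smooth_on S f" and x: "continuous_on I x" "x ` I \<subseteq> S" and v: "continuous_on I v"
  shows "continuous_on I (\<lambda>t. frechet_derivative f (at (x t)) (v t))"
proof -
  have "frechet_derivative f (at (x t)) (v t) =
      (\<Sum>i\<in>Basis. (v t \<bullet> i) *\<^sub>R frechet_derivative f (at (x t)) i)" if "t \<in> I" for t
  proof -
    have "linear (frechet_derivative f (at (x t)))"
      using smooth_on_D(1)[OF f] x(2) that by (intro linear_frechet_derivative) blast
    then have "frechet_derivative f (at (x t)) (\<Sum>i\<in>Basis. (v t \<bullet> i) *\<^sub>R i) =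
        (\<Sum>i\<in>Basis. (v t \<bullet> i) *\<^sub>R frechet_derivative f (at (x t)) i)"
      by (simp add: linear_sum linear_cmul)
    then show ?thesis by (simp add: euclidean_representation)
  qed
  moreover have "continuous_on I (\<lambda>t. \<Sum>i\<in>Basis. (v t \<bullet> i) *\<^sub>R frechet_derivative f (at (x t)) i)"
    by (intro continuous_intros v continuous_on_compose2[OF smooth_on_D(2)[OF f] x])
  ultimately show ?thesis by (simp cong: continuous_on_cong)
qed

section \<open>Speed of curves in Euclidean charts\<close>

locale flat_manifold =
  fixes M :: "('p, 'n::finite) riem_mfd"
  assumes riem: "riemannian_manifold M" and flat: "locally_euclidean M"
begin

text \<open>Such a chart is compatible with the atlas but need not belong to it. Regularity of
  curves is postulated in atlas charts only, so statements about curves in a Euclidean chart pass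
  through a transition map.\<close>

definition euclidean_chart :: "('p, 'n) chart \<Rightarrow> bool" where
  "euclidean_chart c \<longleftrightarrow> smooth_atlas (rm_top M) (insert c (rm_atlas M)) \<and>
     (\<forall>c'\<in>rm_atlas M. \<forall>q\<in>fst c \<inter> fst c'. \<forall>v w.
        rm_tensor M c' q v w = inner (transition_deriv c' c q v) (transition_deriv c' c q w))"

lemma euclidean_chart_exists:
  assumes "p \<in> pts M"
  obtains c where "p \<in> fst c" "euclidean_chart c"
  using assms flat unfolding locally_euclidean_def euclidean_chart_def by blast

lemma atlas_chart: "c \<in> rm_atlas M \<Longrightarrow> is_chart (rm_top M) c"
  using riem unfolding riemannian_manifold_def smooth_manifold_def smooth_atlas_def by blast

lemma atlas_cover:
  assumes "p \<in> pts M"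
  shows "\<exists>c. c \<in> rm_atlas M \<and> p \<in> fst c"
proof -
  have "p \<in> (\<Union>c\<in>rm_atlas M. fst c)"
    using assms riem unfolding riemannian_manifold_def smooth_manifold_def smooth_atlas_def pts_def by blast
  then show ?thesis by blast
qed

lemma euclidean_chart_is_chart: "euclidean_chart c \<Longrightarrow> is_chart (rm_top M) c"
  unfolding euclidean_chart_def smooth_atlas_def by blast

lemma euclidean_chart_smooth:
  assumes "euclidean_chart c" "c' \<in> rm_atlas M"
  shows "smooth_on (snd c ` (fst c \<inter> fst c')) (transition c c')"
    "smooth_on (snd c' ` (fst c \<inter> fst c')) (transition c' c)"
  using assms unfolding euclidean_chart_def smooth_atlas_def by (auto simp: Int_commute)

lemma transition_apply: "is_chart T c \<Longrightarrow> p \<in> fst c \<Longrightarrow> transition c c' (snd c p) = snd c' p"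
  unfolding transition_def by (simp add: inv_into_f_f chart_inj)

lemma path_in_pts: "pathin (rm_top M) g \<Longrightarrow> t \<in> {0..1} \<Longrightarrow> g t \<in> pts M"
  unfolding pathin_local pts_def by blast

lemma chart_openin: "is_chart T c \<Longrightarrow> openin T (fst c)"
  by (simp add: is_chart_def)

lemma chart_path_continuous:
  assumes g: "pathin (rm_top M) g" and c: "is_chart (rm_top M) c"
    and ab: "{a..b} \<subseteq> {0..1}" "g ` {a..b} \<subseteq> fst c"
  shows "continuous_on {a..b} (snd c \<circ> g)"
  unfolding continuous_on_iff
proof (intro ballI allI impI)
  fix t and e :: real assume t: "t \<in> {a..b}" and e: "0 < e"
  have "openin (rm_top M) {p \<in> fst c. snd c p \<in> ball (snd c (g t)) e}"
    by (rule chart_preimage_open[OF c open_ball])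
  moreover have "g t \<in> fst c" using ab(2) t by blast
  then have "g t \<in> {p \<in> fst c. snd c p \<in> ball (snd c (g t)) e}" using e by simp
  moreover have "t \<in> {0..1}" using t ab by blast
  ultimately obtain r where r: "r > 0" "\<forall>s\<in>{0..1}. \<bar>s - t\<bar> < r \<longrightarrow> g s \<in> {p \<in> fst c. snd c p \<in> ball (snd c (g t)) e}"
    using g unfolding pathin_local by blast
  show "\<exists>d>0. \<forall>x'\<in>{a..b}. dist x' t < d \<longrightarrow> dist ((snd c \<circ> g) x') ((snd c \<circ> g) t) < e"
  proof (intro exI[of _ r] conjI ballI impI)
    fix s assume s: "s \<in> {a..b}" "dist s t < r"
    then have "snd c (g s) \<in> ball (snd c (g t)) e" using r(2) ab(1) by (auto simp: dist_real_def)
    then show "dist ((snd c \<circ> g) s) ((snd c \<circ> g) t) < e" by (simp add: dist_commute)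
  qed fact
qed

lemma euclidean_chart_derivative:
  assumes c: "euclidean_chart c" and c': "c' \<in> rm_atlas M" and I: "open I" "t \<in> I"
    and g: "\<And>s. s \<in> I \<Longrightarrow> g s \<in> fst c \<inter> fst c'"
    and v: "((snd c' \<circ> g) has_vector_derivative v) (at t)"
  shows "((snd c \<circ> g) has_vector_derivative transition_deriv c' c (g t) v) (at t)"
proof -
  let ?T = "transition c' c"
  have "snd c' (g t) \<in> snd c' ` (fst c \<inter> fst c')" using g I by blast
  then have "?T differentiable (at (snd c' (g t)))"
    using smooth_on_D(1)[OF euclidean_chart_smooth(2)[OF c c']] by blast
  then have "(?T has_derivative transition_deriv c' c (g t)) (at ((snd c' \<circ> g) t) within range (snd c' \<circ> g))"
    unfolding transition_deriv_def by (simp add: frechet_derivative_works has_derivative_at_withinI)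
  from vector_derivative_diff_chain_within[OF v this]
  have "((?T \<circ> (snd c' \<circ> g)) has_vector_derivative transition_deriv c' c (g t) v) (at t)"
    by (simp add: o_def)
  then show ?thesis
    by (rule has_vector_derivative_transform_within_open[OF _ I])
      (use g transition_apply[OF atlas_chart[OF c']] in auto)
qed

text \<open>At such points the speed can be computed in any Euclidean chart.\<close>
definition regular_at :: "(real \<Rightarrow> 'p) \<Rightarrow> real \<Rightarrow> bool" where
  "regular_at g t \<longleftrightarrow> g t \<in> pts M \<and>
     (\<forall>V. openin (rm_top M) V \<longrightarrow> g t \<in> V \<longrightarrow> (\<exists>r>0. g ` {t-r<..<t+r} \<subseteq> V)) \<and>
     (\<forall>c\<in>rm_atlas M. g t \<in> fst c \<longrightarrow> (\<exists>v. ((snd c \<circ> g) has_vector_derivative v) (at t)))"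

lemma regular_atD:
  assumes "regular_at g t"
  shows "g t \<in> pts M"
    and "openin (rm_top M) V \<Longrightarrow> g t \<in> V \<Longrightarrow> \<exists>r>0. g ` {t-r<..<t+r} \<subseteq> V"
    and "c \<in> rm_atlas M \<Longrightarrow> g t \<in> fst c \<Longrightarrow> \<exists>v. ((snd c \<circ> g) has_vector_derivative v) (at t)"
  using assms unfolding regular_at_def by simp_all

text \<open>An atlas chart around \<open>g t\<close> contains the curve over a small interval free
  of corners, and there the regularity condition applies.\<close>

lemma piecewise_regular:
  assumes path: "pathin (rm_top M) g"
    and C1: "\<And>c a b. c \<in> rm_atlas M \<Longrightarrow> 0 \<le> a \<Longrightarrow> a < b \<Longrightarrow> b \<le> 1 \<Longrightarrow> g ` {a..b} \<subseteq> fst c \<Longrightarrow>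
        {a<..<b} \<inter> S = {} \<Longrightarrow> C1_on_segment a b (snd c \<circ> g)"
    and S: "finite S" and t: "t \<in> {0<..<1} - S"
  shows "regular_at g t"
proof -
  have "open ({0<..<1} - S)" using S by (simp add: finite_imp_closed open_Diff)
  then obtain e where e: "e > 0" "ball t e \<subseteq> {0<..<1} - S" using t open_contains_ball by blast
  have sub: "{t-e<..<t+e} \<subseteq> {0<..<1} - S" using e(2) by (auto simp: ball_def dist_real_def subset_iff)
  have nb: "\<exists>r>0. r \<le> e \<and> g ` {t-r<..<t+r} \<subseteq> V" if V: "openin (rm_top M) V" "g t \<in> V" for V
  proof -
    have "t \<in> {0..1}" using t by simp
    then obtain r where r: "r > 0" "\<forall>s\<in>{0..1}. \<bar>s - t\<bar> < r \<longrightarrow> g s \<in> V"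
      using path V unfolding pathin_local by blast
    have "g s \<in> V" if "s \<in> {t - min r e<..<t + min r e}" for s
    proof -
      have "s \<in> {t-e<..<t+e}" "\<bar>s - t\<bar> < r" using that by (auto simp: abs_less_iff)
      then have "s \<in> {0..1}" using sub by fastforce
      then show ?thesis using r(2) \<open>\<bar>s - t\<bar> < r\<close> by blast
    qed
    then show ?thesis using r(1) e(1) by (intro exI[of _ "min r e"]) auto
  qed
  show ?thesis
    unfolding regular_at_def
  proof (intro conjI ballI allI impI)
    show "g t \<in> pts M" using t path_in_pts[OF path] by simp
    show "\<exists>r>0. g ` {t-r<..<t+r} \<subseteq> V" if "openin (rm_top M) V" "g t \<in> V" for V
      using nb[OF that] by blast
    fix c assume c: "c \<in> rm_atlas M" "g t \<in> fst c"
    obtain r where r: "r > 0" "r \<le> e" "g ` {t-r<..<t+r} \<subseteq> fst c"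
      using nb[OF chart_openin[OF atlas_chart[OF c(1)]] c(2)] by blast
    let ?a = "t - r / 2" and ?b = "t + r / 2"
    have s1: "{?a..?b} \<subseteq> {t-r<..<t+r}" using r(1) by (auto simp: field_simps)
    also have "\<dots> \<subseteq> {t-e<..<t+e}" using r(2) by auto
    finally have s2: "{?a..?b} \<subseteq> {0<..<1} - S" using sub by blast
    have "?a \<in> {?a..?b}" "?b \<in> {?a..?b}" using r(1) by auto
    then have ab: "0 \<le> ?a" "?b \<le> 1" using s2 by fastforce+
    have "C1_on_segment ?a ?b (snd c \<circ> g)"
    proof (rule C1[OF c(1) ab(1) _ ab(2)])
      show "?a < ?b" using r(1) by simp
      show "g ` {?a..?b} \<subseteq> fst c" using s1 r(3) by blast
      have "{?a<..<?b} \<subseteq> {?a..?b}" by auto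
      then show "{?a<..<?b} \<inter> S = {}" using s2 by blast
    qed
    then show "\<exists>v. ((snd c \<circ> g) has_vector_derivative v) (at t)"
      by (rule C1_on_segment_at[of _ _ _ t]) (use r(1) in auto)
  qed
qed

text \<open>\<open>curve_speed\<close> evaluates the tensor in some chosen atlas chart. The
  transition to the Euclidean chart turns this tensor into the inner product, so the Euclidean norm
  results whatever the choice was.\<close>

lemma regular_speed:
  assumes reg: "regular_at g t" and c: "euclidean_chart c" "g t \<in> fst c"
  shows "((snd c \<circ> g) has_vector_derivative vector_derivative (snd c \<circ> g) (at t)) (at t)"
    and "norm (vector_derivative (snd c \<circ> g) (at t)) = curve_speed M g t"
proof -
  have "g t \<in> pts M"
    using chart_domain_subset[OF euclidean_chart_is_chart[OF c(1)]] c(2) unfolding pts_def by blast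
  then have ex: "\<exists>c. c \<in> rm_atlas M \<and> g t \<in> fst c" by (rule atlas_cover)
  define c' where "c' = (SOME c. c \<in> rm_atlas M \<and> g t \<in> fst c)"
  have c': "c' \<in> rm_atlas M" "g t \<in> fst c'" using someI_ex[OF ex] unfolding c'_def by auto
  obtain v where v: "((snd c' \<circ> g) has_vector_derivative v) (at t)"
    using regular_atD(3)[OF reg c'] ..
  have op: "openin (rm_top M) (fst c \<inter> fst c')"
    using chart_openin[OF euclidean_chart_is_chart[OF c(1)]] chart_openin[OF atlas_chart[OF c'(1)]] by blast
  have "g t \<in> fst c \<inter> fst c'" using c c' by blast
  from regular_atD(2)[OF reg op this]
  obtain r where r: "r > 0" "g ` {t-r<..<t+r} \<subseteq> fst c \<inter> fst c'" by blast
  have d: "((snd c \<circ> g) has_vector_derivative transition_deriv c' c (g t) v) (at t)"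
    by (rule euclidean_chart_derivative[OF c(1) c'(1) _ _ _ v, of "{t-r<..<t+r}"]) (use r in auto)
  then have eq: "vector_derivative (snd c \<circ> g) (at t) = transition_deriv c' c (g t) v"
    by (rule vector_derivative_at)
  show "((snd c \<circ> g) has_vector_derivative vector_derivative (snd c \<circ> g) (at t)) (at t)"
    using d eq by simp
  have "curve_speed M g t = sqrt (rm_tensor M c' (g t) v v)"
    unfolding curve_speed_def Let_def c'_def[symmetric] using vector_derivative_at[OF v] by simp
  also have "rm_tensor M c' (g t) v v = transition_deriv c' c (g t) v \<bullet> transition_deriv c' c (g t) v"
    using c c' unfolding euclidean_chart_def by blast
  finally show "norm (vector_derivative (snd c \<circ> g) (at t)) = curve_speed M g t"
    using eq by (simp add: norm_eq_sqrt_inner)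
qed

text \<open>Also valid at corners, where \<open>vector_derivative\<close> is just some vector: the
  tensor is nonnegative on every vector, the zero vector being covered by bilinearity.\<close>

lemma curve_speed_nonneg:
  assumes "g t \<in> pts M"
  shows "0 \<le> curve_speed M g t"
proof -
  have ex: "\<exists>c. c \<in> rm_atlas M \<and> g t \<in> fst c" using assms by (rule atlas_cover)
  define c' where "c' = (SOME c. c \<in> rm_atlas M \<and> g t \<in> fst c)"
  have c': "c' \<in> rm_atlas M" "g t \<in> fst c'" using someI_ex[OF ex] unfolding c'_def by auto
  have t: "bilinear (rm_tensor M c' (g t))" "\<And>v. v \<noteq> 0 \<Longrightarrow> rm_tensor M c' (g t) v v > 0"
    using riem c' unfolding riemannian_manifold_def riemannian_metric_def by blast+
  have "0 \<le> rm_tensor M c' (g t) v v" for v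
    using t(2)[of v] bilinear_lzero[OF t(1), of v] by (cases "v = 0") auto
  then show ?thesis unfolding curve_speed_def Let_def c'_def[symmetric] by simp
qed

text \<open>The chart chosen in \<open>curve_speed\<close> depends only on the point of the
  manifold. Both curves are therefore measured in the same chart, and the factor comes out of the
  quadratic form.\<close>

lemma regular_affine:
  assumes reg: "regular_at g (m * t + l)" and m: "m \<noteq> 0" and I: "open I" "t \<in> I"
    and h: "\<And>s. s \<in> I \<Longrightarrow> h s = g (m * s + l)"
  shows "curve_speed M h t = \<bar>m\<bar> * curve_speed M g (m * t + l)"
proof -
  have ht: "h t = g (m * t + l)" using h I by blast
  have "g (m * t + l) \<in> pts M" using regular_atD(1)[OF reg] .
  then have ex: "\<exists>c. c \<in> rm_atlas M \<and> g (m * t + l) \<in> fst c" by (rule atlas_cover)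
  define c' where "c' = (SOME c. c \<in> rm_atlas M \<and> g (m * t + l) \<in> fst c)"
  have c': "c' \<in> rm_atlas M" "g (m * t + l) \<in> fst c'" using someI_ex[OF ex] unfolding c'_def by auto
  obtain v where v: "((snd c' \<circ> g) has_vector_derivative v) (at (m * t + l))"
    using regular_atD(3)[OF reg c'] ..
  have "((\<lambda>s. m * s + l) has_vector_derivative m) (at t)"
    by (auto intro!: derivative_eq_intros simp flip: has_real_derivative_iff_has_vector_derivative)
  from vector_diff_chain_within[OF this, of "snd c' \<circ> g" v]
  have "((snd c' \<circ> g) \<circ> (\<lambda>s. m * s + l) has_vector_derivative m *\<^sub>R v) (at t)"
    using v by (simp add: has_vector_derivative_at_within)
  then have "((snd c' \<circ> h) has_vector_derivative m *\<^sub>R v) (at t)"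
    by (rule has_vector_derivative_transform_within_open[OF _ I]) (use h in auto)
  then have "curve_speed M h t = sqrt (rm_tensor M c' (h t) (m *\<^sub>R v) (m *\<^sub>R v))"
    unfolding curve_speed_def Let_def ht c'_def[symmetric] by (simp add: vector_derivative_at)
  also have "bilinear (rm_tensor M c' (h t))"
    using riem c' ht unfolding riemannian_manifold_def riemannian_metric_def by auto
  then have "rm_tensor M c' (h t) (m *\<^sub>R v) (m *\<^sub>R v) = m\<^sup>2 * rm_tensor M c' (h t) v v"
    by (simp add: bilinear_lmul bilinear_rmul power2_eq_square)
  also have "sqrt \<dots> = \<bar>m\<bar> * sqrt (rm_tensor M c' (g (m * t + l)) v v)"
    by (simp add: real_sqrt_mult ht)
  also have "sqrt (rm_tensor M c' (g (m * t + l)) v v) = curve_speed M g (m * t + l)"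
    unfolding curve_speed_def Let_def c'_def[symmetric] by (simp add: vector_derivative_at[OF v])
  finally show ?thesis .
qed

end

section \<open>Corners, reparametrization and concatenation of curves\<close>

lemma affine_image_Icc:
  fixes m l a b :: real
  assumes "a \<le> b"
  shows "(\<lambda>t. m * t + l) ` {a..b} = {min (m * a + l) (m * b + l)..max (m * a + l) (m * b + l)}"
proof (cases "0 \<le> m")
  case True
  then have "m * a + l \<le> m * b + l" using assms by (simp add: mult_left_mono)
  then show ?thesis using True assms by (simp add: image_affinity_atLeastAtMost)
next
  case False
  then have "m * b + l \<le> m * a + l" using assms by (simp add: mult_left_mono_neg)
  then show ?thesis using False assms by (simp add: image_affinity_atLeastAtMost)
qed

context flat_manifold
begin

definition corners :: "(real \<Rightarrow> 'p) \<Rightarrow> real set \<Rightarrow> bool" where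
  "corners g S \<longleftrightarrow> finite S \<and> 0 \<in> S \<and> 1 \<in> S \<and> (\<forall>c\<in>rm_atlas M. \<forall>a b.
     0 \<le> a \<and> a < b \<and> b \<le> 1 \<and> g ` {a..b} \<subseteq> fst c \<and> {a<..<b} \<inter> S = {} \<longrightarrow> C1_on_segment a b (snd c \<circ> g))"

lemma cornersD:
  assumes "corners g S"
  shows "finite S" "0 \<in> S" "1 \<in> S"
    and "c \<in> rm_atlas M \<Longrightarrow> 0 \<le> a \<Longrightarrow> a < b \<Longrightarrow> b \<le> 1 \<Longrightarrow> g ` {a..b} \<subseteq> fst c \<Longrightarrow>
      {a<..<b} \<inter> S = {} \<Longrightarrow> C1_on_segment a b (snd c \<circ> g)"
  using assms unfolding corners_def by simp_all

lemma piecewiseD: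
  assumes "piecewise_C1_curve M g"
  obtains S where "pathin (rm_top M) g" "corners g S"
proof -
  obtain S where S: "finite S" "\<forall>c\<in>rm_atlas M. \<forall>a b.
        0 \<le> a \<and> a < b \<and> b \<le> 1 \<and> g ` {a..b} \<subseteq> fst c \<and> {a<..<b} \<inter> S = {}
        \<longrightarrow> C1_on_segment a b (snd c \<circ> g)"
    and p: "pathin (rm_top M) g"
    using assms unfolding piecewise_C1_curve_def by auto
  have "corners g (insert 0 (insert 1 S))"
    using S unfolding corners_def by simp
  then show ?thesis using that p by blast
qed

lemma piecewiseI: "pathin (rm_top M) g \<Longrightarrow> corners g S \<Longrightarrow> piecewise_C1_curve M g"
  unfolding piecewise_C1_curve_def corners_def by auto

lemma corners_regular:
  assumes "pathin (rm_top M) g" "corners g S" "t \<in> {0..1}" "t \<notin> S"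
  shows "regular_at g t"
proof (rule piecewise_regular[OF assms(1) cornersD(4)[OF assms(2)] cornersD(1)[OF assms(2)]])
  have "t \<noteq> 0" "t \<noteq> 1" using assms(2-4) cornersD(2,3) by blast+
  then show "t \<in> {0<..<1} - S" using assms(3,4) by simp
qed

text \<open>Integrability is a local property. Around any parameter one can avoid all other corners
  and split at the parameter itself; on each half the speed equals, except at the two ends, the norm
  of a continuous function. Lengths are Henstock-Kurzweil integrals, which default to zero if they
  do not exist, so additivity of length rests on this fact.\<close>

lemma curve_speed_integrable:
  assumes path: "pathin (rm_top M) g" and S: "corners g S"
  shows "curve_speed M g integrable_on {0..1}"
proof -
  have "\<forall>x\<in>cbox 0 1. \<exists>d>0. \<forall>u v. x \<in> cbox u v \<and> cbox u v \<subseteq> ball x d \<and> cbox u v \<subseteq> cbox 0 1 \<longrightarrow>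
      curve_speed M g integrable_on cbox u v"
  proof
    fix t0 :: real assume "t0 \<in> cbox 0 1"
    then have t0: "t0 \<in> {0..1}" by simp
    obtain c where c: "g t0 \<in> fst c" "euclidean_chart c"
      using euclidean_chart_exists[OF path_in_pts[OF path t0]] .
    obtain c' where c': "c' \<in> rm_atlas M" "g t0 \<in> fst c'"
      using atlas_cover[OF path_in_pts[OF path t0]] by blast
    have op: "openin (rm_top M) (fst c \<inter> fst c')"
      using chart_openin[OF euclidean_chart_is_chart[OF c(2)]] chart_openin[OF atlas_chart[OF c'(1)]] by blast
    have "g t0 \<in> fst c \<inter> fst c'" using c c' by blast
    then obtain r where r: "r > 0" "\<forall>s\<in>{0..1}. \<bar>s - t0\<bar> < r \<longrightarrow> g s \<in> fst c \<inter> fst c'"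
      using path t0 op unfolding pathin_local by blast
    obtain d where d: "d > 0" "\<forall>s\<in>S. s \<noteq> t0 \<longrightarrow> d \<le> dist t0 s"
      using finite_set_avoid[OF cornersD(1)[OF S]] by blast
    have key: "curve_speed M g integrable_on {a..b}"
      if ab: "a \<le> b" "{a..b} \<subseteq> {0..1}" "{a..b} \<subseteq> ball t0 (min r d)" "t0 \<notin> {a<..<b}" for a b
    proof (cases "a = b")
      case True
      then show ?thesis using integrable_on_refl[of "curve_speed M g" a] by simp
    next
      case False
      then have "a < b" using ab by simp
      have sub: "g s \<in> fst c \<inter> fst c'" if "s \<in> {a..b}" for s
      proof -
        have "s \<in> {0..1}" using that ab(2) by blast
        moreover have "s \<in> ball t0 (min r d)" using that ab(3) by blast
        then have "\<bar>s - t0\<bar> < r" by (simp add: dist_real_def abs_minus_commute)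
        ultimately show ?thesis using r(2) by blast
      qed
      have noS: "{a<..<b} \<inter> S = {}"
      proof (rule ccontr)
        assume "{a<..<b} \<inter> S \<noteq> {}"
        then obtain s where s: "s \<in> {a<..<b}" "s \<in> S" by blast
        then have "d \<le> dist t0 s" using d(2) ab(4) by metis
        moreover have "s \<in> ball t0 (min r d)" using s(1) ab(3) by (meson greaterThanLessThan_subseteq_atLeastAtMost_iff order_refl subsetD)
        ultimately show False by simp
      qed
      have "0 \<le> a" "b \<le> 1" using ab(1,2) by auto
      moreover have "g ` {a..b} \<subseteq> fst c'" using sub by blast
      ultimately have "C1_on_segment a b (snd c' \<circ> g)"
        by (intro cornersD(4)[OF S c'(1)] \<open>a < b\<close> noS)
      then obtain D where D: "continuous_on {a..b} D"
        "\<And>t. t \<in> {a..b} \<Longrightarrow> ((snd c' \<circ> g) has_vector_derivative D t) (at t within {a..b})"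
        unfolding C1_on_segment_def by blast
      \<comment> \<open>The derivative \<open>D\<close> is known in the atlas chart; its image under
        the transition is continuous up to the ends of the interval, which may be corners.\<close>
      define F where "F t = transition_deriv c' c (g t) (D t)" for t
      have "continuous_on {a..b} (\<lambda>t. frechet_derivative (transition c' c) (at ((snd c' \<circ> g) t)) (D t))"
      proof (rule continuous_on_frechet_derivative_apply[OF euclidean_chart_smooth(2)[OF c(2) c'(1)] _ _ D(1)])
        show "continuous_on {a..b} (snd c' \<circ> g)"
          using sub by (intro chart_path_continuous[OF path atlas_chart[OF c'(1)] ab(2)]) blast
        show "(snd c' \<circ> g) ` {a..b} \<subseteq> snd c' ` (fst c \<inter> fst c')" using sub by auto
      qed
      then have F: "continuous_on {a..b} F" by (simp add: F_def transition_deriv_def)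
      have "curve_speed M g t = norm (F t)" if t: "t \<in> {a..b} - {a, b}" for t
      proof -
        have t': "t \<in> {a<..<b}" using t by auto
        have "((snd c' \<circ> g) has_vector_derivative D t) (at t)"
          using D(2)[of t] t' by (simp add: at_within_Icc_at)
        from euclidean_chart_derivative[OF c(2) c'(1) open_greaterThanLessThan t' _ this]
        have "((snd c \<circ> g) has_vector_derivative F t) (at t)"
          using sub unfolding F_def by (meson greaterThanLessThan_subseteq_atLeastAtMost_iff order_refl subsetD)
        moreover have "regular_at g t"
          using t' noS ab(2) by (intro corners_regular[OF path S]) auto
        moreover have "g t \<in> fst c" using sub t by blast
        ultimately show ?thesis using regular_speed(2)[OF _ c(2), of g t] by (simp add: vector_derivative_at)
      qed
      moreover have "(\<lambda>t. norm (F t)) integrable_on {a..b}"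
        using F by (intro integrable_continuous_interval continuous_intros)
      ultimately show ?thesis
        using integrable_spike_finite[of "{a, b}" "{a..b}" "curve_speed M g" "\<lambda>t. norm (F t)"] by simp
    qed
    show "\<exists>d>0. \<forall>u v. t0 \<in> cbox u v \<and> cbox u v \<subseteq> ball t0 d \<and> cbox u v \<subseteq> cbox 0 1 \<longrightarrow>
      curve_speed M g integrable_on cbox u v"
    proof (rule exI[of _ "min r d"], intro conjI allI impI)
      show "min r d > 0" using r d by simp
      fix u v assume "t0 \<in> cbox u v \<and> cbox u v \<subseteq> ball t0 (min r d) \<and> cbox u v \<subseteq> cbox 0 1"
      then have uv: "u \<le> t0" "t0 \<le> v" "{u..v} \<subseteq> ball t0 (min r d)" "{u..v} \<subseteq> {0..1}" by simp_all
      have s1: "{u..t0} \<subseteq> {u..v}" and s2: "{t0..v} \<subseteq> {u..v}" using uv(1,2) by auto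
      have "curve_speed M g integrable_on {u..t0}"
        by (rule key[OF uv(1)]) (use s1 uv(3,4) in \<open>blast, blast, simp\<close>)
      moreover have "curve_speed M g integrable_on {t0..v}"
        by (rule key[OF uv(2)]) (use s2 uv(3,4) in \<open>blast, blast, simp\<close>)
      ultimately have "curve_speed M g integrable_on {u..v}"
        by (rule Henstock_Kurzweil_Integration.integrable_combine[OF uv(1,2)])
      then show "curve_speed M g integrable_on cbox u v" by simp
    qed
  qed
  from integrable_on_little_subintervals[OF this] show ?thesis by simp
qed

lemma curve_speed_integrable_on:
  assumes "pathin (rm_top M) g" "corners g S" "{a..b} \<subseteq> {0..1}"
  shows "curve_speed M g integrable_on {a..b}"
  using integrable_subinterval_real[OF curve_speed_integrable[OF assms(1,2)] assms(3)] .

lemma integral_speed_nonneg: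
  assumes "pathin (rm_top M) g" "{a..b} \<subseteq> {0..1}"
  shows "0 \<le> integral {a..b} (curve_speed M g)"
proof (cases "curve_speed M g integrable_on {a..b}")
  case True
  then show ?thesis
    by (rule integral_nonneg) (use assms path_in_pts in \<open>auto intro!: curve_speed_nonneg\<close>)
qed (simp add: not_integrable_integral)

text \<open>The fundamental theorem of calculus for the coordinate curve, whose derivative has the
  speed as its norm away from the corners.\<close>

lemma chart_dist_le:
  assumes path: "pathin (rm_top M) g" and S: "corners g S" and c: "euclidean_chart c"
    and ab: "a \<le> b" "{a..b} \<subseteq> {0..1}" and sub: "g ` {a..b} \<subseteq> fst c"
  shows "dist (snd c (g a)) (snd c (g b)) \<le> integral {a..b} (curve_speed M g)"
proof -
  define S' where "S' = insert a (insert b S)"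
  \<comment> \<open>The value zero at the exceptional parameters keeps the norm bound valid
    everywhere, and finitely many values do not affect the integral.\<close>
  define D where "D t = (if t \<in> S' then 0 else vector_derivative (snd c \<circ> g) (at t))" for t
  have fin: "finite S'" using cornersD(1)[OF S] by (simp add: S'_def)
  have reg: "regular_at g t" if "t \<in> {a..b} - S'" for t
    using that ab(2) by (intro corners_regular[OF path S]) (auto simp: S'_def)
  have int: "(D has_integral ((snd c \<circ> g) b - (snd c \<circ> g) a)) {a..b}"
  proof (rule fundamental_theorem_of_calculus_interior_strong[OF fin ab(1)])
    show "continuous_on {a..b} (snd c \<circ> g)"
      by (rule chart_path_continuous[OF path euclidean_chart_is_chart[OF c] ab(2) sub])
    fix t assume t: "t \<in> {a<..<b} - S'"
    then have "g t \<in> fst c" using sub by force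
    then show "((snd c \<circ> g) has_vector_derivative D t) (at t)"
      using regular_speed(1)[OF reg c, of t] t by (simp add: D_def)
  qed
  have "norm (integral {a..b} D) \<le> integral {a..b} (curve_speed M g)"
  proof (rule integral_norm_bound_integral)
    show "D integrable_on {a..b}" using int by blast
    show "curve_speed M g integrable_on {a..b}" by (rule curve_speed_integrable_on[OF path S ab(2)])
    fix t assume t: "t \<in> {a..b}"
    show "norm (D t) \<le> curve_speed M g t"
    proof (cases "t \<in> S'")
      case True
      have "t \<in> {0..1}" using t ab(2) by blast
      then have "g t \<in> pts M" by (rule path_in_pts[OF path])
      then show ?thesis using True curve_speed_nonneg by (simp add: D_def)
    next
      case False
      then have "norm (vector_derivative (snd c \<circ> g) (at t)) = curve_speed M g t"
        using t sub by (intro regular_speed(2)[OF reg c]) auto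
      then show ?thesis using False by (simp add: D_def)
    qed
  qed
  then show ?thesis
    using integral_unique[OF int] by (simp add: dist_norm norm_minus_commute)
qed

lemma affine_piece_C1:
  assumes S: "corners g S" and m: "m \<noteq> 0" and pq: "(\<lambda>t. m * t + l) ` {p..q} \<subseteq> {0..1}"
    and h: "\<And>t. t \<in> {p..q} \<Longrightarrow> h t = g (m * t + l)"
    and c: "c \<in> rm_atlas M" and ab: "a < b" "{a..b} \<subseteq> {p..q}" "h ` {a..b} \<subseteq> fst c"
    and noS: "{a<..<b} \<inter> {t. m * t + l \<in> S} = {}"
  shows "C1_on_segment a b (snd c \<circ> h)"
proof (rule C1_on_segment_affine[OF _ _ ab(1)])
  let ?lo = "min (m * a + l) (m * b + l)" and ?hi = "max (m * a + l) (m * b + l)"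
  have J: "(\<lambda>t. m * t + l) ` {a..b} = {?lo..?hi}" using ab(1) by (intro affine_image_Icc) simp
  have sub: "{?lo..?hi} \<subseteq> {0..1}" unfolding J[symmetric] using pq ab(2) by blast
  have "m * a \<noteq> m * b" using m ab(1) by simp
  then have "m * a < m * b \<or> m * b < m * a" by linarith
  then have lt: "?lo < ?hi" by (elim disjE) simp_all
  show "C1_on_segment ?lo ?hi (snd c \<circ> g)"
  proof (rule cornersD(4)[OF S c _ lt])
    have "?lo \<in> {?lo..?hi}" "?hi \<in> {?lo..?hi}" using lt by simp_all
    then have "?lo \<in> {0..1}" "?hi \<in> {0..1}" using sub by blast+
    then show "0 \<le> ?lo" "?hi \<le> 1" by (simp_all only: atLeastAtMost_iff)
    show "g ` {?lo..?hi} \<subseteq> fst c"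
    proof
      fix y assume "y \<in> g ` {?lo..?hi}"
      then obtain t where "t \<in> {a..b}" "y = g (m * t + l)" unfolding J[symmetric] by blast
      then have "h t \<in> fst c" "h t = y" using h[of t] ab(2,3) by blast+
      then show "y \<in> fst c" by simp
    qed
    show "{?lo<..<?hi} \<inter> S = {}"
    proof (rule ccontr)
      assume "{?lo<..<?hi} \<inter> S \<noteq> {}"
      then obtain s where s: "s \<in> S" "?lo < s" "s < ?hi" by auto
      then have "s \<in> (\<lambda>t. m * t + l) ` {a..b}" unfolding J by simp
      then obtain t where t: "t \<in> {a..b}" "s = m * t + l" by blast
      have "t \<noteq> a" "t \<noteq> b" using s t by auto
      then have "t \<in> {a<..<b}" using t by auto
      then show False using noS s t by blast
    qed
  qed
  show "(snd c \<circ> h) t = (snd c \<circ> g) (m * t + l)" if "t \<in> {a..b}" for t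
    using h[of t] ab(2) that by auto
qed

text \<open>Change of variables. The speeds are related only away from the preimages of corners and
  from \<open>p\<close> and \<open>q\<close>, beyond which \<open>h\<close> is unrelated to
  \<open>g\<close>; these are finitely many parameters.\<close>

lemma affine_piece_length:
  assumes path: "pathin (rm_top M) g" and S: "corners g S" and m: "m \<noteq> 0" and pq: "p < q"
    and sub: "(\<lambda>t. m * t + l) ` {p..q} \<subseteq> {0..1}"
    and h: "\<And>t. t \<in> {p..q} \<Longrightarrow> h t = g (m * t + l)"
  shows "(curve_speed M h has_integral integral ((\<lambda>t. m * t + l) ` {p..q}) (curve_speed M g)) {p..q}"
proof -
  let ?lo = "min (m * p + l) (m * q + l)" and ?hi = "max (m * p + l) (m * q + l)"
  let ?I = "integral ((\<lambda>t. m * t + l) ` {p..q}) (curve_speed M g)"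
  have J: "(\<lambda>t. m * t + l) ` {p..q} = cbox ?lo ?hi" using pq affine_image_Icc[of p q m l] by simp
  have "curve_speed M g integrable_on {?lo..?hi}"
    by (rule curve_speed_integrable_on[OF path S]) (use J sub in simp)
  then have "(curve_speed M g has_integral ?I) (cbox ?lo ?hi)" unfolding J by (simp add: has_integral_integral)
  from has_integral_affinity[OF this m, of l]
  have "((\<lambda>x. curve_speed M g (m * x + l)) has_integral (1 / \<bar>m\<bar>) * ?I)
      ((\<lambda>x. (1 / m) * x + - ((1 / m) * l)) ` ((\<lambda>t. m * t + l) ` {p..q}))"
    unfolding J by simp
  moreover have "(\<lambda>x. (1 / m) * x + - ((1 / m) * l)) ` ((\<lambda>t. m * t + l) ` {p..q}) = {p..q}"
  proof -
    have "(1 / m) * (m * t + l) + - ((1 / m) * l) = t" for t using m by (simp add: field_simps)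
    then show ?thesis by (simp add: image_image)
  qed
  ultimately have "((\<lambda>x. curve_speed M g (m * x + l)) has_integral (1 / \<bar>m\<bar>) * ?I) {p..q}" by simp
  from has_integral_mult_right[OF this, of "\<bar>m\<bar>"]
  have int: "((\<lambda>x. \<bar>m\<bar> * curve_speed M g (m * x + l)) has_integral ?I) {p..q}"
    using m by simp
  have "inj (\<lambda>t. m * t + l)" using m by (auto intro: injI)
  then have "finite {t. m * t + l \<in> S}"
    using finite_vimageI[OF cornersD(1)[OF S], of "\<lambda>t. m * t + l"] by (simp add: vimage_def)
  then have fin: "finite ({p, q} \<union> {t. m * t + l \<in> S})" by simp
  show ?thesis
  proof (rule has_integral_spike_finite[OF fin _ int])
    fix t assume t: "t \<in> {p..q} - ({p, q} \<union> {t. m * t + l \<in> S})"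
    have "regular_at g (m * t + l)"
      by (rule corners_regular[OF path S]) (use t sub in blast)+
    then show "curve_speed M h t = \<bar>m\<bar> * curve_speed M g (m * t + l)"
      by (rule regular_affine[OF _ m, of _ _ _ "{p<..<q}"]) (use t h in auto)
  qed
qed

lemma affine_curve:
  assumes g: "piecewise_C1_curve M g" and m: "m \<noteq> 0" and sub: "(\<lambda>t. m * t + l) ` {0..1} \<subseteq> {0..1}"
  shows "piecewise_C1_curve M (\<lambda>t. g (m * t + l))"
    and "curve_length M (\<lambda>t. g (m * t + l)) = integral ((\<lambda>t. m * t + l) ` {0..1}) (curve_speed M g)"
proof -
  obtain S where path: "pathin (rm_top M) g" and S: "corners g S" using piecewiseD[OF g] .
  let ?S = "{0, 1} \<union> {t. m * t + l \<in> S}"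
  have "inj (\<lambda>t. m * t + l)" using m by (auto intro: injI)
  then have fin: "finite {t. m * t + l \<in> S}"
    using finite_vimageI[OF cornersD(1)[OF S], of "\<lambda>t. m * t + l"] by (simp add: vimage_def)
  have "corners (\<lambda>t. g (m * t + l)) ?S"
    unfolding corners_def
  proof (intro conjI ballI allI impI)
    fix c a b assume "c \<in> rm_atlas M" and *: "0 \<le> a \<and> a < b \<and> b \<le> 1 \<and>
      (\<lambda>t. g (m * t + l)) ` {a..b} \<subseteq> fst c \<and> {a<..<b} \<inter> ?S = {}"
    then show "C1_on_segment a b (snd c \<circ> (\<lambda>t. g (m * t + l)))"
      by (intro affine_piece_C1[OF S m sub]) auto
  qed (use fin in auto)
  moreover have "pathin (rm_top M) (\<lambda>t. g (m * t + l))"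
    unfolding pathin_local
  proof (intro ballI conjI allI impI)
    fix t :: real assume t: "t \<in> {0..1}"
    have t': "m * t + l \<in> {0..1}" using sub t by blast
    then show "g (m * t + l) \<in> topspace (rm_top M)" using path unfolding pathin_local by blast
    fix V assume V: "openin (rm_top M) V" "g (m * t + l) \<in> V"
    then obtain e where e: "e > 0" "\<forall>s\<in>{0..1}. \<bar>s - (m * t + l)\<bar> < e \<longrightarrow> g s \<in> V"
      using path t' unfolding pathin_local by blast
    show "\<exists>e>0. \<forall>s\<in>{0..1}. \<bar>s - t\<bar> < e \<longrightarrow> g (m * s + l) \<in> V"
    proof (intro exI[of _ "e / \<bar>m\<bar>"] conjI ballI impI)
      show "e / \<bar>m\<bar> > 0" using e m by simp
      fix s :: real assume s: "s \<in> {0..1}" "\<bar>s - t\<bar> < e / \<bar>m\<bar>"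
      have "\<bar>(m * s + l) - (m * t + l)\<bar> = \<bar>m\<bar> * \<bar>s - t\<bar>"
        by (simp add: abs_mult[symmetric] algebra_simps)
      also have "\<dots> < e" using s(2) m by (simp add: field_simps)
      finally show "g (m * s + l) \<in> V" using e(2) sub s(1) by blast
    qed
  qed
  ultimately show "piecewise_C1_curve M (\<lambda>t. g (m * t + l))" by (rule piecewiseI[rotated])
  show "curve_length M (\<lambda>t. g (m * t + l)) = integral ((\<lambda>t. m * t + l) ` {0..1}) (curve_speed M g)"
    unfolding curve_length_def
    using affine_piece_length[OF path S m _ sub, of "\<lambda>t. g (m * t + l)"] by (intro integral_unique) simp
qed

lemma join_curves:
  assumes g: "piecewise_C1_curve M g" and h: "piecewise_C1_curve M h" and gh: "g 1 = h 0"
  obtains k where "piecewise_C1_curve M k" "k 0 = g 0" "k 1 = h 1"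
    "curve_length M k = curve_length M g + curve_length M h"
proof -
  obtain S where gp: "pathin (rm_top M) g" and S: "corners g S" using piecewiseD[OF g] .
  obtain S' where hp: "pathin (rm_top M) h" and S': "corners h S'" using piecewiseD[OF h] .
  \<comment> \<open>The summands \<open>0\<close> and \<open>-1\<close> make both halves literal
    instances of the affine lemmas.\<close>
  define k where "k t = (if t \<le> 1/2 then g (2 * t + 0) else h (2 * t + (-1)))" for t :: real
  have kg: "k t = g (2 * t + 0)" if "t \<in> {0..1/2}" for t using that by (simp add: k_def)
  have kh: "k t = h (2 * t + (-1))" if "t \<in> {1/2..1}" for t
  proof (cases "t = 1/2")
    case True
    then have "2 * t + 0 = 1" "2 * t + (-1) = 0" by simp_all
    then show ?thesis using gh True by (simp only: k_def if_True order_refl)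
  next
    case False
    then show ?thesis using that by (simp add: k_def)
  qed
  have im1: "(\<lambda>t. 2 * t + 0) ` {0..1/2} = {0..1::real}"
    using affine_image_Icc[of 0 "1/2" 2 0] by simp
  have im2: "(\<lambda>t. 2 * t + (-1)) ` {1/2..1} = {0..1::real}"
    using affine_image_Icc[of "1/2" 1 2 "-1"] by simp
  \<comment> \<open>The junction \<open>1/2\<close> becomes a corner, so a segment on which
    regularity must be shown lies in one of the two halves.\<close>
  let ?S = "{0, 1, 1/2} \<union> {t. 2 * t + 0 \<in> S} \<union> {t. 2 * t + (-1) \<in> S'}"
  have inj: "inj (\<lambda>t::real. 2 * t + l)" for l by (auto intro: injI)
  have "finite {t. 2 * t + 0 \<in> S}"
    using finite_vimageI[OF cornersD(1)[OF S] inj[of 0]] by (simp add: vimage_def)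
  moreover have "finite {t. 2 * t + (-1) \<in> S'}"
    using finite_vimageI[OF cornersD(1)[OF S'] inj[of "-1"]] by (simp add: vimage_def)
  ultimately have fin: "finite ?S" by simp
  have "corners k ?S"
    unfolding corners_def
  proof (intro conjI ballI allI impI)
    fix c a b assume c: "c \<in> rm_atlas M" and *: "0 \<le> a \<and> a < b \<and> b \<le> 1 \<and>
      k ` {a..b} \<subseteq> fst c \<and> {a<..<b} \<inter> ?S = {}"
    then have ab: "0 \<le> a" "a < b" "b \<le> 1" "k ` {a..b} \<subseteq> fst c" and noS: "{a<..<b} \<inter> ?S = {}" by blast+
    have "1/2 \<notin> {a<..<b}" using noS by blast
    then consider "b \<le> 1/2" | "1/2 \<le> a" by force
    then show "C1_on_segment a b (snd c \<circ> k)"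
    proof cases
      case 1
      have "{a<..<b} \<inter> {t. 2 * t + 0 \<in> S} = {}" using noS by blast
      then show ?thesis
        by (rule affine_piece_C1[OF S _ _ kg c ab(2) _ ab(4), rotated -1]) (use im1 1 ab in auto)
    next
      case 2
      have "{a<..<b} \<inter> {t. 2 * t + (-1) \<in> S'} = {}" using noS by blast
      then show ?thesis
        by (rule affine_piece_C1[OF S' _ _ kh c ab(2) _ ab(4), rotated -1]) (use im2 2 ab in auto)
    qed
  qed (use fin in auto)
  moreover have "pathin (rm_top M) k"
    unfolding pathin_local
  proof (intro ballI conjI allI impI)
    fix t :: real assume t: "t \<in> {0..1}"
    show "k t \<in> topspace (rm_top M)"
    proof (cases "t \<le> 1/2")
      case True
      then have "2 * t + 0 \<in> {0..1}" using t by simp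
      from path_in_pts[OF gp this] show ?thesis using True by (simp add: pts_def k_def)
    next
      case False
      then have "2 * t + (-1) \<in> {0..1}" using t by simp
      from path_in_pts[OF hp this] show ?thesis using False by (simp add: pts_def k_def)
    qed
    fix V assume V: "openin (rm_top M) V" "k t \<in> V"
    have e1: "\<exists>e>0. \<forall>s\<in>{0..1/2}. \<bar>s - t\<bar> < e \<longrightarrow> k s \<in> V"
    proof (cases "t \<le> 1/2")
      case True
      then have "2 * t + 0 \<in> {0..1}" "g (2 * t + 0) \<in> V" using t V kg[of t] by simp_all
      then obtain e where e: "e > 0" "\<forall>s\<in>{0..1}. \<bar>s - (2 * t + 0)\<bar> < e \<longrightarrow> g s \<in> V"
        using gp V(1) unfolding pathin_local by blast
      show ?thesis
      proof (intro exI[of _ "e/2"] conjI ballI impI)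
        fix s :: real assume s: "s \<in> {0..1/2}" "\<bar>s - t\<bar> < e / 2"
        then have "2 * s + 0 \<in> {0..1}" by simp
        moreover have "\<bar>(2 * s + 0) - (2 * t + 0)\<bar> < e" using s(2) by arith
        ultimately
        show "k s \<in> V" using e(2) kg[OF s(1)] by simp
      qed (use e in simp)
    next
      case False
      then have "\<not> \<bar>s - t\<bar> < t - 1/2" if "s \<in> {0..1/2}" for s using that by auto
      then show ?thesis using False by (intro exI[of _ "t - 1/2"]) auto
    qed
    have e2: "\<exists>e>0. \<forall>s\<in>{1/2..1}. \<bar>s - t\<bar> < e \<longrightarrow> k s \<in> V"
    proof (cases "1/2 \<le> t")
      case True
      then have "2 * t + (-1) \<in> {0..1}" "h (2 * t + (-1)) \<in> V" using t V kh[of t] by simp_all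
      then obtain e where e: "e > 0" "\<forall>s\<in>{0..1}. \<bar>s - (2 * t + (-1))\<bar> < e \<longrightarrow> h s \<in> V"
        using hp V(1) unfolding pathin_local by blast
      show ?thesis
      proof (intro exI[of _ "e/2"] conjI ballI impI)
        fix s :: real assume s: "s \<in> {1/2..1}" "\<bar>s - t\<bar> < e / 2"
        then have "2 * s + (-1) \<in> {0..1}" by simp
        moreover have "\<bar>(2 * s + (-1)) - (2 * t + (-1))\<bar> < e" using s(2) by arith
        ultimately
        show "k s \<in> V" using e(2) kh[OF s(1)] by simp
      qed (use e in simp)
    next
      case False
      then have "\<not> \<bar>s - t\<bar> < 1/2 - t" if "s \<in> {1/2..1}" for s using that by auto
      then show ?thesis using False by (intro exI[of _ "1/2 - t"]) auto
    qed
    obtain d1 where d1: "d1 > 0" "\<forall>s\<in>{0..1/2}. \<bar>s - t\<bar> < d1 \<longrightarrow> k s \<in> V" using e1 by blast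
    obtain d2 where d2: "d2 > 0" "\<forall>s\<in>{1/2..1}. \<bar>s - t\<bar> < d2 \<longrightarrow> k s \<in> V" using e2 by blast
    show "\<exists>e>0. \<forall>s\<in>{0..1}. \<bar>s - t\<bar> < e \<longrightarrow> k s \<in> V"
    proof (intro exI[of _ "min d1 d2"] conjI ballI impI)
      fix s :: real assume s: "s \<in> {0..1}" "\<bar>s - t\<bar> < min d1 d2"
      show "k s \<in> V"
      proof (cases "s \<le> 1/2")
        case True
        then have "s \<in> {0..1/2}" "\<bar>s - t\<bar> < d1" using s by simp_all
        then show ?thesis using d1(2) by blast
      next
        case False
        then have "s \<in> {1/2..1}" "\<bar>s - t\<bar> < d2" using s by simp_all
        then show ?thesis using d2(2) by blast
      qed
    qed (use d1 d2 in simp)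
  qed
  ultimately have k: "piecewise_C1_curve M k" by (rule piecewiseI[rotated])
  have "(curve_speed M k has_integral integral {0..1} (curve_speed M g)) {0..1/2}"
    by (rule affine_piece_length[OF gp S, where m = 2 and l = 0 and p = 0 and q = "1/2" and h = k, unfolded im1])
      (simp, simp, simp, rule kg)
  moreover have "(curve_speed M k has_integral integral {0..1} (curve_speed M h)) {1/2..1}"
    by (rule affine_piece_length[OF hp S', where m = 2 and l = "-1" and p = "1/2" and q = 1 and h = k, unfolded im2])
      (simp, simp, simp, rule kh)
  ultimately have "(curve_speed M k has_integral curve_length M g + curve_length M h) {0..1}"
    unfolding curve_length_def by (intro has_integral_combine[of 0 "1/2" 1]) auto
  then have "curve_length M k = curve_length M g + curve_length M h"
    unfolding curve_length_def[of M k] by (rule integral_unique)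
  then show ?thesis using that[OF k] by (simp add: k_def)
qed


section \<open>Comparison of lengths with Euclidean distances in a chart\<close>

lemma segment_curve:
  assumes c: "euclidean_chart c" and p: "p \<in> fst c" and q: "q \<in> fst c"
    and seg: "closed_segment (snd c p) (snd c q) \<subseteq> snd c ` fst c"
  obtains g where "piecewise_C1_curve M g" "g 0 = p" "g 1 = q"
    "curve_length M g = dist (snd c p) (snd c q)"
proof -
  define x where "x = snd c p"
  define v where "v = snd c q - snd c p"
  define line where "line t = x + t *\<^sub>R v" for t :: real
  define g where "g t = inv_into (fst c) (snd c) (line t)" for t
  have ch: "is_chart (rm_top M) c" by (rule euclidean_chart_is_chart[OF c])
  have line_in: "line t \<in> snd c ` fst c" if "t \<in> {0..1}" for t
  proof -
    have "line t = (1 - t) *\<^sub>R snd c p + t *\<^sub>R snd c q"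
      by (simp add: line_def x_def v_def algebra_simps)
    then have "line t \<in> closed_segment (snd c p) (snd c q)"
      using that unfolding closed_segment_def by auto
    then show ?thesis using seg by blast
  qed
  have g_in: "g t \<in> fst c" "snd c (g t) = line t" if "t \<in> {0..1}" for t
    using inv_into_into[OF line_in[OF that]] f_inv_into_f[OF line_in[OF that]] by (simp_all add: g_def)
  have line_deriv: "(line has_vector_derivative v) (at t within A)" for t A
    unfolding line_def by (auto intro!: derivative_eq_intros)
  have line_cont: "continuous_on A line" for A
    unfolding line_def by (intro continuous_intros)
  have "continuous_map (top_of_set {0..1}) (top_of_set (snd c ` fst c)) line"
    using line_cont line_in by (auto simp: continuous_map_in_subtopology)
  from continuous_map_compose[OF this chart_inv_continuous[OF ch]]
  have path: "pathin (rm_top M) g"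
    unfolding pathin_def g_def o_def .
  have S: "corners g {0, 1}"
    unfolding corners_def
  proof (intro conjI ballI allI impI)
    fix c' a b assume c': "c' \<in> rm_atlas M" and *: "0 \<le> a \<and> a < b \<and> b \<le> 1 \<and> g ` {a..b} \<subseteq> fst c' \<and> {a<..<b} \<inter> {0, 1} = {}"
    have t01: "t \<in> {0..1}" if "t \<in> {a..b}" for t using that * by auto
    note smooth = euclidean_chart_smooth(1)[OF c c']
    have line_im: "line t \<in> snd c ` (fst c \<inter> fst c')" if "t \<in> {a..b}" for t
      using g_in[OF t01[OF that]] * that by (metis IntI image_eqI image_subset_iff)
    have eq: "snd c' \<circ> g = transition c c' \<circ> line"
      by (simp add: fun_eq_iff transition_def g_def)
    show "C1_on_segment a b (snd c' \<circ> g)"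
      unfolding C1_on_segment_def eq
    proof (intro exI[of _ "\<lambda>t. frechet_derivative (transition c c') (at (line t)) v"] conjI ballI)
      show "continuous_on {a..b} (\<lambda>t. frechet_derivative (transition c c') (at (line t)) v)"
        using line_im by (intro continuous_on_frechet_derivative_apply[OF smooth] line_cont) auto
      fix t assume t: "t \<in> {a..b}"
      have "transition c c' differentiable (at (line t))"
        by (rule smooth_on_D(1)[OF smooth line_im[OF t]])
      then have "(transition c c' has_derivative frechet_derivative (transition c c') (at (line t)))
          (at (line t) within line ` {a..b})"
        by (simp add: frechet_derivative_works has_derivative_at_withinI)
      from vector_derivative_diff_chain_within[OF line_deriv this]
      show "((transition c c' \<circ> line) has_vector_derivative frechet_derivative (transition c c') (at (line t)) v)
          (at t within {a..b})" .
    qed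
  qed auto
  have speed: "curve_speed M g t = norm v" if "t \<in> {0..1} - {0, 1}" for t
  proof -
    have t: "t \<in> {0<..<1}" "t \<in> {0..1}" using that by auto
    have "regular_at g t" using that by (intro corners_regular[OF path S]) auto
    moreover have "((snd c \<circ> g) has_vector_derivative v) (at t)"
      by (rule has_vector_derivative_transform_within_open[OF line_deriv open_greaterThanLessThan t(1)])
        (use g_in in auto)
    ultimately show ?thesis
      using regular_speed(2)[where g = g and t = t, OF _ c g_in(1)[OF t(2)]] by (simp add: vector_derivative_at)
  qed
  have "((\<lambda>t. norm v) has_integral norm v) {0..1::real}"
    using has_integral_const_real[of "norm v" 0 1] by simp
  then have "(curve_speed M g has_integral norm v) {0..1}"
    by (rule has_integral_spike_finite[of "{0, 1}", rotated 2]) (simp, rule speed)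
  then have len: "curve_length M g = dist (snd c p) (snd c q)"
    unfolding curve_length_def by (simp add: integral_unique v_def dist_norm norm_minus_commute)
  have "g 0 = p" "g 1 = q"
    using p q chart_inj[OF ch] by (simp_all add: g_def line_def x_def v_def inv_into_f_f)
  then show ?thesis using that piecewiseI[OF path S] len by blast
qed

lemma length_split:
  assumes path: "pathin (rm_top M) g" and S: "corners g S" and s: "s \<in> {0..1}"
  shows "integral {0..s} (curve_speed M g) + integral {s..1} (curve_speed M g) = curve_length M g"
  unfolding curve_length_def
  using s by (intro Henstock_Kurzweil_Integration.integral_combine curve_speed_integrable[OF path S]) auto

lemma curve_length_nonneg:
  assumes "piecewise_C1_curve M g"
  shows "0 \<le> curve_length M g"
proof -
  have "pathin (rm_top M) g" using assms unfolding piecewise_C1_curve_def by blast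
  from integral_speed_nonneg[OF this, of 0 1] show ?thesis by (simp add: curve_length_def)
qed

text \<open>First exit argument: up to the first time at which the curve leaves the coordinate ball,
  its coordinates have moved by at most its length, which is smaller than the radius, so it cannot
  have left.\<close>

lemma short_curve_in_chart:
  assumes c: "euclidean_chart c" and g: "piecewise_C1_curve M g" and p: "g 0 \<in> fst c"
    and ball: "ball (snd c (g 0)) r \<subseteq> snd c ` fst c" and len: "curve_length M g < r"
  shows "g 1 \<in> fst c" "dist (snd c (g 0)) (snd c (g 1)) \<le> curve_length M g"
proof -
  obtain S where path: "pathin (rm_top M) g" and S: "corners g S" using piecewiseD[OF g] .
  have ch: "is_chart (rm_top M) c" by (rule euclidean_chart_is_chart[OF c])
  define x where "x = snd c (g 0)"
  \<comment> \<open>An intermediate radius makes the closed ball lie inside the image of the chart,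
    so that its preimage is compact.\<close>
  define r' where "r' = (curve_length M g + r) / 2"
  have r': "curve_length M g < r'" "r' < r" using len by (simp_all add: r'_def)
  have r0: "0 < r'" using r' curve_length_nonneg[OF g] by linarith
  define V where "V = {y \<in> fst c. snd c y \<in> ball x r'}"
  define K where "K = inv_into (fst c) (snd c) ` cball x r'"
  have cb: "cball x r' \<subseteq> snd c ` fst c"
  proof -
    have "cball x r' \<subseteq> ball x r" using r'(2) by auto
    then show ?thesis using ball by (simp add: x_def)
  qed
  have "compactin (top_of_set (snd c ` fst c)) (cball x r')"
    using cb by (simp add: compactin_subtopology)
  then have "compactin (rm_top M) K"
    unfolding K_def by (rule image_compactin[OF _ chart_inv_continuous[OF ch]])
  \<comment> \<open>Since compact sets are closed in a Hausdorff space, the curve is still in the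
    chart domain at its first exit time.\<close>
  moreover have "Hausdorff_space (rm_top M)"
    using riem unfolding riemannian_manifold_def smooth_manifold_def by blast
  ultimately have clK: "closedin (rm_top M) K" using compactin_imp_closedin by blast
  have KD: "K \<subseteq> fst c"
  proof
    fix y assume "y \<in> K"
    then obtain z where "z \<in> snd c ` fst c" "y = inv_into (fst c) (snd c) z" using cb unfolding K_def by blast
    then show "y \<in> fst c" by (simp add: inv_into_into)
  qed
  have VK: "V \<subseteq> K"
  proof
    fix y assume "y \<in> V"
    then have "y \<in> fst c" "snd c y \<in> cball x r'" by (auto simp: V_def)
    then show "y \<in> K" unfolding K_def using chart_inj[OF ch] by (intro image_eqI[of _ _ "snd c y"]) simp_all
  qed
  have opV: "openin (rm_top M) V" unfolding V_def by (rule chart_preimage_open[OF ch open_ball])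
  have all: "g t \<in> V" if "t \<in> {0..1}" for t
  proof (rule ccontr)
    assume "g t \<notin> V"
    define A where "A = {0..1} - {s \<in> {0..1}. g s \<in> V}"
    have "continuous_map (top_of_set {0..1}) (rm_top M) g" using path by (simp add: pathin_def)
    from openin_continuous_map_preimage[OF this opV]
    have "openin (top_of_set {0..1}) {s \<in> {0..1}. g s \<in> V}" by simp
    then have "closedin (top_of_set {0..1}) A"
      unfolding A_def by (intro closedin_diff) (simp_all add: closed_subset)
    then have "compact A" using closedin_compact compact_Icc by blast
    moreover have "A \<noteq> {}" using that \<open>g t \<notin> V\<close> unfolding A_def by blast
    ultimately obtain s where s: "s \<in> A" "\<And>u. u \<in> A \<Longrightarrow> s \<le> u"
      using compact_attains_inf[of A] by blast
    have s01: "s \<in> {0..1}" "g s \<notin> V" using s(1) by (auto simp: A_def)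
    have before: "g u \<in> V" if "u \<in> {0..1}" "u < s" for u
      using s(2)[of u] that unfolding A_def by fastforce
    have "g 0 \<in> V" using p r0 by (simp add: V_def x_def)
    then have "0 < s" using s01 by (cases "s = 0") auto
    have "g s \<in> K"
    proof (rule ccontr)
      assume "g s \<notin> K"
      then have "g s \<in> topspace (rm_top M) - K" using path_in_pts[OF path s01(1)] by (simp add: pts_def)
      moreover have "openin (rm_top M) (topspace (rm_top M) - K)" using clK by (simp add: openin_diff)
      ultimately obtain e where e: "e > 0" "\<forall>u\<in>{0..1}. \<bar>u - s\<bar> < e \<longrightarrow> g u \<in> topspace (rm_top M) - K"
        using path s01(1) unfolding pathin_local by blast
      define u where "u = max 0 (s - e / 2)"
      have u: "u \<in> {0..1}" "u < s" "\<bar>u - s\<bar> < e" using \<open>0 < s\<close> s01(1) e(1) by (auto simp: u_def)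
      have "g u \<in> V" by (rule before[OF u(1,2)])
      moreover have "g u \<notin> K" using e(2) u by blast
      ultimately show False using VK by blast
    qed
    have sub: "g ` {0..s} \<subseteq> fst c"
    proof
      fix y assume "y \<in> g ` {0..s}"
      then obtain u where u: "u \<in> {0..s}" "y = g u" by blast
      show "y \<in> fst c"
      proof (cases "u = s")
        case True
        then show ?thesis using u KD \<open>g s \<in> K\<close> by blast
      next
        case False
        then have "u \<in> {0..1}" "u < s" using u s01 by auto
        then show ?thesis using before[of u] u by (simp add: V_def)
      qed
    qed
    have "{0..s} \<subseteq> {0..1}" using s01 by auto
    then have "dist x (snd c (g s)) \<le> integral {0..s} (curve_speed M g)"
      using chart_dist_le[OF path S c _ _ sub] \<open>0 < s\<close> by (simp add: x_def)
    moreover have "0 \<le> integral {s..1} (curve_speed M g)"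
      using s01 by (intro integral_speed_nonneg[OF path]) auto
    ultimately have "dist x (snd c (g s)) \<le> curve_length M g"
      using length_split[OF path S s01(1)] by linarith
    then have "dist x (snd c (g s)) < r'" using r'(1) by linarith
    moreover have "g s \<in> fst c" using KD \<open>g s \<in> K\<close> by blast
    ultimately show False using s01(2) by (simp add: V_def)
  qed
  then have sub: "g ` {0..1} \<subseteq> fst c" unfolding V_def by blast
  then show "g 1 \<in> fst c" by force
  show "dist (snd c (g 0)) (snd c (g 1)) \<le> curve_length M g"
    using chart_dist_le[OF path S c _ _ sub] by (simp add: curve_length_def)
qed

lemma chart_ball:
  assumes c: "euclidean_chart c" and p: "p \<in> fst c" and V: "openin (rm_top M) V" "p \<in> V"
  obtains r where "0 < r" "ball (snd c p) r \<subseteq> snd c ` (V \<inter> fst c)"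
proof -
  have "open (snd c ` (V \<inter> fst c))" by (rule chart_open_image[OF euclidean_chart_is_chart[OF c] V(1)])
  moreover have "snd c p \<in> snd c ` (V \<inter> fst c)" using p V by blast
  ultimately show ?thesis using that unfolding open_contains_ball by blast
qed

lemma segment_curve_ball:
  assumes c: "euclidean_chart c" and p: "p \<in> fst c" "q \<in> fst c"
    and ball: "ball (snd c p) r \<subseteq> snd c ` fst c" and q: "dist (snd c p) (snd c q) < r"
  obtains g where "piecewise_C1_curve M g" "g 0 = p" "g 1 = q"
    "curve_length M g = dist (snd c p) (snd c q)"
proof -
  have "0 < r" using q zero_le_dist[of "snd c p" "snd c q"] by linarith
  then have "closed_segment (snd c p) (snd c q) \<subseteq> ball (snd c p) r"
    using q by (intro closed_segment_subset) auto
  then have "closed_segment (snd c p) (snd c q) \<subseteq> snd c ` fst c" using ball by blast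
  from segment_curve[OF c p this] show ?thesis using that by blast
qed

lemma reverse_curve:
  assumes "piecewise_C1_curve M g"
  obtains h where "piecewise_C1_curve M h" "h 0 = g 1" "h 1 = g 0" "curve_length M h = curve_length M g"
proof -
  have im: "(\<lambda>t. (-1) * t + 1) ` {0..1} = {0..1::real}"
    using affine_image_Icc[of 0 1 "-1" 1] by simp
  have h: "piecewise_C1_curve M (\<lambda>t. g ((-1) * t + 1))"
    by (rule affine_curve(1)[OF assms]) (simp, simp only: im subset_refl)
  have "curve_length M (\<lambda>t. g ((-1) * t + 1)) = integral ((\<lambda>t. (-1) * t + 1) ` {0..1}) (curve_speed M g)"
    by (rule affine_curve(2)[OF assms]) (simp, simp only: im subset_refl)
  then have "curve_length M (\<lambda>t. g ((-1) * t + 1)) = curve_length M g"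
    by (simp only: im curve_length_def[of M g])
  from that[OF h _ _ this] show ?thesis by simp
qed

text \<open>Being joined by a curve is an equivalence relation whose classes are open, because
  nearby points are joined by coordinate segments; connectedness leaves one class.\<close>

lemma curve_exists:
  assumes p: "p \<in> pts M" and q: "q \<in> pts M"
  shows "\<exists>g. piecewise_C1_curve M g \<and> g 0 = p \<and> g 1 = q"
proof -
  let ?R = "\<lambda>x y. \<exists>g. piecewise_C1_curve M g \<and> g 0 = x \<and> g 1 = y"
  have trans: "?R x z" if xy: "?R x y" and yz: "?R y z" for x y z
  proof -
    obtain g where g: "piecewise_C1_curve M g" "g 0 = x" "g 1 = y" using xy by blast
    obtain h where h: "piecewise_C1_curve M h" "h 0 = y" "h 1 = z" using yz by blast
    have "g 1 = h 0" using g h by simp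
    from join_curves[OF g(1) h(1) this]
    obtain k where k: "piecewise_C1_curve M k" "k 0 = g 0" "k 1 = h 1" by blast
    show ?thesis by (rule exI[of _ k]) (use k g h in simp)
  qed
  have sym: "?R y x" if xy: "?R x y" for x y
  proof -
    obtain g where g: "piecewise_C1_curve M g" "g 0 = x" "g 1 = y" using xy by blast
    from reverse_curve[OF g(1)]
    obtain h where h: "piecewise_C1_curve M h" "h 0 = g 1" "h 1 = g 0" by blast
    show ?thesis by (rule exI[of _ h]) (use h g in simp)
  qed
  have loc: "\<exists>V. openin (rm_top M) V \<and> y \<in> V \<and> V \<subseteq> pts M \<and> (\<forall>z\<in>V. ?R y z)" if y: "y \<in> pts M" for y
  proof -
    obtain c where c: "y \<in> fst c" "euclidean_chart c" using euclidean_chart_exists[OF y] .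
    note ch = euclidean_chart_is_chart[OF c(2)]
    obtain r where r: "0 < r" "ball (snd c y) r \<subseteq> snd c ` (fst c \<inter> fst c)"
      using chart_ball[OF c(2,1) chart_openin[OF ch] c(1)] .
    then have r2: "ball (snd c y) r \<subseteq> snd c ` fst c" by simp
    have R: "?R y z" if z: "z \<in> fst c" "snd c z \<in> ball (snd c y) r" for z
    proof -
      have "dist (snd c y) (snd c z) < r" using z by simp
      from segment_curve_ball[OF c(2,1) z(1) r2 this]
      obtain g where "piecewise_C1_curve M g" "g 0 = y" "g 1 = z" by blast
      then show ?thesis by blast
    qed
    let ?V = "{z \<in> fst c. snd c z \<in> ball (snd c y) r}"
    have "openin (rm_top M) ?V" by (rule chart_preimage_open[OF ch open_ball])
    moreover have "y \<in> ?V" using c r by simp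
    moreover have "?V \<subseteq> pts M" using chart_domain_subset[OF ch] by (auto simp: pts_def)
    ultimately show ?thesis using R by blast
  qed
  let ?C = "{x \<in> pts M. ?R p x}"
  have "openin (rm_top M) ?C"
  proof (subst openin_subopen, intro ballI)
    fix x assume x: "x \<in> ?C"
    then obtain V where V: "openin (rm_top M) V" "x \<in> V" "V \<subseteq> pts M" "\<forall>z\<in>V. ?R x z"
      using loc[of x] by blast
    have "V \<subseteq> ?C" using V(3,4) x trans[of p x] by blast
    then show "\<exists>V. openin (rm_top M) V \<and> x \<in> V \<and> V \<subseteq> ?C" using V by blast
  qed
  moreover have "closedin (rm_top M) ?C"
    unfolding closedin_def
  proof (intro conjI)
    show "?C \<subseteq> topspace (rm_top M)" by (auto simp: pts_def)
    show "openin (rm_top M) (topspace (rm_top M) - ?C)"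
    proof (subst openin_subopen, intro ballI)
      fix x assume x: "x \<in> topspace (rm_top M) - ?C"
      then have "x \<in> pts M" by (simp add: pts_def)
      then obtain V where V: "openin (rm_top M) V" "x \<in> V" "V \<subseteq> pts M" "\<forall>z\<in>V. ?R x z"
        using loc[of x] by blast
      have "z \<notin> ?C" if z: "z \<in> V" for z
      proof
        assume "z \<in> ?C"
        then have "?R p z" by blast
        moreover have "?R z x" using sym V(4) z by blast
        ultimately have "?R p x" by (rule trans)
        then show False using x \<open>x \<in> pts M\<close> by blast
      qed
      then have "V \<subseteq> topspace (rm_top M) - ?C" using V(3) by (auto simp: pts_def)
      then show "\<exists>V. openin (rm_top M) V \<and> x \<in> V \<and> V \<subseteq> topspace (rm_top M) - ?C" using V by blast
    qed
  qed
  moreover have "connected_space (rm_top M)"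
    using riem unfolding riemannian_manifold_def smooth_manifold_def by blast
  ultimately have "?C = {} \<or> ?C = topspace (rm_top M)"
    unfolding connected_space_clopen_in by blast
  moreover have "p \<in> ?C"
  proof -
    obtain V where "p \<in> V" "\<forall>z\<in>V. ?R p z" using loc[OF p] by blast
    then have "?R p p" by blast
    then show ?thesis using p by blast
  qed
  ultimately have "?C = pts M" by (auto simp: pts_def)
  then show ?thesis using q by blast
qed

section \<open>The Riemannian distance\<close>

lemma riem_dist_le:
  assumes "piecewise_C1_curve M g"
  shows "riem_dist M (g 0) (g 1) \<le> curve_length M g"
  unfolding riem_dist_def
proof (rule cInf_lower)
  show "curve_length M g \<in> {curve_length M \<gamma> |\<gamma>. piecewise_C1_curve M \<gamma> \<and> \<gamma> 0 = g 0 \<and> \<gamma> 1 = g 1}"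
    using assms by blast
  show "bdd_below {curve_length M \<gamma> |\<gamma>. piecewise_C1_curve M \<gamma> \<and> \<gamma> 0 = g 0 \<and> \<gamma> 1 = g 1}"
    using curve_length_nonneg by (intro bdd_belowI[of _ 0]) auto
qed

lemma riem_dist_lessE:
  assumes "p \<in> pts M" "q \<in> pts M" "riem_dist M p q < e"
  obtains g where "piecewise_C1_curve M g" "g 0 = p" "g 1 = q" "curve_length M g < e"
proof -
  have "{curve_length M \<gamma> |\<gamma>. piecewise_C1_curve M \<gamma> \<and> \<gamma> 0 = p \<and> \<gamma> 1 = q} \<noteq> {}"
    using curve_exists[OF assms(1,2)] by blast
  from cInf_lessD[OF this assms(3)[unfolded riem_dist_def]] show ?thesis using that by blast
qed

lemma riem_dist_nonneg:
  assumes "p \<in> pts M" "q \<in> pts M"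
  shows "0 \<le> riem_dist M p q"
proof (rule ccontr)
  assume "\<not> ?thesis"
  then have "riem_dist M p q < 0" by simp
  from riem_dist_lessE[OF assms this]
  obtain g where "piecewise_C1_curve M g" "curve_length M g < 0" by blast
  then show False using curve_length_nonneg[of g] by linarith
qed

lemma riem_dist_triangle:
  assumes "p \<in> pts M" "q \<in> pts M" "r \<in> pts M"
  shows "riem_dist M p r \<le> riem_dist M p q + riem_dist M q r"
proof (rule field_le_epsilon)
  fix e :: real assume e: "0 < e"
  have "riem_dist M p q < riem_dist M p q + e / 2" using e by simp
  from riem_dist_lessE[OF assms(1,2) this]
  obtain g where g: "piecewise_C1_curve M g" "g 0 = p" "g 1 = q" "curve_length M g < riem_dist M p q + e / 2" .
  have "riem_dist M q r < riem_dist M q r + e / 2" using e by simp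
  from riem_dist_lessE[OF assms(2,3) this]
  obtain h where h: "piecewise_C1_curve M h" "h 0 = q" "h 1 = r" "curve_length M h < riem_dist M q r + e / 2" .
  have "g 1 = h 0" using g h by simp
  from join_curves[OF g(1) h(1) this]
  obtain k where k: "piecewise_C1_curve M k" "k 0 = g 0" "k 1 = h 1"
    "curve_length M k = curve_length M g + curve_length M h" .
  show "riem_dist M p r \<le> riem_dist M p q + riem_dist M q r + e"
    using riem_dist_le[OF k(1)] k g h by simp
qed

lemma riem_dist_commute_le:
  assumes "p \<in> pts M" "q \<in> pts M"
  shows "riem_dist M p q \<le> riem_dist M q p"
proof (rule field_le_epsilon)
  fix e :: real assume e: "0 < e"
  have "riem_dist M q p < riem_dist M q p + e" using e by simp
  from riem_dist_lessE[OF assms(2,1) this]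
  obtain g where g: "piecewise_C1_curve M g" "g 0 = q" "g 1 = p" "curve_length M g < riem_dist M q p + e" .
  from reverse_curve[OF g(1)]
  obtain h where h: "piecewise_C1_curve M h" "h 0 = g 1" "h 1 = g 0" "curve_length M h = curve_length M g" .
  show "riem_dist M p q \<le> riem_dist M q p + e"
    using riem_dist_le[OF h(1)] h g by simp
qed

text \<open>Coordinate segments bound the distance from above. From below, nearly minimal curves are
  too short to leave the chart, so their length is at least the coordinate distance.\<close>

lemma riem_dist_in_chart:
  assumes c: "euclidean_chart c" and p: "p \<in> fst c" and ball: "ball (snd c p) r \<subseteq> snd c ` fst c"
  shows "q \<in> fst c \<Longrightarrow> dist (snd c p) (snd c q) < r \<Longrightarrow> riem_dist M p q = dist (snd c p) (snd c q)"
    and "q \<in> pts M \<Longrightarrow> riem_dist M p q < r \<Longrightarrow> q \<in> fst c \<and> dist (snd c p) (snd c q) < r"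
proof -
  have sub: "fst c \<subseteq> pts M"
    using chart_domain_subset[OF euclidean_chart_is_chart[OF c]] by (simp add: pts_def)
  have le: "q \<in> fst c \<and> dist (snd c p) (snd c q) \<le> riem_dist M p q"
    if q: "q \<in> pts M" "riem_dist M p q < r" for q
  proof -
    have ex: "q \<in> fst c \<and> dist (snd c p) (snd c q) < riem_dist M p q + e" if e: "0 < e" "riem_dist M p q + e \<le> r" for e
    proof -
      have "riem_dist M p q < riem_dist M p q + e" using e by simp
      from riem_dist_lessE[OF _ q(1) this] p sub
      obtain g where g: "piecewise_C1_curve M g" "g 0 = p" "g 1 = q" "curve_length M g < riem_dist M p q + e"
        by blast
      have "curve_length M g < r" using g(4) e(2) by linarith
      from short_curve_in_chart[OF c g(1) _ _ this] g p ball show ?thesis by simp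
    qed
    have q1: "q \<in> fst c" using ex[of "r - riem_dist M p q"] q(2) by simp
    have "dist (snd c p) (snd c q) \<le> riem_dist M p q + e" if "0 < e" for e
    proof -
      define e' where "e' = min e (r - riem_dist M p q)"
      have "0 < e'" "riem_dist M p q + e' \<le> r" "e' \<le> e" using q(2) that by (auto simp: e'_def)
      then show ?thesis using ex[of e'] by linarith
    qed
    then show ?thesis using q1 field_le_epsilon by blast
  qed
  show "q \<in> fst c \<and> dist (snd c p) (snd c q) < r" if "q \<in> pts M" "riem_dist M p q < r"
    using le[OF that] that(2) by auto
  show "riem_dist M p q = dist (snd c p) (snd c q)" if q: "q \<in> fst c" "dist (snd c p) (snd c q) < r"
  proof -
    from segment_curve_ball[OF c p q(1) ball q(2)]
    obtain g where g: "piecewise_C1_curve M g" "g 0 = p" "g 1 = q" "curve_length M g = dist (snd c p) (snd c q)" .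
    have 1: "riem_dist M p q \<le> dist (snd c p) (snd c q)" using riem_dist_le[OF g(1)] g by simp
    then have "riem_dist M p q < r" using q(2) by linarith
    moreover have "q \<in> pts M" using q(1) sub by blast
    ultimately show ?thesis using le[of q] 1 by simp
  qed
qed

end

section \<open>Locally flat metric spaces\<close>

text \<open>After translation to the origin, polarization shows that inner products are multiplied
  by \<open>\<rho>\<^sup>2\<close>. Hence the map coincides on the ball with a linear map built from
  its values on small multiples of the basis; the linear map is injective and so, in equal finite
  dimensions, surjective.\<close>

lemma similitude_image_ball:
  fixes f :: "'a::euclidean_space \<Rightarrow> 'a"
  assumes r: "0 < r" and \<rho>: "0 < \<rho>"
    and sim: "\<And>x y. x \<in> ball a r \<Longrightarrow> y \<in> ball a r \<Longrightarrow> dist (f x) (f y) = \<rho> * dist x y"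
  shows "f ` ball a r = ball (f a) (\<rho> * r)"
proof -
  define g where "g u = f (a + u) - f a" for u
  have gg: "norm (g u - g v) = \<rho> * norm (u - v)" if "norm u < r" "norm v < r" for u v
    using sim[of "a + u" "a + v"] that by (simp add: g_def dist_norm)
  have g0: "g 0 = 0" by (simp add: g_def)
  have gn: "norm (g u) = \<rho> * norm u" if "norm u < r" for u
    using gg[of u 0] that r g0 by simp
  have inner_g: "g u \<bullet> g v = \<rho>\<^sup>2 * (u \<bullet> v)" if "norm u < r" "norm v < r" for u v
  proof -
    have "(norm (g u - g v))\<^sup>2 = (norm (g u))\<^sup>2 + (norm (g v))\<^sup>2 - 2 * (g u \<bullet> g v)"
      by (simp add: power2_norm_eq_inner inner_diff_left inner_diff_right inner_commute)
    moreover have "(norm (u - v))\<^sup>2 = (norm u)\<^sup>2 + (norm v)\<^sup>2 - 2 * (u \<bullet> v)"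
      by (simp add: power2_norm_eq_inner inner_diff_left inner_diff_right inner_commute)
    ultimately show ?thesis
      using gg[OF that] gn that by (simp add: power_mult_distrib algebra_simps)
  qed
  \<comment> \<open>The factor \<open>r / 2\<close> moves the basis vectors into the ball, where
    \<open>g\<close> is controlled; \<open>2 / r\<close> undoes it.\<close>
  define T where "T u = (\<Sum>i\<in>Basis. (u \<bullet> i) *\<^sub>R ((2 / r) *\<^sub>R g ((r / 2) *\<^sub>R i)))" for u
  have lin: "linear T"
    unfolding T_def by (intro linear_compose_sum ballI linearI) (auto simp: algebra_simps)
  have half: "norm ((r / 2) *\<^sub>R i) < r" if "i \<in> Basis" for i :: 'a
    using r that by simp
  have gT: "g u \<bullet> T v = \<rho>\<^sup>2 * (u \<bullet> v)" if "norm u < r" for u v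
  proof -
    have "g u \<bullet> T v = (\<Sum>i\<in>Basis. (v \<bullet> i) * ((2 / r) * (\<rho>\<^sup>2 * (u \<bullet> ((r / 2) *\<^sub>R i)))))"
      unfolding T_def inner_sum_right inner_scaleR_right using inner_g[OF that half]
      by (intro sum.cong refl) (simp only: inner_scaleR_right)
    also have "\<dots> = \<rho>\<^sup>2 * (u \<bullet> v)"
      using r by (subst euclidean_inner[of u v]) (simp add: sum_distrib_left algebra_simps)
    finally show ?thesis .
  qed
  have TT: "T u \<bullet> T v = \<rho>\<^sup>2 * (u \<bullet> v)" for u v
  proof -
    have "T u \<bullet> T v = (\<Sum>i\<in>Basis. (u \<bullet> i) * ((2 / r) * (\<rho>\<^sup>2 * (((r / 2) *\<^sub>R i) \<bullet> v))))"
      unfolding T_def[of u] inner_sum_left inner_scaleR_left using gT[OF half]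
      by (intro sum.cong refl) (simp only: inner_scaleR_left)
    also have "\<dots> = \<rho>\<^sup>2 * (u \<bullet> v)"
      using r by (subst euclidean_inner[of u v]) (simp add: sum_distrib_left algebra_simps inner_commute)
    finally show ?thesis .
  qed
  have T_eq: "T u = g u" if "norm u < r" for u
  proof -
    have "(g u - T u) \<bullet> (g u - T u) = 0"
      using gT[OF that] TT inner_g[OF that that] by (simp add: inner_diff_left inner_diff_right inner_commute)
    then show ?thesis by simp
  qed
  have Tn: "norm (T u) = \<rho> * norm u" for u
    using TT[of u u] \<rho> by (simp add: norm_eq_sqrt_inner real_sqrt_mult)
  have "u = 0" if "T u = 0" for u
    using Tn[of u] \<rho> that by simp
  then have "inj T" using linear_injective_0[OF lin] by blast
  then have "surj T" using lin linear_injective_imp_surjective by blast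
  show ?thesis
  proof (intro equalityI subsetI)
    fix y assume "y \<in> f ` ball a r"
    then obtain x where x: "x \<in> ball a r" "y = f x" by blast
    then show "y \<in> ball (f a) (\<rho> * r)"
      using sim[of a x] r \<rho> by simp
  next
    fix y assume y: "y \<in> ball (f a) (\<rho> * r)"
    obtain u where u: "T u = y - f a" using \<open>surj T\<close> by (metis surjD)
    then have "\<rho> * norm u < \<rho> * r" using y Tn[of u] by (simp add: dist_norm norm_minus_commute)
    then have "norm u < r" using \<rho> by simp
    then have "f (a + u) = y" using T_eq[of u] u by (simp add: g_def)
    moreover have "a + u \<in> ball a r" using \<open>norm u < r\<close> by (simp add: dist_norm)
    ultimately show "y \<in> f ` ball a r" by blast
  qed
qed

text \<open>The points equidistant from two distinct points form a hyperplane, which contains no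
  ball. The contradiction comes from moving away from the centre in the normal direction.\<close>

lemma eq_of_equidistant:
  fixes a b c :: "'a::euclidean_space"
  assumes e: "0 < e" and eq: "\<And>s. s \<in> ball c e \<Longrightarrow> dist a s = dist b s"
  shows "a = b"
proof (rule ccontr)
  assume ne: "a \<noteq> b"
  define t where "t = e / (2 * norm (a - b))"
  have sq: "2 * (s \<bullet> (a - b)) = a \<bullet> a - b \<bullet> b" if "s \<in> ball c e" for s
  proof -
    have "(dist a s)\<^sup>2 = (dist b s)\<^sup>2" using eq[OF that] by simp
    then show ?thesis
      by (simp add: dist_norm power2_norm_eq_inner inner_diff_left inner_diff_right inner_commute algebra_simps)
  qed
  have "c \<in> ball c e" using e by simp
  moreover have "c + t *\<^sub>R (a - b) \<in> ball c e" using e ne by (simp add: t_def dist_norm)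
  ultimately have "(c + t *\<^sub>R (a - b)) \<bullet> (a - b) = c \<bullet> (a - b)"
    using sq[of c] sq[of "c + t *\<^sub>R (a - b)"] by simp
  then have "t * ((a - b) \<bullet> (a - b)) = 0" by (simp add: inner_add_left)
  moreover have "t \<noteq> 0" using e ne by (simp add: t_def)
  ultimately show False using ne by simp
qed

context Metric_space
begin

definition flat_chart :: "('a \<Rightarrow> 'e::euclidean_space) \<Rightarrow> 'a \<Rightarrow> real \<Rightarrow> bool" where
  "flat_chart \<phi> q r \<longleftrightarrow> 0 < r \<and> q \<in> M \<and> bij_betw \<phi> (mball q r) (ball (\<phi> q) r) \<and>
     (\<forall>x\<in>mball q r. \<forall>y\<in>mball q r. dist (\<phi> x) (\<phi> y) = d x y)"

lemma flat_chart_dist: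
  "flat_chart \<phi> q r \<Longrightarrow> x \<in> mball q r \<Longrightarrow> y \<in> mball q r \<Longrightarrow> dist (\<phi> x) (\<phi> y) = d x y"
  by (simp add: flat_chart_def)

lemma flat_chart_in:
  "flat_chart \<phi> q r \<Longrightarrow> x \<in> mball q r \<Longrightarrow> \<phi> x \<in> ball (\<phi> q) r"
  unfolding flat_chart_def by (meson bij_betwE)

lemma flat_chart_surj:
  assumes "flat_chart \<phi> q r" "dist (\<phi> q) y < r"
  obtains x where "x \<in> mball q r" "\<phi> x = y" "d q x = dist (\<phi> q) y"
proof -
  have "y \<in> \<phi> ` mball q r" using assms unfolding flat_chart_def bij_betw_def by auto
  then obtain x where x: "x \<in> mball q r" "\<phi> x = y" by blast
  moreover have "q \<in> mball q r" using assms by (simp add: flat_chart_def)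
  ultimately show ?thesis using that[OF x] flat_chart_dist[OF assms(1), of q x] by simp
qed

lemma flat_chart_smaller:
  assumes "flat_chart \<phi> q r" "0 < r'" "r' \<le> r"
  shows "flat_chart \<phi> q r'"
proof -
  have sub: "mball q r' \<subseteq> mball q r" using assms(3) mball_subset_concentric by blast
  have q: "q \<in> mball q r" using assms by (simp add: flat_chart_def)
  have "inj_on \<phi> (mball q r')"
    using assms(1) sub unfolding flat_chart_def bij_betw_def by (meson inj_on_subset)
  moreover have "\<phi> ` mball q r' = ball (\<phi> q) r'"
  proof (intro equalityI subsetI)
    fix y assume "y \<in> \<phi> ` mball q r'"
    then obtain x where x: "x \<in> mball q r'" "y = \<phi> x" by blast
    then have "dist (\<phi> q) y = d q x" using flat_chart_dist[OF assms(1) q, of x] sub by blast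
    then show "y \<in> ball (\<phi> q) r'" using x by simp
  next
    fix y assume "y \<in> ball (\<phi> q) r'"
    then have y: "dist (\<phi> q) y < r'" by simp
    then have "dist (\<phi> q) y < r" using assms(3) by linarith
    then obtain x where "x \<in> mball q r" "\<phi> x = y" "d q x < r'"
      using flat_chart_surj[OF assms(1), of y] y by metis
    then show "y \<in> \<phi> ` mball q r'" by auto
  qed
  ultimately show ?thesis
    using assms sub unfolding flat_chart_def bij_betw_def by blast
qed

end

text \<open>One radius serves all centres close to \<open>p\<close>; this form passes to uniform
  radii over compact sets. The parameter \<open>E\<close> fixes the Euclidean model, hence the
  dimension.\<close>

locale locally_flat_space = Metric_space M d for M :: "'a set" and d +
  fixes E :: "'e::euclidean_space itself"
  assumes locally_flat: "p \<in> M \<Longrightarrow> \<exists>r>0. \<forall>q\<in>mball p r. \<exists>\<phi>::'a \<Rightarrow> 'e. flat_chart \<phi> q r"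
begin

lemma exists_flat_chart:
  assumes "p \<in> M"
  obtains \<phi> :: "'a \<Rightarrow> 'e" and r where "flat_chart \<phi> p r"
  using locally_flat[OF assms] centre_in_mball_iff assms by blast

text \<open>In flat charts with the same model space around both points this becomes the Euclidean
  case; the target chart preserves distances, so equality of coordinates lifts back to equality of
  points.\<close>

lemma similitude_image_mball:
  fixes \<phi> \<psi> :: "'a \<Rightarrow> 'e"
  assumes c: "flat_chart \<phi> x r" and c': "flat_chart \<psi> (h x) (\<rho> * r)" and \<rho>: "0 < \<rho>"
    and h: "h ` mball x r \<subseteq> M" and sim: "similitude_with_ratio d (mball x r) h \<rho>"
  shows "h ` mball x r = mball (h x) (\<rho> * r)"
proof -
  have r: "0 < r" and x: "x \<in> mball x r" using c by (auto simp: flat_chart_def)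
  define inv\<phi> where "inv\<phi> = inv_into (mball x r) \<phi>"
  have bij: "bij_betw \<phi> (mball x r) (ball (\<phi> x) r)" using c by (simp add: flat_chart_def)
  have inv: "inv\<phi> u \<in> mball x r" "\<phi> (inv\<phi> u) = u" if "u \<in> ball (\<phi> x) r" for u
    using that bij_betw_inv_into_right[OF bij that] bij_betwE[OF bij_betw_inv_into[OF bij]]
    unfolding inv\<phi>_def by blast+
  have inv2: "inv\<phi> (\<phi> y) = y" if "y \<in> mball x r" for y
    using bij_betw_inv_into_left[OF bij that] unfolding inv\<phi>_def .
  have hin: "h y \<in> mball (h x) (\<rho> * r)" if "y \<in> mball x r" for y
    using sim x that h \<rho> unfolding similitude_with_ratio_def by (auto simp: image_subset_iff)
  have "(\<psi> \<circ> h \<circ> inv\<phi>) ` ball (\<phi> x) r = ball ((\<psi> \<circ> h \<circ> inv\<phi>) (\<phi> x)) (\<rho> * r)"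
  proof (rule similitude_image_ball[OF r \<rho>])
    fix u v assume "u \<in> ball (\<phi> x) r" "v \<in> ball (\<phi> x) r"
    note u = inv[OF this(1)] and v = inv[OF this(2)]
    have "dist (\<psi> (h (inv\<phi> u))) (\<psi> (h (inv\<phi> v))) = d (h (inv\<phi> u)) (h (inv\<phi> v))"
      by (rule flat_chart_dist[OF c' hin[OF u(1)] hin[OF v(1)]])
    also have "\<dots> = \<rho> * d (inv\<phi> u) (inv\<phi> v)"
      using sim u(1) v(1) unfolding similitude_with_ratio_def by blast
    also have "\<dots> = \<rho> * dist u v" using flat_chart_dist[OF c u(1) v(1)] u(2) v(2) by simp
    finally show "dist ((\<psi> \<circ> h \<circ> inv\<phi>) u) ((\<psi> \<circ> h \<circ> inv\<phi>) v) = \<rho> * dist u v" by simp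
  qed
  then have img: "(\<psi> \<circ> h \<circ> inv\<phi>) ` ball (\<phi> x) r = ball (\<psi> (h x)) (\<rho> * r)" using inv2[OF x] by simp
  show ?thesis
  proof (intro equalityI subsetI)
    fix y assume "y \<in> h ` mball x r"
    then show "y \<in> mball (h x) (\<rho> * r)" using hin by auto
  next
    fix y assume y: "y \<in> mball (h x) (\<rho> * r)"
    then have "\<psi> y \<in> (\<psi> \<circ> h \<circ> inv\<phi>) ` ball (\<phi> x) r" using flat_chart_in[OF c'] img by blast
    then obtain u where u: "u \<in> ball (\<phi> x) r" "\<psi> y = \<psi> (h (inv\<phi> u))" by auto
    have "h (inv\<phi> u) \<in> mball (h x) (\<rho> * r)" using hin inv u by blast
    then have "y = h (inv\<phi> u)"
      using flat_chart_dist[OF c' y, of "h (inv\<phi> u)"] u(2) y by simp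
    then show "y \<in> h ` mball x r" using inv u by blast
  qed
qed

text \<open>Similitudes between flat spaces of equal dimension are open maps.\<close>

lemma similitude_image_contains_mball:
  assumes U: "openin mtopology U" "x \<in> U" and \<rho>: "0 < \<rho>"
    and h: "h ` U \<subseteq> M" and sim: "similitude_with_ratio d U h \<rho>"
  obtains e where "0 < e" "mball (h x) e \<subseteq> h ` U"
proof -
  obtain r0 where r0: "r0 > 0" "mball x r0 \<subseteq> U" using U openin_mtopology by blast
  have xM: "x \<in> M" "h x \<in> M" using U h by (auto simp: openin_mtopology)
  obtain \<phi> :: "'a \<Rightarrow> 'e" and r1 where r1: "flat_chart \<phi> x r1" using exists_flat_chart[OF xM(1)] .
  obtain \<psi> :: "'a \<Rightarrow> 'e" and r2 where r2: "flat_chart \<psi> (h x) r2" using exists_flat_chart[OF xM(2)] .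
  define r where "r = min r0 (min r1 (r2 / \<rho>))"
  have "r \<le> r2 / \<rho>" by (simp add: r_def)
  then have "\<rho> * r \<le> r2" using \<rho> by (simp add: field_simps)
  moreover have "0 < r1" "0 < r2" using r1 r2 by (auto simp: flat_chart_def)
  ultimately have r: "0 < r" "r \<le> r0" "r \<le> r1" "\<rho> * r \<le> r2"
    using r0(1) \<rho> by (auto simp: r_def)
  have sub: "mball x r \<subseteq> U" using r0 r mball_subset_concentric by blast
  have "h ` mball x r = mball (h x) (\<rho> * r)"
  proof (rule similitude_image_mball)
    show "flat_chart \<phi> x r" using flat_chart_smaller[OF r1] r by simp
    show "flat_chart \<psi> (h x) (\<rho> * r)" using flat_chart_smaller[OF r2] r \<rho> by simp
    show "h ` mball x r \<subseteq> M" using h sub by blast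
    show "similitude_with_ratio d (mball x r) h \<rho>" using sim sub unfolding similitude_with_ratio_def by blast
  qed fact
  then show ?thesis using that[of "\<rho> * r"] r \<rho> sub by auto
qed

text \<open>The common values of both maps contain a ball around \<open>f (g u)\<close>. The two
  images of \<open>x\<close> have the same distances to its points, namely \<open>\<sigma>\<close>
  times the distances in the domain, so their coordinates coincide. All points involved lie in one
  flat ball, where distances are Euclidean.\<close>

lemma similitude_unique:
  fixes \<phi> :: "'a \<Rightarrow> 'e"
  assumes c: "flat_chart \<phi> z r" and \<sigma>: "0 < \<sigma>"
    and f: "f ` X \<subseteq> M" "similitude_with_ratio d X f \<sigma>" and f': "similitude_with_ratio d X f' \<sigma>"
    and U: "openin mtopology U" "u \<in> U" and g: "g ` U \<subseteq> X" "similitude_with_ratio d U g \<rho>" and \<rho>: "0 < \<rho>"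
    and eq: "\<And>x. x \<in> U \<Longrightarrow> f (g x) = f' (g x)"
    and near: "f (g u) \<in> mball z r" "f x \<in> mball z r" "f' x \<in> mball z r" and x: "x \<in> X"
  shows "f x = f' x"
proof -
  have fg: "(f \<circ> g) ` U \<subseteq> M" using f(1) g(1) by auto
  have "similitude_with_ratio d U (f \<circ> g) (\<sigma> * \<rho>)"
    using f(2) g unfolding similitude_with_ratio_def by (simp add: image_subset_iff)
  then obtain e where e: "0 < e" "mball ((f \<circ> g) u) e \<subseteq> (f \<circ> g) ` U"
    using similitude_image_contains_mball[OF U _ fg, of "\<sigma> * \<rho>"] \<sigma> \<rho> by (metis mult_pos_pos)
  let ?y = "f (g u)"
  \<comment> \<open>Small enough for both purposes: inside the image of \<open>f \<circ> g\<close>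
    and inside the flat ball.\<close>
  define e' where "e' = min e (r - dist (\<phi> z) (\<phi> ?y))"
  have e': "0 < e'" using e(1) flat_chart_in[OF c near(1)] by (simp add: e'_def)
  have "\<phi> (f x) = \<phi> (f' x)"
  proof (rule eq_of_equidistant[OF e'])
    fix s assume s: "s \<in> ball (\<phi> ?y) e'"
    have "dist (\<phi> z) s \<le> dist (\<phi> z) (\<phi> ?y) + dist (\<phi> ?y) s" by (rule dist_triangle)
    then have "dist (\<phi> z) s < r" using s by (simp add: e'_def)
    from flat_chart_surj[OF c this] obtain w where w: "w \<in> mball z r" "\<phi> w = s" by blast
    have "d ?y w < e" using flat_chart_dist[OF c near(1) w(1)] w(2) s by (simp add: e'_def)
    then have "w \<in> (f \<circ> g) ` U" using e(2) w(1) near(1) by auto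
    then obtain v where v: "v \<in> U" "w = f (g v)" by auto
    have gv: "g v \<in> X" using g(1) v(1) by blast
    have "d (f x) w = \<sigma> * d x (g v)" using f(2) x gv v(2) unfolding similitude_with_ratio_def by blast
    moreover have "d (f' x) w = \<sigma> * d x (g v)"
      using f' x gv v(2) eq[OF v(1)] unfolding similitude_with_ratio_def by auto
    ultimately show "dist (\<phi> (f x)) s = dist (\<phi> (f' x)) s"
      using flat_chart_dist[OF c near(2) w(1)] flat_chart_dist[OF c near(3) w(1)] w(2) by simp
  qed
  then show ?thesis using flat_chart_dist[OF c near(2,3)] near by simp
qed

text \<open>Lebesgue number argument. The centres \<open>q\<close> may lie slightly off
  \<open>C\<close>, as do the centres of image balls that are merely close to a point of the compact
  set.\<close>

lemma uniformly_flat: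
  assumes "compactin mtopology C"
  obtains r where "0 < r" "\<And>x q. x \<in> C \<Longrightarrow> q \<in> mball x r \<Longrightarrow> \<exists>\<phi>::'a \<Rightarrow> 'e. flat_chart \<phi> q r"
proof -
  have CM: "C \<subseteq> M" using assms compactin_subspace by force
  have "\<forall>p\<in>C. \<exists>r>0. \<forall>q\<in>mball p r. \<exists>\<phi>::'a \<Rightarrow> 'e. flat_chart \<phi> q r"
    using locally_flat CM by blast
  then obtain r where r: "\<And>p. p \<in> C \<Longrightarrow> 0 < r p"
    "\<And>p q. p \<in> C \<Longrightarrow> q \<in> mball p (r p) \<Longrightarrow> \<exists>\<phi>::'a \<Rightarrow> 'e. flat_chart \<phi> q (r p)"
    by metis
  have "\<exists>\<F>. finite \<F> \<and> \<F> \<subseteq> (\<lambda>p. mball p (r p / 2)) ` C \<and> C \<subseteq> \<Union>\<F>"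
  proof (rule compactinD[OF assms])
    show "C \<subseteq> \<Union>((\<lambda>p. mball p (r p / 2)) ` C)"
    proof
      fix p assume p: "p \<in> C"
      then have "p \<in> mball p (r p / 2)" using r(1)[OF p] CM by auto
      then show "p \<in> \<Union>((\<lambda>p. mball p (r p / 2)) ` C)" using p by blast
    qed
  qed auto
  then obtain \<F> where F: "finite \<F>" "\<F> \<subseteq> (\<lambda>p. mball p (r p / 2)) ` C" "C \<subseteq> \<Union>\<F>" by blast
  from finite_subset_image[OF F(1,2)]
  obtain P where P: "finite P" "P \<subseteq> C" "C \<subseteq> (\<Union>p\<in>P. mball p (r p / 2))"
    using F(3) by blast
  \<comment> \<open>Half radii leave room for the distance from \<open>x\<close> to
    \<open>q\<close>; the element 1 covers the case of no covering balls.\<close>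
  define e where "e = Min (insert 1 ((\<lambda>p. r p / 2) ` P))"
  have e: "0 < e" "e \<le> r p / 2" if "p \<in> P" for p
  proof -
    have pos: "\<And>p. p \<in> P \<Longrightarrow> 0 < r p" using P r(1) by blast
    show "e \<le> r p / 2" unfolding e_def using P that by (intro Min_le) auto
    show "0 < e" unfolding e_def using P pos by (subst Min_gr_iff) auto
  qed
  have e0: "0 < e"
    using e(1) P(3) by (cases "P = {}") (auto simp: e_def)
  show ?thesis
  proof (rule that[OF e0])
    fix x q assume x: "x \<in> C" and q: "q \<in> mball x e"
    obtain p where p: "p \<in> P" "x \<in> mball p (r p / 2)" using P x by blast
    have "q \<in> mball p (r p)"
    proof -
      have "d p q < r p"
        using p q e(2)[OF p(1)] triangle[of p x q] by simp
      then show ?thesis using p q by simp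
    qed
    then obtain \<phi> :: "'a \<Rightarrow> 'e" where "flat_chart \<phi> q (r p)" using r(2)[of p q] p(1) P(2) by auto
    moreover have "e \<le> r p" using e(2)[OF p(1)] e0 by linarith
    ultimately have "flat_chart \<phi> q e" by (intro flat_chart_smaller[OF _ e0])
    then show "\<exists>\<phi>::'a \<Rightarrow> 'e. flat_chart \<phi> q e" by (rule exI[of _ \<phi>])
  qed
qed

text \<open>A net of the Euclidean ball of radius \<open>a\<close> is chosen once and scaled by
  \<open>D\<close>, so its size depends neither on the scale nor on the centre. The chart has twice
  the radius of the ball so that all scaled net points lie in it.\<close>

lemma uniform_nets:
  assumes a: "0 < a" and c: "0 < c"
  obtains P :: nat where "\<And>D y (\<phi>::'a \<Rightarrow> 'e). 0 < D \<Longrightarrow> flat_chart \<phi> y (2 * a * D) \<Longrightarrow>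
    \<exists>Z\<subseteq>M. finite Z \<and> card Z \<le> P \<and> (\<forall>q\<in>mball y (a * D). \<exists>z\<in>Z. d z q < c * D)"
proof -
  have "\<exists>k. finite k \<and> k \<subseteq> cball (0::'e) a \<and> cball 0 a \<subseteq> (\<Union>x\<in>k. ball x c)"
    using compact_imp_seq_compact[OF compact_cball[of "0::'e" a]] c
    by (intro seq_compact_imp_totally_bounded[rule_format])
  then obtain K where K: "finite K" "K \<subseteq> cball (0::'e) a" "cball 0 a \<subseteq> (\<Union>x\<in>K. ball x c)" by blast
  show ?thesis
  proof (rule that[of "card K"])
    fix D y and \<phi> :: "'a \<Rightarrow> 'e"
    assume D: "0 < D" and ch: "flat_chart \<phi> y (2 * a * D)"
    have y: "y \<in> M" using ch by (simp add: flat_chart_def)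
    have "\<exists>x. x \<in> mball y (2 * a * D) \<and> \<phi> x = \<phi> y + D *\<^sub>R k" if "k \<in> K" for k
    proof -
      have "norm k \<le> a" using that K by auto
      then have "D * norm k \<le> D * a" using D by simp
      moreover have "D * a < 2 * a * D" using D a by simp
      ultimately have "dist (\<phi> y) (\<phi> y + D *\<^sub>R k) < 2 * a * D"
        using D by (simp add: dist_norm)
      then show ?thesis using flat_chart_surj[OF ch] by metis
    qed
    then obtain g where g: "\<And>k. k \<in> K \<Longrightarrow> g k \<in> mball y (2 * a * D)" "\<And>k. k \<in> K \<Longrightarrow> \<phi> (g k) = \<phi> y + D *\<^sub>R k"
      by metis
    have "\<exists>z\<in>g ` K. d z q < c * D" if q: "q \<in> mball y (a * D)" for q
    proof -
      have q2: "q \<in> mball y (2 * a * D)"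
        using q a D mball_subset_concentric[of "a * D" "2 * a * D" y] by (auto simp: algebra_simps)
      have yb: "y \<in> mball y (2 * a * D)" using y a D by simp
      define u where "u = (1 / D) *\<^sub>R (\<phi> q - \<phi> y)"
      have Du: "D *\<^sub>R u = \<phi> q - \<phi> y" using D by (simp add: u_def)
      have "D * norm u = d y q"
        using flat_chart_dist[OF ch yb q2] D arg_cong[OF Du, of norm]
        by (simp add: dist_norm norm_minus_commute)
      then have "D * norm u \<le> D * a" using q by (simp add: mult.commute)
      then have "norm u \<le> a" using D by simp
      then obtain k where k: "k \<in> K" "dist k u < c" using K(3) by auto
      have "\<phi> (g k) - \<phi> q = D *\<^sub>R (k - u)"
        by (simp add: scaleR_diff_right Du g(2)[OF k(1)])
      then have "d (g k) q = norm (D *\<^sub>R (k - u))"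
        using flat_chart_dist[OF ch g(1)[OF k(1)] q2] by (simp add: dist_norm)
      also have "\<dots> < c * D" using k(2) D by (simp add: dist_norm)
      finally show ?thesis using k by blast
    qed
    moreover have "g ` K \<subseteq> M" using g by auto
    ultimately show "\<exists>Z\<subseteq>M. finite Z \<and> card Z \<le> card K \<and> (\<forall>q\<in>mball y (a * D). \<exists>z\<in>Z. d z q < c * D)"
      using K(1) card_image_le[OF K(1), of g] by (intro exI[of _ "g ` K"]) simp
  qed
qed

text \<open>Two distinct points make the ratio of a similitude on the open set unique. They exist
  because the basis of the Euclidean model is nonempty.\<close>

lemma openin_two_points:
  assumes "openin mtopology U" "U \<noteq> {}"
  obtains x y where "x \<in> U" "y \<in> U" "x \<noteq> y"
proof -
  obtain x where xU: "x \<in> U" using assms(2) by blast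
  then obtain r0 where x: "x \<in> U" "0 < r0" "mball x r0 \<subseteq> U" "x \<in> M"
    using assms(1) unfolding openin_mtopology by blast
  obtain \<phi> :: "'a \<Rightarrow> 'e" and r1 where r1: "flat_chart \<phi> x r1" using exists_flat_chart[OF x(4)] .
  define r where "r = min r0 r1"
  have c: "flat_chart \<phi> x r" using flat_chart_smaller[OF r1] x r1 by (auto simp: r_def flat_chart_def)
  obtain b :: 'e where b: "b \<in> Basis" using nonempty_Basis by blast
  have "0 < r" using c by (simp add: flat_chart_def)
  then have *: "dist (\<phi> x) (\<phi> x + (r / 2) *\<^sub>R b) = r / 2" using b by (simp add: dist_norm)
  then have "dist (\<phi> x) (\<phi> x + (r / 2) *\<^sub>R b) < r" using \<open>0 < r\<close> by linarith
  from flat_chart_surj[OF c this] obtain y where "y \<in> mball x r" "d x y = r / 2" using * by metis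
  moreover have "mball x r \<subseteq> U" using x mball_subset_concentric[of r r0 x] by (auto simp: r_def)
  ultimately have "y \<in> U" "x \<noteq> y" using x(4) \<open>0 < r\<close> by auto
  then show ?thesis using that[OF xU] by blast
qed

end

section \<open>The manifold as a locally flat metric space\<close>

context flat_manifold
begin

lemma riem_dist_zero:
  assumes p: "p \<in> pts M" and q: "q \<in> pts M"
  shows "riem_dist M p q = 0 \<longleftrightarrow> p = q"
proof -
  obtain c where c: "p \<in> fst c" "euclidean_chart c" using euclidean_chart_exists[OF p] .
  note ch = euclidean_chart_is_chart[OF c(2)]
  obtain r where r: "0 < r" "ball (snd c p) r \<subseteq> snd c ` (fst c \<inter> fst c)"
    using chart_ball[OF c(2,1) chart_openin[OF ch] c(1)] .
  then have ball: "ball (snd c p) r \<subseteq> snd c ` fst c" by simp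
  note d = riem_dist_in_chart[OF c(2,1) ball]
  show ?thesis
  proof
    assume z: "riem_dist M p q = 0"
    then have "q \<in> fst c" "dist (snd c p) (snd c q) < r" using d(2)[OF q] r(1) by simp_all
    then have "snd c p = snd c q" using d(1)[of q] z by simp
    then show "p = q" using chart_inj[OF ch] c(1) \<open>q \<in> fst c\<close> by (auto dest: inj_onD)
  next
    assume "p = q"
    then show "riem_dist M p q = 0" using d(1)[of p] c(1) r(1) by simp
  qed
qed

text \<open>Outside the manifold \<^const>\<open>riem_dist\<close> is the infimum of the empty set, whose sign is unknown,
  whereas \<^locale>\<open>Metric_space\<close> asks for nonnegativity on the whole type.\<close>
definition total_dist :: "'p \<Rightarrow> 'p \<Rightarrow> real" where
  "total_dist p q = (if p \<in> pts M \<and> q \<in> pts M then riem_dist M p q else 0)"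

lemma total_dist_eq: "p \<in> pts M \<Longrightarrow> q \<in> pts M \<Longrightarrow> total_dist p q = riem_dist M p q"
  by (simp add: total_dist_def)

sublocale Metric_space "pts M" total_dist
proof
  show "0 \<le> total_dist x y" for x y
    using riem_dist_nonneg by (simp add: total_dist_def)
  show "total_dist x y = total_dist y x" for x y
    using riem_dist_commute_le[of x y] riem_dist_commute_le[of y x] by (auto simp: total_dist_def)
  show "total_dist x y = 0 \<longleftrightarrow> x = y" if "x \<in> pts M" "y \<in> pts M" for x y
    using riem_dist_zero[OF that] that by (simp add: total_dist_def)
  show "total_dist x z \<le> total_dist x y + total_dist y z" if "x \<in> pts M" "y \<in> pts M" "z \<in> pts M" for x y z
    using riem_dist_triangle[OF that] that by (simp add: total_dist_def)
qed

lemma mball_in_chart: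
  assumes c: "euclidean_chart c" and p: "p \<in> fst c" and ball: "ball (snd c p) r \<subseteq> snd c ` fst c"
  shows "mball p r = {x \<in> fst c. snd c x \<in> ball (snd c p) r}"
    and "q \<in> mball p r \<Longrightarrow> total_dist p q = dist (snd c p) (snd c q)"
proof -
  have sub: "fst c \<subseteq> pts M"
    using chart_domain_subset[OF euclidean_chart_is_chart[OF c]] by (simp add: pts_def)
  note d = riem_dist_in_chart[OF c p ball]
  have pM: "p \<in> pts M" using p sub by blast
  show eq: "mball p r = {x \<in> fst c. snd c x \<in> ball (snd c p) r}"
  proof (intro equalityI subsetI)
    fix x assume "x \<in> mball p r"
    then have "x \<in> pts M" "riem_dist M p x < r" using total_dist_eq[OF pM] by auto
    then show "x \<in> {x \<in> fst c. snd c x \<in> ball (snd c p) r}" using d(2) by simp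
  next
    fix x assume "x \<in> {x \<in> fst c. snd c x \<in> ball (snd c p) r}"
    then have x: "x \<in> fst c" "dist (snd c p) (snd c x) < r" by simp_all
    then have "x \<in> pts M" using sub by blast
    then show "x \<in> mball p r" using d(1)[OF x] x(2) pM total_dist_eq[OF pM] by simp
  qed
  show "total_dist p q = dist (snd c p) (snd c q)" if q: "q \<in> mball p r"
  proof -
    have "q \<in> fst c" "dist (snd c p) (snd c q) < r" using q unfolding eq by simp_all
    then show ?thesis using d(1) total_dist_eq[OF pM, of q] sub by auto
  qed
qed

lemma mtopology_eq: "mtopology = rm_top M"
  unfolding topology_eq
proof (intro allI iffI)
  fix V assume V: "openin (rm_top M) V"
  then have "V \<subseteq> pts M" unfolding pts_def by (rule openin_subset)
  moreover have "\<exists>r>0. mball p r \<subseteq> V" if p: "p \<in> V" for p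
  proof -
    obtain c where c: "p \<in> fst c" "euclidean_chart c"
      using euclidean_chart_exists[of p] p \<open>V \<subseteq> pts M\<close> by blast
    obtain r where r: "0 < r" "ball (snd c p) r \<subseteq> snd c ` (V \<inter> fst c)"
      using chart_ball[OF c(2,1) V p] .
    have ball: "ball (snd c p) r \<subseteq> snd c ` fst c" using r(2) by blast
    have "mball p r \<subseteq> V"
    proof
      fix x assume "x \<in> mball p r"
      then have x: "x \<in> fst c" "snd c x \<in> ball (snd c p) r" unfolding mball_in_chart(1)[OF c(2,1) ball] by auto
      then obtain y where y: "y \<in> V \<inter> fst c" "snd c x = snd c y" using r(2) by blast
      then have "x = y" using chart_inj[OF euclidean_chart_is_chart[OF c(2)]] x(1) by (auto dest: inj_onD)
      then show "x \<in> V" using y by simp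
    qed
    then show ?thesis using r(1) by blast
  qed
  ultimately show "openin mtopology V" unfolding openin_mtopology by blast
next
  fix V assume V: "openin mtopology V"
  show "openin (rm_top M) V"
  proof (subst openin_subopen, intro ballI)
    fix p assume p: "p \<in> V"
    obtain r0 where r0: "r0 > 0" "mball p r0 \<subseteq> V" and pM: "p \<in> pts M"
      using V p unfolding openin_mtopology by blast
    obtain c where c: "p \<in> fst c" "euclidean_chart c" using euclidean_chart_exists[OF pM] .
    note ch = euclidean_chart_is_chart[OF c(2)]
    obtain r1 where r1: "0 < r1" "ball (snd c p) r1 \<subseteq> snd c ` (fst c \<inter> fst c)"
      using chart_ball[OF c(2,1) chart_openin[OF ch] c(1)] .
    define r where "r = min r0 r1"
    have "ball (snd c p) r \<subseteq> ball (snd c p) r1" by (auto simp: r_def)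
    then have ball: "ball (snd c p) r \<subseteq> snd c ` fst c" using r1 by blast
    have "openin (rm_top M) (mball p r)"
      unfolding mball_in_chart(1)[OF c(2,1) ball] by (rule chart_preimage_open[OF ch open_ball])
    moreover have "p \<in> mball p r" using pM r0 r1 by (simp add: r_def)
    moreover have "mball p r \<subseteq> V" using r0(2) mball_subset_concentric[of r r0 p] by (simp add: r_def)
    ultimately show "\<exists>T. openin (rm_top M) T \<and> p \<in> T \<and> T \<subseteq> V" by blast
  qed
qed

lemma locally_flat_space: "locally_flat_space TYPE(real ^ 'n) (pts M) total_dist"
proof
  fix p assume p: "p \<in> pts M"
  obtain c where c: "p \<in> fst c" "euclidean_chart c" using euclidean_chart_exists[OF p] .
  note ch = euclidean_chart_is_chart[OF c(2)]
  obtain r0 where r0: "0 < r0" "ball (snd c p) r0 \<subseteq> snd c ` (fst c \<inter> fst c)"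
    using chart_ball[OF c(2,1) chart_openin[OF ch] c(1)] .
  \<comment> \<open>With \<open>q\<close> within \<open>r\<close> of \<open>p\<close>, points of the
    ball of radius \<open>r\<close> about \<open>q\<close> are within \<open>2 * r\<close> of
    \<open>p\<close>, and the ball of radius \<open>2 * r\<close> about one of them, which contains
    all the others, stays within \<open>4 * r\<close>.\<close>
  define r where "r = r0 / 4"
  have r: "0 < r" "r0 = 4 * r" using r0 by (simp_all add: r_def)
  have sub: "fst c \<subseteq> pts M" using chart_domain_subset[OF ch] by (simp add: pts_def)
  have B: "ball (snd c x) a \<subseteq> snd c ` fst c" if x: "dist (snd c p) (snd c x) + a \<le> 4 * r" for x a
  proof -
    have "ball (snd c x) a \<subseteq> ball (snd c p) r0"
      using x r(2) by (subst ball_subset_ball_iff) (simp add: dist_commute)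
    then show ?thesis using r0 by blast
  qed
  have p4: "mball p (4 * r) = {x \<in> fst c. snd c x \<in> ball (snd c p) (4 * r)}"
    by (rule mball_in_chart(1)[OF c(2,1)]) (rule B, simp)
  have "flat_chart (snd c) q r" if q: "q \<in> mball p r" for q
  proof -
    have "q \<in> mball p (4 * r)" using q r(1) mball_subset_concentric[of r "4 * r" p] by auto
    then have qc: "q \<in> fst c" unfolding p4 by blast
    have ballp: "ball (snd c p) r \<subseteq> snd c ` fst c" by (rule B) (use r in simp)
    have qd: "dist (snd c p) (snd c q) < r"
      using q unfolding mball_in_chart(1)[OF c(2,1) ballp] by simp
    have ballq: "ball (snd c q) r \<subseteq> snd c ` fst c" by (rule B) (use qd r in simp)
    have mb: "mball q r = {x \<in> fst c. snd c x \<in> ball (snd c q) r}"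
      by (rule mball_in_chart(1)[OF c(2) qc ballq])
    have dist: "dist (snd c x) (snd c y) = total_dist x y" if x: "x \<in> mball q r" and y: "y \<in> mball q r" for x y
    proof -
      have x': "x \<in> fst c" "dist (snd c q) (snd c x) < r" using x unfolding mb by auto
      have y': "y \<in> fst c" "dist (snd c q) (snd c y) < r" using y unfolding mb by auto
      have "dist (snd c p) (snd c x) \<le> dist (snd c p) (snd c q) + dist (snd c q) (snd c x)" by (rule dist_triangle)
      then have "dist (snd c p) (snd c x) + 2 * r \<le> 4 * r" using x'(2) qd by linarith
      then have ballx: "ball (snd c x) (2 * r) \<subseteq> snd c ` fst c" by (rule B)
      have "dist (snd c x) (snd c y) < 2 * r"
        using dist_triangle3[of "snd c x" "snd c y" "snd c q"] x'(2) y'(2) by linarith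
      then have "y \<in> mball x (2 * r)"
        unfolding mball_in_chart(1)[OF c(2) x'(1) ballx] using y'(1) by simp
      then show ?thesis using mball_in_chart(2)[OF c(2) x'(1) ballx] by simp
    qed
    have "bij_betw (snd c) (mball q r) (ball (snd c q) r)"
      unfolding bij_betw_def
    proof (intro conjI)
      show "inj_on (snd c) (mball q r)"
        using chart_inj[OF ch] unfolding mb by (auto simp: inj_on_def)
      show "snd c ` mball q r = ball (snd c q) r" using ballq unfolding mb by auto
    qed
    then show ?thesis
      using r(1) qc sub dist unfolding flat_chart_def by blast
  qed
  then show "\<exists>r>0. \<forall>q\<in>mball p r. \<exists>\<phi>::'p \<Rightarrow> real ^ 'n. flat_chart \<phi> q r" using r(1) by blast
qed

end

section \<open>Growth of powers of nonnegative matrices\<close>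

text \<open>All vertices of the walks except possibly the first lie in \<open>S\<close>.\<close>
primrec walk_weight :: "'a set \<Rightarrow> ('a \<Rightarrow> 'a \<Rightarrow> real) \<Rightarrow> nat \<Rightarrow> 'a \<Rightarrow> 'a \<Rightarrow> real" where
  "walk_weight S a 0 i j = (if i = j then 1 else 0)"
| "walk_weight S a (Suc m) i j = (\<Sum>l\<in>S. a i l * walk_weight S a m l j)"

lemma walk_weight_nonneg:
  assumes "\<And>i j. a i j \<ge> 0"
  shows "walk_weight S a m i j \<ge> 0"
  by (induction m arbitrary: i) (auto intro!: sum_nonneg mult_nonneg_nonneg assms)

lemma walk_weight_mono:
  assumes "\<And>i j. a i j \<ge> 0" "S \<subseteq> S'" "finite S'"
  shows "walk_weight S a m i j \<le> walk_weight S' a m i j"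
proof (induction m arbitrary: i)
  case (Suc m)
  have "(\<Sum>l\<in>S. a i l * walk_weight S a m l j) \<le> (\<Sum>l\<in>S. a i l * walk_weight S' a m l j)"
    by (intro sum_mono mult_left_mono Suc assms)
  also have "\<dots> \<le> (\<Sum>l\<in>S'. a i l * walk_weight S' a m l j)"
    by (intro sum_mono2 assms mult_nonneg_nonneg walk_weight_nonneg)
  finally show ?case by simp
qed auto

text \<open>Decomposition of a walk at its last visit to \<open>q\<close>.\<close>
lemma walk_weight_last_visit:
  assumes a: "\<And>i j. a i j \<ge> 0" and fin: "finite S" and q: "q \<in> S"
  shows "walk_weight S a m p j \<le> (if p = q then 0 else walk_weight (S - {q}) a m p j) +
           (\<Sum>l\<le>m. walk_weight S a l p q * walk_weight (S - {q}) a (m - l) q j)"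
proof (induction m arbitrary: p)
  case 0
  show ?case by auto
next
  case (Suc m)
  let ?W = "walk_weight S a" and ?V = "walk_weight (S - {q}) a"
  have "?W (Suc m) p j = (\<Sum>x\<in>S. a p x * ?W m x j)" by simp
  also have "\<dots> \<le> (\<Sum>x\<in>S. a p x * ((if x = q then 0 else ?V m x j) + (\<Sum>l\<le>m. ?W l x q * ?V (m - l) q j)))"
    by (intro sum_mono mult_left_mono Suc a)
  also have "\<dots> = (\<Sum>x\<in>S. a p x * (if x = q then 0 else ?V m x j)) +
      (\<Sum>x\<in>S. \<Sum>l\<le>m. a p x * ?W l x q * ?V (m - l) q j)"
    by (simp add: algebra_simps sum.distrib sum_distrib_left)
  also have "(\<Sum>x\<in>S. a p x * (if x = q then 0 else ?V m x j)) = ?V (Suc m) p j"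
    using q fin by (simp add: sum.remove[OF fin q])
  also have "(\<Sum>x\<in>S. \<Sum>l\<le>m. a p x * ?W l x q * ?V (m - l) q j) = (\<Sum>l\<le>m. ?W (Suc l) p q * ?V (m - l) q j)"
    by (subst sum.swap) (simp add: sum_distrib_right)
  also have "\<dots> = (\<Sum>l\<in>{1..Suc m}. ?W l p q * ?V (Suc m - l) q j)"
    by (rule sum.reindex_bij_witness[where i = "\<lambda>l. l - 1" and j = Suc]) auto
  finally have "?W (Suc m) p j \<le> ?V (Suc m) p j + (\<Sum>l\<in>{1..Suc m}. ?W l p q * ?V (Suc m - l) q j)" .
  \<comment> \<open>For \<open>p = q\<close> the new term \<open>l = 0\<close> accounts for the
    walks without return; for \<open>p \<noteq> q\<close> it vanishes.\<close>
  then have "?W (Suc m) p j \<le> (if p = q then 0 else ?V (Suc m) p j) +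
      (?W 0 p q * ?V (Suc m - 0) q j + (\<Sum>l\<in>{1..Suc m}. ?W l p q * ?V (Suc m - l) q j))"
    by (cases "p = q") (simp_all del: walk_weight.simps(2) sum.cl_ivl_Suc)
  also have "?W 0 p q * ?V (Suc m - 0) q j + (\<Sum>l\<in>{1..Suc m}. ?W l p q * ?V (Suc m - l) q j) =
      (\<Sum>l\<le>Suc m. ?W l p q * ?V (Suc m - l) q j)"
    by (subst atMost_atLeast0, subst sum.atLeast_Suc_atMost) (simp_all del: walk_weight.simps sum.cl_ivl_Suc)
  finally show ?case .
qed

text \<open>An elementary substitute for the theory of irreducible blocks. Vertices are removed one
  at a time: the returns to \<open>q\<close> have weight at most 1 by the bound on the diagonal, and
  what follows the last visit avoids \<open>q\<close> and is covered by induction. Only the sum over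
  the time of the last visit is lost, which explains \<open>t > 1\<close>.\<close>

lemma walk_weight_growth:
  fixes a :: "'a \<Rightarrow> 'a \<Rightarrow> real"
  assumes a: "\<And>i j. a i j \<ge> 0" and fin: "finite S" and t: "t > 1"
    and diag: "\<And>m i. i \<in> S \<Longrightarrow> walk_weight S a m i i \<le> 1"
  shows "\<exists>C\<ge>0. \<forall>m. \<forall>i\<in>S. \<forall>j\<in>S. walk_weight S a m i j \<le> C * t ^ m"
proof -
  define B where "B = (\<Sum>i\<in>S. \<Sum>l\<in>S. a i l)"
  have "B \<ge> 0" unfolding B_def by (intro sum_nonneg a)
  have row: "(\<Sum>l\<in>S. a i l) \<le> B" if "i \<in> S" for i
    unfolding B_def using that fin by (intro member_le_sum[of i S "\<lambda>i. \<Sum>l\<in>S. a i l"]) (auto intro: sum_nonneg a)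
  have "\<exists>C\<ge>0. \<forall>m. \<forall>i\<in>S'. \<forall>j\<in>S. walk_weight S' a m i j \<le> C * t ^ m" if "S' \<subseteq> S" for S'
    using finite_subset[OF that fin] that
  proof (induction "card S'" arbitrary: S')
    case 0
    then show ?case by auto
  next
    case (Suc k)
    let ?W = "walk_weight S' a"
    have "\<exists>C\<ge>0. \<forall>m. \<forall>i\<in>S' - {q}. \<forall>j\<in>S. walk_weight (S' - {q}) a m i j \<le> C * t ^ m" if "q \<in> S'" for q
      using Suc.hyps Suc.prems that by (intro Suc.hyps(1)) auto
    then obtain C where C: "\<And>q. q \<in> S' \<Longrightarrow> C q \<ge> 0"
      "\<And>q m i j. q \<in> S' \<Longrightarrow> i \<in> S' - {q} \<Longrightarrow> j \<in> S \<Longrightarrow> walk_weight (S' - {q}) a m i j \<le> C q * t ^ m"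
      by metis
    \<comment> \<open>The first factor bounds a walk from \<open>q\<close> without return: it is
      empty, or one step of weight at most \<open>B\<close> followed by a walk avoiding
      \<open>q\<close>. The second bounds the geometric sum over the times of the last
      visit.\<close>
    define D where "D = (1 + (\<Sum>q\<in>S'. B * C q)) * (t / (t - 1))"
    have CB: "C q * B \<le> (\<Sum>q\<in>S'. B * C q)" if "q \<in> S'" for q
      using that Suc.prems(1) C(1) \<open>B \<ge> 0\<close>
      by (subst mult.commute) (rule member_le_sum, auto)
    have D0: "0 \<le> D" unfolding D_def using t C(1) \<open>B \<ge> 0\<close>
      by (intro mult_nonneg_nonneg add_nonneg_nonneg sum_nonneg) auto
    have "?W m q j \<le> D * t ^ m" if "q \<in> S'" "j \<in> S" for m q j
    proof -
      let ?V = "walk_weight (S' - {q}) a"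
      have V: "?V r q j \<le> (1 + (\<Sum>q\<in>S'. B * C q)) * t ^ r" for r
      proof (cases r)
        case 0
        have "0 \<le> (\<Sum>q\<in>S'. B * C q)" using C(1) \<open>B \<ge> 0\<close> by (intro sum_nonneg) auto
        then show ?thesis using 0 by simp
      next
        case (Suc r')
        have "?V r q j = (\<Sum>x\<in>S'-{q}. a q x * ?V r' x j)" using Suc by simp
        also have "\<dots> \<le> (\<Sum>x\<in>S'-{q}. a q x * (C q * t ^ r'))"
          using C(2) that by (intro sum_mono mult_left_mono a) auto
        also have "\<dots> = (\<Sum>x\<in>S'-{q}. a q x) * (C q * t ^ r')" by (simp add: sum_distrib_right)
        also have "\<dots> \<le> B * (C q * t ^ r')"
        proof (rule mult_right_mono)
          have "(\<Sum>x\<in>S'-{q}. a q x) \<le> (\<Sum>x\<in>S. a q x)"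
            using Suc.prems(2) fin a by (intro sum_mono2) auto
          also have "\<dots> \<le> B" using row Suc.prems(2) that by auto
          finally show "(\<Sum>x\<in>S'-{q}. a q x) \<le> B" .
        qed (use C(1) that t in auto)
        also have "\<dots> \<le> (1 + (\<Sum>q\<in>S'. B * C q)) * t ^ r'"
        proof -
          have "C q * B \<le> 1 + (\<Sum>q\<in>S'. B * C q)" using CB[OF that(1)] by simp
          from mult_right_mono[OF this, of "t^r'"] t show ?thesis by (simp add: algebra_simps)
        qed
        also have "\<dots> \<le> (1 + (\<Sum>q\<in>S'. B * C q)) * t ^ r"
          using t C(1) \<open>B \<ge> 0\<close> unfolding Suc
          by (intro mult_left_mono power_increasing add_nonneg_nonneg sum_nonneg) auto
        finally show ?thesis .
      qed
      have "?W m q j \<le> (\<Sum>l\<le>m. ?W l q q * ?V (m - l) q j)"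
        using walk_weight_last_visit[OF a Suc.prems(1) that(1), where m = m and p = q and j = j] by simp
      also have "\<dots> \<le> (\<Sum>l\<le>m. 1 * ?V (m - l) q j)"
        using walk_weight_mono[OF a Suc.prems(2) fin] diag that Suc.prems(2)
        by (intro sum_mono mult_right_mono walk_weight_nonneg a) (meson order_trans subsetD)
      also have "\<dots> \<le> (\<Sum>l\<le>m. (1 + (\<Sum>q\<in>S'. B * C q)) * t ^ (m - l))"
        using V by (intro sum_mono) simp
      also have "\<dots> = (1 + (\<Sum>q\<in>S'. B * C q)) * (\<Sum>l\<le>m. t ^ (m - l))"
        by (simp add: sum_distrib_left)
      also have "(\<Sum>l\<le>m. t ^ (m - l)) = (\<Sum>l\<le>m. t ^ l)"
        by (rule sum.reindex_bij_witness[where i = "\<lambda>l. m - l" and j = "\<lambda>l. m - l"]) auto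
      also have "\<dots> = (t ^ Suc m - 1) / (t - 1)"
        using t by (simp add: sum_gp0 field_simps)
      also have "(1 + (\<Sum>q\<in>S'. B * C q)) * \<dots> \<le> (1 + (\<Sum>q\<in>S'. B * C q)) * (t / (t - 1) * t ^ m)"
        using t C(1) \<open>B \<ge> 0\<close>
        by (intro mult_left_mono add_nonneg_nonneg sum_nonneg) (auto simp: divide_right_mono)
      finally show ?thesis unfolding D_def by (simp add: mult.assoc)
    qed
    with D0 show ?case by blast
  qed
  from this[of S] show ?thesis by auto
qed

lemma pow_mat_Suc_left:
  fixes A :: "'a::semiring_1 mat"
  assumes A: "A \<in> carrier_mat n n"
  shows "A ^\<^sub>m Suc m = A * A ^\<^sub>m m"
proof (induction m)
  case 0
  show ?case using A by simp
next
  case (Suc m)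
  have "A ^\<^sub>m Suc (Suc m) = (A * A ^\<^sub>m m) * A" using Suc by simp
  also have "\<dots> = A * (A ^\<^sub>m m * A)" using A by (intro assoc_mult_mat) auto
  finally show ?case by simp
qed

lemma pow_mat_walk_weight:
  assumes A: "A \<in> carrier_mat n n" and "i < n" "j < n"
  shows "(A ^\<^sub>m m) $$ (i, j) = walk_weight {..<n} (\<lambda>i j. A $$ (i, j)) m i j"
  using assms(2)
proof (induction m arbitrary: i)
  case 0
  then show ?case using A \<open>j < n\<close> by auto
next
  case (Suc m)
  have "(A ^\<^sub>m Suc m) $$ (i, j) = (A * A ^\<^sub>m m) $$ (i, j)"
    by (simp only: pow_mat_Suc_left[OF A])
  also have "\<dots> = (\<Sum>l\<in>{0..<n}. A $$ (i, l) * (A ^\<^sub>m m) $$ (l, j))"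
    using A Suc.prems \<open>j < n\<close> by (subst index_mult_mat) (auto simp: scalar_prod_def intro!: sum.cong)
  also have "\<dots> = (\<Sum>l\<in>{..<n}. A $$ (i, l) * walk_weight {..<n} (\<lambda>i j. A $$ (i, j)) m l j)"
    using Suc.IH by (intro sum.cong) auto
  finally show ?case by simp
qed

lemma map_mat_of_real_pow:
  assumes A: "A \<in> carrier_mat n n"
  shows "map_mat complex_of_real A ^\<^sub>m m = map_mat complex_of_real (A ^\<^sub>m m)"
  using assms
  by (induction m) (auto simp: of_real_hom.mat_hom_mult[of _ n n _ n])

definition real_spectral_radius :: "real mat \<Rightarrow> real" where
  "real_spectral_radius A = spectral_radius (map_mat complex_of_real A)"

lemma spectral_radius_attained:
  assumes A: "A \<in> carrier_mat n n" and n: "n > 0"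
  obtains v \<mu> where "eigenvector A v \<mu>" "norm \<mu> = spectral_radius A"
  using spectral_radius_mem_max(1)[OF A n] unfolding spectrum_def eigenvalue_def by auto

lemma real_spectral_radius_nonneg:
  assumes A: "A \<in> carrier_mat n n" and n: "n > 0"
  shows "0 \<le> real_spectral_radius A"
  unfolding real_spectral_radius_def
  using spectral_radius_attained[of "map_mat complex_of_real A" n] assms by (metis map_carrier_mat norm_ge_zero)

text \<open>An eigenvector for an eigenvalue of maximal modulus is multiplied by the powers of the
  eigenvalue, and these cannot outgrow the entries of the matrix powers.\<close>

lemma real_spectral_radius_le:
  assumes A: "A \<in> carrier_mat n n" and n: "n > 0" and t: "t > 0"
    and bound: "\<And>m i j. i < n \<Longrightarrow> j < n \<Longrightarrow> \<bar>(A ^\<^sub>m m) $$ (i, j)\<bar> \<le> C * t ^ m"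
  shows "real_spectral_radius A \<le> t"
proof (rule ccontr)
  let ?B = "map_mat complex_of_real A"
  have B: "?B \<in> carrier_mat n n" using A by simp
  obtain v \<mu> where ev: "eigenvector ?B v \<mu>" and \<mu>: "norm \<mu> = spectral_radius ?B"
    using spectral_radius_attained[OF B n] .
  have v: "v \<in> carrier_vec n" "v \<noteq> 0\<^sub>v n" using ev B unfolding eigenvector_def by auto
  then obtain i where i: "i < n" "vec_index v i \<noteq> 0"
    by (metis carrier_vecD eq_vecI index_zero_vec(1) index_zero_vec(2))
  define s where "s = (\<Sum>j<n. norm (vec_index v j))"
  have le: "norm \<mu> ^ m * norm (vec_index v i) \<le> C * s * t ^ m" for m
  proof -
    have "\<mu> ^ m * vec_index v i = vec_index (?B ^\<^sub>m m *\<^sub>v v) i"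
      using eigenvector_pow[OF B ev, of m] v i by simp
    also have "\<dots> = (\<Sum>j\<in>{0..<n}. complex_of_real ((A ^\<^sub>m m) $$ (i, j)) * vec_index v j)"
      using A v i by (simp add: map_mat_of_real_pow[OF A] scalar_prod_def)
    finally have "norm \<mu> ^ m * norm (vec_index v i) = norm (\<Sum>j\<in>{0..<n}. complex_of_real ((A ^\<^sub>m m) $$ (i, j)) * vec_index v j)"
      by (metis norm_mult norm_power)
    also have "\<dots> \<le> (\<Sum>j\<in>{0..<n}. norm (complex_of_real ((A ^\<^sub>m m) $$ (i, j)) * vec_index v j))"
      by (rule norm_sum)
    also have "\<dots> \<le> (\<Sum>j\<in>{0..<n}. C * t ^ m * norm (vec_index v j))"
      using bound i by (intro sum_mono) (auto simp: norm_mult intro!: mult_right_mono)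
    also have "\<dots> = C * s * t ^ m"
      by (simp add: s_def sum_distrib_left lessThan_atLeast0 algebra_simps)
    finally show ?thesis .
  qed
  assume "\<not> real_spectral_radius A \<le> t"
  then have gt: "norm \<mu> / t > 1" using \<mu> t by (simp add: real_spectral_radius_def)
  obtain m where m: "(norm \<mu> / t) ^ m > C * s / norm (vec_index v i)"
    using real_arch_pow[OF gt] by blast
  then have "C * s * t ^ m < norm \<mu> ^ m * norm (vec_index v i)"
    using i t by (simp add: power_divide field_simps)
  with le[of m] show False by simp
qed

text \<open>After division by \<open>t\<close> the spectral radius is below 1, and then the Jordan
  normal form bounds all powers.\<close>

lemma real_spectral_radius_less_growth:
  assumes A: "A \<in> carrier_mat n n" and n: "n > 0" and t: "t > real_spectral_radius A"
  shows "\<exists>C\<ge>0. \<forall>m i j. i < n \<longrightarrow> j < n \<longrightarrow> \<bar>(A ^\<^sub>m m) $$ (i, j)\<bar> \<le> C * t ^ m"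
proof -
  have t0: "t > 0" using t real_spectral_radius_nonneg[OF A n] by simp
  define B where "B = map_mat complex_of_real ((1 / t) \<cdot>\<^sub>m A)"
  have B: "B \<in> carrier_mat n n" using A by (simp add: B_def)
  have "spectral_radius B < 1"
  proof -
    obtain v \<mu> where ev: "eigenvector B v \<mu>" and \<mu>: "norm \<mu> = spectral_radius B"
      using spectral_radius_attained[OF B n] .
    have v: "v \<in> carrier_vec n" "v \<noteq> 0\<^sub>v n" and Bv: "B *\<^sub>v v = \<mu> \<cdot>\<^sub>v v"
      using ev B unfolding eigenvector_def by auto
    have "map_mat complex_of_real A *\<^sub>v v = (of_real t * \<mu>) \<cdot>\<^sub>v v"
    proof (rule eq_vecI)
      fix i assume "i < dim_vec ((of_real t * \<mu>) \<cdot>\<^sub>v v)"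
      then have i: "i < n" using v by simp
      have "vec_index (B *\<^sub>v v) i = (1 / of_real t) * vec_index (map_mat complex_of_real A *\<^sub>v v) i"
        using A v i by (simp add: B_def scalar_prod_def sum_divide_distrib)
      then show "vec_index (map_mat complex_of_real A *\<^sub>v v) i = vec_index ((of_real t * \<mu>) \<cdot>\<^sub>v v) i"
        using Bv v i t0 by (simp add: field_simps)
    qed (use A v in auto)
    then have "of_real t * \<mu> \<in> spectrum (map_mat complex_of_real A)"
      using v A unfolding spectrum_def eigenvalue_def eigenvector_def by auto
    then have "norm (of_real t * \<mu>) \<le> real_spectral_radius A"
      unfolding real_spectral_radius_def using A n
      by (intro spectral_radius_mem_max(2)[of _ n]) auto
    moreover have "norm (of_real t * \<mu>) = t * norm \<mu>" using t0 by (simp add: norm_mult)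
    ultimately have "t * norm \<mu> < t * 1" using t by linarith
    then show ?thesis using t0 \<mu> by (simp only: mult_less_cancel_left_pos)
  qed
  then obtain c where c: "\<And>m. norm_bound (B ^\<^sub>m m) c"
    using spectral_radius_jnf_norm_bound_less_1_upper_triangular[OF B] by blast
  have pow: "((1 / t) \<cdot>\<^sub>m A) ^\<^sub>m m = (1 / t) ^ m \<cdot>\<^sub>m A ^\<^sub>m m" for m
  proof (induction m)
    case (Suc m)
    have "((1 / t) \<cdot>\<^sub>m A) ^\<^sub>m Suc m = ((1 / t) ^ m \<cdot>\<^sub>m A ^\<^sub>m m) * ((1 / t) \<cdot>\<^sub>m A)"
      using Suc by simp
    also have "\<dots> = (1 / t) ^ Suc m \<cdot>\<^sub>m (A ^\<^sub>m Suc m)"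
      using A by (intro eq_matI) (auto simp: scalar_prod_def sum_distrib_left algebra_simps intro!: sum.cong)
    finally show ?case .
  qed (use A in auto)
  have "\<bar>(A ^\<^sub>m m) $$ (i, j)\<bar> \<le> max c 0 * t ^ m" if "i < n" "j < n" for m i j
  proof -
    have "(B ^\<^sub>m m) $$ (i, j) = complex_of_real ((1 / t) ^ m * (A ^\<^sub>m m) $$ (i, j))"
      unfolding B_def using A that by (subst map_mat_of_real_pow[of _ n]) (auto simp: pow)
    moreover have "norm ((B ^\<^sub>m m) $$ (i, j)) \<le> c"
      using c[of m] B that unfolding norm_bound_def by auto
    ultimately have "\<bar>(1 / t) ^ m * (A ^\<^sub>m m) $$ (i, j)\<bar> \<le> c" by (metis norm_of_real real_norm_def)
    then have "\<bar>(A ^\<^sub>m m) $$ (i, j)\<bar> \<le> c * t ^ m"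
      using t0 by (simp add: abs_mult power_divide field_simps)
    also have "\<dots> \<le> max c 0 * t ^ m" using t0 by (intro mult_right_mono) auto
    finally show ?thesis .
  qed
  then show ?thesis by (intro exI[of _ "max c 0"]) auto
qed

text \<open>Otherwise the closed walks of each length from any vertex have total weight at most 1,
  so the entries of the powers grow at most like \<open>t ^ m\<close> for a \<open>t\<close>
  strictly between 1 and the spectral radius.\<close>

lemma real_spectral_radius_gt_1_diag:
  assumes A: "A \<in> carrier_mat n n" and n: "n > 0"
    and nonneg: "\<And>i j. i < n \<Longrightarrow> j < n \<Longrightarrow> A $$ (i, j) \<ge> 0"
    and gt: "real_spectral_radius A > 1"
  shows "\<exists>m\<ge>1. \<exists>i<n. (A ^\<^sub>m m) $$ (i, i) > 1"
proof (rule ccontr)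
  assume neg: "\<not> ?thesis"
  \<comment> \<open>Nothing is known about entries outside the index range; cutting them off makes
    the weights nonnegative everywhere.\<close>
  define a where "a i j = (if i < n \<and> j < n then A $$ (i, j) else 0)" for i j
  have a: "a i j \<ge> 0" for i j using nonneg by (simp add: a_def)
  have W: "(A ^\<^sub>m m) $$ (i, j) = walk_weight {..<n} a m i j" if "i < n" "j < n" for m i j
  proof -
    have "walk_weight {..<n} (\<lambda>i j. A $$ (i, j)) m i j = walk_weight {..<n} a m i j"
      using that(1) by (induction m arbitrary: i) (auto simp: a_def)
    then show ?thesis using pow_mat_walk_weight[OF A that] by simp
  qed
  obtain t where t: "t > 1" "t < real_spectral_radius A" using gt dense by blast
  have "walk_weight {..<n} a m i i \<le> 1" if "i \<in> {..<n}" for m i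
  proof (cases m)
    case (Suc k)
    then have "\<not> (A ^\<^sub>m m) $$ (i, i) > 1"
      using neg that by (metis Suc_le_mono One_nat_def lessThan_iff zero_le)
    then show ?thesis using W[of i i m] that by simp
  qed simp
  from walk_weight_growth[OF a finite_lessThan t(1) this]
  obtain C where C: "\<And>m i j. i < n \<Longrightarrow> j < n \<Longrightarrow> walk_weight {..<n} a m i j \<le> C * t ^ m"
    by auto
  have "\<bar>(A ^\<^sub>m m) $$ (i, j)\<bar> \<le> C * t ^ m" if "i < n" "j < n" for m i j
    using C[OF that, of m] W[OF that, of m] walk_weight_nonneg[of a "{..<n}" m i j, OF a] by simp
  from real_spectral_radius_le[OF A n _ this] t show False by simp
qed

section \<open>Graphs with finitely many types of vertices\<close>

lemma sum_UN_le:
  fixes f :: "'b \<Rightarrow> real"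
  assumes "finite I" "\<And>i. i \<in> I \<Longrightarrow> finite (B i)" "\<And>x. 0 \<le> f x"
  shows "sum f (\<Union>i\<in>I. B i) \<le> (\<Sum>i\<in>I. sum f (B i))"
  using assms(1,2)
proof (induction I rule: finite_induct)
  case (insert i I)
  have fin: "finite (B i)" "finite (\<Union>i\<in>I. B i)" using insert by auto
  have "sum f (B i \<union> (\<Union>i\<in>I. B i)) + sum f (B i \<inter> (\<Union>i\<in>I. B i)) = sum f (B i) + sum f (\<Union>i\<in>I. B i)"
    by (rule sum.union_inter[OF fin])
  moreover have "0 \<le> sum f (B i \<inter> (\<Union>i\<in>I. B i))" by (intro sum_nonneg assms(3))
  ultimately have "sum f (B i \<union> (\<Union>i\<in>I. B i)) \<le> sum f (B i) + sum f (\<Union>i\<in>I. B i)" by linarith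
  also have "\<dots> \<le> sum f (B i) + (\<Sum>i\<in>I. sum f (B i))" using insert by simp
  finally show ?case using insert by simp
qed simp

lemma powr_rescale:
  fixes r c s s' :: real
  assumes "0 < r" "0 < c"
  shows "r powr s' * (c / r) powr (s' - s) = c powr (s' - s) * r powr s"
proof -
  have "r powr s' = r powr s * r powr (s' - s)" by (simp flip: powr_add)
  moreover have "(c / r) powr (s' - s) = c powr (s' - s) / r powr (s' - s)" using assms by (simp add: powr_divide)
  moreover have "r powr (s' - s) \<noteq> 0" using assms by simp
  ultimately show ?thesis by simp
qed

lemma powr_lt_one:
  fixes x y :: real
  assumes "0 < x" "x < 1" "0 < y"
  shows "x powr y < 1"
  using powr_less_mono2[of y x 1] assms by simp

lemma relpow_Suc_iff: "(x, z) \<in> R ^^ Suc m \<longleftrightarrow> (\<exists>y. (x, y) \<in> R \<and> (y, z) \<in> R ^^ m)"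
  unfolding relpow.simps(2) relpow_commute[symmetric] by auto

lemma relpow_Suc_Image: "(R ^^ Suc m) `` {x} = (\<Union>y\<in>R `` {x}. (R ^^ m) `` {y})"
  unfolding set_eq_iff Image_singleton_iff relpow_Suc_iff UN_iff by blast

text \<open>What the spectral argument uses of the reduced graph. An edge has weight
  \<open>rho u / rho v\<close>, so weights telescope along paths. A single edge need not contract,
  as its label may be empty; \<open>drop\<close> asserts that a return to the same type
  does.\<close>

locale typed_graph =
  fixes VR :: "'a set" and Er :: "('a \<times> 'a) set" and rho :: "'a \<Rightarrow> real" and ty :: "'a \<Rightarrow> nat"
    and Q :: nat and A :: "real \<Rightarrow> real mat" and \<eta> \<theta> :: real
  assumes edges: "Er \<subseteq> VR \<times> VR" and fin_children: "\<And>v. finite (Er `` {v})"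
    and rho_pos: "\<And>v. v \<in> VR \<Longrightarrow> 0 < rho v" and ty_less: "\<And>v. v \<in> VR \<Longrightarrow> ty v < Q"
    and A_carrier: "\<And>s. 0 \<le> s \<Longrightarrow> A s \<in> carrier_mat Q Q"
    and A_row: "\<And>s v j. 0 \<le> s \<Longrightarrow> v \<in> VR \<Longrightarrow> j < Q \<Longrightarrow>
      A s $$ (ty v, j) = (\<Sum>u\<in>{u \<in> Er `` {v}. ty u = j}. (rho u / rho v) powr s)"
    and A_zero: "\<And>s i j. 0 \<le> s \<Longrightarrow> i < Q \<Longrightarrow> i \<notin> ty ` VR \<Longrightarrow> j < Q \<Longrightarrow> A s $$ (i, j) = 0"
    and nonempty: "VR \<noteq> {}" and child: "\<And>v. v \<in> VR \<Longrightarrow> \<exists>u. (v, u) \<in> Er"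
    and eta: "0 < \<eta>" "\<eta> < 1" and rho_lower: "\<And>v u. (v, u) \<in> Er \<Longrightarrow> \<eta> * rho v \<le> rho u"
    and rho_upper: "\<And>v u. (v, u) \<in> Er \<Longrightarrow> rho u \<le> rho v"
    and theta: "0 < \<theta>" "\<theta> < 1"
    and drop: "\<And>m v u. 1 \<le> m \<Longrightarrow> (v, u) \<in> Er ^^ m \<Longrightarrow> ty v = ty u \<Longrightarrow> rho u \<le> \<theta> * rho v"
begin

lemma Q_pos: "0 < Q"
  using nonempty ty_less by (metis ex_in_conv not_gr0 not_less_zero)

lemma edge_VR: "(v, u) \<in> Er \<Longrightarrow> v \<in> VR" "(v, u) \<in> Er \<Longrightarrow> u \<in> VR"
  using edges by auto

lemma relpow_VR: "v \<in> VR \<Longrightarrow> (v, u) \<in> Er ^^ m \<Longrightarrow> u \<in> VR"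
  by (induction m arbitrary: u) (auto dest: edge_VR)

lemma finite_relpow: "finite ((Er ^^ m) `` {v})"
proof (induction m arbitrary: v)
  case 0
  have "(Er ^^ 0) `` {v} = {v}" by auto
  then show ?case by simp
next
  case (Suc m)
  have "(Er ^^ Suc m) `` {v} = (\<Union>u\<in>Er `` {v}. (Er ^^ m) `` {u})"
    by (rule relpow_Suc_Image)
  then show ?case using Suc fin_children by simp
qed

text \<open>Paths are counted with multiplicity, even if their ends coincide; by telescoping each
  path contributes a power of the ratio between its ends.\<close>

primrec chain_weight :: "nat \<Rightarrow> real \<Rightarrow> 'a \<Rightarrow> nat \<Rightarrow> real" where
  "chain_weight 0 s v t = (if ty v = t then 1 else 0)"
| "chain_weight (Suc m) s v t = (\<Sum>u\<in>Er `` {v}. (rho u / rho v) powr s * chain_weight m s u t)"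

lemma chain_weight_nonneg: "0 \<le> chain_weight m s v t"
  by (induction m arbitrary: v) (auto intro!: sum_nonneg)

lemma A_pow:
  assumes s: "0 \<le> s" and v: "v \<in> VR" and t: "t < Q"
  shows "(A s ^\<^sub>m m) $$ (ty v, t) = chain_weight m s v t"
  using v
proof (induction m arbitrary: v)
  case 0
  then show ?case using A_carrier[OF s] ty_less[of v] t by auto
next
  case (Suc m)
  have "(A s ^\<^sub>m Suc m) $$ (ty v, t) = (A s * A s ^\<^sub>m m) $$ (ty v, t)"
    by (simp only: pow_mat_Suc_left[OF A_carrier[OF s]])
  also have "\<dots> = (\<Sum>l\<in>{0..<Q}. A s $$ (ty v, l) * (A s ^\<^sub>m m) $$ (l, t))"
    using A_carrier[OF s] ty_less[OF Suc.prems] t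
    by (subst index_mult_mat) (auto simp: scalar_prod_def intro!: sum.cong)
  also have "\<dots> = (\<Sum>l\<in>{0..<Q}. \<Sum>u\<in>{u \<in> Er `` {v}. ty u = l}. (rho u / rho v) powr s * chain_weight m s u t)"
  proof (rule sum.cong[OF refl])
    fix l assume l: "l \<in> {0..<Q}"
    have "A s $$ (ty v, l) * (A s ^\<^sub>m m) $$ (l, t) =
        (\<Sum>u\<in>{u \<in> Er `` {v}. ty u = l}. (rho u / rho v) powr s * (A s ^\<^sub>m m) $$ (l, t))"
      using l by (simp add: A_row[OF s Suc.prems] sum_distrib_right)
    also have "\<dots> = (\<Sum>u\<in>{u \<in> Er `` {v}. ty u = l}. (rho u / rho v) powr s * chain_weight m s u t)"
    proof (rule sum.cong[OF refl])
      fix u assume u: "u \<in> {u \<in> Er `` {v}. ty u = l}"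
      then have "u \<in> VR" "ty u = l" using edge_VR by auto
      then show "(rho u / rho v) powr s * (A s ^\<^sub>m m) $$ (l, t) = (rho u / rho v) powr s * chain_weight m s u t"
        using Suc.IH[of u] by simp
    qed
    finally show "A s $$ (ty v, l) * (A s ^\<^sub>m m) $$ (l, t) =
      (\<Sum>u\<in>{u \<in> Er `` {v}. ty u = l}. (rho u / rho v) powr s * chain_weight m s u t)" .
  qed
  also have "\<dots> = (\<Sum>u\<in>Er `` {v}. (rho u / rho v) powr s * chain_weight m s u t)"
    by (rule sum.group) (use fin_children edge_VR ty_less in auto)
  finally show ?case by simp
qed

lemma A_pow_zero:
  assumes s: "0 \<le> s" and i: "i < Q" "i \<notin> ty ` VR" and j: "j < Q" and m: "m \<noteq> 0"
  shows "(A s ^\<^sub>m m) $$ (i, j) = 0"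
proof -
  obtain k where k: "m = Suc k" using m by (cases m) auto
  have "(A s ^\<^sub>m m) $$ (i, j) = (A s * A s ^\<^sub>m k) $$ (i, j)"
    by (simp only: k pow_mat_Suc_left[OF A_carrier[OF s]])
  also have "\<dots> = (\<Sum>l\<in>{0..<Q}. A s $$ (i, l) * (A s ^\<^sub>m k) $$ (l, j))"
    using A_carrier[OF s] i j by (subst index_mult_mat) (auto simp: scalar_prod_def intro!: sum.cong)
  also have "\<dots> = 0" using A_zero[OF s i] by simp
  finally show ?thesis .
qed

section \<open>The spectral radius as a function of the exponent\<close>

definition lam :: "real \<Rightarrow> real" where "lam s = real_spectral_radius (A s)"

lemma lam_nonneg: "0 \<le> s \<Longrightarrow> 0 \<le> lam s"
  unfolding lam_def using real_spectral_radius_nonneg[OF A_carrier Q_pos] by blast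

lemma lam_leI:
  assumes s: "0 \<le> s" and t: "0 < t"
    and bound: "\<And>m v j. v \<in> VR \<Longrightarrow> j < Q \<Longrightarrow> chain_weight m s v j \<le> C * t ^ m"
  shows "lam s \<le> t"
  unfolding lam_def
\<comment> \<open>The maximum with 1 covers the zeroth power, whose diagonal is 1 even in rows of
  types without vertices.\<close>
proof (rule real_spectral_radius_le[OF A_carrier[OF s] Q_pos t, of "max 1 C"])
  fix m i j assume i: "i < Q" and j: "j < Q"
  have pos: "0 \<le> max 1 C * t ^ m" using t by simp
  show "\<bar>(A s ^\<^sub>m m) $$ (i, j)\<bar> \<le> max 1 C * t ^ m"
  proof (cases "i \<in> ty ` VR")
    case True
    then obtain v where v: "v \<in> VR" "i = ty v" by blast
    have "chain_weight m s v j \<le> C * t ^ m" by (rule bound[OF v(1) j])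
    also have "\<dots> \<le> max 1 C * t ^ m" using t by (intro mult_right_mono) auto
    finally show ?thesis using A_pow[OF s v(1) j] v(2) chain_weight_nonneg[of m s v j] by simp
  next
    case False
    show ?thesis
    proof (cases "m = 0")
      case True
      then show ?thesis using A_carrier[OF s] i j by (cases "i = j") simp_all
    next
      case m: False
      show ?thesis using A_pow_zero[OF s i False j m] pos by simp
    qed
  qed
qed

lemma lam_less_growth:
  assumes s: "0 \<le> s" and t: "lam s < t"
  obtains C where "0 \<le> C" "\<And>m v j. v \<in> VR \<Longrightarrow> j < Q \<Longrightarrow> chain_weight m s v j \<le> C * t ^ m"
proof -
  obtain C where C: "C \<ge> 0" "\<forall>m i j. i < Q \<longrightarrow> j < Q \<longrightarrow> \<bar>(A s ^\<^sub>m m) $$ (i, j)\<bar> \<le> C * t ^ m"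
    using real_spectral_radius_less_growth[OF A_carrier[OF s] Q_pos t[unfolded lam_def]] by blast
  have "chain_weight m s v j \<le> C * t ^ m" if v: "v \<in> VR" and j: "j < Q" for m v j
  proof -
    have "\<bar>(A s ^\<^sub>m m) $$ (ty v, j)\<bar> \<le> C * t ^ m" using C(2) ty_less[OF v] j by blast
    then show ?thesis using A_pow[OF s v j, of m] by simp
  qed
  then show ?thesis using that C(1) by blast
qed

text \<open>On each path the additional factor is a power of the total contraction, which is at most
  \<open>c\<close>. In the induction the first edge uses up its share of \<open>c\<close>, whence
  the division.\<close>

lemma chain_weight_exponent_le:
  assumes "v \<in> VR" "0 < c" "\<And>u. (v, u) \<in> Er ^^ m \<Longrightarrow> rho u \<le> c * rho v" "s \<le> s'"
  shows "chain_weight m s' v t \<le> c powr (s' - s) * chain_weight m s v t"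
  using assms(1-3)
proof (induction m arbitrary: v c)
  case 0
  have "rho v \<le> c * rho v" using "0.prems"(3)[of v] by simp
  then have "1 \<le> c" using rho_pos[OF "0.prems"(1)] by simp
  then have "1 \<le> c powr (s' - s)" using \<open>s \<le> s'\<close> by (simp add: ge_one_powr_ge_zero)
  then show ?case by simp
next
  case (Suc m)
  have "(rho u / rho v) powr s' * chain_weight m s' u t \<le>
      c powr (s' - s) * ((rho u / rho v) powr s * chain_weight m s u t)" if u: "u \<in> Er `` {v}" for u
  proof -
    have uV: "u \<in> VR" using u edge_VR by auto
    let ?r = "rho u / rho v"
    have r: "0 < ?r" using rho_pos uV Suc.prems(1) by simp
    have "rho z \<le> (c / ?r) * rho u" if "(u, z) \<in> Er ^^ m" for z
    proof -
      have "(v, z) \<in> Er ^^ Suc m" using u that unfolding relpow_Suc_iff by blast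
      then have "rho z \<le> c * rho v" by (rule Suc.prems(3))
      then show ?thesis using rho_pos[OF uV] by simp
    qed
    then have "chain_weight m s' u t \<le> (c / ?r) powr (s' - s) * chain_weight m s u t"
      by (rule Suc.IH[OF uV divide_pos_pos[OF Suc.prems(2) r]])
    then have "?r powr s' * chain_weight m s' u t \<le> ?r powr s' * ((c / ?r) powr (s' - s) * chain_weight m s u t)"
      by (intro mult_left_mono) auto
    also have "\<dots> = (?r powr s' * (c / ?r) powr (s' - s)) * chain_weight m s u t" by simp
    also have "?r powr s' * (c / ?r) powr (s' - s) = c powr (s' - s) * ?r powr s"
      by (rule powr_rescale[OF r Suc.prems(2)])
    finally show ?thesis by (simp add: mult.assoc)
  qed
  then show ?case unfolding chain_weight.simps sum_distrib_left by (rule sum_mono)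
qed

lemma chain_weight_exponent_ge:
  assumes "v \<in> VR" "0 < c" "\<And>u. (v, u) \<in> Er ^^ m \<Longrightarrow> c * rho v \<le> rho u" "s \<le> s'"
  shows "c powr (s' - s) * chain_weight m s v t \<le> chain_weight m s' v t"
  using assms(1-3)
proof (induction m arbitrary: v c)
  case 0
  have "c * rho v \<le> rho v" using "0.prems"(3)[of v] by simp
  then have "c \<le> 1" using rho_pos[OF "0.prems"(1)] by simp
  then have "c powr (s' - s) \<le> 1" using \<open>s \<le> s'\<close> "0.prems"(2) by (simp add: powr_le1)
  then show ?case by simp
next
  case (Suc m)
  have "c powr (s' - s) * ((rho u / rho v) powr s * chain_weight m s u t) \<le>
      (rho u / rho v) powr s' * chain_weight m s' u t" if u: "u \<in> Er `` {v}" for u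
  proof -
    have uV: "u \<in> VR" using u edge_VR by auto
    let ?r = "rho u / rho v"
    have r: "0 < ?r" using rho_pos uV Suc.prems(1) by simp
    have "(c / ?r) * rho u \<le> rho z" if "(u, z) \<in> Er ^^ m" for z
    proof -
      have "(v, z) \<in> Er ^^ Suc m" using u that unfolding relpow_Suc_iff by blast
      then have "c * rho v \<le> rho z" by (rule Suc.prems(3))
      then show ?thesis using rho_pos[OF uV] by simp
    qed
    then have "(c / ?r) powr (s' - s) * chain_weight m s u t \<le> chain_weight m s' u t"
      by (rule Suc.IH[OF uV divide_pos_pos[OF Suc.prems(2) r]])
    then have "?r powr s' * ((c / ?r) powr (s' - s) * chain_weight m s u t) \<le> ?r powr s' * chain_weight m s' u t"
      by (intro mult_left_mono) auto
    moreover have "?r powr s' * (c / ?r) powr (s' - s) = c powr (s' - s) * ?r powr s"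
      by (rule powr_rescale[OF r Suc.prems(2)])
    ultimately show ?thesis by (simp only: mult.assoc[symmetric])
  qed
  then show ?case unfolding chain_weight.simps sum_distrib_left by (rule sum_mono)
qed

lemma rho_relpow_upper: "(v, u) \<in> Er ^^ m \<Longrightarrow> rho u \<le> rho v"
proof (induction m arbitrary: u)
  case (Suc m)
  then obtain w where "(v, w) \<in> Er ^^ m" "(w, u) \<in> Er" by auto
  then show ?case using Suc.IH[of w] rho_upper[of w u] by linarith
qed auto

lemma rho_relpow_lower: "(v, u) \<in> Er ^^ m \<Longrightarrow> \<eta> ^ m * rho v \<le> rho u"
proof (induction m arbitrary: u)
  case (Suc m)
  then obtain w where w: "(v, w) \<in> Er ^^ m" "(w, u) \<in> Er" by auto
  have "\<eta> * (\<eta> ^ m * rho v) \<le> \<eta> * rho w" using Suc.IH[OF w(1)] eta by simp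
  then show ?case using rho_lower[OF w(2)] by simp
qed auto

text \<open>Pigeonhole: among the \<open>Q + 1\<close> vertices of the path two have the same type,
  and between them \<open>drop\<close> applies.\<close>

lemma rho_relpow_Q:
  assumes v: "v \<in> VR" and u: "(v, u) \<in> Er ^^ Q"
  shows "rho u \<le> \<theta> * rho v"
proof -
  obtain f where f: "f 0 = v" "f Q = u" "\<And>i. i < Q \<Longrightarrow> (f i, f (Suc i)) \<in> Er"
    using u unfolding relpow_fun_conv by blast
  have seg: "(f a, f b) \<in> Er ^^ (b - a)" if "a \<le> b" "b \<le> Q" for a b
    unfolding relpow_fun_conv by (rule exI[of _ "\<lambda>i. f (a + i)"]) (use f(3) that in auto)
  have fV: "f i \<in> VR" if "i \<le> Q" for i
    using relpow_VR[OF v, of "f i" i] seg[of 0 i] that f(1) by simp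
  have "card ((\<lambda>i. ty (f i)) ` {..Q}) \<le> card {..<Q}"
    by (rule card_mono) (use fV ty_less in auto)
  then have "\<not> inj_on (\<lambda>i. ty (f i)) {..Q}" using card_image[of "\<lambda>i. ty (f i)" "{..Q}"] by auto
  then obtain a b where ab: "a \<le> Q" "b \<le> Q" "a \<noteq> b" "ty (f a) = ty (f b)"
    by (auto simp: inj_on_def)
  define a' b' where "a' = min a b" and "b' = max a b"
  have ab': "a' < b'" "b' \<le> Q" "ty (f a') = ty (f b')" using ab by (auto simp: a'_def b'_def min_def max_def)
  have "rho (f b') \<le> \<theta> * rho (f a')"
    using drop[OF _ seg[of a' b'] ab'(3)] ab' by simp
  moreover have "rho (f a') \<le> rho v" using rho_relpow_upper[OF seg[of 0 a']] ab' f(1) by simp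
  moreover have "rho u \<le> rho (f b')" using rho_relpow_upper[OF seg[of b' Q]] ab' f(2) by simp
  ultimately show ?thesis using mult_left_mono[of "rho (f a')" "rho v" \<theta>] theta by linarith
qed

lemma rho_relpow_decay:
  assumes v: "v \<in> VR" and u: "(v, u) \<in> Er ^^ (Q * k + l)"
  shows "rho u \<le> \<theta> ^ k * rho v"
  using v u
proof (induction k arbitrary: v)
  case 0
  then show ?case using rho_relpow_upper by simp
next
  case (Suc k)
  have "Q * Suc k + l = Q + (Q * k + l)" by simp
  then have "(v, u) \<in> Er ^^ Q O Er ^^ (Q * k + l)" using Suc.prems(2) by (metis relpow_add)
  then obtain w where w: "(v, w) \<in> Er ^^ Q" "(w, u) \<in> Er ^^ (Q * k + l)" by auto
  have "rho u \<le> \<theta> ^ k * rho w" by (rule Suc.IH[OF relpow_VR[OF Suc.prems(1) w(1)] w(2)])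
  also have "\<dots> \<le> \<theta> ^ k * (\<theta> * rho v)"
    using rho_relpow_Q[OF Suc.prems(1) w(1)] theta by (intro mult_left_mono) auto
  finally show ?case by (simp add: mult_ac)
qed

text \<open>The contraction per step that amounts to \<open>\<theta>\<close> in \<open>Q\<close>
  steps.\<close>

definition \<kappa> :: real where "\<kappa> = \<theta> powr (1 / Q)"

lemma kappa: "0 < \<kappa>" "\<kappa> < 1"
  unfolding \<kappa>_def using theta Q_pos by (simp_all add: powr_lt_one)

text \<open>The factor \<open>1 / \<theta>\<close> compensates for the last, possibly incomplete
  block of \<open>Q\<close> steps.\<close>

lemma rho_relpow_kappa:
  assumes v: "v \<in> VR" and u: "(v, u) \<in> Er ^^ m"
  shows "rho u \<le> (1 / \<theta>) * \<kappa> ^ m * rho v"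
proof -
  let ?k = "m div Q"
  have "rho u \<le> \<theta> ^ ?k * rho v" using rho_relpow_decay[OF v, of u ?k "m mod Q"] u by simp
  also have "\<theta> ^ ?k \<le> (1 / \<theta>) * \<kappa> ^ m"
  proof -
    have "real m < (real ?k + 1) * Q"
    proof -
      have "m < (?k + 1) * Q" using Q_pos by (metis Suc_eq_plus1 div_less_iff_less_mult lessI)
      then show ?thesis by (metis of_nat_1 of_nat_add of_nat_less_iff of_nat_mult)
    qed
    then have "real m / Q \<le> real ?k + 1" using Q_pos by (simp add: field_simps)
    then have "\<theta> powr (real ?k + 1) \<le> \<theta> powr (real m / Q)"
      using theta by (intro powr_mono') auto
    moreover have "\<theta> powr (real ?k + 1) = \<theta> ^ ?k * \<theta>" using theta by (simp add: powr_add powr_realpow)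
    moreover have "\<theta> powr (real m / Q) = \<kappa> ^ m"
      using theta by (simp add: \<kappa>_def powr_powr flip: powr_realpow)
    ultimately show ?thesis using theta by (simp add: field_simps)
  qed
  finally show ?thesis using rho_pos[OF v] by simp
qed

text \<open>Raising the exponent multiplies the path weights of length \<open>m\<close> by at most a
  constant times the \<open>m\<close>-th power of \<open>\<kappa> powr (s' - s)\<close>; the
  constant disappears in the growth rate.\<close>

lemma lam_decrease:
  assumes s: "0 \<le> s" "s \<le> s'"
  shows "lam s' \<le> \<kappa> powr (s' - s) * lam s"
proof -
  have le: "lam s' \<le> \<kappa> powr (s' - s) * t" if t: "lam s < t" for t
  proof -
    obtain C where C: "0 \<le> C" "\<And>m v j. v \<in> VR \<Longrightarrow> j < Q \<Longrightarrow> chain_weight m s v j \<le> C * t ^ m"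
      using lam_less_growth[OF s(1) t] by blast
    have t0: "0 < t" using t lam_nonneg[OF s(1)] by linarith
    show ?thesis
    proof (rule lam_leI)
      show "0 \<le> s'" "0 < \<kappa> powr (s' - s) * t" using s t0 kappa by auto
      fix m v j assume v: "v \<in> VR" and j: "j < Q"
      have "chain_weight m s' v j \<le> ((1 / \<theta>) * \<kappa> ^ m) powr (s' - s) * chain_weight m s v j"
        by (rule chain_weight_exponent_le[OF v _ rho_relpow_kappa[OF v] s(2)]) (use theta kappa in simp)
      also have "\<dots> \<le> ((1 / \<theta>) * \<kappa> ^ m) powr (s' - s) * (C * t ^ m)"
        by (intro mult_left_mono C(2)[OF v j]) auto
      also have "((1 / \<theta>) * \<kappa> ^ m) powr (s' - s) = (1 / \<theta>) powr (s' - s) * (\<kappa> powr (s' - s)) ^ m"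
        using theta kappa by (subst powr_mult) (auto simp: powr_powr mult.commute simp flip: powr_realpow)
      finally show "chain_weight m s' v j \<le> ((1 / \<theta>) powr (s' - s) * C) * (\<kappa> powr (s' - s) * t) ^ m"
        by (simp add: power_mult_distrib mult_ac)
    qed
  qed
  have k: "0 < \<kappa> powr (s' - s)" using kappa by simp
  show ?thesis
  proof (rule field_le_epsilon)
    fix e :: real assume e: "0 < e"
    have "lam s < lam s + e / \<kappa> powr (s' - s)" using divide_pos_pos[OF e k] by simp
    from le[OF this] show "lam s' \<le> \<kappa> powr (s' - s) * lam s + e" using k by (simp add: distrib_left)
  qed
qed

text \<open>One edge contracts at most by \<open>\<eta>\<close>, which limits how much the larger
  exponent can reduce the weights. Growth rates of path weights take the place of
  eigenvectors.\<close>

lemma lam_increase: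
  assumes s: "0 \<le> s" "s \<le> s'"
  shows "\<eta> powr (s' - s) * lam s \<le> lam s'"
proof -
  let ?c = "\<eta> powr (s' - s)"
  have c: "0 < ?c" using eta by simp
  have le: "lam s \<le> t / ?c" if t: "lam s' < t" for t
  proof -
    have s': "0 \<le> s'" using s by simp
    obtain C where C: "0 \<le> C" "\<And>m v j. v \<in> VR \<Longrightarrow> j < Q \<Longrightarrow> chain_weight m s' v j \<le> C * t ^ m"
      using lam_less_growth[OF s' t] by blast
    have t0: "0 < t" using t lam_nonneg[OF s'] by linarith
    show ?thesis
    proof (rule lam_leI[OF s(1)])
      show "0 < t / ?c" using t0 c by simp
      fix m v j assume v: "v \<in> VR" and j: "j < Q"
      have "(\<eta> ^ m) powr (s' - s) * chain_weight m s v j \<le> chain_weight m s' v j"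
        by (rule chain_weight_exponent_ge[OF v _ rho_relpow_lower s(2)]) (use eta in simp)
      also have "\<dots> \<le> C * t ^ m" by (rule C(2)[OF v j])
      also have "(\<eta> ^ m) powr (s' - s) = ?c ^ m"
        using eta by (simp add: powr_powr mult.commute flip: powr_realpow)
      finally show "chain_weight m s v j \<le> C * (t / ?c) ^ m"
        using c by (simp add: power_divide field_simps)
    qed
  qed
  have "lam s \<le> lam s' / ?c"
  proof (rule field_le_epsilon)
    fix e :: real assume e: "0 < e"
    have "lam s' < lam s' + e * ?c" using mult_pos_pos[OF e c] by simp
    from le[OF this] show "lam s \<le> lam s' / ?c + e" using c by (simp add: add_divide_distrib)
  qed
  then show ?thesis using c by (simp add: field_simps)
qed

lemma sum_chain_weight_Suc:
  "(\<Sum>j<Q. chain_weight (Suc m) s v j) = (\<Sum>u\<in>Er `` {v}. (rho u / rho v) powr s * (\<Sum>j<Q. chain_weight m s u j))"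
  by (simp add: sum_distrib_left) (rule sum.swap)

lemma sum_chain_weight_0: "v \<in> VR \<Longrightarrow> (\<Sum>j<Q. chain_weight 0 s v j) = 1"
  using ty_less[of v] by simp

text \<open>For exponent 0 every path has weight 1, and since every vertex has a child there are
  paths of any length, so the path counts do not decay.\<close>

lemma lam_0_ge_1: "1 \<le> lam 0"
proof (rule ccontr)
  assume "\<not> 1 \<le> lam 0"
  then obtain t where t: "lam 0 < t" "t < 1" using dense[of "lam 0" 1] by auto
  have t0: "0 < t" using t lam_nonneg[of 0] by linarith
  obtain C where C: "0 \<le> C" "\<And>m v j. v \<in> VR \<Longrightarrow> j < Q \<Longrightarrow> chain_weight m 0 v j \<le> C * t ^ m"
    using lam_less_growth[OF order_refl t(1)] by blast
  have ge: "1 \<le> (\<Sum>j<Q. chain_weight m 0 v j)" if "v \<in> VR" for m v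
    using that
  proof (induction m arbitrary: v)
    case 0
    then show ?case using sum_chain_weight_0[of v 0] by simp
  next
    case (Suc m)
    obtain u where u: "(v, u) \<in> Er" using child[OF Suc.prems] by blast
    have pos: "0 < rho w / rho v" if "w \<in> Er `` {v}" for w
      using that edge_VR rho_pos by auto
    have "1 \<le> (\<Sum>j<Q. chain_weight m 0 u j)" using Suc.IH edge_VR(2)[OF u] .
    also have "\<dots> \<le> (\<Sum>u\<in>Er `` {v}. \<Sum>j<Q. chain_weight m 0 u j)"
      using u fin_children
      by (intro member_le_sum[of u _ "\<lambda>u. \<Sum>j<Q. chain_weight m 0 u j"] sum_nonneg chain_weight_nonneg) auto
    also have "\<dots> = (\<Sum>u\<in>Er `` {v}. (rho u / rho v) powr 0 * (\<Sum>j<Q. chain_weight m 0 u j))"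
    proof (rule sum.cong[OF refl])
      fix w assume "w \<in> Er `` {v}"
      \<comment> \<open>A zero base would give \<open>0 powr 0 = 0\<close>, so the ratios have to be
        nonzero.\<close>
      from less_imp_neq[OF pos[OF this]] have "rho w / rho v \<noteq> 0" by (rule not_sym)
      then show "(\<Sum>j<Q. chain_weight m 0 w j) = (rho w / rho v) powr 0 * (\<Sum>j<Q. chain_weight m 0 w j)"
        by simp
    qed
    finally show ?case by (simp only: sum_chain_weight_Suc)
  qed
  obtain v where v: "v \<in> VR" using nonempty by blast
  have le: "1 \<le> (Q * C) * t ^ m" for m
  proof -
    have "1 \<le> (\<Sum>j<Q. chain_weight m 0 v j)" by (rule ge[OF v])
    also have "\<dots> \<le> (\<Sum>j<Q. C * t ^ m)" using C(2)[OF v] by (intro sum_mono) auto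
    finally show ?thesis by simp
  qed
  have "(\<lambda>m. (Q * C) * t ^ m) \<longlonglongrightarrow> (Q * C) * 0"
    using t t0 by (intro tendsto_mult tendsto_const LIMSEQ_realpow_zero) auto
  then have "\<forall>\<^sub>F m in sequentially. (Q * C) * t ^ m < 1" by (rule order_tendstoD) simp
  from eventually_happens'[OF sequentially_bot this] obtain m where "(Q * C) * t ^ m < 1" by blast
  then show False using le[of m] by linarith
qed

lemma lam_pos: "0 \<le> s \<Longrightarrow> 0 < lam s"
proof -
  assume s: "0 \<le> s"
  have "0 < lam 0" using lam_0_ge_1 by linarith
  moreover have "0 < \<eta> powr s" using eta(1) by simp
  ultimately have "0 < \<eta> powr s * lam 0" by simp
  then show ?thesis using lam_increase[of 0 s] s by simp
qed

lemma lam_strict_decrease: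
  assumes "0 \<le> s" "s < s'"
  shows "lam s' < lam s"
proof -
  have "\<kappa> powr (s' - s) < 1" using kappa assms by (intro powr_lt_one) auto
  then have "\<kappa> powr (s' - s) * lam s < 1 * lam s" by (rule mult_strict_right_mono[OF _ lam_pos[OF assms(1)]])
  then show ?thesis using lam_decrease[of s s'] assms by simp
qed

text \<open>The logarithm of the spectral radius is decreasing, and \<open>lam_increase\<close>
  bounds its decrease, so it is Lipschitz with constant \<open>- ln \<eta>\<close>.\<close>

lemma lam_continuous: "continuous_on {0..} lam"
proof -
  have lip: "\<bar>ln (lam s) - ln (lam s')\<bar> \<le> - ln \<eta> * (s' - s)" if s: "0 \<le> s" "s \<le> s'" for s s'
  proof -
    have p: "0 < lam s" "0 < lam s'" using lam_pos s by auto
    have "ln (\<eta> powr (s' - s) * lam s) \<le> ln (lam s')"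
      using lam_increase[OF s] p eta by (subst ln_le_cancel_iff) auto
    then have "(s' - s) * ln \<eta> + ln (lam s) \<le> ln (lam s')" using p eta by (simp add: ln_mult ln_powr)
    moreover have "lam s' \<le> lam s"
      using lam_strict_decrease[OF s(1), of s'] s(2) by (cases "s = s'") auto
    then have "ln (lam s') \<le> ln (lam s)" using p by simp
    ultimately show ?thesis by (simp add: algebra_simps)
  qed
  have "(- ln \<eta>)-lipschitz_on {0..} (\<lambda>s. ln (lam s))"
  proof (rule lipschitz_onI)
    fix x y :: real assume xy: "x \<in> {0..}" "y \<in> {0..}"
    show "dist (ln (lam x)) (ln (lam y)) \<le> - ln \<eta> * dist x y"
    proof (cases "x \<le> y")
      case True
      then show ?thesis using lip[of x y] xy by (simp add: dist_real_def)
    next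
      case False
      then show ?thesis using lip[of y x] xy by (simp add: dist_real_def abs_minus_commute)
    qed
  qed (use eta in simp)
  then have "continuous_on {0..} (\<lambda>s. ln (lam s))" by (rule lipschitz_on_continuous_on)
  then have "continuous_on {0..} (\<lambda>s. exp (ln (lam s)))" by (rule continuous_on_exp)
  then show ?thesis by (rule continuous_on_eq) (simp add: lam_pos)
qed

theorem unique_exponent: "\<exists>!\<alpha>. 0 \<le> \<alpha> \<and> lam \<alpha> = 1"
proof -
  have "(\<lambda>n::nat. \<kappa> ^ n * lam 0) \<longlonglongrightarrow> 0 * lam 0"
    using kappa by (intro tendsto_mult tendsto_const LIMSEQ_realpow_zero) auto
  then have "\<forall>\<^sub>F n in sequentially. \<kappa> ^ n * lam 0 < 1" by (rule order_tendstoD) simp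
  from eventually_happens'[OF sequentially_bot this] obtain n :: nat where n: "\<kappa> ^ n * lam 0 < 1" by blast
  have "{0..real n} \<subseteq> {0..}" by auto
  then have cont: "continuous_on {0..real n} lam" by (rule continuous_on_subset[OF lam_continuous])
  have "lam (real n) \<le> 1"
    using lam_decrease[of 0 "real n"] n kappa by (simp add: powr_realpow)
  then have "\<exists>x. 0 \<le> x \<and> x \<le> real n \<and> lam x = 1"
    by (rule IVT2'[OF _ lam_0_ge_1 of_nat_0_le_iff cont])
  then obtain x where x: "0 \<le> x" "lam x = 1" by blast
  show ?thesis
  proof (rule ex1I[of _ x])
    fix y assume "0 \<le> y \<and> lam y = 1"
    then have y: "0 \<le> y" "lam y = 1" by simp_all
    have "\<not> x < y" using lam_strict_decrease[OF x(1), of y] x(2) y(2) by linarith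
    moreover have "\<not> y < x" using lam_strict_decrease[OF y(1), of x] x(2) y(2) by linarith
    ultimately show "y = x" by simp
  qed (use x in simp)
qed

text \<open>Distinct paths may end in the same vertex, which gives an inequality. For covers this is
  the direction that is wanted.\<close>

lemma sum_relpow_le_chain_weight:
  assumes "v \<in> VR"
  shows "(\<Sum>u\<in>(Er ^^ m) `` {v}. (rho u / rho v) powr s) \<le> (\<Sum>j<Q. chain_weight m s v j)"
  using assms
proof (induction m arbitrary: v)
  case 0
  have "(Er ^^ 0) `` {v} = {v}" by auto
  then show ?case using sum_chain_weight_0[OF "0.prems", of s] rho_pos[OF "0.prems"] by simp
next
  case (Suc m)
  have "(Er ^^ Suc m) `` {v} = (\<Union>u\<in>Er `` {v}. (Er ^^ m) `` {u})"
    by (rule relpow_Suc_Image)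
  then have "(\<Sum>z\<in>(Er ^^ Suc m) `` {v}. (rho z / rho v) powr s) \<le>
      (\<Sum>u\<in>Er `` {v}. \<Sum>z\<in>(Er ^^ m) `` {u}. (rho z / rho v) powr s)"
    using sum_UN_le[OF fin_children, of v "\<lambda>u. (Er ^^ m) `` {u}" "\<lambda>z. (rho z / rho v) powr s"]
    by (simp add: finite_relpow)
  also have "\<dots> \<le> (\<Sum>u\<in>Er `` {v}. (rho u / rho v) powr s * (\<Sum>j<Q. chain_weight m s u j))"
  proof (rule sum_mono)
    fix u assume "u \<in> Er `` {v}"
    then have u: "u \<in> VR" using edge_VR by auto
    have "(\<Sum>z\<in>(Er ^^ m) `` {u}. (rho z / rho v) powr s) =
        (\<Sum>z\<in>(Er ^^ m) `` {u}. (rho u / rho v) powr s * (rho z / rho u) powr s)"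
    proof (rule sum.cong[OF refl])
      fix z assume "z \<in> (Er ^^ m) `` {u}"
      then have "0 < rho z" using relpow_VR[OF u] rho_pos by auto
      then show "(rho z / rho v) powr s = (rho u / rho v) powr s * (rho z / rho u) powr s"
        using rho_pos[OF u] rho_pos[OF Suc.prems] by (simp flip: powr_mult)
    qed
    also have "\<dots> = (rho u / rho v) powr s * (\<Sum>z\<in>(Er ^^ m) `` {u}. (rho z / rho u) powr s)"
      by (simp add: sum_distrib_left)
    also have "\<dots> \<le> (rho u / rho v) powr s * (\<Sum>j<Q. chain_weight m s u j)"
      by (intro mult_left_mono Suc.IH u) auto
    finally show "(\<Sum>z\<in>(Er ^^ m) `` {u}. (rho z / rho v) powr s) \<le>
      (rho u / rho v) powr s * (\<Sum>j<Q. chain_weight m s u j)" .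
  qed
  finally show ?case by (simp only: sum_chain_weight_Suc)
qed

text \<open>Since 1 exceeds the spectral radius, it is an admissible growth rate, so the sums stay
  bounded as the length grows.\<close>

lemma sum_relpow_bounded:
  assumes s: "0 \<le> s" and lam: "lam s < 1"
  obtains C where "0 \<le> C" "\<And>m v. v \<in> VR \<Longrightarrow> (\<Sum>u\<in>(Er ^^ m) `` {v}. (rho u / rho v) powr s) \<le> C"
proof -
  obtain C where C: "0 \<le> C" "\<And>m v j. v \<in> VR \<Longrightarrow> j < Q \<Longrightarrow> chain_weight m s v j \<le> C * 1 ^ m"
    using lam_less_growth[OF s lam] by blast
  have "(\<Sum>u\<in>(Er ^^ m) `` {v}. (rho u / rho v) powr s) \<le> Q * C" if v: "v \<in> VR" for m v
  proof -
    have "(\<Sum>u\<in>(Er ^^ m) `` {v}. (rho u / rho v) powr s) \<le> (\<Sum>j<Q. chain_weight m s v j)"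
      by (rule sum_relpow_le_chain_weight[OF v])
    also have "\<dots> \<le> (\<Sum>j<Q. C)" using C(2)[OF v, of _ m] by (intro sum_mono) simp
    finally show ?thesis by simp
  qed
  then show ?thesis using that[of "Q * C"] C(1) by simp
qed

text \<open>Two paths with a common end are traced back together, the parent being unique at each
  step below \<open>v\<close>.\<close>

lemma relpow_meet:
  assumes uniq: "\<And>x y z. (v, x) \<in> Er\<^sup>* \<Longrightarrow> (v, y) \<in> Er\<^sup>* \<Longrightarrow> (x, z) \<in> Er \<Longrightarrow> (y, z) \<in> Er \<Longrightarrow> x = y"
    and xy: "(v, x) \<in> Er\<^sup>*" "(v, y) \<in> Er\<^sup>*"
  shows "(x, z) \<in> Er ^^ n \<Longrightarrow> (y, z) \<in> Er ^^ n \<Longrightarrow> x = y"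
proof (induction n arbitrary: z)
  case (Suc n)
  obtain z1 where z1: "(x, z1) \<in> Er ^^ n" "(z1, z) \<in> Er" using Suc.prems(1) by (rule relpow_Suc_E)
  obtain z2 where z2: "(y, z2) \<in> Er ^^ n" "(z2, z) \<in> Er" using Suc.prems(2) by (rule relpow_Suc_E)
  have "(v, z1) \<in> Er\<^sup>*" by (rule rtrancl_trans[OF xy(1) relpow_imp_rtrancl[OF z1(1)]])
  moreover have "(v, z2) \<in> Er\<^sup>*" by (rule rtrancl_trans[OF xy(2) relpow_imp_rtrancl[OF z2(1)]])
  ultimately have "z1 = z2" by (rule uniq[OF _ _ z1(2) z2(2)])
  then show ?case using Suc.IH[OF z1(1)] z2(1) by simp
qed simp

lemma chain_weight_nonzero: "chain_weight m s v t \<noteq> 0 \<Longrightarrow> \<exists>u. (v, u) \<in> Er ^^ m \<and> ty u = t"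
proof (induction m arbitrary: v)
  case 0
  then show ?case by (cases "ty v = t") auto
next
  case (Suc m)
  have "\<exists>u\<in>Er `` {v}. chain_weight m s u t \<noteq> 0"
  proof (rule ccontr)
    assume "\<not> (\<exists>u\<in>Er `` {v}. chain_weight m s u t \<noteq> 0)"
    then have "chain_weight (Suc m) s v t = 0" unfolding chain_weight.simps by (intro sum.neutral) simp
    then show False using Suc.prems by simp
  qed
  then obtain u where u: "(v, u) \<in> Er" "chain_weight m s u t \<noteq> 0" by blast
  from Suc.IH[OF u(2)] obtain z where z: "(u, z) \<in> Er ^^ m" "ty z = t" by blast
  have "(v, z) \<in> Er ^^ Suc m" using u(1) z(1) by (rule relpow_Suc_I2)
  then show ?case using z(2) by blast
qed

text \<open>With unique parents the descendants of different children are disjoint, so paths and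
  their ends correspond. The mass requires this equality, since merging paths would count weight
  twice.\<close>

lemma chain_weight_eq_sum:
  assumes v: "v \<in> VR"
    and uniq: "\<And>x y z. (v, x) \<in> Er\<^sup>* \<Longrightarrow> (v, y) \<in> Er\<^sup>* \<Longrightarrow> (x, z) \<in> Er \<Longrightarrow> (y, z) \<in> Er \<Longrightarrow> x = y"
  shows "chain_weight m s v t = (\<Sum>u\<in>{u \<in> (Er ^^ m) `` {v}. ty u = t}. (rho u / rho v) powr s)"
  using assms
proof (induction m arbitrary: v)
  case 0
  have "{u \<in> (Er ^^ 0) `` {v}. ty u = t} = (if ty v = t then {v} else {})" by auto
  then show ?case using rho_pos[OF "0.prems"(1)] by simp
next
  case (Suc m)
  let ?D = "\<lambda>u. {z \<in> (Er ^^ m) `` {u}. ty z = t}"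
  note uq = Suc.prems(2)
  have "{u \<in> (Er ^^ Suc m) `` {v}. ty u = t} = (\<Union>u\<in>Er `` {v}. ?D u)"
    unfolding relpow_Suc_Image by blast
  moreover have "?D x \<inter> ?D y = {}" if "x \<in> Er `` {v}" "y \<in> Er `` {v}" "x \<noteq> y" for x y
  proof (rule ccontr)
    assume "?D x \<inter> ?D y \<noteq> {}"
    then obtain z where z: "(x, z) \<in> Er ^^ m" "(y, z) \<in> Er ^^ m" by blast
    have r: "(v, x) \<in> Er\<^sup>*" "(v, y) \<in> Er\<^sup>*" using that(1,2) by blast+
    have "x = y" by (rule relpow_meet[OF uq r z])
    then show False using that(3) by simp
  qed
  ultimately have "(\<Sum>u\<in>{u \<in> (Er ^^ Suc m) `` {v}. ty u = t}. (rho u / rho v) powr s) =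
      (\<Sum>u\<in>Er `` {v}. \<Sum>z\<in>?D u. (rho z / rho v) powr s)"
  proof -
    assume eq: "{u \<in> (Er ^^ Suc m) `` {v}. ty u = t} = (\<Union>u\<in>Er `` {v}. ?D u)"
      and disj: "\<And>x y. x \<in> Er `` {v} \<Longrightarrow> y \<in> Er `` {v} \<Longrightarrow> x \<noteq> y \<Longrightarrow> ?D x \<inter> ?D y = {}"
    have "finite (?D u)" for u by (rule finite_subset[OF _ finite_relpow[of m u]]) blast
    then show ?thesis unfolding eq using disj by (intro sum.UNION_disjoint fin_children) blast+
  qed
  also have "\<dots> = (\<Sum>u\<in>Er `` {v}. (rho u / rho v) powr s * chain_weight m s u t)"
  proof (rule sum.cong[OF refl])
    fix u assume u: "u \<in> Er `` {v}"
    then have uV: "u \<in> VR" using edge_VR by auto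
    have "(\<Sum>z\<in>?D u. (rho z / rho v) powr s) = (\<Sum>z\<in>?D u. (rho u / rho v) powr s * (rho z / rho u) powr s)"
    proof (rule sum.cong[OF refl])
      fix z assume "z \<in> ?D u"
      then have "0 < rho z" using relpow_VR[OF uV] rho_pos by auto
      then show "(rho z / rho v) powr s = (rho u / rho v) powr s * (rho z / rho u) powr s"
        using rho_pos[OF uV] rho_pos[OF Suc.prems(1)] by (simp flip: powr_mult)
    qed
    also have "\<dots> = (rho u / rho v) powr s * (\<Sum>z\<in>?D u. (rho z / rho u) powr s)"
      by (simp add: sum_distrib_left)
    also have "(\<Sum>z\<in>?D u. (rho z / rho u) powr s) = chain_weight m s u t"
    proof (rule Suc.IH[OF uV, symmetric])
      fix x y z assume "(u, x) \<in> Er\<^sup>*" "(u, y) \<in> Er\<^sup>*" "(x, z) \<in> Er" "(y, z) \<in> Er"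
      moreover have "(v, u) \<in> Er" using u by blast
      ultimately show "x = y" by (intro Suc.prems(2)[of x y z]) (auto intro: converse_rtrancl_into_rtrancl)
    qed
    finally show "(\<Sum>z\<in>?D u. (rho z / rho v) powr s) = (rho u / rho v) powr s * chain_weight m s u t" .
  qed
  finally show ?case by simp
qed

text \<open>A diagonal entry above 1 of some power means that a type reproduces itself with weight
  \<open>S\<close> after \<open>m\<close> steps. The type is realized by a vertex, because otherwise
  its row would vanish.\<close>

lemma expanding_type:
  assumes s: "0 \<le> s" and lam: "1 < lam s"
  obtains m S v0 where "1 \<le> m" "1 < S" "v0 \<in> VR"
    "\<And>v. v \<in> VR \<Longrightarrow> ty v = ty v0 \<Longrightarrow> chain_weight m s v (ty v0) = S"
proof -
  have nn: "0 \<le> A s $$ (i, j)" if "i < Q" "j < Q" for i j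
  proof (cases "i \<in> ty ` VR")
    case True
    then obtain v where v: "v \<in> VR" "i = ty v" by blast
    then show ?thesis using A_row[OF s v(1) that(2)] by (simp add: sum_nonneg)
  next
    case False
    then show ?thesis using A_zero[OF s that(1) False that(2)] by simp
  qed
  obtain m i where mi: "1 \<le> m" "i < Q" "(A s ^\<^sub>m m) $$ (i, i) > 1"
    using real_spectral_radius_gt_1_diag[OF A_carrier[OF s] Q_pos nn lam[unfolded lam_def]] by blast
  have "i \<in> ty ` VR" using A_pow_zero[OF s mi(2) _ mi(2), of m] mi by fastforce
  then obtain v0 where v0: "v0 \<in> VR" "i = ty v0" by blast
  show ?thesis
  proof (rule that[OF mi(1,3) v0(1)])
    fix v assume v: "v \<in> VR" "ty v = ty v0"
    show "chain_weight m s v (ty v0) = (A s ^\<^sub>m m) $$ (i, i)"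
      using A_pow[OF s v(1) mi(2), of m] v v0 by simp
  qed
qed

end

section \<open>Graph-directed systems of similitudes\<close>

lemma lexord_total_on:
  assumes "set xs \<subseteq> S" "set ys \<subseteq> S" "\<And>a b. a \<in> S \<Longrightarrow> b \<in> S \<Longrightarrow> (a, b) \<in> r \<or> a = b \<or> (b, a) \<in> r"
  shows "(xs, ys) \<in> lexord r \<or> xs = ys \<or> (ys, xs) \<in> lexord r"
  using assms(1,2)
proof (induction xs arbitrary: ys)
  case Nil
  then show ?case by (cases ys) auto
next
  case (Cons x xs)
  show ?case
  proof (cases ys)
    case Nil
    then show ?thesis by simp
  next
    case (Cons y ys')
    then have "x \<in> S" "y \<in> S" "set xs \<subseteq> S" "set ys' \<subseteq> S" using Cons.prems by auto
    then show ?thesis using Cons.IH[of ys'] assms(3)[of x y] Cons by auto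
  qed
qed

lemma relpow_imageD: "(x, y) \<in> R ^^ (m + n) \<Longrightarrow> \<exists>z. (x, z) \<in> R ^^ m \<and> (z, y) \<in> R ^^ n"
  unfolding relpow_add by blast

lemma similitude_with_ratio_restrict:
  "similitude_with_ratio d D (restrict h D) r \<longleftrightarrow> similitude_with_ratio d D h r"
  unfolding similitude_with_ratio_def by simp

context Metric_space
begin

lemma ratio_eqI:
  assumes "similitude_with_ratio d D h r" "D \<subseteq> M" "x \<in> D" "y \<in> D" "x \<noteq> y"
  shows "ratio d D h = r"
  unfolding ratio_def
proof (rule the_equality)
  fix r' assume "similitude_with_ratio d D h r'"
  then have "r' * d x y = r * d x y" using assms(1,3,4) unfolding similitude_with_ratio_def by metis
  moreover have "d x y \<noteq> 0" using assms zero by blast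
  ultimately show "r' = r" by simp
qed (rule assms(1))

end

lemma path_map_Nil [simp]: "path_map G [] = id"
  by (simp add: path_map_def)

lemma path_map_Cons [simp]: "path_map G (e # es) = gmap G e \<circ> path_map G es"
  by (simp add: path_map_def)

lemma path_map_append: "path_map G (es @ fs) = path_map G es \<circ> path_map G fs"
  by (induction es) (simp_all add: o_assoc)

locale similitude_gifs = locally_flat_space where E = E and M = M and d = d
  for E :: "'e::euclidean_space itself" and M :: "'a set" and d +
  fixes G :: "('v, 'g, 'a) gifs" and U :: "'v \<Rightarrow> 'a set"
  assumes gifs: "is_gifs M d G" and similitudes: "of_contractive_similitudes d G"
    and invariant: "invariant_family G U"
    and U_open: "\<And>j. j \<in> verts (gr G) \<Longrightarrow> openin mtopology (U j)"
    and U_nonempty: "\<And>j. j \<in> verts (gr G) \<Longrightarrow> U j \<noteq> {}"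
begin

lemma fin_graph: "finite (verts (gr G))" "finite (arcs (gr G))"
  and arc_ends: "e \<in> arcs (gr G) \<Longrightarrow> tail (gr G) e \<in> verts (gr G)" "e \<in> arcs (gr G) \<Longrightarrow> head (gr G) e \<in> verts (gr G)"
proof -
  interpret fin_digraph "gr G" using gifs by (simp add: is_gifs_def)
  show "finite (verts (gr G))" "finite (arcs (gr G))" by auto
  show "e \<in> arcs (gr G) \<Longrightarrow> tail (gr G) e \<in> verts (gr G)" "e \<in> arcs (gr G) \<Longrightarrow> head (gr G) e \<in> verts (gr G)"
    by auto
qed

lemma gdom_sub: "j \<in> verts (gr G) \<Longrightarrow> gdom G j \<subseteq> M"
  using gifs by (simp add: is_gifs_def)

lemma U_sub: "j \<in> verts (gr G) \<Longrightarrow> U j \<subseteq> gdom G j"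
  using invariant by (simp add: invariant_family_def)

lemma gpaths_Nil: "(i, [], j) \<in> gpaths G \<longleftrightarrow> i \<in> verts (gr G) \<and> i = j"
  by (auto simp: gpaths_def pre_digraph.awalk_def pre_digraph.cas.simps)

lemma gpaths_Cons:
  "(i, e # es, j) \<in> gpaths G \<longleftrightarrow> e \<in> arcs (gr G) \<and> tail (gr G) e = i \<and> (head (gr G) e, es, j) \<in> gpaths G"
  using arc_ends by (auto simp: gpaths_def pre_digraph.awalk_def pre_digraph.cas.simps)

lemma gpaths_append:
  "(i, es @ fs, j) \<in> gpaths G \<longleftrightarrow> (\<exists>k. (i, es, k) \<in> gpaths G \<and> (k, fs, j) \<in> gpaths G)"
proof (induction es arbitrary: i)
  case Nil
  have "(i, fs, j) \<in> gpaths G \<Longrightarrow> i \<in> verts (gr G)" by (simp add: gpaths_def pre_digraph.awalk_def)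
  then show ?case by (auto simp: gpaths_Nil)
qed (auto simp: gpaths_Cons)

lemma gpaths_target: "(i, es, j) \<in> gpaths G \<Longrightarrow> (i, es, j') \<in> gpaths G \<Longrightarrow> j = j'"
  by (induction es arbitrary: i) (auto simp: gpaths_Nil gpaths_Cons)

lemma gpaths_source: "(i, es, j) \<in> gpaths G \<Longrightarrow> (i', es, j) \<in> gpaths G \<Longrightarrow> i = i'"
  by (cases es) (auto simp: gpaths_Nil gpaths_Cons)

lemma gpaths_verts:
  assumes "(i, es, j) \<in> gpaths G"
  shows "i \<in> verts (gr G)" "j \<in> verts (gr G)" "set es \<subseteq> arcs (gr G)"
proof -
  show "i \<in> verts (gr G)" "set es \<subseteq> arcs (gr G)" using assms by (simp_all add: gpaths_def pre_digraph.awalk_def)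
  show "j \<in> verts (gr G)" using assms by (induction es arbitrary: i) (auto simp: gpaths_Nil gpaths_Cons)
qed

section \<open>Contraction ratios of edges and paths\<close>

definition edge_ratio :: "'g \<Rightarrow> real" where
  "edge_ratio e = (SOME r. 0 < r \<and> r < 1 \<and> similitude_with_ratio d (gdom G (head (gr G) e)) (gmap G e) r)"

lemma edge_ratio:
  assumes "e \<in> arcs (gr G)"
  shows "0 < edge_ratio e" "edge_ratio e < 1"
    "similitude_with_ratio d (gdom G (head (gr G) e)) (gmap G e) (edge_ratio e)"
proof -
  have "\<exists>r. 0 < r \<and> r < 1 \<and> similitude_with_ratio d (gdom G (head (gr G) e)) (gmap G e) r"
    using similitudes assms by (simp add: of_contractive_similitudes_def)
  from someI_ex[OF this] show "0 < edge_ratio e" "edge_ratio e < 1"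
    "similitude_with_ratio d (gdom G (head (gr G) e)) (gmap G e) (edge_ratio e)"
    unfolding edge_ratio_def by blast+
qed

definition path_ratio :: "'g list \<Rightarrow> real" where "path_ratio es = prod_list (map edge_ratio es)"

lemma path_ratio_simps [simp]:
  "path_ratio [] = 1" "path_ratio (e # es) = edge_ratio e * path_ratio es"
  "path_ratio (es @ fs) = path_ratio es * path_ratio fs"
  by (simp_all add: path_ratio_def)

text \<open>The inserted value 1/2 keeps \<open>rmin\<close> and \<open>rmax\<close> strictly
  between 0 and 1, even for a graph without edges.\<close>

definition rmin :: real where "rmin = Min (insert (1/2) (edge_ratio ` arcs (gr G)))"
definition rmax :: real where "rmax = Max (insert (1/2) (edge_ratio ` arcs (gr G)))"

lemma rmin: "0 < rmin" "rmin < 1" "e \<in> arcs (gr G) \<Longrightarrow> rmin \<le> edge_ratio e"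
proof -
  have fin: "finite (insert (1/2) (edge_ratio ` arcs (gr G)))" using fin_graph by simp
  show "0 < rmin" unfolding rmin_def using fin edge_ratio(1) by (subst Min_gr_iff) auto
  have "rmin \<le> 1/2" unfolding rmin_def using fin by (intro Min_le) auto
  then show "rmin < 1" by simp
  show "e \<in> arcs (gr G) \<Longrightarrow> rmin \<le> edge_ratio e" unfolding rmin_def using fin by (intro Min_le) auto
qed

lemma rmax: "0 < rmax" "rmax < 1" "e \<in> arcs (gr G) \<Longrightarrow> edge_ratio e \<le> rmax"
proof -
  have fin: "finite (insert (1/2) (edge_ratio ` arcs (gr G)))" using fin_graph by simp
  have "1/2 \<le> rmax" unfolding rmax_def using fin by (intro Max_ge) auto
  then show "0 < rmax" by simp
  show "rmax < 1" unfolding rmax_def using fin edge_ratio(2) by (subst Max_less_iff) auto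
  show "e \<in> arcs (gr G) \<Longrightarrow> edge_ratio e \<le> rmax" unfolding rmax_def using fin by (intro Max_ge) auto
qed

lemma path_ratio_bounds:
  assumes "set es \<subseteq> arcs (gr G)"
  shows "0 < path_ratio es" "rmin ^ length es \<le> path_ratio es" "path_ratio es \<le> rmax ^ length es"
proof -
  have "0 < path_ratio es \<and> rmin ^ length es \<le> path_ratio es \<and> path_ratio es \<le> rmax ^ length es"
    using assms
  proof (induction es)
    case (Cons e es)
    then have e: "e \<in> arcs (gr G)" and IH: "0 < path_ratio es" "rmin ^ length es \<le> path_ratio es" "path_ratio es \<le> rmax ^ length es"
      by auto
    have "rmin * rmin ^ length es \<le> edge_ratio e * path_ratio es"
      using rmin(1) rmin(3)[OF e] IH edge_ratio(1)[OF e] by (intro mult_mono) auto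
    moreover have "edge_ratio e * path_ratio es \<le> rmax * rmax ^ length es"
      using rmax(1) rmax(3)[OF e] IH by (intro mult_mono) auto
    ultimately show ?case using IH(1) edge_ratio(1)[OF e] by simp
  qed simp
  then show "0 < path_ratio es" "rmin ^ length es \<le> path_ratio es" "path_ratio es \<le> rmax ^ length es" by auto
qed

lemma path_map_facts:
  assumes "(i, es, j) \<in> gpaths G"
  shows "path_map G es ` gdom G j \<subseteq> gdom G i"
    and "similitude_with_ratio d (gdom G j) (path_map G es) (path_ratio es)"
    and "path_map G es ` U j \<subseteq> U i"
proof -
  have "path_map G es ` gdom G j \<subseteq> gdom G i \<and> similitude_with_ratio d (gdom G j) (path_map G es) (path_ratio es) \<and>
      path_map G es ` U j \<subseteq> U i"
    using assms
  proof (induction es arbitrary: i)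
    case Nil
    then show ?case by (simp add: gpaths_Nil similitude_with_ratio_def)
  next
    case (Cons e es)
    then have e: "e \<in> arcs (gr G)" "tail (gr G) e = i" and p: "(head (gr G) e, es, j) \<in> gpaths G"
      by (auto simp: gpaths_Cons)
    let ?h = "head (gr G) e"
    have IH: "path_map G es ` gdom G j \<subseteq> gdom G ?h" "similitude_with_ratio d (gdom G j) (path_map G es) (path_ratio es)"
      "path_map G es ` U j \<subseteq> U ?h" using Cons.IH[OF p] by auto
    have g: "gmap G e ` gdom G ?h \<subseteq> gdom G i" "gmap G e ` U ?h \<subseteq> U i"
    proof -
      show "gmap G e ` gdom G ?h \<subseteq> gdom G i"
        using gifs e(1) unfolding is_gifs_def e(2)[symmetric] by blast
      show "gmap G e ` U ?h \<subseteq> U i"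
        using invariant e(1) unfolding invariant_family_def e(2)[symmetric] by blast
    qed
    have S: "similitude_with_ratio d (gdom G j) (gmap G e \<circ> path_map G es) (edge_ratio e * path_ratio es)"
      using edge_ratio(3)[OF e(1)] IH(1,2) unfolding similitude_with_ratio_def by (simp add: image_subset_iff)
    have D: "(gmap G e \<circ> path_map G es) ` gdom G j \<subseteq> gdom G i"
      unfolding image_comp[symmetric] using image_mono[OF IH(1), of "gmap G e"] g(1) by (rule order_trans)
    have V: "(gmap G e \<circ> path_map G es) ` U j \<subseteq> U i"
      unfolding image_comp[symmetric] using image_mono[OF IH(3), of "gmap G e"] g(2) by (rule order_trans)
    show ?case unfolding path_map_Cons path_ratio_simps by (intro conjI D S V)
  qed
  then show "path_map G es ` gdom G j \<subseteq> gdom G i"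
    "similitude_with_ratio d (gdom G j) (path_map G es) (path_ratio es)" "path_map G es ` U j \<subseteq> U i" by auto
qed

lemma path_map_dist:
  assumes "(i, es, j) \<in> gpaths G" "x \<in> gdom G j" "y \<in> gdom G j"
  shows "d (path_map G es x) (path_map G es y) = path_ratio es * d x y"
  using path_map_facts(2)[OF assms(1)] assms(2,3) unfolding similitude_with_ratio_def by blast

lemma two_points:
  assumes "j \<in> verts (gr G)"
  obtains x y where "x \<in> gdom G j" "y \<in> gdom G j" "x \<noteq> y" "x \<in> U j" "y \<in> U j" "0 < d x y"
proof -
  obtain x y where xy: "x \<in> U j" "y \<in> U j" "x \<noteq> y"
    using openin_two_points[OF U_open[OF assms] U_nonempty[OF assms]] .
  have g: "x \<in> gdom G j" "y \<in> gdom G j" using xy U_sub[OF assms] by auto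
  then have "x \<in> M" "y \<in> M" using gdom_sub[OF assms] by auto
  then have "0 < d x y" using xy(3) by (simp add: mdist_pos_less)
  then show ?thesis using that g xy by blast
qed

lemma ratio_path_map:
  assumes "(i, es, j) \<in> gpaths G"
  shows "ratio d (gdom G j) (path_map G es) = path_ratio es"
    and "ratio d (gdom G j) (restrict (path_map G es) (gdom G j)) = path_ratio es"
proof -
  have j: "j \<in> verts (gr G)" using gpaths_verts[OF assms] by simp
  from two_points[OF j]
  obtain x y where xy: "x \<in> gdom G j" "y \<in> gdom G j" "x \<noteq> y" and "x \<in> U j" "y \<in> U j" "0 < d x y" .
  show "ratio d (gdom G j) (path_map G es) = path_ratio es"
    by (rule ratio_eqI[OF path_map_facts(2)[OF assms] gdom_sub[OF j] xy])
  show "ratio d (gdom G j) (restrict (path_map G es) (gdom G j)) = path_ratio es"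
    by (rule ratio_eqI[OF _ gdom_sub[OF j] xy]) (simp add: similitude_with_ratio_restrict path_map_facts(2)[OF assms])
qed

definition vrho :: "('v, 'a) vertex \<Rightarrow> real" where "vrho v = ratio d (gdom G (vtgt v)) (vmap v)"

lemma path_vertex_simps [simp]:
  "vsrc (path_vertex G k (i, es, j)) = i" "vtgt (path_vertex G k (i, es, j)) = j"
  "vlevel (path_vertex G k (i, es, j)) = k"
  "vmap (path_vertex G k (i, es, j)) = restrict (path_map G es) (gdom G j)"
  by (simp_all add: path_vertex_def)

lemma vrho_path_vertex: "(i, es, j) \<in> gpaths G \<Longrightarrow> vrho (path_vertex G k (i, es, j)) = path_ratio es"
  by (simp add: vrho_def ratio_path_map)

end

locale nested_gifs = similitude_gifs where E = E and M = M and d = d and G = G and U = U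
  for E :: "'e::euclidean_space itself" and M :: "'a set" and d and G :: "('v, 'g, 'a) gifs" and U +
  fixes \<M> :: "nat \<Rightarrow> ('v, 'g) gpath set" and enum :: "'g \<Rightarrow> nat"
  assumes nested: "nested_index_sets G \<M>" and enum: "inj_on enum (arcs (gr G))"
begin

lemma index_0: "\<M> 0 = {(i, [], i) | i. i \<in> verts (gr G)}"
  and index_finite: "finite (\<M> k)" and index_nonempty: "\<M> k \<noteq> {}" and index_sub: "\<M> k \<subseteq> gpaths G"
  and min_len_tendsto: "filterlim (min_len \<M>) at_top sequentially"
  and index_Suc_prefix: "p \<in> \<M> (Suc k) \<Longrightarrow> \<exists>p'\<in>\<M> k. pprefix p' p"
  and index_long_prefix: "p \<in> gpaths G \<Longrightarrow> plen p > max_len \<M> k \<Longrightarrow> \<exists>p'\<in>\<M> k. pprefix p' p"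
proof -
  note n = nested[unfolded nested_index_sets_def]
  from n show "\<M> 0 = {(i, [], i) | i. i \<in> verts (gr G)}" by (elim conjE)
  from n have "\<forall>k. finite (\<M> k) \<and> \<M> k \<noteq> {} \<and> \<M> k \<subseteq> gpaths G" by (elim conjE)
  then show "finite (\<M> k)" "\<M> k \<noteq> {}" "\<M> k \<subseteq> gpaths G" by simp_all
  from n show "filterlim (min_len \<M>) at_top sequentially" by (elim conjE)
  from n have *: "\<forall>k. \<forall>p\<in>gpaths G. plen p > max_len \<M> k \<or> p \<in> \<M> (Suc k) \<longrightarrow> (\<exists>p'\<in>\<M> k. pprefix p' p)"
    by (elim conjE)
  from n have sub: "\<forall>k. finite (\<M> k) \<and> \<M> k \<noteq> {} \<and> \<M> k \<subseteq> gpaths G" by (elim conjE)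
  show "\<exists>p'\<in>\<M> k. pprefix p' p" if "p \<in> \<M> (Suc k)"
  proof -
    have "p \<in> gpaths G" using sub that by blast
    then show ?thesis using *[rule_format, of p k] that by simp
  qed
  show "\<exists>p'\<in>\<M> k. pprefix p' p" if "p \<in> gpaths G" "plen p > max_len \<M> k"
    using *[rule_format, OF that(1)] that(2) by simp
qed

lemma min_len_le: "p \<in> \<M> k \<Longrightarrow> min_len \<M> k \<le> plen p"
  unfolding min_len_def using index_finite by (intro Min_le) auto

lemma step_bound: "\<exists>L. \<forall>k. \<forall>p\<in>\<M> k. \<forall>p'\<in>\<M> (Suc k). pprefix p p' \<longrightarrow> plen p' - plen p \<le> L"
  using nested unfolding nested_index_sets_def by (elim conjE)

definition L :: nat where
  "L = (SOME L. \<forall>k. \<forall>p\<in>\<M> k. \<forall>p'\<in>\<M> (Suc k). pprefix p p' \<longrightarrow> plen p' - plen p \<le> L)"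

lemma index_step:
  assumes "(i, es, j) \<in> \<M> k" "(i, es @ ks, j') \<in> \<M> (Suc k)"
  shows "length ks \<le> L" "(j, ks, j') \<in> gpaths G"
proof -
  have "\<forall>k. \<forall>p\<in>\<M> k. \<forall>p'\<in>\<M> (Suc k). pprefix p p' \<longrightarrow> plen p' - plen p \<le> L"
    unfolding L_def by (rule someI_ex[OF step_bound])
  from this[rule_format, OF assms] show "length ks \<le> L" by (simp add: pprefix_def plen_def)
  have "(i, es @ ks, j') \<in> gpaths G" "(i, es, j) \<in> gpaths G" using assms index_sub by blast+
  then show "(j, ks, j') \<in> gpaths G" unfolding gpaths_append using gpaths_target by blast
qed

lemma vertexE:
  assumes "v \<in> vertices_at G \<M> k"
  obtains i es j where "(i, es, j) \<in> \<M> k" "(i, es, j) \<in> gpaths G" "v = path_vertex G k (i, es, j)"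
proof -
  obtain p where p: "p \<in> \<M> k" "v = path_vertex G k p" using assms unfolding vertices_at_def by blast
  obtain i es j where e: "p = (i, es, j)" by (cases p)
  have "p \<in> gpaths G" using p(1) index_sub by blast
  then show ?thesis using that[of i es j] p e by simp
qed

lemma vertices_at_level: "v \<in> vertices_at G \<M> k \<Longrightarrow> vlevel v = k"
  by (erule vertexE) simp

lemma vertices_iff: "v \<in> vertices G \<M> \<longleftrightarrow> v \<in> vertices_at G \<M> (vlevel v)"
proof
  assume "v \<in> vertices G \<M>"
  then obtain k where k: "v \<in> vertices_at G \<M> k" unfolding vertices_def by blast
  then show "v \<in> vertices_at G \<M> (vlevel v)" using vertices_at_level[OF k] by simp
qed (auto simp: vertices_def)

lemma finite_vertices_at: "finite (vertices_at G \<M> k)"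
  unfolding vertices_at_def using index_finite by simp

lemma vertex_facts:
  assumes "v \<in> vertices G \<M>"
  shows "vtgt v \<in> verts (gr G)" "0 < vrho v" "similitude_with_ratio d (gdom G (vtgt v)) (vmap v) (vrho v)"
    "vmap v ` gdom G (vtgt v) \<subseteq> M" "vrho v \<le> rmax ^ min_len \<M> (vlevel v)"
    "restrict (vmap v) (gdom G (vtgt v)) = vmap v"
proof -
  from vertexE[OF iffD1[OF vertices_iff assms]]
  obtain i es j where p: "(i, es, j) \<in> \<M> (vlevel v)" "(i, es, j) \<in> gpaths G" "v = path_vertex G (vlevel v) (i, es, j)" .
  define k where "k = vlevel v"
  have v: "v = path_vertex G k (i, es, j)" using p(3) by (simp add: k_def)
  note b = path_ratio_bounds[OF gpaths_verts(3)[OF p(2)]]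
  show "vtgt v \<in> verts (gr G)" using gpaths_verts(2)[OF p(2)] v by simp
  show "0 < vrho v" using b(1) vrho_path_vertex[OF p(2)] v by simp
  show "similitude_with_ratio d (gdom G (vtgt v)) (vmap v) (vrho v)"
    using path_map_facts(2)[OF p(2)] vrho_path_vertex[OF p(2)] v by (simp add: similitude_with_ratio_restrict)
  have "path_map G es ` gdom G j \<subseteq> M"
    using path_map_facts(1)[OF p(2)] gdom_sub[OF gpaths_verts(1)[OF p(2)]] by blast
  then show "vmap v ` gdom G (vtgt v) \<subseteq> M" using v by simp
  have "rmax ^ length es \<le> rmax ^ min_len \<M> k"
    using min_len_le[OF p(1)] rmax by (intro power_decreasing) (auto simp: plen_def k_def)
  then show "vrho v \<le> rmax ^ min_len \<M> (vlevel v)"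
    using b(3) vrho_path_vertex[OF p(2)] v by simp
  show "restrict (vmap v) (gdom G (vtgt v)) = vmap v" using v by simp
qed

text \<open>The relation of a vertex to any descendant, with the composed path as its label. Unlike
  an edge it does not refer to levels, so it composes along paths of the graph.\<close>

definition extends :: "('v, 'a) vertex \<Rightarrow> 'g list \<Rightarrow> ('v, 'a) vertex \<Rightarrow> bool" where
  "extends v ks u \<longleftrightarrow> (vtgt v, ks, vtgt u) \<in> gpaths G \<and> vsrc u = vsrc v \<and> vrho u = vrho v * path_ratio ks \<and>
     vmap u = restrict (vmap v \<circ> path_map G ks) (gdom G (vtgt u))"

lemma extendsD:
  assumes "extends v ks u"
  shows "(vtgt v, ks, vtgt u) \<in> gpaths G" "vsrc u = vsrc v" "vrho u = vrho v * path_ratio ks"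
    "vmap u = restrict (vmap v \<circ> path_map G ks) (gdom G (vtgt u))" "set ks \<subseteq> arcs (gr G)"
proof -
  show p: "(vtgt v, ks, vtgt u) \<in> gpaths G" and "vsrc u = vsrc v" "vrho u = vrho v * path_ratio ks"
    "vmap u = restrict (vmap v \<circ> path_map G ks) (gdom G (vtgt u))"
    using assms unfolding extends_def by simp_all
  show "set ks \<subseteq> arcs (gr G)" by (rule gpaths_verts(3)[OF p])
qed

lemma extends_apply: "extends v ks u \<Longrightarrow> x \<in> gdom G (vtgt u) \<Longrightarrow> vmap u x = vmap v (path_map G ks x)"
  using extendsD(4)[of v ks u] by simp

lemma extends_trans:
  assumes vu: "extends v ks u" and uw: "extends u ls w"
  shows "extends v (ks @ ls) w"
proof -
  have "vmap w x = restrict (vmap v \<circ> path_map G (ks @ ls)) (gdom G (vtgt w)) x" for x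
  proof (cases "x \<in> gdom G (vtgt w)")
    case True
    then have "path_map G ls x \<in> gdom G (vtgt u)" using path_map_facts(1)[OF extendsD(1)[OF uw]] by blast
    then show ?thesis
      using extends_apply[OF uw True] extends_apply[OF vu] True by (simp add: path_map_append)
  next
    case False
    then show ?thesis using extendsD(4)[OF uw] by simp
  qed
  then have "vmap w = restrict (vmap v \<circ> path_map G (ks @ ls)) (gdom G (vtgt w))" by (rule ext)
  moreover have "(vtgt v, ks @ ls, vtgt w) \<in> gpaths G"
    unfolding gpaths_append using extendsD(1)[OF vu] extendsD(1)[OF uw] by blast
  ultimately show ?thesis
    using extendsD(2,3)[OF vu] extendsD(2,3)[OF uw] unfolding extends_def by simp
qed

lemma vedge_facts:
  assumes "(v, ks, u) \<in> vedges G \<M>"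
  shows "v \<in> vertices G \<M>" "u \<in> vertices G \<M>" "vlevel u = Suc (vlevel v)" "extends v ks u" "length ks \<le> L"
proof -
  obtain k i es j j' where e: "v = path_vertex G k (i, es, j)" "u = path_vertex G (Suc k) (i, es @ ks, j')"
    "(i, es, j) \<in> \<M> k" "(i, es @ ks, j') \<in> \<M> (Suc k)"
    using assms unfolding vedges_def by blast
  show "v \<in> vertices G \<M>" "u \<in> vertices G \<M>"
    using e unfolding vertices_def vertices_at_def by blast+
  show "vlevel u = Suc (vlevel v)" using e by simp
  show "length ks \<le> L" using index_step(1)[OF e(3,4)] .
  have p: "(i, es, j) \<in> gpaths G" "(i, es @ ks, j') \<in> gpaths G" "(j, ks, j') \<in> gpaths G"
    using e index_sub index_step(2)[OF e(3,4)] by blast+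
  have "restrict (path_map G (es @ ks)) (gdom G j') x =
      restrict (restrict (path_map G es) (gdom G j) \<circ> path_map G ks) (gdom G j') x" for x
  proof (cases "x \<in> gdom G j'")
    case True
    then have "path_map G ks x \<in> gdom G j" using path_map_facts(1)[OF p(3)] by blast
    then show ?thesis using True by (simp add: path_map_append)
  qed simp
  then have "restrict (path_map G (es @ ks)) (gdom G j') =
      restrict (restrict (path_map G es) (gdom G j) \<circ> path_map G ks) (gdom G j')" by (rule ext)
  then show "extends v ks u"
    using p vrho_path_vertex[OF p(1)] vrho_path_vertex[OF p(2)] unfolding extends_def e by simp
qed

section \<open>The reduced graph\<close>

definition min_edges :: "('v, 'g, 'a) vedge set" where "min_edges = minimal_vedges G enum \<M>"

definition min_rel :: "(('v, 'a) vertex \<times> ('v, 'a) vertex) set" where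
  "min_rel = {(v, u). \<exists>ks. (v, ks, u) \<in> min_edges}"

definition VR :: "('v, 'a) vertex set" where "VR = reduced_vertices G enum \<M>"

definition Er :: "(('v, 'a) vertex \<times> ('v, 'a) vertex) set" where
  "Er = {(v, u). \<exists>ks. (v, ks, u) \<in> reduced_vedges G enum \<M>}"

lemma min_edges_vedges: "(v, ks, u) \<in> min_edges \<Longrightarrow> (v, ks, u) \<in> vedges G \<M>"
  unfolding min_edges_def minimal_vedges_def by blast

lemma reduced_iff: "(v, ks, u) \<in> reduced_vedges G enum \<M> \<longleftrightarrow> (v, ks, u) \<in> min_edges \<and> v \<in> VR \<and> u \<in> VR"
  unfolding reduced_vedges_def min_edges_def VR_def by blast

lemma VR_iff: "v \<in> VR \<longleftrightarrow> v \<in> vertices G \<M> \<and> \<not> dead min_edges v"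
  unfolding VR_def reduced_vertices_def min_edges_def by blast

lemma dead_child: "dead min_edges v \<Longrightarrow> (v, ks, u) \<in> min_edges \<Longrightarrow> dead min_edges u"
  by (erule dead.cases) blast

text \<open>Two different labels over the finite edge set are comparable, so one of them would not
  be minimal. The parents may still differ: edges with the same smallest label are all kept.\<close>

lemma min_edge_unique:
  assumes v: "(v, ks, u) \<in> min_edges" and v': "(v', ks', u) \<in> min_edges"
  shows "ks = ks'"
proof -
  let ?r = "{(a, b). enum a < enum b}"
  have "\<not> (ks', ks) \<in> lexord ?r"
    using v min_edges_vedges[OF v'] unfolding min_edges_def minimal_vedges_def by blast
  moreover have "\<not> (ks, ks') \<in> lexord ?r"
    using v' min_edges_vedges[OF v] unfolding min_edges_def minimal_vedges_def by blast
  moreover have "set ks \<subseteq> arcs (gr G)" "set ks' \<subseteq> arcs (gr G)"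
    using extendsD(5)[OF vedge_facts(4)[OF min_edges_vedges[OF v]]]
      extendsD(5)[OF vedge_facts(4)[OF min_edges_vedges[OF v']]] by simp_all
  moreover have "(a, b) \<in> ?r \<or> a = b \<or> (b, a) \<in> ?r" if "a \<in> arcs (gr G)" "b \<in> arcs (gr G)" for a b
    using enum that by (auto simp: inj_on_def)
  ultimately show ?thesis using lexord_total_on[of ks "arcs (gr G)" ks' ?r] by blast
qed

text \<open>The lexicographic order on words is not well-founded, but labels of edges have bounded
  length over a finite alphabet, so a smallest one exists.\<close>

lemma min_parent:
  assumes u: "u \<in> vertices_at G \<M> (Suc k)"
  shows "\<exists>v\<in>vertices_at G \<M> k. (v, u) \<in> min_rel"
proof -
  let ?r = "{(a, b). enum a < enum b}"
  define KS where "KS = {ks. \<exists>v. (v, ks, u) \<in> vedges G \<M>}"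
  have "KS \<subseteq> {ks. set ks \<subseteq> arcs (gr G) \<and> length ks \<le> L}"
  proof
    fix ks assume "ks \<in> KS"
    then obtain v where e: "(v, ks, u) \<in> vedges G \<M>" unfolding KS_def by blast
    show "ks \<in> {ks. set ks \<subseteq> arcs (gr G) \<and> length ks \<le> L}"
      using vedge_facts(5)[OF e] extendsD(5)[OF vedge_facts(4)[OF e]] by simp
  qed
  then have fin: "finite KS" using finite_lists_length_le[OF fin_graph(2)] finite_subset by blast
  from vertexE[OF u]
  obtain i es j where p: "(i, es, j) \<in> \<M> (Suc k)" "u = path_vertex G (Suc k) (i, es, j)" by blast
  obtain p' where p': "p' \<in> \<M> k" "pprefix p' (i, es, j)" using index_Suc_prefix[OF p(1)] by blast
  obtain i' es' j' where p'': "p' = (i', es', j')" by (cases p')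
  have "i' = i" "prefix es' es" using p'(2) p'' by (simp_all add: pprefix_def)
  then obtain ks where "es = es' @ ks" by (auto simp: prefix_def)
  then have "(path_vertex G k (i, es', j'), ks, u) \<in> vedges G \<M>"
    unfolding vedges_def using p p' p'' \<open>i' = i\<close> by blast
  then have "KS \<noteq> {}" unfolding KS_def by blast
  have tr: "trans ?r" by (auto simp: trans_def)
  have irr: "(xs, xs) \<notin> lexord ?r" for xs by (rule lexord_irreflexive) simp
  have "asymp_on KS (\<lambda>x y. (x, y) \<in> lexord ?r)"
    by (rule asymp_onI) (use lexord_trans[OF _ _ tr] irr in blast)
  moreover have "transp_on KS (\<lambda>x y. (x, y) \<in> lexord ?r)"
    by (rule transp_onI) (use lexord_trans[OF _ _ tr] in blast)
  ultimately obtain ks where ks: "ks \<in> KS" "\<forall>x\<in>KS. x \<noteq> ks \<longrightarrow> (x, ks) \<notin> lexord ?r"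
    using Finite_Set.bex_min_element[OF fin] \<open>KS \<noteq> {}\<close> by blast
  then obtain v where v: "(v, ks, u) \<in> vedges G \<M>" unfolding KS_def by blast
  have "(x, ks) \<notin> lexord ?r" if "x \<in> KS" for x using ks(2) that irr by (cases "x = ks") auto
  then have "(v, ks, u) \<in> min_edges"
    using v unfolding min_edges_def minimal_vedges_def KS_def by blast
  moreover have "v \<in> vertices_at G \<M> k"
    using vedge_facts(1,3)[OF v] vertices_iff vertices_at_level[OF u] by simp
  ultimately show ?thesis unfolding min_rel_def by blast
qed

lemma min_relD:
  assumes "(v, u) \<in> min_rel"
  shows "v \<in> vertices G \<M>" "u \<in> vertices G \<M>" "vlevel u = Suc (vlevel v)" "\<exists>ks. extends v ks u \<and> length ks \<le> L"
proof -
  obtain ks where "(v, ks, u) \<in> vedges G \<M>" using assms min_edges_vedges unfolding min_rel_def by auto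
  note e = vedge_facts[OF this]
  show "v \<in> vertices G \<M>" "u \<in> vertices G \<M>" "vlevel u = Suc (vlevel v)" "\<exists>ks. extends v ks u \<and> length ks \<le> L"
    using e by blast+
qed

lemma finite_min_children: "finite (min_rel `` {v})"
proof (rule finite_subset)
  show "min_rel `` {v} \<subseteq> vertices_at G \<M> (Suc (vlevel v))"
  proof
    fix u assume "u \<in> min_rel `` {v}"
    then have "(v, u) \<in> min_rel" by simp
    from min_relD(2,3)[OF this] show "u \<in> vertices_at G \<M> (Suc (vlevel v))"
      using iffD1[OF vertices_iff, of u] by simp
  qed
qed (rule finite_vertices_at)

lemma Er_min_rel: "(v, u) \<in> Er \<longleftrightarrow> (v, u) \<in> min_rel \<and> v \<in> VR \<and> u \<in> VR"
  unfolding Er_def min_rel_def reduced_iff by blast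

text \<open>A dead vertex has dead children only, so minimal parents of live vertices are live. This
  is how live vertices are traced back to a root within the reduced graph.\<close>

lemma Er_parent: "(v, u) \<in> min_rel \<Longrightarrow> u \<in> VR \<Longrightarrow> (v, u) \<in> Er"
  using min_relD(1)[of v u] dead_child unfolding Er_min_rel VR_iff min_rel_def by blast

lemma VR_child:
  assumes "v \<in> VR"
  shows "\<exists>u. (v, u) \<in> Er"
proof (rule ccontr)
  assume neg: "\<not> ?thesis"
  have "dead min_edges v"
  proof (rule dead.intros)
    fix ks u assume e: "(v, ks, u) \<in> min_edges"
    then have "u \<notin> VR" using neg assms unfolding Er_min_rel min_rel_def by blast
    then show "dead min_edges u" using vedge_facts(2)[OF min_edges_vedges[OF e]] by (simp add: VR_iff)
  qed
  then show False using assms by (simp add: VR_iff)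
qed

text \<open>A dead vertex has descendants on finitely many levels: by finite branching the heights
  of its children have a maximum.\<close>

lemma dead_bounded: "dead min_edges v \<Longrightarrow> \<exists>h. \<forall>n\<ge>h. (min_rel ^^ n) `` {v} = {}"
proof (induction rule: dead.induct)
  case (1 v)
  have "\<forall>u\<in>min_rel `` {v}. \<exists>h. \<forall>n\<ge>h. (min_rel ^^ n) `` {u} = {}"
    using 1 unfolding min_rel_def by blast
  from bchoice[OF this]
  obtain h where "\<forall>u\<in>min_rel `` {v}. \<forall>n\<ge>h u. (min_rel ^^ n) `` {u} = {}" ..
  then have h: "\<forall>n\<ge>h u. (min_rel ^^ n) `` {u} = {}" if "u \<in> min_rel `` {v}" for u using that by blast
  define H where "H = Max (insert 0 (h ` (min_rel `` {v})))"
  have H: "h u \<le> H" if "u \<in> min_rel `` {v}" for u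
    unfolding H_def using finite_min_children that by (intro Max_ge) auto
  have "(min_rel ^^ n) `` {v} = {}" if n: "n \<ge> Suc H" for n
  proof -
    define m where "m = n - 1"
    have m: "n = Suc m" "m \<ge> H" using n by (simp_all add: m_def)
    have "(min_rel ^^ m) `` {u} = {}" if u: "u \<in> min_rel `` {v}" for u
      using h[OF u] H[OF u] m(2) by (meson order_trans)
    then show ?thesis unfolding m(1) relpow_Suc_Image by blast
  qed
  then show ?case by blast
qed

lemma min_ancestor:
  assumes "u \<in> vertices_at G \<M> (k + n)"
  shows "\<exists>v\<in>vertices_at G \<M> k. (v, u) \<in> min_rel ^^ n"
  using assms
proof (induction n arbitrary: u)
  case 0
  then show ?case by (intro bexI[of _ u]) auto
next
  case (Suc n)
  obtain w where w: "w \<in> vertices_at G \<M> (k + n)" "(w, u) \<in> min_rel" using min_parent[of u "k + n"] Suc.prems by auto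
  obtain v where "v \<in> vertices_at G \<M> k" "(v, w) \<in> min_rel ^^ n" using Suc.IH[OF w(1)] by blast
  then show ?case using w(2) by auto
qed

text \<open>If \<open>n\<close> is at least the height below every dead vertex of level
  \<open>k\<close>, then only live vertices of that level have descendants \<open>n\<close> levels
  down.\<close>

lemma live_ancestors:
  obtains n where "\<And>u. u \<in> vertices_at G \<M> (k + n) \<Longrightarrow> \<exists>v\<in>vertices_at G \<M> k \<inter> VR. (v, u) \<in> min_rel ^^ n"
proof -
  let ?D = "{v \<in> vertices_at G \<M> k. dead min_edges v}"
  have fin: "finite ?D" using finite_vertices_at by simp
  have "\<forall>v\<in>?D. \<exists>h. \<forall>n\<ge>h. (min_rel ^^ n) `` {v} = {}" using dead_bounded by blast
  from bchoice[OF this] obtain h where "\<forall>v\<in>?D. \<forall>n\<ge>h v. (min_rel ^^ n) `` {v} = {}" ..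
  then have h: "\<forall>n\<ge>h v. (min_rel ^^ n) `` {v} = {}" if "v \<in> ?D" for v using that by blast
  define n where "n = Max (insert 0 (h ` ?D))"
  show ?thesis
  proof (rule that[of n])
    fix u assume "u \<in> vertices_at G \<M> (k + n)"
    then obtain v where v: "v \<in> vertices_at G \<M> k" "(v, u) \<in> min_rel ^^ n" using min_ancestor by blast
    have "\<not> dead min_edges v"
    proof
      assume "dead min_edges v"
      then have vD: "v \<in> ?D" using v by blast
      then have "h v \<le> n" unfolding n_def using fin by (intro Max_ge) auto
      then have "(min_rel ^^ n) `` {v} = {}" using h[OF vD] by blast
      then show False using v(2) by blast
    qed
    moreover have "v \<in> vertices G \<M>" using v(1) unfolding vertices_def by blast
    ultimately show "\<exists>v\<in>vertices_at G \<M> k \<inter> VR. (v, u) \<in> min_rel ^^ n" using v by (auto simp: VR_iff)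
  qed
qed

lemma VR_nonempty: "VR \<noteq> {}"
proof -
  obtain n where n: "\<And>u. u \<in> vertices_at G \<M> (0 + n) \<Longrightarrow> \<exists>v\<in>vertices_at G \<M> 0 \<inter> VR. (v, u) \<in> min_rel ^^ n"
    using live_ancestors[of 0] by blast
  have "vertices_at G \<M> (0 + n) \<noteq> {}" unfolding vertices_at_def using index_nonempty by simp
  then show ?thesis using n by blast
qed

lemma VR_from_root:
  assumes "v \<in> VR" "v \<in> vertices_at G \<M> k"
  shows "\<exists>r\<in>vertices_at G \<M> 0 \<inter> VR. (r, v) \<in> Er ^^ k"
  using assms
proof (induction k arbitrary: v)
  case 0
  then show ?case by (intro bexI[of _ v]) auto
next
  case (Suc k)
  obtain w where w: "w \<in> vertices_at G \<M> k" "(w, v) \<in> min_rel" using min_parent[OF Suc.prems(2)] by blast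
  have e: "(w, v) \<in> Er" by (rule Er_parent[OF w(2) Suc.prems(1)])
  then have "w \<in> VR" by (simp add: Er_min_rel)
  from Suc.IH[OF this w(1)] obtain r where "r \<in> vertices_at G \<M> 0 \<inter> VR" "(r, w) \<in> Er ^^ k" by blast
  then show ?case using e by auto
qed

lemma min_rel_relpow:
  assumes "(v, u) \<in> min_rel ^^ n" "v \<in> vertices G \<M>"
  shows "u \<in> vertices G \<M> \<and> vlevel u = vlevel v + n \<and> (\<exists>ks. extends v ks u)"
  using assms(1)
proof (induction n arbitrary: u)
  case 0
  then have uv: "u = v" by simp

  have "extends v [] v"
    using vertex_facts(1,6)[OF assms(2)] by (simp add: extends_def gpaths_Nil)
  then show ?case using uv assms(2) by auto
next
  case (Suc n)
  then obtain w where w: "(v, w) \<in> min_rel ^^ n" "(w, u) \<in> min_rel" by auto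
  obtain ks where ks: "extends v ks w" using Suc.IH[OF w(1)] by blast
  obtain ls where ls: "extends w ls u" using min_relD(4)[OF w(2)] by blast
  have "extends v (ks @ ls) u" by (rule extends_trans[OF ks ls])
  then show ?case using Suc.IH[OF w(1)] min_relD(2,3)[OF w(2)] by auto
qed

lemma Er_relpow_min_rel: "(v, u) \<in> Er ^^ n \<Longrightarrow> (v, u) \<in> min_rel ^^ n"
proof (induction n arbitrary: u)
  case (Suc n)
  from relpow_Suc_E[OF Suc.prems] obtain w where w: "(v, w) \<in> Er ^^ n" "(w, u) \<in> Er" .
  have "(w, u) \<in> min_rel" using w(2) by (simp add: Er_min_rel)
  then show ?case by (rule relpow_Suc_I[OF Suc.IH[OF w(1)]])
qed simp

lemma Er_relpow:
  assumes "(v, u) \<in> Er ^^ n" "v \<in> VR"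
  shows "u \<in> vertices G \<M>" "vlevel u = vlevel v + n" "\<exists>ks. extends v ks u"
  using min_rel_relpow[OF Er_relpow_min_rel[OF assms(1)]] assms(2) by (auto simp: VR_iff)

section \<open>Neighborhood types\<close>

lemma finite_neighbors: "finite (neighbors G U \<M> v)"
  unfolding neighbors_def using finite_vertices_at[of "vlevel v"] by simp

lemma vmap_U: "v \<in> vertices G \<M> \<Longrightarrow> x \<in> U (vtgt v) \<Longrightarrow> x \<in> gdom G (vtgt v)"
  using U_sub vertex_facts(1) by blast

lemma self_neighbor: "v \<in> vertices G \<M> \<Longrightarrow> v \<in> neighbors G U \<M> v"
  using vertices_iff U_nonempty[OF vertex_facts(1)] unfolding neighbors_def by auto

lemma same_type_refl:
  assumes "v \<in> vertices G \<M>"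
  shows "same_type d G U \<M> v v"
  unfolding same_type_def
proof (intro conjI refl exI[of _ id])
  show "\<exists>r>0. similitude_with_ratio d (\<Union>u\<in>neighbors G U \<M> v. vmap u ` U (vtgt u)) id r"
    by (intro exI[of _ 1]) (simp add: similitude_with_ratio_def)
qed auto

text \<open>By reflexivity \<open>u\<close> belongs to its own type, which is the same set as that
  of \<open>v\<close>.\<close>

lemma ntype_eqD:
  assumes "v \<in> vertices G \<M>" "u \<in> vertices G \<M>" "ntype d G U \<M> v = ntype d G U \<M> u"
  shows "same_type d G U \<M> v u"
  using same_type_refl[OF assms(2)] assms unfolding ntype_def by blast

text \<open>A vertex that is repeated with the same type would be repeated at infinitely many levels, whereas
  the paths in \<open>\<M> k\<close> become arbitrarily long.\<close>
lemma same_type_drop: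
  assumes v: "v \<in> vertices G \<M>" and u: "u \<in> vertices G \<M>" and type: "same_type d G U \<M> v u"
    and lev: "vlevel u = vlevel v + m" "1 \<le> m" and ext: "extends v ks u"
  shows "vrho u \<le> rmax * vrho v"
proof (cases "ks = []")
  case False
  have "set ks \<subseteq> arcs (gr G)" by (rule extendsD(5)[OF ext])
  then have "path_ratio ks \<le> rmax ^ length ks" by (rule path_ratio_bounds)
  also have "\<dots> \<le> rmax ^ 1" using False rmax by (intro power_decreasing) (auto simp: Suc_le_eq)
  finally have "vrho v * path_ratio ks \<le> vrho v * rmax"
    using vertex_facts(2)[OF v] by simp
  then show ?thesis using ext unfolding extends_def by (simp add: mult.commute)
next
  case True
  have tgt: "vtgt u = vtgt v" "vsrc u = vsrc v" and map: "vmap u = vmap v"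
    using ext True vertex_facts(6)[OF v] by (simp_all add: extends_def gpaths_Nil)
  \<comment> \<open>The vertices with the map of \<open>v\<close>, at levels increasing by
    \<open>m\<close>. The condition on prolongations in \<open>same_type\<close>, applied to the
    empty path, links the existence of \<open>w n\<close> to that of \<open>w (Suc n)\<close> for
    \<open>n \<ge> 1\<close>.\<close>
  define w where "w n = Vertex (vmap v) (vsrc v) (vtgt v) (vlevel v + n * m)" for n
  have ext_v: "extend_vertex G v [] (vtgt v) (n * m) = w n" for n
    using vertex_facts(6)[OF v] by (simp add: extend_vertex_def w_def)
  have ext_u: "extend_vertex G u [] (vtgt v) (n * m) = w (Suc n)" for n
    using vertex_facts(6)[OF v] tgt map lev by (simp add: extend_vertex_def w_def)
  obtain g where g: "g v = u" "\<And>x l es j. x \<in> neighbors G U \<M> v \<Longrightarrow> l \<ge> 1 \<Longrightarrow> (vtgt x, es, j) \<in> gpaths G \<Longrightarrow>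
      (extend_vertex G x es j l \<in> vertices_at G \<M> (vlevel x + l) \<longleftrightarrow>
       extend_vertex G (g x) es j l \<in> vertices_at G \<M> (vlevel (g x) + l))"
    using type unfolding same_type_def by blast
  have iff: "w n \<in> vertices_at G \<M> (vlevel v + n * m) \<longleftrightarrow> w (Suc n) \<in> vertices_at G \<M> (vlevel v + Suc n * m)"
    if n: "1 \<le> n" for n
  proof -
    have "1 \<le> n * m" using n lev(2) by simp
    moreover have "(vtgt v, [], vtgt v) \<in> gpaths G" using vertex_facts(1)[OF v] by (simp add: gpaths_Nil)
    ultimately show ?thesis
      using g(2)[OF self_neighbor[OF v], of "n * m" "[]" "vtgt v"] lev(1)
      unfolding g(1) ext_v ext_u by (simp add: add.assoc)
  qed
  have "w 1 = u" using tgt map lev by (cases u) (simp add: w_def)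
  then have base: "w 1 \<in> vertices_at G \<M> (vlevel v + 1 * m)" using u vertices_iff lev(1) by simp
  have all: "w (Suc n) \<in> vertices_at G \<M> (vlevel v + Suc n * m)" for n
  proof (induction n)
    case 0
    then show ?case using base by simp
  next
    case (Suc n)
    then show ?case using iff[of "Suc n"] by simp
  qed
  \<comment> \<open>So the fixed ratio of \<open>v\<close> would occur at arbitrarily high levels,
    where ratios are arbitrarily small.\<close>
  have le: "vrho v \<le> rmax ^ min_len \<M> (vlevel v + Suc n * m)" for n
  proof -
    have "w (Suc n) \<in> vertices G \<M>" using all unfolding vertices_def by blast
    from vertex_facts(5)[OF this] show ?thesis by (simp add: w_def vrho_def)
  qed
  have pos: "0 < vrho v" by (rule vertex_facts(2)[OF v])
  obtain N :: nat where N: "rmax ^ N < vrho v" using real_arch_pow_inv[OF pos rmax(2)] by blast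
  have "\<forall>\<^sub>F k in sequentially. N \<le> min_len \<M> k" using min_len_tendsto by (simp add: filterlim_at_top)
  then obtain k0 where k0: "\<And>k. k \<ge> k0 \<Longrightarrow> N \<le> min_len \<M> k" unfolding eventually_sequentially by blast
  have "k0 \<le> vlevel v + Suc k0 * m" using lev(2) by (cases m) auto
  then have "rmax ^ min_len \<M> (vlevel v + Suc k0 * m) \<le> rmax ^ N"
    using k0 rmax by (intro power_decreasing) auto
  then show ?thesis using le[of k0] N by linarith
qed

end

locale gftc_gifs = nested_gifs where E = E and M = M and d = d and G = G and U = U and \<M> = \<M> and enum = enum
  for E :: "'e::euclidean_space itself" and M :: "'a set" and d and G :: "('v, 'g, 'a) gifs" and U and \<M> and enum +
  fixes Ts :: "('v, 'a) vertex set list" and A :: "real \<Rightarrow> real mat"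
  assumes Ts_distinct: "distinct Ts" and Ts_set: "set Ts = ntype d G U \<M> ` vertices G \<M>"
    and A_matrix: "\<And>\<alpha>. 0 \<le> \<alpha> \<Longrightarrow> weighted_incidence_matrix d G enum U \<M> Ts \<alpha> (A \<alpha>)"
begin

definition ty :: "('v, 'a) vertex \<Rightarrow> nat" where
  "ty v = (SOME i. i < length Ts \<and> Ts ! i = ntype d G U \<M> v)"

lemma ty:
  assumes "v \<in> vertices G \<M>"
  shows "ty v < length Ts" "Ts ! ty v = ntype d G U \<M> v"
proof -
  have "\<exists>i. i < length Ts \<and> Ts ! i = ntype d G U \<M> v"
    using assms Ts_set by (metis image_eqI in_set_conv_nth)
  from someI_ex[OF this] show "ty v < length Ts" "Ts ! ty v = ntype d G U \<M> v" unfolding ty_def by auto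
qed

lemma ty_eq_iff:
  assumes "v \<in> vertices G \<M>" "j < length Ts"
  shows "ty v = j \<longleftrightarrow> ntype d G U \<M> v = Ts ! j"
  using ty[OF assms(1)] Ts_distinct assms(2) by (metis nth_eq_iff_index_eq)

text \<open>The label of an edge has at most \<open>L\<close> letters; the exponent
  \<open>Suc L\<close> keeps the lower bound below 1 also for \<open>L = 0\<close>. A return to the
  same type reads at least one letter and so contracts by \<open>rmax\<close>.\<close>

sublocale typed_graph VR Er vrho ty "length Ts" A "rmin ^ Suc L" rmax
proof
  have VRv: "v \<in> vertices G \<M>" if "v \<in> VR" for v using that by (simp add: VR_iff)
  show "Er \<subseteq> VR \<times> VR" by (auto simp: Er_min_rel)
  show finE: "finite (Er `` {v})" for v
    by (rule finite_subset[OF _ finite_min_children[of v]]) (auto simp: Er_min_rel)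
  show "0 < vrho v" if "v \<in> VR" for v using vertex_facts(2)[OF VRv[OF that]] .
  show "ty v < length Ts" if "v \<in> VR" for v using ty(1)[OF VRv[OF that]] .
  show "A s \<in> carrier_mat (length Ts) (length Ts)" if "0 \<le> s" for s
    using A_matrix[OF that] unfolding weighted_incidence_matrix_def by blast
  show "VR \<noteq> {}" by (rule VR_nonempty)
  show "\<exists>u. (v, u) \<in> Er" if "v \<in> VR" for v using VR_child[OF that] .
  show "0 < rmin ^ Suc L" using rmin by simp
  show "rmin ^ Suc L < 1" using rmin by (intro power_Suc_less_one) auto
  show "0 < rmax" "rmax < 1" using rmax by auto
  have step: "\<exists>ks. extends v ks u \<and> length ks \<le> L" if "(v, u) \<in> Er" for v u
    using min_relD(4) that by (simp add: Er_min_rel)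
  have pos: "0 < vrho v" if "(v, u) \<in> Er" for v u
    using vertex_facts(2)[OF VRv] that by (simp add: Er_min_rel)
  show "rmin ^ Suc L * vrho v \<le> vrho u" if e: "(v, u) \<in> Er" for v u
  proof -
    obtain ks where ks: "extends v ks u" "length ks \<le> L" using step[OF e] by blast
    have "set ks \<subseteq> arcs (gr G)" using ks extendsD(5) by simp
    then have "rmin ^ length ks \<le> path_ratio ks" by (rule path_ratio_bounds)
    moreover have "rmin ^ Suc L \<le> rmin ^ length ks" using ks(2) rmin by (intro power_decreasing) auto
    ultimately have "rmin ^ Suc L * vrho v \<le> path_ratio ks * vrho v"
      using pos[OF e] by (intro mult_right_mono) auto
    then show ?thesis using ks(1) by (simp add: extends_def mult.commute)
  qed
  show "vrho u \<le> vrho v" if e: "(v, u) \<in> Er" for v u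
  proof -
    obtain ks where ks: "extends v ks u" using step[OF e] by blast
    have "set ks \<subseteq> arcs (gr G)" using ks extendsD(5) by simp
    then have "path_ratio ks \<le> rmax ^ length ks" by (rule path_ratio_bounds)
    also have "\<dots> \<le> 1" using rmax by (intro power_le_one) auto
    finally have "vrho v * path_ratio ks \<le> vrho v * 1" using pos[OF e] by (intro mult_left_mono) auto
    then show ?thesis using ks by (simp add: extends_def)
  qed
  show "vrho u \<le> rmax * vrho v" if "1 \<le> m" "(v, u) \<in> Er ^^ m" "ty v = ty u" for m v u
  proof -
    define m' where "m' = m - 1"
    have m': "m = Suc m'" using that(1) by (simp add: m'_def)
    then have vVR: "v \<in> VR" using that(2) unfolding m' relpow_Suc_iff by (auto simp: Er_min_rel)
    note r = Er_relpow[OF that(2) vVR]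
    have "ntype d G U \<M> v = ntype d G U \<M> u" using ty(2)[OF VRv[OF vVR]] ty(2)[OF r(1)] that(3) by simp
    then have "same_type d G U \<M> v u" by (rule ntype_eqD[OF VRv[OF vVR] r(1)])
    then show ?thesis using same_type_drop[OF VRv[OF vVR] r(1) _ r(2) that(1)] r(3) by blast
  qed
  show "A s $$ (ty v, j) = (\<Sum>u\<in>{u \<in> Er `` {v}. ty u = j}. (vrho u / vrho v) powr s)"
    if s: "0 \<le> s" and v: "v \<in> VR" and j: "j < length Ts" for s v j
  proof -
    let ?S = "{(ks, u). (v, ks, u) \<in> reduced_vedges G enum \<M> \<and> ntype d G U \<M> u = Ts ! j}"
    have "A s $$ (ty v, j) = (\<Sum>(ks, u)\<in>?S. ratio d (gdom G (vtgt u)) (path_map G ks) powr s)"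
    proof -
      have "\<forall>i<length Ts. \<forall>j<length Ts. (\<forall>v\<in>reduced_vertices G enum \<M>. ntype d G U \<M> v = Ts ! i \<longrightarrow>
           A s $$ (i, j) = (\<Sum>(ks, u)\<in>{(ks, u). (v, ks, u) \<in> reduced_vedges G enum \<M> \<and>
                                         ntype d G U \<M> u = Ts ! j}.
                            ratio d (gdom G (vtgt u)) (path_map G ks) powr s))"
        using A_matrix[OF s] unfolding weighted_incidence_matrix_def by simp
      from this[rule_format, OF ty(1)[OF VRv[OF v]] j v[unfolded VR_def] ty(2)[OF VRv[OF v], symmetric]]
      show ?thesis .
    qed
    also have "\<dots> = (\<Sum>p\<in>?S. (vrho (snd p) / vrho v) powr s)"
    proof (rule sum.cong[OF refl])
      fix p assume "p \<in> ?S"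
      then obtain ks u where p: "p = (ks, u)" "(v, ks, u) \<in> min_edges" by (auto simp: reduced_iff)
      have ext: "extends v ks u" by (rule vedge_facts(4)[OF min_edges_vedges[OF p(2)]])
      then have "ratio d (gdom G (vtgt u)) (path_map G ks) = path_ratio ks"
        unfolding extends_def using ratio_path_map(1) by blast
      also have "\<dots> = vrho u / vrho v" using ext vertex_facts(2)[OF VRv[OF v]] by (simp add: extends_def)
      finally show "(case p of (ks, u) \<Rightarrow> ratio d (gdom G (vtgt u)) (path_map G ks) powr s) =
          (vrho (snd p) / vrho v) powr s" using p(1) by simp
    qed
    \<comment> \<open>The smallest label into \<open>u\<close> is unique, so the sum over labelled
      edges is a sum over children.\<close>
    also have "\<dots> = (\<Sum>u\<in>snd ` ?S. (vrho u / vrho v) powr s)"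
    proof (rule sum.reindex[symmetric, unfolded o_def])
      show "inj_on snd ?S"
      proof (rule inj_onI)
        fix p q assume pq: "p \<in> ?S" "q \<in> ?S" "snd p = snd q"
        obtain ks u where p: "p = (ks, u)" by (cases p)
        obtain ls where q: "q = (ls, u)" using pq(3) p by (cases q) simp
        have "(v, ks, u) \<in> min_edges" "(v, ls, u) \<in> min_edges" using pq p q by (auto simp: reduced_iff)
        then have "ks = ls" by (rule min_edge_unique)
        then show "p = q" using p q by simp
      qed
    qed
    also have "snd ` ?S = {u \<in> Er `` {v}. ty u = j}"
    proof (intro equalityI subsetI)
      fix u assume "u \<in> snd ` ?S"
      then obtain ks where ks: "(v, ks, u) \<in> reduced_vedges G enum \<M>" "ntype d G U \<M> u = Ts ! j" by auto
      then have "u \<in> vertices G \<M>" using VRv by (simp add: reduced_iff)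
      then show "u \<in> {u \<in> Er `` {v}. ty u = j}" using ks ty_eq_iff[OF _ j] unfolding Er_def by blast
    next
      fix u assume "u \<in> {u \<in> Er `` {v}. ty u = j}"
      then obtain ks where ks: "(v, ks, u) \<in> reduced_vedges G enum \<M>" "ty u = j" unfolding Er_def by blast
      then have "u \<in> vertices G \<M>" using VRv by (simp add: reduced_iff)
      then have "(ks, u) \<in> ?S" using ks ty_eq_iff[OF _ j] by blast
      then show "u \<in> snd ` ?S" by force
    qed
    finally show ?thesis .
  qed
  show "A s $$ (i, j) = 0"
    if s: "0 \<le> s" and i: "i < length Ts" "i \<notin> ty ` VR" and j: "j < length Ts" for s i j
  proof -
    have "\<forall>v\<in>reduced_vertices G enum \<M>. ntype d G U \<M> v \<noteq> Ts ! i"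
      using i(2) ty_eq_iff[OF VRv i(1)] unfolding VR_def by blast
    then show ?thesis using A_matrix[OF s] i(1) j unfolding weighted_incidence_matrix_def by simp
  qed
qed

end

section \<open>The upper bound\<close>

text \<open>A finite cover becomes a sequence by padding with empty sets, whose gauge is 0.\<close>

lemma hausdorff_premeasure_le_finite:
  fixes b :: "'i \<Rightarrow> real"
  assumes fin: "finite I" and cover: "S \<subseteq> (\<Union>v\<in>I. F v)" and sub: "\<And>v. v \<in> I \<Longrightarrow> F v \<subseteq> X"
    and diam: "\<And>v x y. v \<in> I \<Longrightarrow> x \<in> F v \<Longrightarrow> y \<in> F v \<Longrightarrow> 0 \<le> d x y \<and> d x y \<le> b v"
    and b: "\<And>v. v \<in> I \<Longrightarrow> 0 \<le> b v \<and> b v \<le> \<delta>" and s: "0 < s"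
  shows "hausdorff_premeasure X d s \<delta> S \<le> ennreal (\<Sum>v\<in>I. b v powr s)"
proof -
  obtain h where h: "bij_betw h {..<card I} I"
    using ex_bij_betw_nat_finite[OF fin] by (auto simp: atLeast0LessThan)
  define C where "C n = (if n < card I then F (h n) else {})" for n
  have hI: "h n \<in> I" if "n < card I" for n using h that by (auto simp: bij_betw_def)
  have gauge: "hausdorff_gauge d s (C n) \<le> (if n < card I then ennreal (b (h n) powr s) else 0)" for n
  proof (cases "n < card I \<and> F (h n) \<noteq> {}")
    case True
    then obtain x where x: "x \<in> F (h n)" by blast
    have n: "n < card I" using True by simp
    let ?A = "{d x y |x y. x \<in> F (h n) \<and> y \<in> F (h n)}"
    have ne: "?A \<noteq> {}" using x by blast
    have up: "a \<le> b (h n)" if "a \<in> ?A" for a using that diam[OF hI[OF n]] by blast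
    have "Sup ?A \<le> b (h n)" by (rule cSup_least[OF ne up])
    moreover have "0 \<le> Sup ?A"
    proof -
      have "d x x \<le> Sup ?A" by (rule cSup_upper) (use x up in \<open>auto intro!: bdd_aboveI[of _ "b (h n)"]\<close>)
      then show ?thesis using diam[OF hI[OF n] x x] by linarith
    qed
    ultimately have "set_diam d (F (h n)) powr s \<le> b (h n) powr s"
      unfolding set_diam_def using s by (intro powr_mono2) auto
    then show ?thesis using True s by (simp add: hausdorff_gauge_def C_def ennreal_leI)
  next
    case False
    then show ?thesis by (auto simp: hausdorff_gauge_def C_def)
  qed
  have "hausdorff_premeasure X d s \<delta> S \<le> (\<Sum>n. hausdorff_gauge d s (C n))"
    unfolding hausdorff_premeasure_def
  proof (rule Inf_lower, intro CollectI exI[of _ C] conjI refl allI)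
    show "S \<subseteq> (\<Union>i. C i)"
    proof
      fix x assume "x \<in> S"
      then obtain v where v: "v \<in> I" "x \<in> F v" using cover by blast
      have "v \<in> h ` {..<card I}" using v(1) h by (simp add: bij_betw_def)
      then obtain n where n: "n < card I" "h n = v" by blast
      have "x \<in> C n" using n v(2) by (simp add: C_def)
      then show "x \<in> (\<Union>i. C i)" by blast
    qed
    fix n
    show "C n \<subseteq> X" using sub[OF hI] by (simp add: C_def)
    show "\<forall>x\<in>C n. \<forall>y\<in>C n. d x y \<le> \<delta>"
    proof (intro ballI)
      fix x y assume xy: "x \<in> C n" "y \<in> C n"
      have n: "n < card I" using xy(1) by (simp add: C_def split: if_splits)
      have "x \<in> F (h n)" "y \<in> F (h n)" using xy n by (simp_all add: C_def)
      from diam[OF hI[OF n] this] b[OF hI[OF n]] show "d x y \<le> \<delta>" by linarith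
    qed
  qed
  also have "\<dots> = (\<Sum>n<card I. hausdorff_gauge d s (C n))"
    by (rule suminf_finite) (auto simp: C_def hausdorff_gauge_def)
  also have "\<dots> \<le> (\<Sum>n<card I. ennreal (b (h n) powr s))"
  proof (rule sum_mono)
    fix n assume "n \<in> {..<card I}"
    then show "hausdorff_gauge d s (C n) \<le> ennreal (b (h n) powr s)" using gauge[of n] by simp
  qed
  also have "\<dots> = ennreal (\<Sum>n<card I. b (h n) powr s)" by (rule sum_ennreal) simp
  also have "(\<Sum>n<card I. b (h n) powr s) = (\<Sum>v\<in>I. b v powr s)" by (rule sum.reindex_bij_betw[OF h])
  finally show ?thesis .
qed

lemma word_image_Cons: "word_image R (t # ts) F = R t `` word_image R ts F"
  by (simp add: word_image_def)

lemma word_image_Nil: "word_image R [] F = F"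
  by (simp add: word_image_def)

lemma irs_level_words:
  "irs_level E0 N R (k + q) = (\<Union>ts\<in>{ts. length ts = q \<and> set ts \<subseteq> {1..N}}. word_image R ts (irs_level E0 N R k))"
proof (induction q)
  case 0
  then show ?case by (auto simp: word_image_Nil)
next
  case (Suc q)
  have "{ts. length ts = Suc q \<and> set ts \<subseteq> {1..N}} = (\<Union>t\<in>{1..N}. (#) t ` {ts. length ts = q \<and> set ts \<subseteq> {1..N}})"
    by (auto simp: length_Suc_conv)
  then have "(\<Union>ts\<in>{ts. length ts = Suc q \<and> set ts \<subseteq> {1..N}}. word_image R ts (irs_level E0 N R k)) =
      (\<Union>t\<in>{1..N}. \<Union>ts\<in>{ts. length ts = q \<and> set ts \<subseteq> {1..N}}. R t `` word_image R ts (irs_level E0 N R k))"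
    by (simp add: word_image_Cons)
  also have "\<dots> = (\<Union>t\<in>{1..N}. R t `` irs_level E0 N R (k + q))" unfolding Suc by blast
  finally show ?case by simp
qed

locale irs_gifs = gftc_gifs where E = E and M = M and d = d and G = G and U = U and \<M> = \<M> and enum = enum
    and Ts = Ts and A = A
  for E :: "'e::euclidean_space itself" and M :: "'a set" and d and G :: "('v, 'g, 'a) gifs" and U and \<M> and enum
    and Ts A +
  fixes E0 :: "'a set" and N :: nat and R :: "nat \<Rightarrow> ('a \<times> 'a) set" and k0 :: nat and W :: "'v \<Rightarrow> 'a set"
  assumes irs: "is_IRS mtopology E0 N R"
    and W_nonempty: "\<And>j. j \<in> verts (gr G) \<Longrightarrow> W j \<noteq> {}"
    and W_sub: "\<And>j. j \<in> verts (gr G) \<Longrightarrow> W j \<subseteq> gdom G j"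
    and words: "\<And>q. 1 \<le> q \<Longrightarrow> (\<Union>ts\<in>{ts. length ts = q \<and> set ts \<subseteq> {1..N}}. word_image R ts (irs_level E0 N R k0)) =
      (\<Union>(i, es, j)\<in>{p \<in> gpaths G. plen p = q}. path_map G es ` W j)"
begin

abbreviation level :: "nat \<Rightarrow> 'a set" where "level \<equiv> irs_level E0 N R"
abbreviation K :: "'a set" where "K \<equiv> irs_attractor E0 N R"

lemma irs_facts: "1 \<le> N" "E0 \<noteq> {}" "compactin mtopology E0"
  "t \<in> {1..N} \<Longrightarrow> F \<noteq> {} \<Longrightarrow> F \<subseteq> E0 \<Longrightarrow> compactin mtopology F \<Longrightarrow> compactin mtopology (R t `` F)"
  "t \<in> {1..N} \<Longrightarrow> F \<noteq> {} \<Longrightarrow> F \<subseteq> E0 \<Longrightarrow> compactin mtopology F \<Longrightarrow> R t `` F \<noteq> {}"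
  "t \<in> {1..N} \<Longrightarrow> R t `` E0 \<subseteq> E0"
  using irs unfolding is_IRS_def by simp_all

lemma E0_M: "E0 \<subseteq> M" using irs_facts(3) compactin_subspace by force

lemma level_decreasing: "level (Suc k) \<subseteq> level k"
proof (induction k)
  case 0
  have "(\<Union>t\<in>{1..N}. R t `` E0) \<subseteq> E0" using irs_facts(6) by (rule UN_least)
  then show ?case by simp
next
  case (Suc k)
  have "R t `` level (Suc k) \<subseteq> R t `` level k" for t using Suc by (rule Image_mono[OF subset_refl])
  then have "(\<Union>t\<in>{1..N}. R t `` level (Suc k)) \<subseteq> (\<Union>t\<in>{1..N}. R t `` level k)" by (rule UN_mono[OF subset_refl])
  then show ?case by (simp only: irs_level.simps(2))
qed

lemma level_antimono: "k \<le> l \<Longrightarrow> level l \<subseteq> level k"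
  by (rule lift_Suc_antimono_le[where f = level, OF level_decreasing])

lemma level_E0: "level k \<subseteq> E0"
  using level_antimono[of 0 k] by simp

lemma level_compact: "compactin mtopology (level k) \<and> level k \<noteq> {}"
proof (induction k)
  case 0
  then show ?case using irs_facts by simp
next
  case (Suc k)
  note IH = conjunct2[OF Suc] level_E0 conjunct1[OF Suc]
  have c: "compactin mtopology (R t `` level k)" "R t `` level k \<noteq> {}" if "t \<in> {1..N}" for t
    by (rule irs_facts(4)[OF that IH], rule irs_facts(5)[OF that IH])
  have "compactin mtopology (\<Union>t\<in>{1..N}. R t `` level k)"
    by (rule compactin_Union) (use c in auto)
  moreover have "1 \<in> {1..N}" using irs_facts(1) by simp
  then have "(\<Union>t\<in>{1..N}. R t `` level k) \<noteq> {}" using c(2)[of 1] by blast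
  ultimately show ?case by simp
qed

lemma level_closed: "closedin mtopology (level k)"
  using level_compact Hausdorff_space_mtopology compactin_imp_closedin by blast

lemma K_sub: "K \<subseteq> level k"
  unfolding irs_attractor_def by blast

lemma K_E0: "K \<subseteq> E0"
  using K_sub[of 0] by simp

lemma K_compact: "compactin mtopology K"
proof (rule closed_compactin[OF irs_facts(3) K_E0])
  show "closedin mtopology K"
    unfolding irs_attractor_def by (rule closedin_Inter) (use level_closed in auto)
qed

text \<open>The open set and the complements of the levels cover \<open>E0\<close>; a finite
  subcover involves finitely many levels, and the levels decrease.\<close>

lemma level_eventually_in:
  assumes V: "openin mtopology V" "K \<subseteq> V"
  shows "\<exists>k. level k \<subseteq> V"
proof -
  have "\<exists>\<F>. finite \<F> \<and> \<F> \<subseteq> insert V (range (\<lambda>k. M - level k)) \<and> E0 \<subseteq> \<Union>\<F>"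
  proof (rule compactinD[OF irs_facts(3)])
    fix X assume "X \<in> insert V (range (\<lambda>k. M - level k))"
    then show "openin mtopology X" using V(1) level_closed by (auto simp: closedin_def)
  next
    show "E0 \<subseteq> \<Union>(insert V (range (\<lambda>k. M - level k)))"
      using V(2) E0_M unfolding irs_attractor_def by blast
  qed
  then obtain \<F> where F: "finite \<F>" "\<F> \<subseteq> insert V (range (\<lambda>k. M - level k))" "E0 \<subseteq> \<Union>\<F>" by blast
  have "finite (\<F> - {V})" "\<F> - {V} \<subseteq> range (\<lambda>k. M - level k)" using F(1,2) by auto
  from finite_subset_image[OF this] obtain J where J: "finite J" "\<F> - {V} = (\<lambda>k. M - level k) ` J" by blast
  define k where "k = Max (insert 0 J)"
  have "level k \<subseteq> V"
  proof
    fix x assume x: "x \<in> level k"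
    then have "x \<in> E0" using level_E0 by blast
    then obtain X where X: "X \<in> \<F>" "x \<in> X" using F(3) by blast
    show "x \<in> V"
    proof (rule ccontr)
      assume "x \<notin> V"
      then have "X \<in> (\<lambda>k. M - level k) ` J" using X J(2) by blast
      then obtain l where l: "l \<in> J" "x \<notin> level l" using X(2) by blast
      have "l \<le> k" unfolding k_def using J(1) l(1) by (intro Max_ge) auto
      then show False using level_antimono[of l k] x l(2) by blast
    qed
  qed
  then show ?thesis ..
qed

lemma level_paths:
  assumes "1 \<le> q"
  shows "level (k0 + q) = (\<Union>(i, es, j)\<in>{p \<in> gpaths G. plen p = q}. path_map G es ` W j)"
  unfolding irs_level_words words[OF assms] ..

text \<open>The association with the relations is stated for words of positive length, hence the
  nonempty path. Membership in a deep level is how images under long paths are known to be close to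
  the attractor.\<close>

lemma path_map_W:
  assumes p: "(i, es, j) \<in> gpaths G" and es: "es \<noteq> []" and w: "w \<in> W j"
  shows "path_map G es w \<in> level (k0 + length es)" "path_map G es w \<in> E0"
proof -
  have "1 \<le> length es" using es by (cases es) auto
  from level_paths[OF this] show "path_map G es w \<in> level (k0 + length es)"
    using p w by (force simp: plen_def)
  then show "path_map G es w \<in> E0" using level_E0 by blast
qed

lemma E0_bounded:
  assumes "x \<in> M"
  obtains B where "0 < B" "\<And>y. y \<in> E0 \<Longrightarrow> d x y \<le> B"
proof -
  have "mbounded E0" using irs_facts(3) by (rule compactin_imp_mbounded)
  then obtain z B where B: "E0 \<subseteq> mcball z B" unfolding mbounded_def by blast
  show ?thesis
  proof (rule that[of "d x z + \<bar>B\<bar> + 1"])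
    show "0 < d x z + \<bar>B\<bar> + 1" using nonneg[of x z] by linarith
    fix y assume "y \<in> E0"
    then have "z \<in> M" "y \<in> M" "d z y \<le> B" using B by auto
    then show "d x y \<le> d x z + \<bar>B\<bar> + 1" using triangle[OF assms, of z y] by linarith
  qed
qed

lemma root_rho: "v \<in> vertices_at G \<M> 0 \<Longrightarrow> vrho v = 1"
  by (erule vertexE) (auto simp: index_0 vrho_path_vertex)

text \<open>Dead vertices have no descendants far down, so the vertices of the reduced graph suffice for a cover.\<close>
lemma K_cover: "K \<subseteq> (\<Union>v\<in>vertices_at G \<M> k \<inter> VR. vmap v ` (E0 \<inter> gdom G (vtgt v)))"
proof
  fix x assume x: "x \<in> K"
  have "\<exists>n. \<forall>u\<in>vertices_at G \<M> (k + n). \<exists>v\<in>vertices_at G \<M> k \<inter> VR. (v, u) \<in> min_rel ^^ n"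
    by (rule live_ancestors[of k]) (rule exI, rule ballI)
  then obtain n where n: "\<forall>u\<in>vertices_at G \<M> (k + n). \<exists>v\<in>vertices_at G \<M> k \<inter> VR. (v, u) \<in> min_rel ^^ n" ..
  \<comment> \<open>One more than the longest index path of level \<open>k + n\<close>, so the path
    properly extends its index prefix and \<open>rest\<close> is nonempty.\<close>
  define q where "q = Suc (max_len \<M> (k + n))"
  have "x \<in> level (k0 + q)" using x K_sub by blast
  then obtain i es j where p: "(i, es, j) \<in> gpaths G" "length es = q" "x \<in> path_map G es ` W j"
  proof -
    have "1 \<le> q" by (simp add: q_def)
    from level_paths[OF this] have "x \<in> (\<Union>(i, es, j)\<in>{p \<in> gpaths G. plen p = q}. path_map G es ` W j)"
      using \<open>x \<in> level (k0 + q)\<close> by (rule subst)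
    then obtain p where p: "p \<in> gpaths G" "plen p = q" "x \<in> (case p of (i, es, j) \<Rightarrow> path_map G es ` W j)" by blast
    obtain i es j where e: "p = (i, es, j)" by (cases p)
    show ?thesis by (rule that[of i es j]) (use p e in \<open>simp_all add: plen_def\<close>)
  qed
  obtain w where w: "w \<in> W j" "x = path_map G es w" using p(3) by blast
  have "plen (i, es, j) > max_len \<M> (k + n)" using p(2) by (simp add: q_def plen_def)
  from index_long_prefix[OF p(1) this] obtain p' where p': "p' \<in> \<M> (k + n)" "pprefix p' (i, es, j)" by blast
  obtain i' es' j' where e: "p' = (i', es', j')" by (cases p')
  have i': "i' = i" and "prefix es' es" using p'(2) e by (simp_all add: pprefix_def)
  then obtain rest where rest: "es = es' @ rest" by (auto simp: prefix_def)
  have "plen p' \<le> max_len \<M> (k + n)"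
    unfolding max_len_def using p'(1) index_finite by (intro Max_ge) auto
  then have "length es' < length es" using p(2) e by (simp add: q_def plen_def)
  then have ne: "rest \<noteq> []" using rest by auto
  have gp': "(i, es', j') \<in> gpaths G" using p'(1) index_sub e i' by blast
  have "\<exists>l. (i, es', l) \<in> gpaths G \<and> (l, rest, j) \<in> gpaths G" using p(1) rest gpaths_append by simp
  then have gr: "(j', rest, j) \<in> gpaths G" using gpaths_target[OF gp'] by blast
  define u where "u = path_vertex G (k + n) (i, es', j')"
  have "u \<in> vertices_at G \<M> (k + n)" using p'(1) e i' by (simp add: u_def vertices_at_def)
  then obtain v where v: "v \<in> vertices_at G \<M> k" "v \<in> VR" "(v, u) \<in> min_rel ^^ n" using n by blast
  have "v \<in> vertices G \<M>" using v(2) by (simp add: VR_iff)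
  then obtain ls where ls: "extends v ls u" using min_rel_relpow[OF v(3)] by blast
  have jv: "j \<in> verts (gr G)" using gpaths_verts(2)[OF p(1)] .
  have wg: "w \<in> gdom G j" using w(1) W_sub[OF jv] by blast
  have rg: "path_map G rest w \<in> gdom G j'" using path_map_facts(1)[OF gr] wg by blast
  have "(vtgt v, ls, j') \<in> gpaths G" using extendsD(1)[OF ls] by (simp add: u_def)
  then have gl: "(vtgt v, ls @ rest, j) \<in> gpaths G" using gr unfolding gpaths_append by blast
  have "x = vmap u (path_map G rest w)" using w(2) rest rg by (simp add: u_def path_map_append)
  also have "\<dots> = vmap v (path_map G ls (path_map G rest w))"
    using extends_apply[OF ls] rg by (simp add: u_def)
  also have "\<dots> = vmap v (path_map G (ls @ rest) w)" by (simp add: path_map_append)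
  finally have xv: "x = vmap v (path_map G (ls @ rest) w)" .
  \<comment> \<open>The label \<open>ls\<close> may be empty, but \<open>rest\<close> is not, so the
    association applies.\<close>
  have "path_map G (ls @ rest) w \<in> E0" by (rule path_map_W(2)[OF gl _ w(1)]) (use ne in simp)
  moreover have "path_map G (ls @ rest) w \<in> gdom G (vtgt v)" using path_map_facts(1)[OF gl] wg by blast
  ultimately show "x \<in> (\<Union>v\<in>vertices_at G \<M> k \<inter> VR. vmap v ` (E0 \<inter> gdom G (vtgt v)))"
    using xv v by blast
qed

theorem upper_bound:
  assumes s: "0 \<le> s" "lam s < 1" "s < s'"
  shows "hausdorff_measure M d s' K = 0"
proof -
  have s'0: "0 < s'" using s by linarith
  have "\<exists>C. 0 \<le> C \<and> (\<forall>m. \<forall>v\<in>VR. (\<Sum>u\<in>(Er ^^ m) `` {v}. (vrho u / vrho v) powr s) \<le> C)"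
    by (rule sum_relpow_bounded[OF s(1,2)]) (intro exI conjI allI ballI)
  then obtain C where C: "0 \<le> C" "\<And>m v. v \<in> VR \<Longrightarrow> (\<Sum>u\<in>(Er ^^ m) `` {v}. (vrho u / vrho v) powr s) \<le> C"
    by blast
  let ?roots = "vertices_at G \<M> 0 \<inter> VR"
  have fin_roots: "finite ?roots" using finite_vertices_at by blast
  obtain x0 where x0: "x0 \<in> E0" using irs_facts(2) by blast
  obtain B0 where B0: "0 < B0" "\<And>y. y \<in> E0 \<Longrightarrow> d x0 y \<le> B0" using E0_bounded[of x0] x0 E0_M by blast
  define B where "B = 2 * B0"
  have B: "0 < B" using B0 by (simp add: B_def)
  have BE: "d x y \<le> B" if "x \<in> E0" "y \<in> E0" for x y
    using triangle[OF subsetD[OF E0_M that(1)] subsetD[OF E0_M x0] subsetD[OF E0_M that(2)]]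
      B0(2)[OF that(1)] B0(2)[OF that(2)] commute[of x x0]
    by (auto simp: B_def dest: subsetD)
  have "hausdorff_premeasure M d s' \<delta> K = 0" if \<delta>: "0 < \<delta>" for \<delta>
  proof -
    have "hausdorff_premeasure M d s' \<delta> K \<le> 0 + ennreal e" if e: "0 < e" for e
    proof -
      \<comment> \<open>Up to the summand 1, which makes \<open>D\<close> positive, this bounds the
        sum of \<open>B powr s' * vrho v powr s\<close> over the live vertices of any level: they
        descend from live roots, whose ratio is 1.\<close>
      define D where "D = B powr s' * (real (card ?roots) * C) + 1"
      have D: "0 < D" using C(1) by (simp add: D_def add_nonneg_pos)
      \<comment> \<open>A bound on the ratios that makes the diameters of the images at most
        \<open>\<delta>\<close> and the surplus factor \<open>c powr (s' - s)\<close> at most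
        \<open>e / D\<close>.\<close>
      define c where "c = min (\<delta> / B) ((e / D) powr (1 / (s' - s)))"
      have "0 < (e / D) powr (1 / (s' - s))" using e D by (subst powr_gt_zero) simp
      then have c: "0 < c" using divide_pos_pos[OF \<delta> B] by (simp only: c_def min_less_iff_conj simp_thms)
      obtain n0 :: nat where n0: "rmax ^ n0 < c" using real_arch_pow_inv[OF c rmax(2)] by blast
      have "\<forall>\<^sub>F k in sequentially. n0 \<le> min_len \<M> k" using min_len_tendsto by (simp add: filterlim_at_top)
      from eventually_happens'[OF sequentially_bot this] obtain k where k: "n0 \<le> min_len \<M> k" by blast
      have "rmax ^ min_len \<M> k \<le> rmax ^ n0" using k rmax by (intro power_decreasing) auto
      then have small: "rmax ^ min_len \<M> k < c" using n0 by linarith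
      let ?I = "vertices_at G \<M> k \<inter> VR"
      have finI: "finite ?I" using finite_vertices_at by blast
      have v: "v \<in> vertices G \<M>" "vlevel v = k" if "v \<in> ?I" for v
        using that vertices_at_level by (auto simp: VR_iff)
      have rho: "0 < vrho v" "vrho v < c" if "v \<in> ?I" for v
        using vertex_facts(2,5)[OF v(1)[OF that]] v(2)[OF that] small by auto
      have cB: "c * B \<le> \<delta>"
      proof -
        have "c \<le> \<delta> / B" by (simp add: c_def)
        then show ?thesis using B by (simp add: field_simps)
      qed
      have "hausdorff_premeasure M d s' \<delta> K \<le> ennreal (\<Sum>v\<in>?I. (vrho v * B) powr s')"
      proof (rule hausdorff_premeasure_le_finite[OF finI K_cover _ _ _ s'0])
        fix u assume u: "u \<in> ?I"
        show "vmap u ` (E0 \<inter> gdom G (vtgt u)) \<subseteq> M" using vertex_facts(4)[OF v(1)[OF u]] by blast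
        have "vrho u * B \<le> c * B" using rho[OF u] B by (intro mult_right_mono) auto
        then have "vrho u * B \<le> \<delta>" using cB by (rule order_trans)
        then show "0 \<le> vrho u * B \<and> vrho u * B \<le> \<delta>" using rho[OF u] B by simp
        fix x y assume "x \<in> vmap u ` (E0 \<inter> gdom G (vtgt u))" "y \<in> vmap u ` (E0 \<inter> gdom G (vtgt u))"
        then obtain a b where ab: "a \<in> E0" "b \<in> E0" "a \<in> gdom G (vtgt u)" "b \<in> gdom G (vtgt u)" "x = vmap u a" "y = vmap u b"
          by blast
        have "d x y = vrho u * d a b"
          using vertex_facts(3)[OF v(1)[OF u]] ab unfolding similitude_with_ratio_def by blast
        then show "0 \<le> d x y \<and> d x y \<le> vrho u * B" using BE[OF ab(1,2)] rho[OF u] by simp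
      qed
      also have "\<dots> \<le> ennreal e"
      proof (rule ennreal_leI)
        have "(\<Sum>v\<in>?I. (vrho v * B) powr s') \<le> (\<Sum>v\<in>?I. (B powr s' * c powr (s' - s)) * vrho v powr s)"
        proof (rule sum_mono)
          fix u assume u: "u \<in> ?I"
          have "vrho u powr s' = vrho u powr s * vrho u powr (s' - s)" by (simp flip: powr_add)
          also have "\<dots> \<le> vrho u powr s * c powr (s' - s)"
            using rho[OF u] s(3) by (intro mult_left_mono powr_mono2) auto
          finally have "B powr s' * vrho u powr s' \<le> B powr s' * (vrho u powr s * c powr (s' - s))"
            by (rule mult_left_mono) simp
          then show "(vrho u * B) powr s' \<le> (B powr s' * c powr (s' - s)) * vrho u powr s"
            using rho[OF u] B by (simp add: powr_mult mult_ac)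
        qed
        also have "\<dots> = (B powr s' * c powr (s' - s)) * (\<Sum>v\<in>?I. vrho v powr s)" by (simp add: sum_distrib_left)
        also have "\<dots> \<le> (B powr s' * c powr (s' - s)) * (real (card ?roots) * C)"
        proof (rule mult_left_mono)
          have "(\<Sum>v\<in>?I. vrho v powr s) \<le> (\<Sum>v\<in>(\<Union>r\<in>?roots. (Er ^^ k) `` {r}). vrho v powr s)"
          proof (rule sum_mono2)
            show "finite (\<Union>r\<in>?roots. (Er ^^ k) `` {r})" using fin_roots finite_relpow by blast
            show "?I \<subseteq> (\<Union>r\<in>?roots. (Er ^^ k) `` {r})" using VR_from_root by blast
          qed simp
          also have "\<dots> \<le> (\<Sum>r\<in>?roots. \<Sum>v\<in>(Er ^^ k) `` {r}. vrho v powr s)"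
            by (rule sum_UN_le[OF fin_roots]) (auto simp: finite_relpow)
          also have "\<dots> \<le> (\<Sum>r\<in>?roots. C)"
          proof (rule sum_mono)
            fix r assume r: "r \<in> ?roots"
            then have "vrho r = 1" "r \<in> VR" using root_rho by blast+
            then show "(\<Sum>v\<in>(Er ^^ k) `` {r}. vrho v powr s) \<le> C" using C(2)[of r k] by simp
          qed
          finally show "(\<Sum>v\<in>?I. vrho v powr s) \<le> real (card ?roots) * C" by simp
        qed simp
        also have "\<dots> = c powr (s' - s) * (D - 1)" by (simp add: D_def)
        also have "\<dots> \<le> (e / D) * D"
        proof (rule mult_mono)
          have "c powr (s' - s) \<le> ((e / D) powr (1 / (s' - s))) powr (s' - s)"
            using c s(3) by (intro powr_mono2) (auto simp: c_def)
          then show "c powr (s' - s) \<le> e / D" using s(3) e D by (simp add: powr_powr)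
        qed (use e D C(1) in \<open>auto simp: D_def\<close>)
        finally show "(\<Sum>v\<in>?I. (vrho v * B) powr s') \<le> e" using D by simp
      qed
      finally show ?thesis by simp
    qed
    then have "hausdorff_premeasure M d s' \<delta> K \<le> 0" by (rule ennreal_le_epsilon)
    then show ?thesis by (simp only: le_zero_eq)
  qed
  then have "hausdorff_measure M d s' K \<le> 0"
    unfolding hausdorff_measure_def by (intro SUP_least) (simp only: greaterThan_iff order_refl)
  then show ?thesis by (simp only: le_zero_eq)
qed

end

section \<open>The lower bound\<close>

context irs_gifs
begin

lemma path_map_inj:
  assumes "(i, es, j) \<in> gpaths G" "x \<in> gdom G j" "y \<in> gdom G j" "path_map G es x = path_map G es y"
  shows "x = y"
proof -
  have j: "j \<in> verts (gr G)" using gpaths_verts(2)[OF assms(1)] .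
  have M: "x \<in> M" "y \<in> M" using gdom_sub[OF j] assms(2,3) by auto
  have im: "path_map G es y \<in> M"
    using path_map_facts(1)[OF assms(1)] assms(3) gdom_sub[OF gpaths_verts(1)[OF assms(1)]] by blast
  have "path_ratio es * d x y = 0" using path_map_dist[OF assms(1-3)] assms(4) im by simp
  moreover have "0 < path_ratio es" using path_ratio_bounds(1)[OF gpaths_verts(3)[OF assms(1)]] .
  ultimately show ?thesis using M by simp
qed

lemma same_type_target: "same_type d G U \<M> v u \<Longrightarrow> v \<in> vertices G \<M> \<Longrightarrow> vtgt u = vtgt v"
  unfolding same_type_def using self_neighbor by blast

lemma same_ty:
  assumes "v \<in> VR" "u \<in> VR" "ty v = ty u"
  shows "same_type d G U \<M> v u"
proof -
  have "v \<in> vertices G \<M>" "u \<in> vertices G \<M>" using assms by (simp_all add: VR_iff)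
  then show ?thesis using ty(2)[of v] ty(2)[of u] assms(3) by (intro ntype_eqD) simp_all
qed

text \<open>The two parents differ by maps that agree on an open set. Prolonging these by a high power of
  the cycle, both take values in a small flat ball, where similitudes are determined by their values on
  an open set.\<close>
lemma unique_parent:
  assumes v: "v \<in> VR" and cyc: "(vtgt v, c, vtgt v) \<in> gpaths G" "c \<noteq> []"
    and x: "(v, x) \<in> Er\<^sup>*" and y: "(v, y) \<in> Er\<^sup>*" and xz: "(x, z) \<in> Er" and yz: "(y, z) \<in> Er"
  shows "x = y"
proof -
  obtain nx where nx: "(v, x) \<in> Er ^^ nx" using rtrancl_imp_relpow[OF x] by blast
  obtain ny where ny: "(v, y) \<in> Er ^^ ny" using rtrancl_imp_relpow[OF y] by blast
  obtain a where a: "extends v a x" using Er_relpow(3)[OF nx v] by blast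
  obtain b where b: "extends v b y" using Er_relpow(3)[OF ny v] by blast
  obtain ks where ks: "(x, ks, z) \<in> min_edges" using xz unfolding Er_def by (auto simp: reduced_iff)
  obtain ks' where ks': "(y, ks', z) \<in> min_edges" using yz unfolding Er_def by (auto simp: reduced_iff)
  \<comment> \<open>Both edges into \<open>z\<close> carry the same label, so the two parents have
    the same target and their maps agree after the label.\<close>
  have "ks' = ks" by (rule min_edge_unique[OF ks' ks])
  note ks'' = ks'[unfolded this]
  note vx = vedge_facts[OF min_edges_vedges[OF ks]]
  note vy = vedge_facts[OF min_edges_vedges[OF ks'']]
  have lev: "vlevel x = vlevel y" using vx(3) vy(3) by simp
  have src: "vsrc x = vsrc y" using extendsD(2)[OF a] extendsD(2)[OF b] by simp
  have tgt: "vtgt y = vtgt x" by (rule gpaths_source[OF extendsD(1)[OF vy(4)] extendsD(1)[OF vx(4)]])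
  define l where "l = vtgt x"
  define j where "j = vtgt v"
  note cyc = cyc[folded j_def]
  have ga: "(j, a, l) \<in> gpaths G" using extendsD(1)[OF a] by (simp add: j_def l_def)
  have gb: "(j, b, l) \<in> gpaths G" using extendsD(1)[OF b] tgt by (simp add: j_def l_def)
  have gk: "(l, ks, vtgt z) \<in> gpaths G" using extendsD(1)[OF vx(4)] by (simp add: l_def)
  have zv: "vtgt z \<in> verts (gr G)" and lv: "l \<in> verts (gr G)" and jv: "j \<in> verts (gr G)"
    using gpaths_verts[OF gk] gpaths_verts[OF ga] by simp_all
  have vv: "v \<in> vertices G \<M>" using v by (simp add: VR_iff)
  have vinj: "p = q" if "p \<in> gdom G j" "q \<in> gdom G j" "vmap v p = vmap v q" for p q
  proof -
    have M: "p \<in> M" "q \<in> M" using gdom_sub[OF jv] that by auto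
    have "d (vmap v p) (vmap v q) = vrho v * d p q"
      using vertex_facts(3)[OF vv] that(1,2) unfolding similitude_with_ratio_def j_def by blast
    moreover have "vmap v q \<in> M" using vertex_facts(4)[OF vv] that(2) unfolding j_def by blast
    ultimately have "vrho v * d p q = 0" using that(3) by simp
    then show ?thesis using vertex_facts(2)[OF vv] M by simp
  qed
  have agree: "path_map G a (path_map G ks p) = path_map G b (path_map G ks p)" if p: "p \<in> gdom G (vtgt z)" for p
  proof -
    have k: "path_map G ks p \<in> gdom G l" using path_map_facts(1)[OF gk] p by blast
    have "vmap v (path_map G a (path_map G ks p)) = vmap x (path_map G ks p)"
      by (rule extends_apply[OF a, symmetric]) (use k l_def in simp)
    also have "\<dots> = vmap z p" by (rule extends_apply[OF vx(4) p, symmetric])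
    also have "\<dots> = vmap y (path_map G ks p)" by (rule extends_apply[OF vy(4) p])
    also have "\<dots> = vmap v (path_map G b (path_map G ks p))"
      by (rule extends_apply[OF b]) (use k l_def tgt in simp)
    finally have e: "vmap v (path_map G a (path_map G ks p)) = vmap v (path_map G b (path_map G ks p))" .
    show ?thesis by (rule vinj[OF _ _ e]) (use path_map_facts(1)[OF ga] path_map_facts(1)[OF gb] k in blast)+
  qed
  \<comment> \<open>The ratio of either parent times that of the label gives the ratio of
    \<open>z\<close>.\<close>
  have ratio: "path_ratio a = path_ratio b"
  proof -
    have "vrho x * path_ratio ks = vrho y * path_ratio ks"
      by (rule trans[OF extendsD(3)[OF vx(4), symmetric] extendsD(3)[OF vy(4)]])
    moreover have "0 < path_ratio ks" using path_ratio_bounds(1)[OF gpaths_verts(3)[OF gk]] .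
    ultimately have "vrho x = vrho y" by simp
    then have "vrho v * path_ratio a = vrho v * path_ratio b"
      unfolding extendsD(3)[OF a] extendsD(3)[OF b] .
    then show ?thesis using vertex_facts(2)[OF vv] by simp
  qed
  obtain u where u: "u \<in> U (vtgt z)" using U_nonempty[OF zv] by blast
  define u' where "u' = path_map G ks u"
  have u': "u' \<in> gdom G l" using path_map_facts(1)[OF gk] u U_sub[OF zv] unfolding u'_def by blast
  obtain w where w: "w \<in> W l" using W_nonempty[OF lv] by blast
  have wg: "w \<in> gdom G l" using w W_sub[OF lv] by blast
  have "\<exists>r>0. \<forall>p\<in>E0. \<forall>q\<in>mball p r. \<exists>\<phi>::'a \<Rightarrow> 'e. flat_chart \<phi> q r"
    by (rule uniformly_flat[OF irs_facts(3)]) blast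
  then obtain r1 where r1: "0 < r1" "\<forall>p\<in>E0. \<forall>q\<in>mball p r1. \<exists>\<phi>::'a \<Rightarrow> 'e. flat_chart \<phi> q r1" by blast
  have eq: "path_map G a q = path_map G b q" if q: "q \<in> gdom G l" for q
  proof -
    \<comment> \<open>The distances that have to be contracted, added up; the summand 1 makes
      \<open>B\<close> positive.\<close>
    define B where "B = d q u' + d u' w + d q w + 1"
    have B: "0 < B" unfolding B_def using nonneg[of q u'] nonneg[of u' w] nonneg[of q w] by linarith
    obtain n where n: "rmax ^ n < r1 / B" using real_arch_pow_inv[OF divide_pos_pos[OF r1(1) B] rmax(2)] by blast
    \<comment> \<open>The number \<open>n\<close> of repetitions already contracts below the flat
      radius. Since the path is nonempty, \<open>F w\<close> lies in \<open>E0\<close>, where flat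
      charts of radius \<open>r1\<close> exist.\<close>
    define cn where "cn = concat (replicate (Suc n) c)"
    have gcn: "(j, concat (replicate k c), j) \<in> gpaths G" for k
    proof (induction k)
      case 0
      then show ?case using jv by (simp add: gpaths_Nil)
    next
      case (Suc k)
      then show ?case using cyc(1) by (auto simp: gpaths_append)
    qed
    have len: "k \<le> length (concat (replicate k c))" for k
    proof (induction k)
      case (Suc k)
      then show ?case using cyc(2) by (cases c) auto
    qed simp
    note gc = gcn[of "Suc n", folded cn_def]
    have gca: "(j, cn @ a, l) \<in> gpaths G" and gcb: "(j, cn @ b, l) \<in> gpaths G"
      using gc ga gb unfolding gpaths_append by blast+
    define F where "F = path_map G (cn @ a)"
    define F' where "F' = path_map G (cn @ b)"
    define \<sigma> where "\<sigma> = path_ratio (cn @ a)"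

    have \<sigma>0: "0 < \<sigma>" unfolding \<sigma>_def using path_ratio_bounds(1)[OF gpaths_verts(3)[OF gca]] .
    have "\<sigma> \<le> rmax ^ length (cn @ a)" unfolding \<sigma>_def using path_ratio_bounds(3)[OF gpaths_verts(3)[OF gca]] .
    also have "\<dots> \<le> rmax ^ n" using len[of "Suc n"] rmax by (intro power_decreasing) (auto simp: cn_def)
    finally have "\<sigma> < r1 / B" using n by (rule le_less_trans)
    then have "\<sigma> * B < r1" using B by (simp add: pos_less_divide_eq)
    then have sm: "\<sigma> * d q u' + \<sigma> * d u' w + \<sigma> * d q w < r1"
      using \<sigma>0 by (simp add: B_def algebra_simps)
    have nn: "0 \<le> \<sigma> * d q u'" "0 \<le> \<sigma> * d u' w" "0 \<le> \<sigma> * d q w" using \<sigma>0 nonneg by simp_all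
    have dF: "d (F p) (F p') = \<sigma> * d p p'" "d (F' p) (F' p') = \<sigma> * d p p'"
      if "p \<in> gdom G l" "p' \<in> gdom G l" for p p'
      using path_map_dist[OF gca that] path_map_dist[OF gcb that] ratio by (simp_all add: F_def F'_def \<sigma>_def)
    have FM: "F p \<in> M" "F' p \<in> M" if "p \<in> gdom G l" for p
      using path_map_facts(1)[OF gca] path_map_facts(1)[OF gcb] that gdom_sub[OF jv] by (auto simp: F_def F'_def)
    have FF: "F (path_map G ks p) = F' (path_map G ks p)" if "p \<in> gdom G (vtgt z)" for p
      using agree[OF that] by (simp add: F_def F'_def path_map_append)
    have "cn @ a \<noteq> []" using cyc(2) by (simp add: cn_def)
    from path_map_W(2)[OF gca this w] have FwE: "F w \<in> E0" by (simp add: F_def)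
    then have FwM: "F w \<in> M" using E0_M by blast
    have "F w \<in> mball (F w) r1" using FwM r1(1) by simp
    then obtain \<phi> :: "'a \<Rightarrow> 'e" where \<phi>: "flat_chart \<phi> (F w) r1" using r1(2) FwE by blast
    have Fu: "F u' = F' u'" unfolding u'_def using FF u U_sub[OF zv] by blast
    have "F q = F' q"
    proof (rule similitude_unique[OF \<phi> \<sigma>0, where f = F and f' = F' and x = q and X = "gdom G l" and U = "U (vtgt z)" and u = u
          and g = "path_map G ks" and \<rho> = "path_ratio ks"])
      show "F ` gdom G l \<subseteq> M" using FM by blast
      show "similitude_with_ratio d (gdom G l) F \<sigma>" "similitude_with_ratio d (gdom G l) F' \<sigma>"
        using dF by (simp_all add: similitude_with_ratio_def)
      show "openin mtopology (U (vtgt z))" "u \<in> U (vtgt z)" by (rule U_open[OF zv], rule u)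
      show "path_map G ks ` U (vtgt z) \<subseteq> gdom G l" using path_map_facts(1)[OF gk] U_sub[OF zv] by blast
      show "similitude_with_ratio d (U (vtgt z)) (path_map G ks) (path_ratio ks)"
        using path_map_facts(2)[OF gk] U_sub[OF zv] unfolding similitude_with_ratio_def by blast
      show "0 < path_ratio ks" using path_ratio_bounds(1)[OF gpaths_verts(3)[OF gk]] .
      show "F (path_map G ks p) = F' (path_map G ks p)" if "p \<in> U (vtgt z)" for p
        using FF that U_sub[OF zv] by blast
      have wu: "d (F w) (F u') < r1" using dF(1)[OF wg u'] commute[of w u'] sm nn by simp
      then show "F (path_map G ks u) \<in> mball (F w) r1" using FwM FM(1)[OF u'] by (simp add: u'_def)
      show "F q \<in> mball (F w) r1" using dF(1)[OF wg q] commute[of w q] sm nn FwM FM(1)[OF q] by simp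
      \<comment> \<open>The value \<open>F' q\<close> is compared with \<open>F w\<close> through
        \<open>u'\<close>, where both maps agree.\<close>
      have "d (F w) (F' q) \<le> d (F w) (F u') + d (F' u') (F' q)"
        using triangle[OF FwM FM(1)[OF u'] FM(2)[OF q]] by (simp add: Fu)
      then have "d (F w) (F' q) < r1"
        using dF(1)[OF wg u'] dF(2)[OF u' q] commute[of w u'] commute[of u' q] sm nn by simp
      then show "F' q \<in> mball (F w) r1" using FwM FM(2)[OF q] by simp
      show "q \<in> gdom G l" by (rule q)
    qed
    \<comment> \<open>The map of the prefix \<open>cn\<close> is injective and can be
      cancelled.\<close>
    then have e: "path_map G cn (path_map G a q) = path_map G cn (path_map G b q)"
      by (simp add: F_def F'_def path_map_append)
    show ?thesis by (rule path_map_inj[OF gc _ _ e]) (use path_map_facts(1)[OF ga] path_map_facts(1)[OF gb] q in blast)+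
  qed
  have "vmap x = vmap y"
  proof (rule ext)
    fix q
    show "vmap x q = vmap y q"
      using eq[of q] extendsD(4)[OF a] extendsD(4)[OF b] tgt by (cases "q \<in> gdom G l") (simp_all add: l_def)
  qed
  then show ?thesis using lev src tgt by (intro vertex.expand) simp
qed

end

text \<open>The situation for \<open>lam s > 1\<close>, with the data supplied by
  \<open>expanding_type\<close>.\<close>

locale expanding = irs_gifs where E = E and M = M and d = d and G = G and U = U and \<M> = \<M> and enum = enum
    and Ts = Ts and A = A and E0 = E0 and N = N and R = R and k0 = k0 and W = W
  for E :: "'e::euclidean_space itself" and M :: "'a set" and d and G :: "('v, 'g, 'a) gifs" and U and \<M> and enum
    and Ts A and E0 :: "'a set" and N R k0 W +
  fixes s :: real and m :: nat and S :: real and v0 :: "('v, 'a) vertex"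
  assumes s: "0 \<le> s" and m: "1 \<le> m" and S: "1 < S" and v0: "v0 \<in> VR"
    and chain: "\<And>v. v \<in> VR \<Longrightarrow> ty v = ty v0 \<Longrightarrow> chain_weight m s v (ty v0) = S"
begin

definition good :: "('v, 'a) vertex \<Rightarrow> bool" where "good v \<longleftrightarrow> v \<in> VR \<and> ty v = ty v0"

text \<open>One generation of the subtree that carries the mass: \<open>m\<close> levels, with both
  ends of the expanding type.\<close>

definition Rk :: "(('v, 'a) vertex \<times> ('v, 'a) vertex) set" where
  "Rk = {(v, u). (v, u) \<in> Er ^^ m \<and> good v \<and> good u}"

text \<open>Lower bound for the contraction in one generation, that is, along \<open>m\<close> edges
  with labels of at most \<open>L\<close> letters each.\<close>

definition \<eta> :: real where "\<eta> = (rmin ^ Suc L) ^ m"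

lemma eta_pos: "0 < \<eta>" using rmin by (simp add: \<eta>_def)

lemma good_v0: "good v0" using v0 by (simp add: good_def)

lemma good_type: "good v \<Longrightarrow> same_type d G U \<M> v0 v"
  using same_ty[OF v0] by (simp add: good_def)

lemma good_vertex: "good v \<Longrightarrow> v \<in> vertices G \<M>" by (simp add: good_def VR_iff)

lemma good_rho: "good v \<Longrightarrow> 0 < vrho v" using vertex_facts(2)[OF good_vertex] .

lemma good_target: "good v \<Longrightarrow> vtgt v = vtgt v0"
  using same_type_target[OF good_type good_vertex[OF good_v0]] .

text \<open>A descendant of the same type has the same target, and its ratio is strictly smaller, so
  the label leading to it is not empty. This is the cycle along which maps are contracted in
  \<open>unique_parent\<close>.\<close>

lemma cycle: "\<exists>c. (vtgt v0, c, vtgt v0) \<in> gpaths G \<and> c \<noteq> []"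
proof -
  have "chain_weight m s v0 (ty v0) \<noteq> 0" using chain[OF v0 refl] S by simp
  from chain_weight_nonzero[OF this] obtain u where u: "(v0, u) \<in> Er ^^ m" "ty u = ty v0" by blast
  from Er_relpow(3)[OF u(1) v0] obtain c where c: "extends v0 c u" by blast
  have gu: "good u" using relpow_VR[OF v0 u(1)] u(2) by (simp add: good_def)
  have "vrho u \<le> rmax * vrho v0" by (rule drop[OF m u(1) u(2)[symmetric]])
  also have "\<dots> < vrho v0" using good_rho[OF good_v0] rmax by simp
  finally have "c \<noteq> []" using extendsD(3)[OF c] by auto
  then show ?thesis using extendsD(1)[OF c] good_target[OF gu] by auto
qed

lemma good_unique_parent:
  assumes "good v" "(v, x) \<in> Er\<^sup>*" "(v, y) \<in> Er\<^sup>*" "(x, z) \<in> Er" "(y, z) \<in> Er"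
  shows "x = y"
proof -
  obtain c where c: "(vtgt v0, c, vtgt v0) \<in> gpaths G" "c \<noteq> []" using cycle by blast
  have "v \<in> VR" using assms(1) by (simp add: good_def)
  then show ?thesis by (rule unique_parent[OF _ _ c(2) assms(2-5)]) (use c(1) good_target[OF assms(1)] in simp)
qed

lemma RkD: "(v, u) \<in> Rk \<Longrightarrow> good v" "(v, u) \<in> Rk \<Longrightarrow> good u" "(v, u) \<in> Rk \<Longrightarrow> (v, u) \<in> Er ^^ m"
  by (simp_all add: Rk_def)

lemma Rk_pow: "(v, u) \<in> Rk ^^ n \<Longrightarrow> good v \<Longrightarrow> good u \<and> (v, u) \<in> Er ^^ (n * m)"
proof (induction n arbitrary: u)
  case (Suc n)
  from Suc.prems(1) obtain y where y: "(v, y) \<in> Rk ^^ n" "(y, u) \<in> Rk" by (rule relpow_Suc_E)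
  have "(v, u) \<in> Er ^^ (n * m) O Er ^^ m" using Suc.IH[OF y(1) Suc.prems(2)] RkD(3)[OF y(2)] by blast
  then have "(v, u) \<in> Er ^^ (n * m + m)" by (simp add: relpow_add)
  then show ?case using RkD(2)[OF y(2)] by (simp add: add.commute)
qed simp

lemma Rk_ext:
  assumes "(v, u) \<in> Rk ^^ n" "good v"
  shows "\<exists>ks. extends v ks u" "vlevel u = vlevel v + n * m"
  using Er_relpow(2,3)[of v u "n * m"] Rk_pow[OF assms] assms(2) by (simp_all add: good_def)

lemma finite_Rk: "good v \<Longrightarrow> finite ((Rk ^^ n) `` {v})"
  by (rule finite_subset[OF _ finite_relpow[of "n * m" v]]) (use Rk_pow in blast)

text \<open>Uniqueness of parents forbids that different lines of descent meet again, which keeps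
  the mass additive.\<close>

lemma Rk_disjoint:
  assumes "good v" "(v, x) \<in> Rk" "(v, y) \<in> Rk" "x \<noteq> y"
  shows "(Rk ^^ n) `` {x} \<inter> (Rk ^^ n) `` {y} = {}"
proof (rule ccontr)
  assume "(Rk ^^ n) `` {x} \<inter> (Rk ^^ n) `` {y} \<noteq> {}"
  then obtain z where z: "(x, z) \<in> Rk ^^ n" "(y, z) \<in> Rk ^^ n" by blast
  have e: "(x, z) \<in> Er ^^ (n * m)" "(y, z) \<in> Er ^^ (n * m)"
    using Rk_pow[OF z(1) RkD(2)[OF assms(2)]] Rk_pow[OF z(2) RkD(2)[OF assms(3)]] by simp_all
  have "x = y"
    by (rule relpow_meet[OF good_unique_parent[OF assms(1)] relpow_imp_rtrancl[OF RkD(3)[OF assms(2)]]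
          relpow_imp_rtrancl[OF RkD(3)[OF assms(3)]] e])
  then show False using assms(4) by simp
qed

lemma Rk_sum_step:
  assumes v: "good v"
  shows "(\<Sum>u\<in>Rk `` {v}. (vrho u / vrho v) powr s) = S"
proof -
  have vVR: "v \<in> VR" "ty v = ty v0" using v by (simp_all add: good_def)
  have "Rk `` {v} = {u \<in> (Er ^^ m) `` {v}. ty u = ty v0}"
    using v relpow_VR[OF vVR(1)] by (auto simp: Rk_def good_def)
  then show ?thesis
    using chain_weight_eq_sum[OF vVR(1) good_unique_parent[OF v], where m = m and s = s and t = "ty v0"] chain[OF vVR]
    by simp
qed

text \<open>By disjointness the weights below the children add up, so each generation multiplies the
  total by \<open>S\<close>. After division by \<open>S ^ n\<close> the total mass is 1.\<close>

lemma Rk_sum: "good v \<Longrightarrow> (\<Sum>u\<in>(Rk ^^ n) `` {v}. (vrho u / vrho v) powr s) = S ^ n"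
proof (induction n arbitrary: v)
  case 0
  then show ?case using good_rho[OF 0] by simp
next
  case (Suc n)
  have fin: "finite (Rk `` {v})" using finite_Rk[OF Suc.prems, of 1] by simp
  have good: "good y" if "y \<in> Rk `` {v}" for y using that RkD(2) by blast
  have "(\<Sum>u\<in>(Rk ^^ Suc n) `` {v}. (vrho u / vrho v) powr s) =
      (\<Sum>y\<in>Rk `` {v}. \<Sum>u\<in>(Rk ^^ n) `` {y}. (vrho u / vrho v) powr s)"
    unfolding relpow_Suc_Image
  proof (rule sum.UNION_disjoint[OF fin])
    show "\<forall>i\<in>Rk `` {v}. finite ((Rk ^^ n) `` {i})" using finite_Rk good by blast
    show "\<forall>i\<in>Rk `` {v}. \<forall>j\<in>Rk `` {v}. i \<noteq> j \<longrightarrow> (Rk ^^ n) `` {i} \<inter> (Rk ^^ n) `` {j} = {}"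
      using Rk_disjoint[OF Suc.prems] by blast
  qed
  also have "\<dots> = (\<Sum>y\<in>Rk `` {v}. (vrho y / vrho v) powr s * S ^ n)"
  proof (rule sum.cong[OF refl])
    fix y assume y: "y \<in> Rk `` {v}"
    have "(vrho u / vrho v) powr s = (vrho y / vrho v) powr s * (vrho u / vrho y) powr s"
      if "u \<in> (Rk ^^ n) `` {y}" for u
    proof -
      have "good u" using that Rk_pow good[OF y] by blast
      then show ?thesis using good_rho[OF good[OF y]] good_rho[OF Suc.prems] good_rho[of u] by (simp flip: powr_mult)
    qed
    then have "(\<Sum>u\<in>(Rk ^^ n) `` {y}. (vrho u / vrho v) powr s) =
        (vrho y / vrho v) powr s * (\<Sum>u\<in>(Rk ^^ n) `` {y}. (vrho u / vrho y) powr s)"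
      by (simp add: sum_distrib_left)
    then show "(\<Sum>u\<in>(Rk ^^ n) `` {y}. (vrho u / vrho v) powr s) = (vrho y / vrho v) powr s * S ^ n"
      using Suc.IH[OF good[OF y]] by simp
  qed
  also have "\<dots> = S ^ Suc n" unfolding sum_distrib_right[symmetric] Rk_sum_step[OF Suc.prems] by simp
  finally show ?case .
qed

lemma Rk_drop: "(v, u) \<in> Rk ^^ n \<Longrightarrow> good v \<Longrightarrow> vrho u \<le> rmax ^ n * vrho v"
proof (induction n arbitrary: u)
  case (Suc n)
  from Suc.prems(1) obtain y where y: "(v, y) \<in> Rk ^^ n" "(y, u) \<in> Rk" by (rule relpow_Suc_E)
  have "vrho u \<le> rmax * vrho y"
    by (rule drop[OF m RkD(3)[OF y(2)]]) (use RkD(1,2)[OF y(2)] in \<open>simp add: good_def\<close>)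
  also have "\<dots> \<le> rmax * (rmax ^ n * vrho v)" using Suc.IH[OF y(1) Suc.prems(2)] rmax by simp
  finally show ?case by simp
qed simp

lemma Rk_lower: "(v, u) \<in> Rk \<Longrightarrow> \<eta> * vrho v \<le> vrho u"
  unfolding \<eta>_def using rho_relpow_lower[OF RkD(3)] .

lemma Rk_pow_lower: "(v, u) \<in> Rk ^^ n \<Longrightarrow> \<eta> ^ n * vrho v \<le> vrho u"
proof (induction n arbitrary: u)
  case (Suc n)
  from Suc.prems obtain y where y: "(v, y) \<in> Rk ^^ n" "(y, u) \<in> Rk" by (rule relpow_Suc_E)
  have "\<eta> * (\<eta> ^ n * vrho v) \<le> \<eta> * vrho y" using Suc.IH[OF y(1)] eta_pos by simp
  then show ?case using Rk_lower[OF y(2)] by simp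
qed simp

text \<open>The weights of the generation sum up to \<open>S ^ n\<close>, and each of them is at
  least \<open>(\<eta> ^ n) powr s\<close>.\<close>

lemma Rk_card:
  assumes v: "good v"
  shows "real (card ((Rk ^^ n) `` {v})) \<le> (S / \<eta> powr s) ^ n"
proof -
  have "real (card ((Rk ^^ n) `` {v})) * (\<eta> ^ n) powr s = (\<Sum>u\<in>(Rk ^^ n) `` {v}. (\<eta> ^ n) powr s)" by simp
  also have "\<dots> \<le> (\<Sum>u\<in>(Rk ^^ n) `` {v}. (vrho u / vrho v) powr s)"
  proof (rule sum_mono)
    fix u assume "u \<in> (Rk ^^ n) `` {v}"
    then have "\<eta> ^ n * vrho v \<le> vrho u" using Rk_pow_lower by blast
    then have "\<eta> ^ n \<le> vrho u / vrho v" using good_rho[OF v] by (simp add: field_simps)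
    then show "(\<eta> ^ n) powr s \<le> (vrho u / vrho v) powr s" using eta_pos s by (intro powr_mono2) auto
  qed
  also have "\<dots> = S ^ n" by (rule Rk_sum[OF v])
  finally have "real (card ((Rk ^^ n) `` {v})) * (\<eta> powr s) ^ n \<le> S ^ n"
    using eta_pos by (simp add: powr_power flip: powr_realpow) (simp add: powr_powr mult.commute)
  moreover have "0 < (\<eta> powr s) ^ n" using eta_pos by simp
  ultimately show ?thesis by (simp add: power_divide pos_le_divide_eq)
qed


lemma extends_image_U: "extends v ks u \<Longrightarrow> vmap u ` U (vtgt u) \<subseteq> vmap v ` U (vtgt v)"
proof
  fix q assume e: "extends v ks u" and "q \<in> vmap u ` U (vtgt u)"
  then obtain p where p: "p \<in> U (vtgt u)" "q = vmap u p" by blast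
  have "p \<in> gdom G (vtgt u)" using p(1) U_sub[OF gpaths_verts(2)[OF extendsD(1)[OF e]]] by blast
  then have "q = vmap v (path_map G ks p)" using extends_apply[OF e] p(2) by simp
  moreover have "path_map G ks p \<in> U (vtgt v)" using path_map_facts(3)[OF extendsD(1)[OF e]] p(1) by blast
  ultimately show "q \<in> vmap v ` U (vtgt v)" by blast
qed

text \<open>A crude common bound for the ratios of neighbors relative to that of \<open>v0\<close>:
  the sum instead of the maximum, plus 1 for positivity.\<close>

definition nratio :: real where
  "nratio = (\<Sum>u\<in>neighbors G U \<M> v0. vrho u / vrho v0) + 1"

lemma neighbor_vertex: "u \<in> neighbors G U \<M> v \<Longrightarrow> u \<in> vertices G \<M>"
  unfolding neighbors_def vertices_def by blast

lemma nratio_pos: "0 < nratio"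
proof -
  have "0 \<le> (\<Sum>u\<in>neighbors G U \<M> v0. vrho u / vrho v0)"
    by (intro sum_nonneg divide_nonneg_nonneg less_imp_le[OF vertex_facts(2)] neighbor_vertex good_vertex good_v0)
  then show ?thesis by (simp add: nratio_def)
qed

text \<open>The similitude of the equivalence with \<open>v0\<close> multiplies the ratios of all
  neighbors by the same factor, as seen on two points of the open sets. So the comparison of ratios
  carries over from \<open>v0\<close>.\<close>

lemma neighbor_facts:
  assumes v: "good v"
  shows "card (neighbors G U \<M> v) = card (neighbors G U \<M> v0)"
    and "u \<in> neighbors G U \<M> v \<Longrightarrow> vrho u \<le> nratio * vrho v"
proof -
  note t = good_type[OF v, unfolded same_type_def]
  show "card (neighbors G U \<M> v) = card (neighbors G U \<M> v0)" using t by simp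
  assume u: "u \<in> neighbors G U \<M> v"
  let ?N = "neighbors G U \<M>"
  from conjunct2[OF t] obtain \<tau> g where tg: "(\<exists>r>0. similitude_with_ratio d (\<Union>u\<in>?N v0. vmap u ` U (vtgt u)) \<tau> r) \<and>
        bij_betw g (?N v0) (?N v) \<and> g v0 = v \<and>
        (\<forall>u\<in>?N v0. (\<forall>x\<in>U (vtgt u). vmap (g u) x = \<tau> (vmap u x)) \<and> vtgt (g u) = vtgt u \<and>
           (\<forall>l\<ge>1. \<forall>es j. (vtgt u, es, j) \<in> gpaths G \<longrightarrow>
              (extend_vertex G u es j l \<in> vertices_at G \<M> (vlevel u + l) \<longleftrightarrow>
               extend_vertex G (g u) es j l \<in> vertices_at G \<M> (vlevel (g u) + l))))"
    by (elim exE) (rule that)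
  from conjunct1[OF tg] obtain r where r: "0 < r" "similitude_with_ratio d (\<Union>u\<in>?N v0. vmap u ` U (vtgt u)) \<tau> r" by blast
  have g: "bij_betw g (?N v0) (?N v)" "g v0 = v" using tg by simp_all
  have gu: "\<forall>x\<in>U (vtgt w). vmap (g w) x = \<tau> (vmap w x)" "vtgt (g w) = vtgt w" if "w \<in> ?N v0" for w
    using tg that by simp_all
  have ratio: "vrho (g w) = r * vrho w" if w: "w \<in> ?N v0" for w
  proof -
    have wv: "w \<in> vertices G \<M>" by (rule neighbor_vertex[OF w])
    have "g w \<in> ?N v" using g(1) w by (auto simp: bij_betw_def)
    then have gv: "g w \<in> vertices G \<M>" by (rule neighbor_vertex)
    from two_points[OF vertex_facts(1)[OF wv]] obtain x y where
      xy: "x \<in> gdom G (vtgt w)" "y \<in> gdom G (vtgt w)" "x \<noteq> y" "x \<in> U (vtgt w)" "y \<in> U (vtgt w)" "0 < d x y" .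
    have "vrho (g w) * d x y = d (vmap (g w) x) (vmap (g w) y)"
      using vertex_facts(3)[OF gv] xy gu(2)[OF w] unfolding similitude_with_ratio_def by simp
    also have "\<dots> = d (\<tau> (vmap w x)) (\<tau> (vmap w y))" using gu(1)[OF w] xy by simp
    also have "\<dots> = r * d (vmap w x) (vmap w y)"
      using r(2) w xy(4,5) unfolding similitude_with_ratio_def by blast
    also have "d (vmap w x) (vmap w y) = vrho w * d x y"
      using vertex_facts(3)[OF wv] xy unfolding similitude_with_ratio_def by simp
    finally have "vrho (g w) * d x y = (r * vrho w) * d x y" by (simp only: mult.assoc)
    then show ?thesis using xy(6) by (simp only: mult_cancel_right) auto
  qed
  have "u \<in> g ` ?N v0" using g(1) u by (simp add: bij_betw_def)
  then obtain w where w: "w \<in> ?N v0" "u = g w" by blast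
  have "vrho w / vrho v0 \<le> (\<Sum>u\<in>?N v0. vrho u / vrho v0)"
    by (rule member_le_sum[OF w(1) _ finite_neighbors])
      (intro divide_nonneg_nonneg less_imp_le[OF vertex_facts(2)], auto intro: neighbor_vertex good_vertex good_v0)
  then have "vrho w / vrho v0 \<le> nratio" by (simp add: nratio_def)
  then have "vrho w \<le> nratio * vrho v0" using good_rho[OF good_v0] by (simp only: pos_divide_le_eq)
  then have "r * vrho w \<le> r * (nratio * vrho v0)" using r(1) by (intro mult_left_mono) auto
  then show "vrho u \<le> nratio * vrho v"
    using ratio[OF w(1)] ratio[OF self_neighbor[OF good_vertex[OF good_v0]]] w(2) g(2) by (simp add: mult_ac)
qed

section \<open>Overlaps, stopping and the mass of balls\<close>

abbreviation D :: "nat \<Rightarrow> ('v, 'a) vertex set" where "D n \<equiv> (Rk ^^ n) `` {v0}"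

lemma D_good: "v \<in> D n \<Longrightarrow> good v"
  using Rk_pow good_v0 by blast

lemma finite_D: "finite (D n)"
  by (rule finite_Rk[OF good_v0])

text \<open>Neighbors have comparable ratios, and there are boundedly many of them. So a bounded number of
  generations below a bounded number of vertices contains all of the vertices whose image contains \<open>z\<close>.\<close>
lemma multiplicity:
  assumes g: "rmax ^ g * nratio < \<eta>" and \<delta>: "0 < \<delta>" and fin: "finite T"
    and T: "\<And>a v. (a, v) \<in> T \<Longrightarrow> v \<in> D a \<and> \<eta> * \<delta> \<le> vrho v \<and> vrho v \<le> \<delta> \<and> z \<in> vmap v ` U (vtgt v)"
  shows "real (card T) \<le> real (card (neighbors G U \<M> v0)) * (\<Sum>h<g. (S / \<eta> powr s) ^ h)"
proof (cases "T = {}")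
  case True
  have "0 \<le> (\<Sum>h<g. (S / \<eta> powr s) ^ h)" using S by (intro sum_nonneg zero_le_power) auto
  then show ?thesis using True by simp
next
  case False
  \<comment> \<open>The earliest generation in \<open>T\<close>. The ancestors there of all members
    have images containing \<open>z\<close>, hence are neighbors of \<open>v1\<close> and few in
    number.\<close>
  define a0 where "a0 = Min (fst ` T)"
  have "a0 \<in> fst ` T" unfolding a0_def using False fin by (intro Min_in) auto
  then obtain v1 where v1: "(a0, v1) \<in> T" by force
  have a0: "a0 \<le> a" if "(a, v) \<in> T" for a v
    unfolding a0_def using that fin by (intro Min_le) force+
  have v1D: "v1 \<in> D a0" and v1\<delta>: "vrho v1 \<le> \<delta>" and v1z: "z \<in> vmap v1 ` U (vtgt v1)" using T[OF v1] by simp_all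
  note v1g = D_good[OF v1D]
  let ?I = "neighbors G U \<M> v1 \<inter> D a0"
  have "T \<subseteq> (\<Union>v'\<in>?I. \<Union>h\<in>{..<g}. Pair (a0 + h) ` ((Rk ^^ h) `` {v'}))"
  proof
    fix p assume "p \<in> T"
    then obtain a v where p: "p = (a, v)" "(a, v) \<in> T" by (cases p) simp
    have v: "v \<in> D a" "\<eta> * \<delta> \<le> vrho v" "vrho v \<le> \<delta>" "z \<in> vmap v ` U (vtgt v)" using T[OF p(2)] by simp_all
    define h where "h = a - a0"
    have ah: "a = a0 + h" using a0[OF p(2)] by (simp add: h_def)
    have "(v0, v) \<in> Rk ^^ (a0 + h)" using v(1) ah by simp
    from relpow_imageD[OF this] obtain v' where v': "(v0, v') \<in> Rk ^^ a0" "(v', v) \<in> Rk ^^ h" by blast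
    have v'D: "v' \<in> D a0" using v'(1) by blast
    note v'g = D_good[OF v'D]
    obtain ks where "extends v' ks v" using Rk_ext(1)[OF v'(2) v'g] ..
    from extends_image_U[OF this] have z': "z \<in> vmap v' ` U (vtgt v')" using v(4) by blast
    have "(v0, v1) \<in> Rk ^^ a0" using v1D by simp
    note e1 = Rk_ext[OF this good_v0]
    note e' = Rk_ext[OF v'(1) good_v0]
    obtain ks1 where k1: "extends v0 ks1 v1" using e1(1) ..
    obtain ks' where k': "extends v0 ks' v'" using e'(1) ..
    have "vlevel v' = vlevel v1" using e1(2) e'(2) by simp
    moreover have "vsrc v' = vsrc v1" using extendsD(2)[OF k1] extendsD(2)[OF k'] by simp
    moreover have "v' \<in> vertices_at G \<M> (vlevel v')" using good_vertex[OF v'g] by (simp only: vertices_iff)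
    moreover have "vmap v1 ` U (vtgt v1) \<inter> vmap v' ` U (vtgt v') \<noteq> {}" using z' v1z by blast
    ultimately have nb: "v' \<in> neighbors G U \<M> v1" unfolding neighbors_def by simp
    \<comment> \<open>Since the ancestor the ratio has been multiplied by at most
      \<open>rmax ^ h\<close>, yet it is still comparable to \<open>\<delta>\<close>; this bounds
      \<open>h\<close>.\<close>
    have "\<eta> * \<delta> \<le> rmax ^ h * vrho v'" using v(2) Rk_drop[OF v'(2) v'g] by linarith
    also have "\<dots> \<le> rmax ^ h * (nratio * \<delta>)"
    proof (rule mult_left_mono)
      have "vrho v' \<le> nratio * vrho v1" by (rule neighbor_facts(2)[OF v1g nb])
      also have "\<dots> \<le> nratio * \<delta>" using v1\<delta> nratio_pos by simp
      finally show "vrho v' \<le> nratio * \<delta>" .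
    qed (use rmax in simp)
    finally have le: "\<eta> \<le> rmax ^ h * nratio" using \<delta> by simp
    have "h < g"
    proof (rule ccontr)
      assume "\<not> h < g"
      then have "rmax ^ h \<le> rmax ^ g" using rmax by (intro power_decreasing) auto
      then have "rmax ^ h * nratio \<le> rmax ^ g * nratio" using nratio_pos by simp
      then show False using le g by linarith
    qed
    then have "p \<in> Pair (a0 + h) ` ((Rk ^^ h) `` {v'})" "h \<in> {..<g}" "v' \<in> ?I" using p(1) ah v'(2) nb v'D by auto
    then show "p \<in> (\<Union>v'\<in>?I. \<Union>h\<in>{..<g}. Pair (a0 + h) ` ((Rk ^^ h) `` {v'}))" by blast
  qed
  moreover have finI: "finite ?I" using finite_neighbors by blast
  moreover have gI: "good v'" if "v' \<in> ?I" for v' using that D_good by blast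
  moreover have "finite (\<Union>v'\<in>?I. \<Union>h\<in>{..<g}. Pair (a0 + h) ` ((Rk ^^ h) `` {v'}))"
    using finI finite_Rk gI by (intro finite_UN_I finite_imageI finite_lessThan) blast+
  ultimately have "card T \<le> card (\<Union>v'\<in>?I. \<Union>h\<in>{..<g}. Pair (a0 + h) ` ((Rk ^^ h) `` {v'}))"
    by (intro card_mono)
  also have "\<dots> \<le> (\<Sum>v'\<in>?I. card (\<Union>h\<in>{..<g}. Pair (a0 + h) ` ((Rk ^^ h) `` {v'})))" by (rule card_UN_le[OF finI])
  also have "\<dots> \<le> (\<Sum>v'\<in>?I. \<Sum>h\<in>{..<g}. card (Pair (a0 + h) ` ((Rk ^^ h) `` {v'})))"
    by (intro sum_mono card_UN_le finite_lessThan)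
  finally have "card T \<le> (\<Sum>v'\<in>?I. \<Sum>h\<in>{..<g}. card (Pair (a0 + h) ` ((Rk ^^ h) `` {v'})))" .
  then have "real (card T) \<le> real (\<Sum>v'\<in>?I. \<Sum>h\<in>{..<g}. card (Pair (a0 + h) ` ((Rk ^^ h) `` {v'})))"
    by (simp only: of_nat_le_iff)
  also have "\<dots> = (\<Sum>v'\<in>?I. \<Sum>h<g. real (card (Pair (a0 + h) ` ((Rk ^^ h) `` {v'}))))" by (simp only: of_nat_sum)
  also have "\<dots> \<le> (\<Sum>v'\<in>?I. \<Sum>h<g. (S / \<eta> powr s) ^ h)"
  proof (intro sum_mono)
    fix v' h assume "v' \<in> ?I"
    have "card (Pair (a0 + h) ` ((Rk ^^ h) `` {v'})) = card ((Rk ^^ h) `` {v'})"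
      by (rule card_image) (simp add: inj_on_def)
    then show "real (card (Pair (a0 + h) ` ((Rk ^^ h) `` {v'}))) \<le> (S / \<eta> powr s) ^ h"
      using Rk_card[OF gI[OF \<open>v' \<in> ?I\<close>], of h] by (simp only:)
  qed
  also have "\<dots> = real (card ?I) * (\<Sum>h<g. (S / \<eta> powr s) ^ h)" by simp
  also have "\<dots> \<le> real (card (neighbors G U \<M> v0)) * (\<Sum>h<g. (S / \<eta> powr s) ^ h)"
  proof (rule mult_right_mono)
    have "card ?I \<le> card (neighbors G U \<M> v1)" using finite_neighbors by (intro card_mono) auto
    then show "real (card ?I) \<le> real (card (neighbors G U \<M> v0))" using neighbor_facts(1)[OF v1g] by simp
    show "0 \<le> (\<Sum>h<g. (S / \<eta> powr s) ^ h)" using S by (intro sum_nonneg zero_le_power) auto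
  qed
  finally show ?thesis .
qed

text \<open>Take the first vertex on the path with ratio at most \<open>\<delta>\<close>: its
  predecessor has a ratio above \<open>\<delta>\<close>, and one generation contracts at most by
  \<open>\<eta>\<close>.\<close>

lemma stopping:
  assumes "(v, u) \<in> Rk ^^ n" "\<delta> < vrho v" "vrho u \<le> \<delta>"
  shows "\<exists>a x. a \<le> n \<and> (v, x) \<in> Rk ^^ a \<and> (x, u) \<in> Rk ^^ (n - a) \<and> \<eta> * \<delta> \<le> vrho x \<and> vrho x \<le> \<delta>"
  using assms
proof (induction n arbitrary: v)
  case (Suc n)
  from Suc.prems(1) obtain y where y: "(v, y) \<in> Rk" "(y, u) \<in> Rk ^^ n" by (rule relpow_Suc_E2)
  show ?case
  proof (cases "vrho y \<le> \<delta>")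
    case True
    have "\<eta> * \<delta> \<le> \<eta> * vrho v" using Suc.prems(2) eta_pos by simp
    then have "\<eta> * \<delta> \<le> vrho y" using Rk_lower[OF y(1)] by linarith
    moreover have "(v, y) \<in> Rk ^^ 1" using y(1) by simp
    ultimately show ?thesis using y(2) True by (intro exI[of _ 1] exI[of _ y]) simp
  next
    case False
    then have "\<delta> < vrho y" by simp
    from Suc.IH[OF y(2) this Suc.prems(3)] obtain a x where
      ax: "a \<le> n" "(y, x) \<in> Rk ^^ a" "(x, u) \<in> Rk ^^ (n - a)" "\<eta> * \<delta> \<le> vrho x" "vrho x \<le> \<delta>" by (elim exE conjE)
    have "(v, x) \<in> Rk ^^ Suc a" by (rule relpow_Suc_I2[OF y(1) ax(2)])
    then show ?thesis using ax by (intro exI[of _ "Suc a"] exI[of _ x]) simp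
  qed
qed simp

text \<open>Weights of total mass 1 on generation \<open>n\<close>, the finite substitute for a
  limit measure.\<close>

definition wt :: "nat \<Rightarrow> ('v, 'a) vertex \<Rightarrow> real" where
  "wt n u = (vrho u / vrho v0) powr s / S ^ n"

lemma wt_nonneg: "0 \<le> wt n u" using S by (simp add: wt_def)

lemma sum_wt: "(\<Sum>u\<in>D n. wt n u) = 1"
  using Rk_sum[OF good_v0, of n] S unfolding wt_def sum_divide_distrib[symmetric] by simp

text \<open>The mass below \<open>v\<close> is the \<open>s\<close>-th power of its ratio relative
  to \<open>v0\<close>, divided by \<open>S ^ a\<close>; as \<open>S > 1\<close>, the division only
  makes it smaller.\<close>

lemma sum_wt_le:
  assumes v: "v \<in> D a" and a: "a \<le> n" and \<delta>: "vrho v \<le> \<delta>"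
  shows "(\<Sum>u\<in>(Rk ^^ (n - a)) `` {v}. wt n u) \<le> (\<delta> / vrho v0) powr s"
proof -
  note vg = D_good[OF v]
  have "wt n u = (vrho v / vrho v0) powr s / S ^ n * (vrho u / vrho v) powr s" if "u \<in> (Rk ^^ (n - a)) `` {v}" for u
  proof -
    have "good u" using that Rk_pow vg by blast
    then show ?thesis unfolding wt_def using good_rho[OF vg] good_rho[OF good_v0] good_rho[of u] by (simp flip: powr_mult)
  qed
  then have "(\<Sum>u\<in>(Rk ^^ (n - a)) `` {v}. wt n u) =
      (vrho v / vrho v0) powr s / S ^ n * (\<Sum>u\<in>(Rk ^^ (n - a)) `` {v}. (vrho u / vrho v) powr s)"
    by (simp add: sum_distrib_left)
  also have "\<dots> = (vrho v / vrho v0) powr s * (S ^ (n - a) / S ^ n)" using Rk_sum[OF vg] by simp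
  also have "\<dots> \<le> (\<delta> / vrho v0) powr s * 1"
  proof (rule mult_mono)
    show "(vrho v / vrho v0) powr s \<le> (\<delta> / vrho v0) powr s"
      using \<delta> s good_rho[OF vg] good_rho[OF good_v0] by (intro powr_mono2 divide_right_mono) auto
    have "S ^ (n - a) \<le> S ^ n" using S by (intro power_increasing) auto
    then show "S ^ (n - a) / S ^ n \<le> 1" using S by simp
  qed (use S in auto)
  finally show ?thesis by simp
qed


text \<open>The vertices of ratio about \<open>\<delta>\<close> above the points in a ball of radius \<open>\<delta>\<close> have images containing
  balls of radius comparable to \<open>\<delta>\<close>. Such a ball contains a point of a fixed net of bounded size, and
  every point of the net belongs to boundedly many images.\<close>
lemma mass_estimate:
  assumes w0: "w0 \<in> W (vtgt v0)"
  shows "\<exists>C1 \<delta>0. 0 < C1 \<and> 0 < \<delta>0 \<and> (\<forall>c\<in>E0. \<forall>\<delta> n. 0 < \<delta> \<and> \<delta> \<le> \<delta>0 \<and> (\<forall>u\<in>D n. vrho u \<le> \<delta>) \<longrightarrow>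
    (\<Sum>u\<in>{u \<in> D n. vmap u w0 \<in> mball c \<delta>}. wt n u) \<le> C1 * \<delta> powr s)"
proof -
  let ?j = "vtgt v0"
  have jv: "?j \<in> verts (gr G)" by (rule vertex_facts(1)[OF good_vertex[OF good_v0]])
  obtain x0 where x0: "x0 \<in> U ?j" using U_nonempty[OF jv] by blast
  have x0g: "x0 \<in> gdom G ?j" using x0 U_sub[OF jv] by blast
  have w0g: "w0 \<in> gdom G ?j" using w0 W_sub[OF jv] by blast
  have x0M: "x0 \<in> M" and w0M: "w0 \<in> M" using x0g w0g gdom_sub[OF jv] by blast+
  obtain e where e: "0 < e" "mball x0 e \<subseteq> U ?j" using U_open[OF jv] x0 unfolding openin_mtopology by blast
  from exists_flat_chart[OF x0M] obtain \<phi>0 :: "'a \<Rightarrow> 'e" and r' where \<phi>': "flat_chart \<phi>0 x0 r'" .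
  have r': "0 < r'" using \<phi>' by (simp add: flat_chart_def)
  \<comment> \<open>The radius of a flat ball in the open set of the target vertex; the images of
    this ball under vertex maps of small ratio are again balls.\<close>
  define r0 where "r0 = min e r'"
  have r0: "0 < r0" using e(1) r' by (simp add: r0_def)
  have chart0: "flat_chart \<phi>0 x0 r0" by (rule flat_chart_smaller[OF \<phi>' r0]) (simp add: r0_def)
  have "mball x0 r0 \<subseteq> mball x0 e" by (rule mball_subset_concentric) (simp add: r0_def)
  then have ball0: "mball x0 r0 \<subseteq> U ?j" using e(2) by (rule order_trans)
  have ballg: "mball x0 r0 \<subseteq> gdom G ?j" using ball0 U_sub[OF jv] by (rule order_trans)
  from E0_bounded[OF x0M] obtain B0 where B0: "0 < B0" "\<And>y. y \<in> E0 \<Longrightarrow> d x0 y \<le> B0" by blast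
  \<comment> \<open>Bounds the distance from \<open>x0\<close> to the prolongations of
    \<open>w0\<close>: these lie in \<open>E0\<close> if the prolonging path is nonempty, and
    otherwise are \<open>w0\<close> itself.\<close>
  define B where "B = B0 + d x0 w0"
  have B: "0 < B" "d x0 w0 \<le> B" "B0 \<le> B" using B0(1) nonneg[of x0 w0] by (simp_all add: B_def add_pos_nonneg)
  \<comment> \<open>A point of the image at distance below \<open>\<delta>\<close> from
    \<open>c\<close> puts the centre of the image ball within \<open>\<delta> + \<delta> * B\<close>
    of \<open>c\<close>.\<close>
  define a where "a = B + 1"
  have a: "0 < a" using B by (simp add: a_def)
  have "\<exists>r>0. \<forall>p\<in>E0. \<forall>q\<in>mball p r. \<exists>\<phi>::'a \<Rightarrow> 'e. flat_chart \<phi> q r"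
    by (rule uniformly_flat[OF irs_facts(3)]) blast
  then obtain r1 where r1: "0 < r1" "\<forall>p\<in>E0. \<forall>q\<in>mball p r1. \<exists>\<phi>::'a \<Rightarrow> 'e. flat_chart \<phi> q r1" by blast
  \<comment> \<open>The spacing of the net is the guaranteed radius of the image balls, both
    relative to \<open>\<delta>\<close>.\<close>
  have \<eta>r: "0 < \<eta> * r0" using eta_pos r0 by simp
  have "\<exists>P::nat. \<forall>D y. \<forall>\<phi>::'a \<Rightarrow> 'e. 0 < D \<longrightarrow> flat_chart \<phi> y (2 * a * D) \<longrightarrow>
    (\<exists>Z\<subseteq>M. finite Z \<and> card Z \<le> P \<and> (\<forall>q\<in>mball y (a * D). \<exists>z\<in>Z. d z q < (\<eta> * r0) * D))"
    by (rule uniform_nets[OF a \<eta>r]) blast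
  then obtain P :: nat where P: "\<forall>D y. \<forall>\<phi>::'a \<Rightarrow> 'e. 0 < D \<longrightarrow> flat_chart \<phi> y (2 * a * D) \<longrightarrow>
    (\<exists>Z\<subseteq>M. finite Z \<and> card Z \<le> P \<and> (\<forall>q\<in>mball y (a * D). \<exists>z\<in>Z. d z q < (\<eta> * r0) * D))" ..
  obtain g :: nat where g': "rmax ^ g < \<eta> / nratio"
    using real_arch_pow_inv[OF divide_pos_pos[OF eta_pos nratio_pos] rmax(2)] by blast
  have g: "rmax ^ g * nratio < \<eta>" using g' nratio_pos by (simp add: pos_less_divide_eq)
  define B' where "B' = real (card (neighbors G U \<M> v0)) * (\<Sum>h<g. (S / \<eta> powr s) ^ h)"
  have "0 \<le> (\<Sum>h<g. (S / \<eta> powr s) ^ h)" using S by (intro sum_nonneg zero_le_power) auto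
  then have B': "0 \<le> B'" by (simp add: B'_def)
  \<comment> \<open>The first bound keeps all balls involved within flat balls of radius
    \<open>r1\<close>; the second makes the ratio of \<open>v0\<close> exceed
    \<open>\<delta>\<close>, so that a line of descent starts above the stopping scale.\<close>
  define \<delta>0 where "\<delta>0 = min (r1 / (2 * a + r0)) (vrho v0 / 2)"
  have pos: "0 < 2 * a + r0" using a r0 by simp
  have \<rho>0: "0 < vrho v0" by (rule good_rho[OF good_v0])
  have \<delta>0: "0 < \<delta>0" using divide_pos_pos[OF r1(1) pos] \<rho>0 by (simp only: \<delta>0_def min_less_iff_conj) simp
  define C1 where "C1 = real P * B' * (1 / vrho v0) powr s + 1"
  have "0 \<le> real P * B' * (1 / vrho v0) powr s" using B' by simp
  then have C1: "0 < C1" by (simp add: C1_def)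
  have "(\<Sum>u\<in>{u \<in> D n. vmap u w0 \<in> mball c \<delta>}. wt n u) \<le> C1 * \<delta> powr s"
    if c: "c \<in> E0" and \<delta>: "0 < \<delta>" "\<delta> \<le> \<delta>0" and n: "\<forall>u\<in>D n. vrho u \<le> \<delta>" for c \<delta> n
  proof -
    have cM: "c \<in> M" using c E0_M by blast
    have "\<delta> \<le> r1 / (2 * a + r0)" using \<delta>(2) by (simp add: \<delta>0_def)
    then have "\<delta> * (2 * a + r0) \<le> r1" using pos by (simp only: pos_le_divide_eq)
    then have small: "2 * a * \<delta> + \<delta> * r0 \<le> r1" by (simp add: algebra_simps)
    have p1: "0 < a * \<delta>" "0 < \<delta> * r0" using a \<delta>(1) r0 by simp_all
    have "c \<in> mball c r1" using cM r1(1) by simp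
    then obtain \<phi>c :: "'a \<Rightarrow> 'e" where \<phi>c: "flat_chart \<phi>c c r1" using r1(2) c by blast
    have "0 < 2 * a * \<delta>" "2 * a * \<delta> \<le> r1" using p1 small by linarith+
    then have "flat_chart \<phi>c c (2 * a * \<delta>)" by (rule flat_chart_smaller[OF \<phi>c])
    from P[THEN spec, THEN spec, THEN spec, THEN mp, THEN mp, OF \<delta>(1) this]
    obtain Z where Z: "Z \<subseteq> M" "finite Z" "card Z \<le> P"
      "\<forall>q\<in>mball c (a * \<delta>). \<exists>z\<in>Z. d z q < (\<eta> * r0) * \<delta>" by (elim exE conjE) (rule that)
    define Hit where "Hit = {u \<in> D n. vmap u w0 \<in> mball c \<delta>}"
    \<comment> \<open>All vertices with ratio about \<open>\<delta>\<close> above a vertex of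
      \<open>Hit\<close>. A line of descent may contribute several of them, which only enlarges the
      upper bound.\<close>
    define Stop where "Stop = {(k, v). k \<le> n \<and> v \<in> D k \<and> \<eta> * \<delta> \<le> vrho v \<and> vrho v \<le> \<delta> \<and> (\<exists>u\<in>Hit. (v, u) \<in> Rk ^^ (n - k))}"
    have StopD: "k \<le> n" "v \<in> D k" "\<eta> * \<delta> \<le> vrho v" "vrho v \<le> \<delta>" "\<exists>u\<in>Hit. (v, u) \<in> Rk ^^ (n - k)"
      if "(k, v) \<in> Stop" for k v using that by (simp_all add: Stop_def)
    have "Stop \<subseteq> (SIGMA k:{..n}. D k)" using StopD(1,2) by auto
    then have finS: "finite Stop" by (rule finite_subset) (intro finite_SigmaI finite_atMost finite_D)
    let ?under = "\<lambda>p. (Rk ^^ (n - fst p)) `` {snd p}"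
    have fin_under: "finite (?under p)" if "p \<in> Stop" for p
    proof -
      have "snd p \<in> D (fst p)" by (rule StopD(2)) (simp only: prod.collapse that)
      then show ?thesis by (rule finite_Rk[OF D_good])
    qed
    have Hsub: "Hit \<subseteq> (\<Union>p\<in>Stop. ?under p)"
    proof
      fix u assume u: "u \<in> Hit"
      then have uD: "(v0, u) \<in> Rk ^^ n" "vrho u \<le> \<delta>" using n by (auto simp: Hit_def)
      have "\<delta> < vrho v0" using \<delta>(2) \<rho>0 by (simp add: \<delta>0_def)
      from stopping[OF uD(1) this uD(2)] obtain k x where
        x: "k \<le> n" "(v0, x) \<in> Rk ^^ k" "(x, u) \<in> Rk ^^ (n - k)" "\<eta> * \<delta> \<le> vrho x" "vrho x \<le> \<delta>" by (elim exE conjE)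
      have "(k, x) \<in> Stop" using x u by (auto simp: Stop_def)
      moreover have "u \<in> ?under (k, x)" using x(3) by simp
      ultimately show "u \<in> (\<Union>p\<in>Stop. ?under p)" by blast
    qed
    \<comment> \<open>The image of the ball around \<open>x0\<close> is a ball of radius at least
      \<open>\<eta> * \<delta> * r0\<close> with centre close to \<open>c\<close>, so it contains a
      net point.\<close>
    have net: "\<exists>z\<in>Z. z \<in> vmap v ` U (vtgt v)" if p: "(k, v) \<in> Stop" for k v
    proof -
      note vD = StopD[OF p]
      note vg = D_good[OF vD(2)]
      note vv = good_vertex[OF vg]
      note vt = good_target[OF vg]
      obtain u where u: "u \<in> Hit" "(v, u) \<in> Rk ^^ (n - k)" using vD(5) ..
      have ug: "good u" using Rk_pow[OF u(2) vg] ..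
      obtain ks where ks: "extends v ks u" using Rk_ext(1)[OF u(2) vg] ..
      have yc: "vmap u w0 \<in> mball c \<delta>" using u(1) by (simp add: Hit_def)
      define y where "y = path_map G ks w0"
      have gks: "(?j, ks, ?j) \<in> gpaths G" using extendsD(1)[OF ks] vt good_target[OF ug] by simp
      have yg: "y \<in> gdom G ?j" unfolding y_def using path_map_facts(1)[OF gks] w0g by blast
      have yv: "vmap u w0 = vmap v y" unfolding y_def by (rule extends_apply[OF ks]) (use w0g good_target[OF ug] in simp)
      have dy: "d x0 y \<le> B"
      proof (cases "ks = []")
        case True
        then show ?thesis using B(2) by (simp add: y_def)
      next
        case False
        have "y \<in> E0" unfolding y_def by (rule path_map_W(2)[OF gks False w0])
        from B0(2)[OF this] show ?thesis using B(3) by (rule order_trans)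
      qed
      have sim: "d (vmap v p) (vmap v q) = vrho v * d p q" if "p \<in> gdom G ?j" "q \<in> gdom G ?j" for p q
        using vertex_facts(3)[OF vv] that vt unfolding similitude_with_ratio_def by simp
      have vM: "vmap v p \<in> M" if "p \<in> gdom G ?j" for p using vertex_facts(4)[OF vv] that vt by auto
      define q where "q = vmap v x0"
      have qM: "q \<in> M" unfolding q_def by (rule vM[OF x0g])
      have "d (vmap v y) q = vrho v * d x0 y" unfolding q_def sim[OF yg x0g] by (simp add: commute)
      also have "\<dots> \<le> \<delta> * B" using vD(4) dy good_rho[OF vg] \<delta>(1) by (intro mult_mono) simp_all
      finally have "d (vmap v y) q \<le> \<delta> * B" .
      moreover have "d c (vmap v y) < \<delta>" using yc yv by simp
      ultimately have "d c q < \<delta> + \<delta> * B" using triangle[OF cM vM[OF yg] qM] by linarith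
      then have cq: "d c q < a * \<delta>" by (simp add: a_def algebra_simps)
      then have qa: "q \<in> mball c (a * \<delta>)" using cM qM by simp
      with Z(4) obtain z where z: "z \<in> Z" "d z q < (\<eta> * r0) * \<delta>" by blast
      have "a * \<delta> < r1" using p1 small by linarith
      then have "q \<in> mball c r1" using cq cM qM by simp
      then obtain \<psi> :: "'a \<Rightarrow> 'e" where \<psi>: "flat_chart \<psi> q r1" using r1(2) c by blast
      have vr: "0 < vrho v * r0" using good_rho[OF vg] r0 by simp
      have "vrho v * r0 \<le> \<delta> * r0" using vD(4) r0 by simp
      then have "vrho v * r0 \<le> r1" using p1 small by linarith
      from flat_chart_smaller[OF \<psi> vr this] have \<psi>': "flat_chart \<psi> (vmap v x0) (vrho v * r0)" unfolding q_def .
      have "vmap v ` mball x0 r0 = mball (vmap v x0) (vrho v * r0)"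
      proof (rule similitude_image_mball[where h = "vmap v", OF chart0 \<psi>' good_rho[OF vg]])
        show "vmap v ` mball x0 r0 \<subseteq> M" using vM ballg by blast
        show "similitude_with_ratio d (mball x0 r0) (vmap v) (vrho v)"
          unfolding similitude_with_ratio_def using sim ballg by blast
      qed
      moreover have "z \<in> mball (vmap v x0) (vrho v * r0)"
      proof -
        have "(\<eta> * \<delta>) * r0 \<le> vrho v * r0" using vD(3) r0 by (intro mult_right_mono) simp_all
        then have "d q z < vrho v * r0" using z(2) commute[of q z] by (simp add: mult_ac)
        then show ?thesis using Z(1) z(1) qM by (auto simp: q_def)
      qed
      ultimately have "z \<in> vmap v ` mball x0 r0" by (simp only:)
      then have "z \<in> vmap v ` U (vtgt v)" unfolding vt using image_mono[OF ball0] by (rule rev_subsetD)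
      then show ?thesis using z(1) ..
    qed
    define T where "T z = {p \<in> Stop. z \<in> vmap (snd p) ` U (vtgt (snd p))}" for z
    have cardT: "real (card (T z)) \<le> B'" for z
      unfolding B'_def
    proof (rule multiplicity[OF g \<delta>(1), where z = z])
      show "finite (T z)" using finS by (simp add: T_def)
      fix k v assume "(k, v) \<in> T z"
      then have "(k, v) \<in> Stop" "z \<in> vmap v ` U (vtgt v)" by (simp_all add: T_def)
      then show "v \<in> D k \<and> \<eta> * \<delta> \<le> vrho v \<and> vrho v \<le> \<delta> \<and> z \<in> vmap v ` U (vtgt v)"
        using StopD(2)[of k v] StopD(3)[of k v] StopD(4)[of k v] by (intro conjI) simp_all
    qed
    have "Stop \<subseteq> (\<Union>z\<in>Z. T z)"
    proof
      fix p assume p: "p \<in> Stop"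
      obtain k v where kv: "p = (k, v)" by (cases p)
      from net[OF p[unfolded kv]] obtain z where z: "z \<in> Z" "z \<in> vmap v ` U (vtgt v)" ..
      have "p \<in> T z" unfolding T_def using p kv z(2) by simp
      with z(1) show "p \<in> (\<Union>z\<in>Z. T z)" by (rule UN_I)
    qed
    moreover have "finite (\<Union>z\<in>Z. T z)" by (rule finite_subset[OF _ finS]) (auto simp: T_def)
    ultimately have "card Stop \<le> card (\<Union>z\<in>Z. T z)" by (intro card_mono)
    also have "\<dots> \<le> (\<Sum>z\<in>Z. card (T z))" by (rule card_UN_le[OF Z(2)])
    finally have "real (card Stop) \<le> real (\<Sum>z\<in>Z. card (T z))" by (simp only: of_nat_le_iff)
    also have "\<dots> = (\<Sum>z\<in>Z. real (card (T z)))" by (simp only: of_nat_sum)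
    also have "\<dots> \<le> (\<Sum>z\<in>Z. B')" by (intro sum_mono cardT)
    also have "\<dots> = real (card Z) * B'" by simp
    also have "\<dots> \<le> real P * B'" using Z(3) B' by (intro mult_right_mono) simp_all
    finally have cardS: "real (card Stop) \<le> real P * B'" .
    have "(\<Sum>u\<in>Hit. wt n u) \<le> (\<Sum>u\<in>(\<Union>p\<in>Stop. ?under p). wt n u)"
      by (rule sum_mono2[OF _ Hsub wt_nonneg]) (use finS fin_under in simp)
    also have "\<dots> \<le> (\<Sum>p\<in>Stop. \<Sum>u\<in>?under p. wt n u)" by (rule sum_UN_le[OF finS fin_under wt_nonneg])
    also have "\<dots> \<le> (\<Sum>p\<in>Stop. (\<delta> / vrho v0) powr s)"
    proof (rule sum_mono)
      fix p assume p: "p \<in> Stop"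
      obtain k v where kv: "p = (k, v)" by (cases p)
      show "(\<Sum>u\<in>?under p. wt n u) \<le> (\<delta> / vrho v0) powr s"
        unfolding kv fst_conv snd_conv by (rule sum_wt_le) (use StopD[of k v] p kv in simp_all)
    qed
    also have "\<dots> = real (card Stop) * (\<delta> / vrho v0) powr s" by simp
    also have "\<dots> \<le> (real P * B') * (\<delta> / vrho v0) powr s" using cardS by (intro mult_right_mono) simp_all
    also have "\<dots> = (real P * B') * (\<delta> powr s * (1 / vrho v0) powr s)"
      using \<delta>(1) \<rho>0 by (simp flip: powr_mult)
    also have "\<dots> \<le> C1 * \<delta> powr s" by (simp add: C1_def algebra_simps)
    finally show ?thesis unfolding Hit_def .
  qed
  then show ?thesis using C1 \<delta>0 by (intro exI[of _ C1] exI[of _ \<delta>0] conjI ballI allI impI) simp_all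
qed

text \<open>Radii strictly above the diameter allow the sets of a cover to be replaced by open
  balls, as compactness requires, at an arbitrarily small cost. For \<open>s = 0\<close> the gauge
  of a nonempty set is 1, whatever the radius.\<close>

lemma enlarge_gauge:
  assumes C: "C \<subseteq> M" "\<forall>x\<in>C. \<forall>y\<in>C. d x y \<le> \<delta> / 2" and \<delta>: "0 < \<delta>" and e: "0 < e"
  shows "\<exists>r. 0 < r \<and> r \<le> \<delta> \<and> (\<forall>x\<in>C. \<forall>y\<in>C. d x y < r) \<and>
    (C \<noteq> {} \<longrightarrow> ennreal (r powr s) \<le> hausdorff_gauge d s C + ennreal e)"
proof (cases "C = {} \<or> s = 0")
  case True
  have "\<forall>x\<in>C. \<forall>y\<in>C. d x y < \<delta>" using C(2) \<delta> by fastforce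
  then show ?thesis using True \<delta> by (intro exI[of _ \<delta>]) (auto simp: hausdorff_gauge_def)
next
  case False
  then have s0: "0 < s" using s by simp
  obtain x where x: "x \<in> C" using False by blast
  define Dm where "Dm = set_diam d C"
  let ?A = "{d x y | x y. x \<in> C \<and> y \<in> C}"
  have up: "b \<le> \<delta> / 2" if "b \<in> ?A" for b using that C(2) by blast
  have bdd: "bdd_above ?A" using up by (rule bdd_aboveI)
  have le: "d p q \<le> Dm" if "p \<in> C" "q \<in> C" for p q
  proof -
    have "d p q \<in> ?A" using that by blast
    then show ?thesis unfolding Dm_def set_diam_def using bdd by (rule cSup_upper)
  qed
  have "?A \<noteq> {}" using x by blast
  then have "Dm \<le> \<delta> / 2" unfolding Dm_def set_diam_def using up by (rule cSup_least)
  then have D\<delta>: "Dm < \<delta>" using \<delta> by linarith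
  have D0: "0 \<le> Dm" using le[OF x x] nonneg[of x x] by linarith
  \<comment> \<open>The second term raises the \<open>s\<close>-th power of the diameter by exactly
    \<open>e\<close>; the first respects the scale \<open>\<delta>\<close>.\<close>
  define r where "r = min \<delta> ((Dm powr s + e) powr (1 / s))"
  have "Dm = (Dm powr s) powr (1 / s)" using s0 D0 by (simp add: powr_powr)
  also have "\<dots> < (Dm powr s + e) powr (1 / s)" using s0 e by (intro powr_less_mono2) auto
  finally have Dr: "Dm < r" using D\<delta> by (simp add: r_def)
  have r0: "0 < r" using Dr D0 by linarith
  have "r powr s \<le> ((Dm powr s + e) powr (1 / s)) powr s"
    using r0 s0 by (intro powr_mono2) (auto simp: r_def)
  also have "\<dots> = Dm powr s + e" using s0 e by (simp add: powr_powr add_nonneg_pos)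
  finally have "ennreal (r powr s) \<le> ennreal (Dm powr s + e)" by (rule ennreal_leI)
  also have "\<dots> = hausdorff_gauge d s C + ennreal e"
    using False e by (simp add: hausdorff_gauge_def Dm_def ennreal_plus)
  finally have "ennreal (r powr s) \<le> hausdorff_gauge d s C + ennreal e" .
  moreover have "\<forall>x\<in>C. \<forall>y\<in>C. d x y < r" by (intro ballI le_less_trans[OF le Dr])
  moreover have "r \<le> \<delta>" by (simp add: r_def)
  ultimately show ?thesis using r0 by (intro exI[of _ r] conjI impI)
qed

text \<open>Mass distribution principle with finite weights: a cheap cover of \<open>K\<close> is
  reduced to finitely many balls, these contain a whole level of the relation system, and hence all
  points representing a late generation. Their total mass 1 is then estimated ball by ball.\<close>

theorem lower_bound: "hausdorff_measure M d s K \<noteq> 0"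
proof
  assume zero: "hausdorff_measure M d s K = 0"
  let ?j = "vtgt v0"
  have jv: "?j \<in> verts (gr G)" by (rule vertex_facts(1)[OF good_vertex[OF good_v0]])
  obtain w0 where w0: "w0 \<in> W ?j" using W_nonempty[OF jv] by blast
  have w0g: "w0 \<in> gdom G ?j" using w0 W_sub[OF jv] by blast
  obtain C1 \<delta>0 where C1: "0 < C1" "0 < \<delta>0" and est: "\<forall>c\<in>E0. \<forall>\<delta> n. 0 < \<delta> \<and> \<delta> \<le> \<delta>0 \<and> (\<forall>u\<in>D n. vrho u \<le> \<delta>) \<longrightarrow>
    (\<Sum>u\<in>{u \<in> D n. vmap u w0 \<in> mball c \<delta>}. wt n u) \<le> C1 * \<delta> powr s"
    using mass_estimate[OF w0] by (elim exE conjE)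
  \<comment> \<open>The powers of the radii will sum to at most \<open>2 * e\<close>, so the
    estimated mass is at most 2/3.\<close>
  define e where "e = 1 / (3 * C1)"
  have e: "0 < e" using C1 by (simp add: e_def)
  have "hausdorff_premeasure M d s (\<delta>0 / 2) K \<le> hausdorff_measure M d s K"
    unfolding hausdorff_measure_def by (rule SUP_upper) (use C1 in simp)
  then have "hausdorff_premeasure M d s (\<delta>0 / 2) K < ennreal e" using zero e by simp
  then obtain C where C: "(\<Sum>i. hausdorff_gauge d s (C i)) < ennreal e" "K \<subseteq> (\<Union>i. C i)"
    "\<And>i. C i \<subseteq> M" "\<And>i. \<forall>x\<in>C i. \<forall>y\<in>C i. d x y \<le> \<delta>0 / 2"
    unfolding hausdorff_premeasure_def Inf_less_iff by blast
  have e': "0 < e * (1 / 2) ^ Suc i" for i using e by simp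
  have "\<forall>i. \<exists>r. 0 < r \<and> r \<le> \<delta>0 \<and> (\<forall>x\<in>C i. \<forall>y\<in>C i. d x y < r) \<and>
    (C i \<noteq> {} \<longrightarrow> ennreal (r powr s) \<le> hausdorff_gauge d s (C i) + ennreal (e * (1 / 2) ^ Suc i))"
    using enlarge_gauge[OF C(3,4) C1(2) e'] by (rule allI)
  from choice[OF this] obtain r where r: "\<forall>i. 0 < r i \<and> r i \<le> \<delta>0 \<and> (\<forall>x\<in>C i. \<forall>y\<in>C i. d x y < r i) \<and>
    (C i \<noteq> {} \<longrightarrow> ennreal (r i powr s) \<le> hausdorff_gauge d s (C i) + ennreal (e * (1 / 2) ^ Suc i))" ..
  \<comment> \<open>Sets missing \<open>K\<close> are discarded, so the centres can be taken in
    \<open>K\<close> and hence in \<open>E0\<close>, where the mass estimate holds.\<close>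
  define J where "J = {i. C i \<inter> K \<noteq> {}}"
  have "\<forall>i\<in>J. \<exists>c. c \<in> C i \<inter> K" unfolding J_def by blast
  from bchoice[OF this] obtain c where c: "\<forall>i\<in>J. c i \<in> C i \<inter> K" ..
  let ?O = "\<lambda>i. mball (c i) (r i)"
  have "\<exists>\<F>. finite \<F> \<and> \<F> \<subseteq> ?O ` J \<and> K \<subseteq> \<Union>\<F>"
  proof (rule compactinD[OF K_compact])
    show "openin mtopology X" if "X \<in> ?O ` J" for X using that by auto
    show "K \<subseteq> \<Union>(?O ` J)"
    proof
      fix x assume x: "x \<in> K"
      then obtain i where i: "x \<in> C i" using C(2) by blast
      then have iJ: "i \<in> J" using x by (auto simp: J_def)
      have ci: "c i \<in> C i" using c iJ by blast
      have "d (c i) x < r i" using r ci i by blast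
      then have "x \<in> ?O i" using C(3) ci i by (auto simp: in_mball)
      then show "x \<in> \<Union>(?O ` J)" using iJ by blast
    qed
  qed
  then obtain \<F> where F: "finite \<F>" "\<F> \<subseteq> ?O ` J" "K \<subseteq> \<Union>\<F>" by blast
  from finite_subset_image[OF F(1,2)] obtain I where I: "I \<subseteq> J" "finite I" "\<F> = ?O ` I" by blast
  have V: "openin mtopology (\<Union>i\<in>I. ?O i)" by (rule openin_Union) auto
  have KV: "K \<subseteq> (\<Union>i\<in>I. ?O i)" using F(3) I(3) by simp
  obtain k1 where k1: "level k1 \<subseteq> (\<Union>i\<in>I. ?O i)" using level_eventually_in[OF V KV] ..
  \<comment> \<open>A lower bound for all radii, so that one generation is fine enough for all balls
    simultaneously.\<close>
  define \<mu> where "\<mu> = Min (insert 1 (r ` I))"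
  have \<mu>: "0 < \<mu>" unfolding \<mu>_def using I(2) r by (subst Min_gr_iff) auto
  have \<mu>r: "\<mu> \<le> r i" if "i \<in> I" for i unfolding \<mu>_def using I(2) that by (intro Min_le) auto
  obtain n1 :: nat where n1: "rmax ^ n1 < \<mu>" using real_arch_pow_inv[OF \<mu> rmax(2)] by blast
  \<comment> \<open>Long index paths make the ratios small and put the representing points in level
    \<open>k1\<close>. Generation \<open>n\<close> has such paths for large \<open>n\<close>,
    because a generation raises the level by at least one.\<close>
  have "\<forall>\<^sub>F k in sequentially. Suc (max n1 k1) \<le> min_len \<M> k" using min_len_tendsto by (simp add: filterlim_at_top)
  then obtain n where n: "\<And>k. n \<le> k \<Longrightarrow> Suc (max n1 k1) \<le> min_len \<M> k" unfolding eventually_sequentially by blast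
  have u: "vrho u \<le> \<mu>" "vmap u w0 \<in> level k1" if "u \<in> D n" for u
  proof -
    have ug: "good u" by (rule D_good[OF that])
    have "(v0, u) \<in> Rk ^^ n" using that by simp
    then have "vlevel u = vlevel v0 + n * m" by (rule Rk_ext(2)[OF _ good_v0])
    moreover have "n \<le> n * m" using m by simp
    ultimately have "n \<le> vlevel u" by linarith
    note len = n[OF this]
    have "vrho u \<le> rmax ^ min_len \<M> (vlevel u)" by (rule vertex_facts(5)[OF good_vertex[OF ug]])
    also have "\<dots> \<le> rmax ^ n1" using len rmax by (intro power_decreasing) auto
    finally show "vrho u \<le> \<mu>" using n1 by linarith
    have "u \<in> vertices_at G \<M> (vlevel u)" using good_vertex[OF ug] by (simp only: vertices_iff)
    from vertexE[OF this] obtain i es j where p: "(i, es, j) \<in> \<M> (vlevel u)" "(i, es, j) \<in> gpaths G"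
      "u = path_vertex G (vlevel u) (i, es, j)" .
    have j: "j = ?j" using good_target[OF ug] p(3) path_vertex_simps(2) by metis
    have "min_len \<M> (vlevel u) \<le> length es" using min_len_le[OF p(1)] by (simp add: plen_def)
    then have es: "Suc k1 \<le> length es" using len by simp
    then have ne: "es \<noteq> []" by auto
    have "vmap u w0 = restrict (path_map G es) (gdom G j) w0" using p(3) path_vertex_simps(4) by metis
    then have "vmap u w0 = path_map G es w0" using w0g j by simp
    also have "\<dots> \<in> level (k0 + length es)" by (rule path_map_W(1)[OF p(2) ne]) (use w0 j in simp)
    also have "\<dots> \<subseteq> level k1" by (rule level_antimono) (use es in simp)
    finally show "vmap u w0 \<in> level k1" .
  qed
  let ?H = "\<lambda>i. {u \<in> D n. vmap u w0 \<in> ?O i}"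
  have finH: "finite (?H i)" for i by (rule finite_subset[OF _ finite_D[of n]]) blast
  have "1 = (\<Sum>u\<in>D n. wt n u)" by (rule sum_wt[symmetric])
  also have "\<dots> \<le> (\<Sum>u\<in>(\<Union>i\<in>I. ?H i). wt n u)"
  proof (rule sum_mono2[OF _ _ wt_nonneg])
    show "finite (\<Union>i\<in>I. ?H i)" by (intro finite_UN_I I(2) finH)
    show "D n \<subseteq> (\<Union>i\<in>I. ?H i)"
    proof
      fix v assume v: "v \<in> D n"
      then obtain i where "i \<in> I" "vmap v w0 \<in> ?O i" using u(2) k1 by blast
      then show "v \<in> (\<Union>i\<in>I. ?H i)" using v by blast
    qed
  qed
  also have "\<dots> \<le> (\<Sum>i\<in>I. \<Sum>u\<in>?H i. wt n u)" by (rule sum_UN_le[OF I(2) finH wt_nonneg])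
  also have "\<dots> \<le> (\<Sum>i\<in>I. C1 * r i powr s)"
  proof (rule sum_mono)
    fix i assume i: "i \<in> I"
    have "c i \<in> E0" using c I(1) i K_E0 by blast
    moreover have "0 < r i \<and> r i \<le> \<delta>0" using r by simp
    moreover have "\<forall>v\<in>D n. vrho v \<le> r i" using u(1) \<mu>r[OF i] by (blast intro: order_trans)
    ultimately show "(\<Sum>u\<in>?H i. wt n u) \<le> C1 * r i powr s" using est by simp
  qed
  also have "\<dots> = C1 * (\<Sum>i\<in>I. r i powr s)" by (simp add: sum_distrib_left)
  finally have one: "1 \<le> C1 * (\<Sum>i\<in>I. r i powr s)" .
  have "ennreal (\<Sum>i\<in>I. r i powr s) = (\<Sum>i\<in>I. ennreal (r i powr s))" by (rule sum_ennreal[symmetric]) simp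
  also have "\<dots> \<le> (\<Sum>i\<in>I. hausdorff_gauge d s (C i) + ennreal (e * (1 / 2) ^ Suc i))"
  proof (rule sum_mono)
    fix i assume "i \<in> I"
    then have "C i \<noteq> {}" using I(1) by (auto simp: J_def)
    then show "ennreal (r i powr s) \<le> hausdorff_gauge d s (C i) + ennreal (e * (1 / 2) ^ Suc i)" using r by blast
  qed
  also have "\<dots> = (\<Sum>i\<in>I. hausdorff_gauge d s (C i)) + (\<Sum>i\<in>I. ennreal (e * (1 / 2) ^ Suc i))" by (rule sum.distrib)
  also have "\<dots> \<le> ennreal e + ennreal e"
  proof (rule add_mono)
    have "(\<Sum>i\<in>I. hausdorff_gauge d s (C i)) \<le> (\<Sum>i. hausdorff_gauge d s (C i))"
      by (rule sum_le_suminf) (use I(2) in auto)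
    then show "(\<Sum>i\<in>I. hausdorff_gauge d s (C i)) \<le> ennreal e" using C(1) by simp
    have "(\<lambda>i. e * (1 / 2) ^ Suc i) sums (e * 1)" by (rule sums_mult[OF power_half_series])
    then have "(\<Sum>i\<in>I. e * (1 / 2) ^ Suc i) \<le> e"
      using sum_le_suminf[of "\<lambda>i. e * (1 / 2) ^ Suc i" I] I(2) e by (simp add: sums_iff)
    moreover have "(\<Sum>i\<in>I. ennreal (e * (1 / 2) ^ Suc i)) = ennreal (\<Sum>i\<in>I. e * (1 / 2) ^ Suc i)"
      by (rule sum_ennreal) (use e in simp)
    ultimately show "(\<Sum>i\<in>I. ennreal (e * (1 / 2) ^ Suc i)) \<le> ennreal e" by (simp only: ennreal_leI)
  qed
  also have "\<dots> = ennreal (e + e)" by (rule ennreal_plus[symmetric]) (use e in simp_all)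
  finally have "(\<Sum>i\<in>I. r i powr s) \<le> e + e" using e by (simp only: ennreal_le_iff add_nonneg_nonneg less_imp_le)
  then have "C1 * (\<Sum>i\<in>I. r i powr s) \<le> C1 * (e + e)" using C1(1) by (intro mult_left_mono) auto
  also have "\<dots> = 2 / 3" using C1(1) by (simp add: e_def)
  finally show False using one by simp
qed

end

section \<open>The dimension\<close>

lemma similitude_cong:
  assumes eq: "\<And>x y. x \<in> X \<Longrightarrow> y \<in> X \<Longrightarrow> d' x y = d x y" and "D \<subseteq> X" "h ` D \<subseteq> X"
  shows "similitude_with_ratio d' D h r \<longleftrightarrow> similitude_with_ratio d D h r"
proof -
  have "d' (h x) (h y) = d (h x) (h y)" "d' x y = d x y" if "x \<in> D" "y \<in> D" for x y
    using eq assms(2,3) that by (simp_all add: subset_iff image_subset_iff)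
  then show ?thesis unfolding similitude_with_ratio_def by simp
qed

lemma ratio_cong:
  assumes eq: "\<And>x y. x \<in> X \<Longrightarrow> y \<in> X \<Longrightarrow> d' x y = d x y" and "D \<subseteq> X" "h ` D \<subseteq> X"
  shows "ratio d' D h = ratio d D h"
proof -
  have "similitude_with_ratio d' D h = similitude_with_ratio d D h"
    by (rule ext) (rule similitude_cong[where X = X], use assms in auto)
  then show ?thesis unfolding ratio_def by simp
qed

lemma set_diam_cong:
  assumes eq: "\<And>x y. x \<in> X \<Longrightarrow> y \<in> X \<Longrightarrow> d' x y = d x y" and "S \<subseteq> X"
  shows "set_diam d' S = set_diam d S"
proof -
  have "d' x y = d x y" if "x \<in> S" "y \<in> S" for x y using eq assms(2) that by blast
  then have "{d' x y |x y. x \<in> S \<and> y \<in> S} = {d x y |x y. x \<in> S \<and> y \<in> S}" by (intro Collect_cong) metis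
  then show ?thesis unfolding set_diam_def by simp
qed

lemma hausdorff_premeasure_le_cong:
  assumes eq: "\<And>x y. x \<in> X \<Longrightarrow> y \<in> X \<Longrightarrow> d' x y = d x y"
  shows "hausdorff_premeasure X d s \<delta> S \<le> hausdorff_premeasure X d' s \<delta> S"
  unfolding hausdorff_premeasure_def
proof (rule Inf_superset_mono, rule subsetI)
  fix a assume "a \<in> {\<Sum>i. hausdorff_gauge d' s (C i) |C. S \<subseteq> (\<Union>i. C i) \<and>
    (\<forall>i. C i \<subseteq> X \<and> (\<forall>x\<in>C i. \<forall>y\<in>C i. d' x y \<le> \<delta>))}"
  then obtain C where a: "a = (\<Sum>i. hausdorff_gauge d' s (C i))" and C: "S \<subseteq> (\<Union>i. C i)"
    "\<forall>i. C i \<subseteq> X \<and> (\<forall>x\<in>C i. \<forall>y\<in>C i. d' x y \<le> \<delta>)" by (elim CollectE exE conjE)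
  have sub: "C i \<subseteq> X" for i using C(2) by simp
  have "set_diam d' (C i) = set_diam d (C i)" for i by (rule set_diam_cong[OF eq sub])
  then have "a = (\<Sum>i. hausdorff_gauge d s (C i))" unfolding a hausdorff_gauge_def by (simp only:)
  moreover have "\<forall>i. C i \<subseteq> X \<and> (\<forall>x\<in>C i. \<forall>y\<in>C i. d x y \<le> \<delta>)"
  proof (intro allI conjI sub ballI)
    fix i x y assume xy: "x \<in> C i" "y \<in> C i"
    then have "d' x y \<le> \<delta>" using C(2) by blast
    then show "d x y \<le> \<delta>" using eq[OF subsetD[OF sub xy(1)] subsetD[OF sub xy(2)]] by simp
  qed
  ultimately show "a \<in> {\<Sum>i. hausdorff_gauge d s (C i) |C. S \<subseteq> (\<Union>i. C i) \<and>
    (\<forall>i. C i \<subseteq> X \<and> (\<forall>x\<in>C i. \<forall>y\<in>C i. d x y \<le> \<delta>))}" using C(1) by (intro CollectI exI[of _ C] conjI)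
qed

lemma hausdorff_premeasure_cong:
  assumes eq: "\<And>x y. x \<in> X \<Longrightarrow> y \<in> X \<Longrightarrow> d' x y = d x y"
  shows "hausdorff_premeasure X d' s \<delta> S = hausdorff_premeasure X d s \<delta> S"
  by (intro antisym hausdorff_premeasure_le_cong) (simp_all add: eq)

lemma hausdorff_dim_cong:
  assumes eq: "\<And>x y. x \<in> X \<Longrightarrow> y \<in> X \<Longrightarrow> d' x y = d x y"
  shows "hausdorff_dim X d' S = hausdorff_dim X d S"
proof -
  have "hausdorff_premeasure X d' s \<delta> S = hausdorff_premeasure X d s \<delta> S" for s \<delta>
    by (rule hausdorff_premeasure_cong[OF eq])
  then show ?thesis unfolding hausdorff_dim_def hausdorff_measure_def by (simp only:)
qed

lemma is_gifs_cong:
  assumes eq: "\<And>x y. x \<in> X \<Longrightarrow> y \<in> X \<Longrightarrow> d' x y = d x y" and G: "is_gifs X d' G"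
  shows "is_gifs X d G"
proof -
  interpret fin_digraph "gr G" using G by (simp add: is_gifs_def)
  have dom: "gdom G j \<subseteq> X" if "j \<in> verts (gr G)" for j using G that by (simp add: is_gifs_def)
  have im: "gmap G e ` gdom G (head (gr G) e) \<subseteq> gdom G (tail (gr G) e)" if "e \<in> arcs (gr G)" for e
    using G that unfolding is_gifs_def by blast
  have "\<exists>r. 0 \<le> r \<and> r < 1 \<and> (\<forall>x\<in>gdom G (head (gr G) e). \<forall>y\<in>gdom G (head (gr G) e). d (gmap G e x) (gmap G e y) \<le> r * d x y)"
    if e: "e \<in> arcs (gr G)" for e
  proof -
    obtain r where r: "0 \<le> r" "r < 1" "\<forall>x\<in>gdom G (head (gr G) e). \<forall>y\<in>gdom G (head (gr G) e). d' (gmap G e x) (gmap G e y) \<le> r * d' x y"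
      using G e unfolding is_gifs_def by blast
    have "d (gmap G e x) (gmap G e y) \<le> r * d x y" if xy: "x \<in> gdom G (head (gr G) e)" "y \<in> gdom G (head (gr G) e)" for x y
    proof -
      have "x \<in> X" "y \<in> X" using dom[of "head (gr G) e"] e xy by auto
      moreover have "gmap G e x \<in> X" "gmap G e y \<in> X" using im[OF e] dom[of "tail (gr G) e"] e xy by auto
      moreover have "d' (gmap G e x) (gmap G e y) \<le> r * d' x y" using r(3) xy by blast
      ultimately show ?thesis by (simp add: eq)
    qed
    then show ?thesis using r(1,2) by blast
  qed
  moreover have "verts (gr G) \<noteq> {}" using G by (simp add: is_gifs_def)
  ultimately show ?thesis unfolding is_gifs_def using fin_digraph_axioms dom im by blast
qed

lemma of_contractive_similitudes_cong:
  assumes eq: "\<And>x y. x \<in> X \<Longrightarrow> y \<in> X \<Longrightarrow> d' x y = d x y" and G: "is_gifs X d' G"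
    and sim: "of_contractive_similitudes d' G"
  shows "of_contractive_similitudes d G"
  unfolding of_contractive_similitudes_def
proof
  fix e assume e: "e \<in> arcs (gr G)"
  interpret fin_digraph "gr G" using G by (simp add: is_gifs_def)
  have dom: "gdom G (head (gr G) e) \<subseteq> X" "gdom G (tail (gr G) e) \<subseteq> X" using G e by (simp_all add: is_gifs_def)
  have "gmap G e ` gdom G (head (gr G) e) \<subseteq> gdom G (tail (gr G) e)" using G e unfolding is_gifs_def by blast
  then have "gmap G e ` gdom G (head (gr G) e) \<subseteq> X" using dom(2) by (rule order_trans)
  from similitude_cong[where d' = d' and d = d, OF eq dom(1) this]
  have iff: "similitude_with_ratio d' (gdom G (head (gr G) e)) (gmap G e) r \<longleftrightarrow>
    similitude_with_ratio d (gdom G (head (gr G) e)) (gmap G e) r" for r .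
  obtain r where "0 < r" "r < 1" "similitude_with_ratio d' (gdom G (head (gr G) e)) (gmap G e) r"
    using sim e unfolding of_contractive_similitudes_def by blast
  then show "\<exists>r. 0 < r \<and> r < 1 \<and> similitude_with_ratio d (gdom G (head (gr G) e)) (gmap G e) r"
    unfolding iff by blast
qed

context nested_gifs
begin

text \<open>The similitude is an arbitrary function, but its values on the images of the open sets
  are values of vertex maps and so lie in \<open>M\<close>, where the two distances agree.\<close>

lemma same_type_cong_imp:
  assumes eq: "\<And>x y. x \<in> M \<Longrightarrow> y \<in> M \<Longrightarrow> d1 x y = d2 x y"
    and type: "same_type d1 G U \<M> v v'"
  shows "same_type d2 G U \<M> v v'"
proof -
  let ?N = "neighbors G U \<M>"
  note t = type[unfolded same_type_def]
  from conjunct2[OF t] obtain \<tau> g where tg: "(\<exists>r>0. similitude_with_ratio d1 (\<Union>u\<in>?N v. vmap u ` U (vtgt u)) \<tau> r) \<and>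
        bij_betw g (?N v) (?N v') \<and> g v = v' \<and>
        (\<forall>u\<in>?N v. (\<forall>x\<in>U (vtgt u). vmap (g u) x = \<tau> (vmap u x)) \<and> vtgt (g u) = vtgt u \<and>
           (\<forall>l\<ge>1. \<forall>es j. (vtgt u, es, j) \<in> gpaths G \<longrightarrow>
              (extend_vertex G u es j l \<in> vertices_at G \<M> (vlevel u + l) \<longleftrightarrow>
               extend_vertex G (g u) es j l \<in> vertices_at G \<M> (vlevel (g u) + l))))"
    by (elim exE) (rule that)
  from conjunct1[OF tg] obtain r where r: "0 < r" "similitude_with_ratio d1 (\<Union>u\<in>?N v. vmap u ` U (vtgt u)) \<tau> r" by blast
  have bij: "bij_betw g (?N v) (?N v')" using tg by simp
  have gu: "\<forall>x\<in>U (vtgt u). vmap (g u) x = \<tau> (vmap u x)" "vtgt (g u) = vtgt u" if "u \<in> ?N v" for u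
    using tg that by simp_all
  have in_M: "vmap u x \<in> M" if u: "u \<in> ?N w" and x: "x \<in> U (vtgt u)" for u w x
  proof -
    have uv: "u \<in> vertices G \<M>" using u unfolding neighbors_def vertices_def by blast
    show ?thesis using vertex_facts(4)[OF uv] vmap_U[OF uv x] by blast
  qed
  have sub: "(\<Union>u\<in>?N v. vmap u ` U (vtgt u)) \<subseteq> M" using in_M by blast
  have sub': "\<tau> ` (\<Union>u\<in>?N v. vmap u ` U (vtgt u)) \<subseteq> M"
  proof
    fix q assume "q \<in> \<tau> ` (\<Union>u\<in>?N v. vmap u ` U (vtgt u))"
    then obtain u x where u: "u \<in> ?N v" "x \<in> U (vtgt u)" "q = \<tau> (vmap u x)" by blast
    have "g u \<in> ?N v'" using bij u(1) by (auto simp: bij_betw_def)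
    moreover have "x \<in> U (vtgt (g u))" using gu(2)[OF u(1)] u(2) by simp
    ultimately have "vmap (g u) x \<in> M" by (rule in_M)
    then show "q \<in> M" using gu(1)[OF u(1)] u(2,3) by simp
  qed
  have "similitude_with_ratio d2 (\<Union>u\<in>?N v. vmap u ` U (vtgt u)) \<tau> r"
    by (rule iffD1[OF similitude_cong[where X = M and d' = d1 and d = d2, OF eq sub sub'] r(2)])
  then have "\<exists>r>0. similitude_with_ratio d2 (\<Union>u\<in>?N v. vmap u ` U (vtgt u)) \<tau> r" using r(1) by blast
  note new = conjI[OF this conjunct2[OF tg]]
  show ?thesis unfolding same_type_def
    by (rule conjI[OF conjunct1[OF t]], rule exI[of _ \<tau>], rule exI[of _ g], rule new)
qed

lemma ntype_cong:
  assumes eq: "\<And>x y. x \<in> M \<Longrightarrow> y \<in> M \<Longrightarrow> d' x y = d x y"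
  shows "ntype d' G U \<M> = ntype d G U \<M>"
proof -
  have "same_type d' G U \<M> v v' = same_type d G U \<M> v v'" for v v'
    by (rule iffI) (erule same_type_cong_imp[rotated], simp add: eq)+
  then show ?thesis unfolding ntype_def by simp
qed

lemma weighted_incidence_matrix_cong:
  assumes eq: "\<And>x y. x \<in> M \<Longrightarrow> y \<in> M \<Longrightarrow> d' x y = d x y"
    and A: "weighted_incidence_matrix d' G enum U \<M> Ts \<alpha> A"
  shows "weighted_incidence_matrix d G enum U \<M> Ts \<alpha> A"
proof -
  have r: "ratio d' (gdom G (vtgt u)) (path_map G ks) = ratio d (gdom G (vtgt u)) (path_map G ks)"
    if "(v, ks, u) \<in> reduced_vedges G enum \<M>" for v ks u
  proof -
    have "(v, ks, u) \<in> vedges G \<M>" using that min_edges_vedges by (simp add: reduced_iff)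
    then have p: "(vtgt v, ks, vtgt u) \<in> gpaths G" using extendsD(1)[OF vedge_facts(4)] by blast
    have "gdom G (vtgt u) \<subseteq> M" "gdom G (vtgt v) \<subseteq> M" using gdom_sub gpaths_verts[OF p] by blast+
    then show ?thesis using path_map_facts(1)[OF p] by (intro ratio_cong[where X = M] eq) auto
  qed
  have sums: "(\<Sum>(ks, u)\<in>{(ks, u). (v, ks, u) \<in> reduced_vedges G enum \<M> \<and> ntype d G U \<M> u = T}.
      ratio d' (gdom G (vtgt u)) (path_map G ks) powr \<alpha>) =
    (\<Sum>(ks, u)\<in>{(ks, u). (v, ks, u) \<in> reduced_vedges G enum \<M> \<and> ntype d G U \<M> u = T}.
      ratio d (gdom G (vtgt u)) (path_map G ks) powr \<alpha>)" for v T
    by (rule sum.cong[OF refl]) (auto simp: r)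
  have nt: "ntype d' G U \<M> = ntype d G U \<M>" by (rule ntype_cong[OF eq])
  show ?thesis using A unfolding weighted_incidence_matrix_def nt sums .
qed

end

context irs_gifs
begin

text \<open>By strict monotonicity the spectral radius exceeds 1 below \<open>\<alpha>\<close>,
  where the measure is nonzero, and is less than 1 above it, where covers make the measure
  vanish.\<close>

theorem dimension:
  assumes \<alpha>: "0 \<le> \<alpha>" "lam \<alpha> = 1"
  shows "hausdorff_dim M d K = ereal \<alpha>"
proof -
  let ?A = "{s. 0 \<le> s \<and> hausdorff_measure M d s K = 0}"
  have "\<alpha> \<le> s" if s: "s \<in> ?A" for s
  proof (rule ccontr)
    assume "\<not> \<alpha> \<le> s"
    then have lam: "1 < lam s" using lam_strict_decrease[of s \<alpha>] \<alpha>(2) s by simp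
    have s0: "0 \<le> s" using s by simp
    have "\<exists>m S v0. expanding TYPE('e) M d G U \<M> enum Ts A E0 N R k0 W s m S v0"
      by (rule expanding_type[OF s0 lam])
        (intro exI expanding.intro irs_gifs_axioms expanding_axioms.intro s0; assumption)
    then obtain m S v0 where "expanding TYPE('e) M d G U \<M> enum Ts A E0 N R k0 W s m S v0" by (elim exE)
    from expanding.lower_bound[OF this] show False using s by simp
  qed
  then have "ereal \<alpha> \<le> Inf (ereal ` ?A)" by (intro Inf_greatest) auto
  moreover have "Inf (ereal ` ?A) \<le> ereal \<alpha>"
  proof (rule ereal_le_epsilon2)
    fix e :: real assume e: "0 < e"
    \<comment> \<open>The upper bound asks for an exponent with spectral radius below 1 strictly
      under the exponent of the measure, whence the half.\<close>
    have "lam (\<alpha> + e / 2) < 1" using lam_strict_decrease[of \<alpha> "\<alpha> + e / 2"] \<alpha> e by simp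
    then have "hausdorff_measure M d (\<alpha> + e) K = 0" using \<alpha>(1) e by (intro upper_bound[of "\<alpha> + e / 2"]) auto
    then have "\<alpha> + e \<in> ?A" using \<alpha>(1) e by simp
    then have "Inf (ereal ` ?A) \<le> ereal (\<alpha> + e)" by (intro Inf_lower imageI)
    then show "Inf (ereal ` ?A) \<le> ereal \<alpha> + ereal e" by simp
  qed
  ultimately show ?thesis unfolding hausdorff_dim_def by (intro antisym)
qed

end

theorem theorem1p4:
  fixes M :: "('p, 'n::finite) riem_mfd"
    and E0 :: "'p set" and N :: nat and R :: "nat \<Rightarrow> ('p \<times> 'p) set"
    and G :: "('v, 'e, 'p) gifs" and enum :: "'e \<Rightarrow> nat"
    and U :: "'v \<Rightarrow> 'p set" and \<M> :: "nat \<Rightarrow> ('v, 'e) gpath set"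
    and Ts :: "('v, 'p) vertex set list" and A :: "real \<Rightarrow> real mat" and lam :: "real \<Rightarrow> real"
  assumes "riemannian_manifold M" "complete_manifold M" "orientable M" "locally_euclidean M"
    and "is_IRS (rm_top M) E0 N R"
    and "is_gifs (pts M) (riem_dist M) G"
    and "of_contractive_similitudes (riem_dist M) G"
    and "associated_gifs (rm_top M) E0 N R G"
    and "GFTC_witness (rm_top M) (riem_dist M) G U \<M>"
    and "inj_on enum (arcs (gr G))"
    and "distinct Ts" "set Ts = ntype (riem_dist M) G U \<M> ` vertices G \<M>"
    and "\<And>\<alpha>. 0 \<le> \<alpha> \<Longrightarrow> weighted_incidence_matrix (riem_dist M) G enum U \<M> Ts \<alpha> (A \<alpha>)"
    and "\<And>\<alpha>. 0 \<le> \<alpha> \<Longrightarrow> lam \<alpha> = spectral_radius (map_mat complex_of_real (A \<alpha>))"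
  shows "(\<exists>!\<alpha>. 0 \<le> \<alpha> \<and> lam \<alpha> = 1) \<and>
    hausdorff_dim (pts M) (riem_dist M) (irs_attractor E0 N R) =
      ereal (THE \<alpha>. 0 \<le> \<alpha> \<and> lam \<alpha> = 1)"
proof -
  interpret F: flat_manifold M by (rule flat_manifold.intro) (fact assms)+
  \<comment> \<open>The axioms of a metric space are asked on the whole type, while
    \<open>riem_dist\<close> is controlled only on the manifold; all notions are therefore
    transferred to \<open>total_dist\<close>.\<close>
  have eq: "riem_dist M x y = F.total_dist x y" if "x \<in> pts M" "y \<in> pts M" for x y
    using F.total_dist_eq[OF that] by (rule sym)
  obtain k0 W where assoc: "irs_level E0 N R k0 = (\<Union>j\<in>verts (gr G). W j) \<and>
     (\<forall>j\<in>verts (gr G). W j \<noteq> {} \<and> compactin (rm_top M) (W j) \<and>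
        W j \<subseteq> irs_level E0 N R k0 \<and> W j \<subseteq> gdom G j) \<and>
     (\<forall>q\<ge>1. (\<Union>ts\<in>{ts. length ts = q \<and> set ts \<subseteq> {1..N}}.
                word_image R ts (irs_level E0 N R k0)) =
             (\<Union>(i, es, j)\<in>{p \<in> gpaths G. plen p = q}. path_map G es ` W j))"
    using assms(8)[unfolded associated_gifs_def] by (elim exE) (rule that)
  have witness: "invariant_family G U" "nested_index_sets G \<M>"
    "\<And>j. j \<in> verts (gr G) \<Longrightarrow> U j \<noteq> {}" "\<And>j. j \<in> verts (gr G) \<Longrightarrow> openin F.mtopology (U j)"
    using assms(9) unfolding GFTC_witness_def F.mtopology_eq by simp_all
  have sim: "similitude_gifs TYPE(real ^ 'n) (pts M) F.total_dist G U"
    by (intro similitude_gifs.intro similitude_gifs_axioms.intro F.locally_flat_space witness(1,3,4)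
        is_gifs_cong[where d' = "riem_dist M" and d = F.total_dist, OF eq assms(6)]
        of_contractive_similitudes_cong[where d' = "riem_dist M" and d = F.total_dist, OF eq assms(6,7)])
  \<comment> \<open>The congruences for types and for the matrix live in this locale, so it is
    interpreted before the assumptions on \<open>Ts\<close> and \<open>A\<close> are
    transferred.\<close>
  interpret B: nested_gifs "TYPE(real ^ 'n)" "pts M" F.total_dist G U \<M> enum
    by (intro nested_gifs.intro nested_gifs_axioms.intro sim witness(2) assms(10))
  interpret I: irs_gifs "TYPE(real ^ 'n)" "pts M" F.total_dist G U \<M> enum Ts A E0 N R k0 W
  proof (intro irs_gifs.intro gftc_gifs.intro gftc_gifs_axioms.intro irs_gifs_axioms.intro)
    show "nested_gifs TYPE(real ^ 'n) (pts M) F.total_dist G U \<M> enum" by (rule B.nested_gifs_axioms)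
    show "distinct Ts" by (rule assms(11))
    have "ntype (riem_dist M) G U \<M> = ntype F.total_dist G U \<M>" by (rule B.ntype_cong[OF eq])
    then show "set Ts = ntype F.total_dist G U \<M> ` vertices G \<M>" using assms(12) by (simp only:)
    show "weighted_incidence_matrix F.total_dist G enum U \<M> Ts \<alpha> (A \<alpha>)" if "0 \<le> \<alpha>" for \<alpha>
      by (rule B.weighted_incidence_matrix_cong[where d' = "riem_dist M", OF eq assms(13)[OF that]])
    show "is_IRS F.mtopology E0 N R" using assms(5) unfolding F.mtopology_eq .
    show "W j \<noteq> {}" "W j \<subseteq> gdom G j" if "j \<in> verts (gr G)" for j using assoc that by simp_all
    show "(\<Union>ts\<in>{ts. length ts = q \<and> set ts \<subseteq> {1..N}}. word_image R ts (irs_level E0 N R k0)) =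
      (\<Union>(i, es, j)\<in>{p \<in> gpaths G. plen p = q}. path_map G es ` W j)" if "1 \<le> q" for q
      using conjunct2[OF conjunct2[OF assoc]] that by simp
  qed
  have "0 \<le> \<alpha> \<and> lam \<alpha> = 1 \<longleftrightarrow> 0 \<le> \<alpha> \<and> I.lam \<alpha> = 1" for \<alpha>
    using assms(14) by (auto simp: I.lam_def real_spectral_radius_def)
  with I.unique_exponent have ex: "\<exists>!\<alpha>. 0 \<le> \<alpha> \<and> lam \<alpha> = 1"
    and lam: "\<And>\<alpha>. 0 \<le> \<alpha> \<and> lam \<alpha> = 1 \<Longrightarrow> 0 \<le> \<alpha> \<and> I.lam \<alpha> = 1" by simp_all
  from lam[OF theI'[OF ex]]
  have "hausdorff_dim (pts M) F.total_dist (irs_attractor E0 N R) = ereal (THE \<alpha>. 0 \<le> \<alpha> \<and> lam \<alpha> = 1)"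
    by (intro I.dimension) simp_all
  moreover have "hausdorff_dim (pts M) (riem_dist M) (irs_attractor E0 N R) = hausdorff_dim (pts M) F.total_dist (irs_attractor E0 N R)"
    by (rule hausdorff_dim_cong[OF eq])
  ultimately show ?thesis using ex by simp
qed

end
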